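(* Let $\Omega\subset\mathbb{R}^N$, $1\le N\le3$, be a bounded open set with smooth boundary $\Gamma$, $\mu>0$, $\gamma=0$, and $h$ satisfying assumption (H) of the context. Let $(e,\theta,\chi,\xi,u,p)$ be a stationary weak solution, i.e. a sextuple of functions independent of time which is a weak solution on $(0,T)$ (as defined in the context, with $\gamma=0$). Then $e,\theta,\chi,\xi,u,p$ are all constant functions, and: if $h(\theta)-\log p>0$ then $\chi=1$ and $p=2u$; if $h(\theta)-\log p=0$ then $0\le\chi\le1$ and $p=(1+\chi)u$; if $h(\theta)-\log p<0$ then $\chi=0$ and $p=u$.
   Context: Notation: $H=L^2(\Omega)$, $V=H^1(\Omega)$, $H\subset V'$, $T>0$, $Q=\Omega\times(0,T)$. Assumption (H): there is $c_h>1$ with $h\in C^2(\mathbb{R})\cap W^{2,\infty}(\mathbb{R})$, $\|h\|_{W^{2,\infty}(\mathbb{R})}+\sup_r|rh'(r)|\le c_h$, and $\frac1{c_h}\le1+rh''(r)s\le c_h$ for all $r\in\mathbb{R}$, $s\in[0,1]$. $\psi(\theta,\chi)=\theta-\chi(h(\theta)-\theta h'(\theta))$. $A_\gamma:V\to V'$, $\langle A_\gamma v,w\rangle=\int_\Omega\nabla v\cdot\nabla w\,dx+\gamma\int_\Gamma vw\,dS$; $A=A_0$, extended to $W^{1,q}(\Omega)\to(W^{1,q'}(\Omega))'$ for $1<q<\frac{N+2}{N+1}$, $q'=q/(q-1)$. $\hat\beta(r)=\int_0^r\log(1+s)ds$ for $r\in[0,1]$, $+\infty$ otherwise; $J(v)=\int_\Omega\hat\beta(v)dx$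 on $V$, $\partial_{V,V'}J$ its subdifferential $V\to2^{V'}$. $(1*p)(t)=\int_0^tp(s)ds$. Weak solution on $(0,T)$ with initial data $e_0,\chi_0,u_0$: $(e,\theta,\chi,\xi,u,p)$ with $e,\theta\in L^q(0,T;W^{1,q}(\Omega))$ for some $1<q<\frac{N+2}{N+1}$, $\partial_te\in L^1(0,T;(W^{1,q'}(\Omega))')$, $\chi\in H^1(0,T;H)\cap L^2(0,T;V)$, $\xi\in L^2(0,T;V')$, $u\in L^\infty(0,T;V')\cap L^2(0,T;H)$, $u>0$ a.e., $p\in L^2(0,T;H)$, $1*p\in L^\infty(0,T;V)$, satisfying $\partial_te+A\theta=-h(\theta)\partial_t\chi+\mu(\partial_t\chi)^2$ in $(W^{1,q'}(\Omega))'$ a.e. in $(0,T)$; $e=\psi(\theta,\chi)$ a.e.; $\mu\partial_t\chi+A\chi+\xi=h(\theta)-\log u$ in $V'$ a.e.; $\xi(t)\in\partial_{V,V'}J(\chi(t))$ a.e. $t$; $u+A_\gamma(1*p)=u_0$ in $V'$ a.e. in $(0,T)$ (equivalently $\partial_tu+A_\gamma p=0$); $p=u(1+\chi)$ a.e.; $e(0)=e_0$, $\chi(0)=\chi_0$.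
   Formalization: Ω is additionally assumed connected; on a disconnected Ω the claim fails (take θ equal to different constants on the components, χ=0, and u=p a large constant). *)

theory Defs
  imports "HOL-Analysis.Analysis"
begin

definition pd :: "'n::finite \<Rightarrow> (real^'n \<Rightarrow> real) \<Rightarrow> real^'n \<Rightarrow> real" where
  "pd i f x = frechet_derivative f (at x) (axis i 1)"

fun Ck_on :: "nat \<Rightarrow> (real^'n::finite) set \<Rightarrow> (real^'n \<Rightarrow> real) \<Rightarrow> bool" where
  "Ck_on 0 U f = continuous_on U f"
| "Ck_on (Suc k) U f =
     ((\<forall>x\<in>U. f differentiable (at x)) \<and> continuous_on U f \<and> (\<forall>i. Ck_on k U (pd i f)))"

definition smooth_on :: "(real^'n::finite) set \<Rightarrow> (real^'n \<Rightarrow> real) \<Rightarrow> bool" where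
  "smooth_on U f \<longleftrightarrow> (\<forall>k. Ck_on k U f)"

definition smooth_boundary :: "(real^'n::finite) set \<Rightarrow> bool" where
  "smooth_boundary \<Omega> \<longleftrightarrow>
     (\<forall>x0\<in>frontier \<Omega>. \<exists>U \<rho>. open U \<and> x0 \<in> U \<and> smooth_on U \<rho> \<and>
        \<Omega> \<inter> U = {x\<in>U. \<rho> x < 0} \<and>
        (\<forall>x\<in>U. frechet_derivative \<rho> (at x) \<noteq> (\<lambda>v. 0)))"

definition test_fun :: "(real^'n::finite) set \<Rightarrow> (real^'n \<Rightarrow> real) \<Rightarrow> bool" where
  "test_fun \<Omega> \<phi> \<longleftrightarrow> smooth_on UNIV \<phi> \<and> compact (closure {x. \<phi> x \<noteq> 0})
      \<and> closure {x. \<phi> x \<noteq> 0} \<subseteq> \<Omega>"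

definition Lp :: "real \<Rightarrow> (real^'n::finite) set \<Rightarrow> (real^'n \<Rightarrow> real) \<Rightarrow> bool" where
  "Lp q \<Omega> f \<longleftrightarrow> f \<in> borel_measurable (lebesgue_on \<Omega>)
      \<and> integrable (lebesgue_on \<Omega>) (\<lambda>x. \<bar>f x\<bar> powr q)"

definition Lp_norm :: "real \<Rightarrow> (real^'n::finite) set \<Rightarrow> (real^'n \<Rightarrow> real) \<Rightarrow> real" where
  "Lp_norm q \<Omega> f = (\<integral>x. \<bar>f x\<bar> powr q \<partial>lebesgue_on \<Omega>) powr (1/q)"

definition weak_grad :: "(real^'n::finite) set \<Rightarrow> (real^'n \<Rightarrow> real) \<Rightarrow> (real^'n \<Rightarrow> real^'n) \<Rightarrow> bool" where
  "weak_grad \<Omega> f g \<longleftrightarrow> (\<forall>\<phi>. test_fun \<Omega> \<phi> \<longrightarrow> (\<forall>i.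
      (\<integral>x. f x * pd i \<phi> x \<partial>lebesgue_on \<Omega>) = - (\<integral>x. g x $ i * \<phi> x \<partial>lebesgue_on \<Omega>)))"

definition W1 :: "real \<Rightarrow> (real^'n::finite) set \<Rightarrow> (real^'n \<Rightarrow> real) \<Rightarrow> bool" where
  "W1 q \<Omega> f \<longleftrightarrow> Lp q \<Omega> f \<and> (\<exists>g. (\<forall>i. Lp q \<Omega> (\<lambda>x. g x $ i)) \<and> weak_grad \<Omega> f g)"

definition wgrad :: "real \<Rightarrow> (real^'n::finite) set \<Rightarrow> (real^'n \<Rightarrow> real) \<Rightarrow> real^'n \<Rightarrow> real^'n" where
  "wgrad q \<Omega> f = (SOME g. (\<forall>i. Lp q \<Omega> (\<lambda>x. g x $ i)) \<and> weak_grad \<Omega> f g)"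

definition W1_norm :: "real \<Rightarrow> (real^'n::finite) set \<Rightarrow> (real^'n \<Rightarrow> real) \<Rightarrow> real" where
  "W1_norm q \<Omega> f = Lp_norm q \<Omega> f + (\<Sum>i\<in>UNIV. Lp_norm q \<Omega> (\<lambda>x. wgrad q \<Omega> f x $ i))"

abbreviation V :: "(real^'n::finite) set \<Rightarrow> (real^'n \<Rightarrow> real) \<Rightarrow> bool" where
  "V \<Omega> f \<equiv> W1 2 \<Omega> f"

definition dual :: "real \<Rightarrow> (real^'n::finite) set \<Rightarrow> ((real^'n \<Rightarrow> real) \<Rightarrow> real) \<Rightarrow> bool" where
  "dual q \<Omega> L \<longleftrightarrow>
     (\<forall>v w. W1 q \<Omega> v \<longrightarrow> W1 q \<Omega> w \<longrightarrow> L (\<lambda>x. v x + w x) = L v + L w) \<and>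
     (\<forall>c v. W1 q \<Omega> v \<longrightarrow> L (\<lambda>x. c * v x) = c * L v) \<and>
     (\<exists>C. \<forall>v. W1 q \<Omega> v \<longrightarrow> \<bar>L v\<bar> \<le> C * W1_norm q \<Omega> v)"

definition Aform :: "real \<Rightarrow> real \<Rightarrow> (real^'n::finite) set \<Rightarrow> (real^'n \<Rightarrow> real) \<Rightarrow> (real^'n \<Rightarrow> real) \<Rightarrow> real" where
  "Aform q r \<Omega> v w = (\<integral>x. inner (wgrad q \<Omega> v x) (wgrad r \<Omega> w x) \<partial>lebesgue_on \<Omega>)"

definition beta_hat :: "real \<Rightarrow> ennreal" where
  "beta_hat r = (if 0 \<le> r \<and> r \<le> 1 then ennreal (integral {0..r} (\<lambda>s. ln (1 + s))) else \<infinity>)"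

definition J :: "(real^'n::finite) set \<Rightarrow> (real^'n \<Rightarrow> real) \<Rightarrow> ennreal" where
  "J \<Omega> v = (\<integral>\<^sup>+ x. beta_hat (v x) \<partial>lebesgue_on \<Omega>)"

definition subdiff_J :: "(real^'n::finite) set \<Rightarrow> (real^'n \<Rightarrow> real) \<Rightarrow> ((real^'n \<Rightarrow> real) \<Rightarrow> real) \<Rightarrow> bool" where
  "subdiff_J \<Omega> chi \<xi> \<longleftrightarrow> V \<Omega> chi \<and> dual 2 \<Omega> \<xi> \<and> J \<Omega> chi < \<infinity> \<and>
     (\<forall>v. V \<Omega> v \<longrightarrow>
        enn2ereal (J \<Omega> v) \<ge> enn2ereal (J \<Omega> chi) + ereal (\<xi> (\<lambda>x. v x - chi x)))"

definition assumption_H :: "(real \<Rightarrow> real) \<Rightarrow> bool" where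
  "assumption_H h \<longleftrightarrow> (\<exists>c>1.
     (\<forall>r. h differentiable (at r)) \<and> (\<forall>r. deriv h differentiable (at r)) \<and>
     continuous_on UNIV (deriv (deriv h)) \<and>
     bounded (range h) \<and> bounded (range (deriv h)) \<and> bounded (range (deriv (deriv h))) \<and>
     bounded (range (\<lambda>r. r * deriv h r)) \<and>
     (SUP r. \<bar>h r\<bar>) + (SUP r. \<bar>deriv h r\<bar>) + (SUP r. \<bar>deriv (deriv h) r\<bar>)
       + (SUP r. \<bar>r * deriv h r\<bar>) \<le> c \<and>
     (\<forall>r s. 0 \<le> s \<and> s \<le> 1 \<longrightarrow>
        1 / c \<le> 1 + r * deriv (deriv h) r * s \<and> 1 + r * deriv (deriv h) r * s \<le> c))"

definition psi :: "(real \<Rightarrow> real) \<Rightarrow> real \<Rightarrow> real \<Rightarrow> real" where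
  "psi h \<theta> chi = \<theta> - chi * (h \<theta> - \<theta> * deriv h \<theta>)"

text \<open>A time-independent sextuple (e,\<theta>,chi,\<xi>,u,p) which is a weak solution on (0,T) with
  initial data e0, chi0, u0.  Since all functions are constant in time, \<partial>_t e = \<partial>_t chi = 0,
  the Bochner-space memberships reduce to memberships of the spatial profiles, and
  (1*p)(t) = t p.\<close>
definition stationary_weak_solution ::
  "(real^'n::finite) set \<Rightarrow> real \<Rightarrow> real \<Rightarrow> (real \<Rightarrow> real) \<Rightarrow>
   (real^'n \<Rightarrow> real) \<Rightarrow> (real^'n \<Rightarrow> real) \<Rightarrow> ((real^'n \<Rightarrow> real) \<Rightarrow> real) \<Rightarrow>
   (real^'n \<Rightarrow> real) \<Rightarrow> (real^'n \<Rightarrow> real) \<Rightarrow> (real^'n \<Rightarrow> real) \<Rightarrow>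
   ((real^'n \<Rightarrow> real) \<Rightarrow> real) \<Rightarrow> (real^'n \<Rightarrow> real) \<Rightarrow> (real^'n \<Rightarrow> real) \<Rightarrow> bool" where
  "stationary_weak_solution \<Omega> T \<mu> h e0 chi0 u0 e \<theta> chi \<xi> u p \<longleftrightarrow>
     (\<exists>q. 1 < q \<and> q < (real CARD('n) + 2) / (real CARD('n) + 1) \<and>
          W1 q \<Omega> e \<and> W1 q \<Omega> \<theta> \<and>
          \<comment> \<open>\<partial>_t e + A \<theta> = -h(\<theta>) \<partial>_t chi + \<mu> (\<partial>_t chi)^2 in (W^{1,q'})', with \<partial>_t e = \<partial>_t chi = 0\<close>
          (\<forall>w. W1 (q / (q - 1)) \<Omega> w \<longrightarrow>
             0 + Aform q (q / (q - 1)) \<Omega> \<theta> w = - (\<integral>x. h (\<theta> x) * 0 * w x \<partial>lebesgue_on \<Omega>)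
                + \<mu> * (\<integral>x. 0 ^ 2 * w x \<partial>lebesgue_on \<Omega>))) \<and>
     V \<Omega> chi \<and> dual 2 \<Omega> \<xi> \<and> Lp 2 \<Omega> u \<and> (AE x in lebesgue_on \<Omega>. u x > 0) \<and>
     Lp 2 \<Omega> p \<and> V \<Omega> p \<and>
     (AE x in lebesgue_on \<Omega>. e x = psi h (\<theta> x) (chi x)) \<and>
     \<comment> \<open>\<mu> \<partial>_t chi + A chi + \<xi> = h(\<theta>) - log u in V'\<close>
     (\<forall>w. V \<Omega> w \<longrightarrow>
        integrable (lebesgue_on \<Omega>) (\<lambda>x. (h (\<theta> x) - ln (u x)) * w x) \<and>
        \<mu> * 0 + Aform 2 2 \<Omega> chi w + \<xi> w = (\<integral>x. (h (\<theta> x) - ln (u x)) * w x \<partial>lebesgue_on \<Omega>)) \<and>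
     subdiff_J \<Omega> chi \<xi> \<and>
     \<comment> \<open>u + A_0 (1*p) = u0 in V', a.e. in (0,T)\<close>
     dual 2 \<Omega> u0 \<and>
     (AE t in lebesgue_on {0<..<T}. \<forall>w. V \<Omega> w \<longrightarrow>
        (\<integral>x. u x * w x \<partial>lebesgue_on \<Omega>) + Aform 2 2 \<Omega> (\<lambda>x. t * p x) w = u0 w) \<and>
     (AE x in lebesgue_on \<Omega>. p x = u x * (1 + chi x)) \<and>
     (AE x in lebesgue_on \<Omega>. e x = e0 x) \<and> (AE x in lebesgue_on \<Omega>. chi x = chi0 x)"

end

theory Submission
  imports Defs
begin

text \<open>The crux is that \<open>\<theta>\<close>, which lies only in \<open>W\<^sup>1\<^sup>,\<^sup>q\<close> with \<open>q < 2\<close>, is an admissible test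
  function in its own equation. Near a point of the closure of \<open>\<Omega>\<close> the equation is tested with the
  regularised fundamental solution plus, at the boundary, its composition with the reflection
  \<open>x \<mapsto> x - 2 \<rho>(x) \<nabla>\<rho>(x) / |\<nabla>\<rho>(x)|\<^sup>2\<close>; the error kernel has a singularity of order \<open>1 - N\<close> only.
  Hence \<open>|\<theta>|\<close> is bounded by a constant plus a constant times its own Riesz potential of order 1,
  and iterating this bound makes \<open>\<theta>\<close> bounded; differentiating the representation with respect to the pole
  then puts \<open>\<nabla>\<theta>\<close> in every \<open>L\<^sup>s\<close>. Testing with \<open>\<theta>\<close> gives \<open>\<nabla>\<theta> = 0\<close>.

  The equation for \<open>u\<close> at two different times gives \<open>\<nabla>p = 0\<close>. Since \<open>log u = log p - log (1 + chi)\<close>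
  and \<open>log (1 + chi)\<close> is the derivative of the convex potential, the inclusion for \<open>\<xi>\<close> tested
  with \<open>c - chi\<close>, \<open>0 \<le> c \<le> 1\<close>, becomes
  \<open>\<integral>|\<nabla>chi|\<^sup>2 + k \<integral>(c - chi) \<le> 0\<close> with \<open>k = h(\<theta>) - log p\<close>. Taking \<open>c\<close> to be \<open>0\<close> or \<open>1\<close>
  according to the sign of \<open>k\<close> shows that \<open>chi\<close> is constant, and then locates it.\<close>

subsection \<open>Calculus of smooth functions\<close>

text \<open>The obstacle is that the conjugate exponent of q < 2 exceeds 2, so the gradient of
  \<open>\<theta>\<close> cannot be paired with itself and no energy estimate can start. For e > 0
  the kernels are smooth on the whole space, hence admissible test functions for every exponent;
  \<open>e\<close> tends to 0 only after integration against a test function in the pole z, where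
  plain mollifier convergence suffices. The direct kernel has no defect and the cutoff terms live
  away from the pole, so the only singular remainder comes from the reflection. Differentiated in
  the pole it has order -N, just short of integrable. Since \<open>S x\<close> and z lie on opposite
  sides of the boundary, a factor dist(z)^(-\<alpha>) can be traded for a gain of \<alpha> in that
  order, and dist^(-\<alpha>) is in L^s once \<alpha> = 1/(2s). Traces and surface integrals are
  avoided: integration by parts up to the boundary uses cutoffs varying in thin layers, and asks
  only for fields that are tangential up to O(dist).\<close>

named_theorems smooth_intros

lemma pd_eqI: "(f has_derivative f') (at x) \<Longrightarrow> pd i f x = f' (axis i 1)"
  unfolding pd_def by (simp add: frechet_derivative_at[symmetric])

lemma pd_cong_open:
  assumes "open U" "x \<in> U" "\<And>y. y \<in> U \<Longrightarrow> f y = g y"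
  shows "pd i f x = pd i g x"
proof -
  have "(f has_derivative D) (at x) \<longleftrightarrow> (g has_derivative D) (at x)" for D
    using assms has_derivative_transform_within_open by metis
  then show ?thesis unfolding pd_def frechet_derivative_def by simp
qed

lemma differentiable_cong_open:
  assumes "open U" "x \<in> U" "\<And>y. y \<in> U \<Longrightarrow> f y = g y" "f differentiable (at x)"
  shows "g differentiable (at x)"
  using assms has_derivative_transform_within_open unfolding differentiable_def by metis

text \<open>Openness of \<open>U\<close> matters: \<open>pd\<close> looks at a neighbourhood of the
  point, so agreement on \<open>U\<close> passes to the partial derivatives and the induction can
  continue with them.\<close>

lemma Ck_on_cong:
  assumes "open U" "\<And>y. y \<in> U \<Longrightarrow> f y = g y"
  shows "Ck_on k U f \<Longrightarrow> Ck_on k U g"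
  using assms(2)
proof (induction k arbitrary: f g)
  case 0
  then show ?case by (simp cong: continuous_on_cong)
next
  case (Suc k)
  have 1: "\<forall>x\<in>U. g differentiable (at x)"
    using Suc.prems differentiable_cong_open[OF assms(1)] by (metis Ck_on.simps(2))
  have 2: "continuous_on U g" using Suc.prems by (simp cong: continuous_on_cong)
  have "Ck_on k U (pd i g)" for i
  proof (rule Suc.IH)
    show "Ck_on k U (pd i f)" using Suc.prems(1) by simp
    show "pd i f y = pd i g y" if "y \<in> U" for y
      by (rule pd_cong_open[OF assms(1) that Suc.prems(2)])
  qed
  with 1 2 show ?case by simp
qed

lemma smooth_on_cong:
  assumes "open U" "\<And>y. y \<in> U \<Longrightarrow> f y = g y" "smooth_on U f"
  shows "smooth_on U g"
  using assms Ck_on_cong unfolding smooth_on_def by blast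

text \<open>An unfolding of smoothness without the order \<open>k\<close>. Continuity is absent on
  the right because differentiability at every point gives it. A function whose partial derivatives
  are already known to be smooth is thus handled without a new induction.\<close>

lemma smooth_on_iff:
  "smooth_on U f \<longleftrightarrow> (\<forall>x\<in>U. f differentiable (at x)) \<and> (\<forall>i. smooth_on U (pd i f))" (is "?l = ?r")
proof
  assume ?l
  then have "Ck_on (Suc k) U f" for k unfolding smooth_on_def by blast
  then show ?r unfolding smooth_on_def by (simp only: Ck_on.simps) blast
next
  assume r: ?r
  then have c: "continuous_on U f"
    by (metis continuous_at_imp_continuous_on differentiable_imp_continuous_within)
  show ?l unfolding smooth_on_def
  proof
    fix k show "Ck_on k U f" using r c by (cases k) (auto simp: smooth_on_def)
  qed
qed

lemma smooth_on_diff: "smooth_on U f \<Longrightarrow> x \<in> U \<Longrightarrow> f differentiable (at x)"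
  and smooth_on_pd: "smooth_on U f \<Longrightarrow> smooth_on U (pd i f)"
  by (auto simp: smooth_on_iff[of U f])

lemma smooth_on_continuous: "smooth_on U f \<Longrightarrow> continuous_on U f"
  unfolding smooth_on_def by (metis Ck_on.simps(1))

lemma Ck_on_subset: "Ck_on k U f \<Longrightarrow> W \<subseteq> U \<Longrightarrow> Ck_on k W f"
  by (induction k arbitrary: f) (auto intro: continuous_on_subset)

lemma smooth_on_subset: "smooth_on U f \<Longrightarrow> W \<subseteq> U \<Longrightarrow> smooth_on W f"
  unfolding smooth_on_def using Ck_on_subset by blast

lemma Ck_on_Suc_D: "Ck_on (Suc k) U f \<Longrightarrow> Ck_on k U f"
  by (induction k arbitrary: f) auto

text \<open>\<open>pd\<close> records the Frechet derivative only on the coordinate axes; by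
  linearity these values determine it. The product and chain rules for \<open>pd\<close> are read
  off from this total derivative.\<close>

lemma has_derivative_pd:
  assumes "f differentiable (at x)"
  shows "(f has_derivative (\<lambda>v. \<Sum>i\<in>UNIV. v $ i * pd i f x)) (at x)"
proof -
  let ?D = "frechet_derivative f (at x)"
  have D: "(f has_derivative ?D) (at x)" using assms frechet_derivative_works by blast
  then have l: "linear ?D" using has_derivative_linear by blast
  have "?D v = (\<Sum>i\<in>UNIV. v $ i * pd i f x)" for v
  proof -
    have "?D v = ?D (\<Sum>i\<in>UNIV. v $ i *\<^sub>R axis i 1)"
      by (simp add: basis_expansion scalar_mult_eq_scaleR[symmetric])
    also have "\<dots> = (\<Sum>i\<in>UNIV. v $ i * pd i f x)"
      unfolding linear_sum[OF l] by (simp add: linear_scale[OF l] pd_def)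
    finally show ?thesis .
  qed
  with D show ?thesis by (metis (no_types, lifting) ext)
qed

lemma pd_const [simp]: "pd i (\<lambda>x. c) = (\<lambda>x. 0)"
  by (rule ext, rule pd_eqI[THEN trans]) (auto intro!: derivative_eq_intros)

lemma pd_coord: "pd i (\<lambda>x. x $ j) = (\<lambda>x. if i = j then 1 else 0)"
proof (rule ext)
  fix x :: "real^'a"
  have "((\<lambda>x. x $ j) has_derivative (\<lambda>x. x $ j)) (at x)"
    by (intro bounded_linear_imp_has_derivative bounded_linear_vec_nth)
  from pd_eqI[OF this] show "pd i (\<lambda>x. x $ j) x = (if i = j then 1 else 0)"
    by (simp add: axis_def)
qed

lemma pd_add:
  assumes "f differentiable (at x)" "g differentiable (at x)"
  shows "pd i (\<lambda>x. f x + g x) x = pd i f x + pd i g x"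
  using pd_eqI[OF has_derivative_add[OF has_derivative_pd[OF assms(1)] has_derivative_pd[OF assms(2)]], of i]
  by (simp add: axis_def if_distrib[of "\<lambda>z. z * _"] cong: if_cong)

lemma pd_mult:
  assumes "f differentiable (at x)" "g differentiable (at x)"
  shows "pd i (\<lambda>x. f x * g x) x = f x * pd i g x + pd i f x * g x"
  using pd_eqI[OF has_derivative_mult[OF has_derivative_pd[OF assms(1)] has_derivative_pd[OF assms(2)]], of i]
  by (simp add: axis_def if_distrib[of "\<lambda>z. z * _"] cong: if_cong)

lemma pd_compose_real:
  assumes "f differentiable (at x)" "(g has_real_derivative g') (at (f x))"
  shows "pd i (\<lambda>x. g (f x)) x = g' * pd i f x"
  using pd_eqI[OF has_derivative_compose[OF has_derivative_pd[OF assms(1)] assms(2)[unfolded has_field_derivative_def]], of i]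
  by (simp add: axis_def if_distrib[of "\<lambda>z. z * _"] cong: if_cong)

lemma pd_sum:
  assumes "finite I" "\<And>k. k \<in> I \<Longrightarrow> f k differentiable (at x)"
  shows "pd i (\<lambda>x. \<Sum>k\<in>I. f k x) x = (\<Sum>k\<in>I. pd i (f k) x)"
  using assms
proof (induction I rule: finite_induct)
  case (insert k I)
  then show ?case by (simp add: pd_add)
qed simp

lemma Ck_on_const: "Ck_on k U (\<lambda>x. c)"
  by (induction k arbitrary: c) auto

lemma smooth_on_const [smooth_intros, simp]: "smooth_on U (\<lambda>x. c)"
  by (simp add: smooth_on_def Ck_on_const)

lemma smooth_on_coord [smooth_intros, simp]: "smooth_on U (\<lambda>x. x $ j)"
proof -
  have "(\<lambda>x::real^'a. x $ j) differentiable (at x)" for x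
    by (rule bounded_linear_imp_differentiable[OF bounded_linear_vec_nth])
  then show ?thesis
    by (subst smooth_on_iff) (auto simp: pd_coord)
qed

lemma Ck_on_add:
  assumes "open U" shows "Ck_on k U f \<Longrightarrow> Ck_on k U g \<Longrightarrow> Ck_on k U (\<lambda>x. f x + g x)"
proof (induction k arbitrary: f g)
  case (Suc k)
  have "Ck_on k U (pd i (\<lambda>x. f x + g x))" for i
    by (rule Ck_on_cong[OF assms, of "\<lambda>x. pd i f x + pd i g x"])
       (use Suc in \<open>auto simp: pd_add\<close>)
  with Suc.prems show ?case by (auto intro: continuous_on_add)
qed (auto intro: continuous_on_add)

lemma Ck_on_mult:
  assumes "open U" shows "Ck_on k U f \<Longrightarrow> Ck_on k U g \<Longrightarrow> Ck_on k U (\<lambda>x. f x * g x)"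
proof (induction k arbitrary: f g)
  case (Suc k)
  have "Ck_on k U (pd i (\<lambda>x. f x * g x))" for i
    by (rule Ck_on_cong[OF assms, of "\<lambda>x. f x * pd i g x + pd i f x * g x"])
       (use Suc Ck_on_Suc_D[OF Suc.prems(1)] Ck_on_Suc_D[OF Suc.prems(2)] in
         \<open>auto simp: pd_mult intro!: Ck_on_add[OF assms]\<close>)
  with Suc.prems show ?case by (auto intro: continuous_on_mult)
qed (auto intro: continuous_on_mult)

lemma smooth_on_add [smooth_intros]:
  "open U \<Longrightarrow> smooth_on U f \<Longrightarrow> smooth_on U g \<Longrightarrow> smooth_on U (\<lambda>x. f x + g x)"
  by (simp add: smooth_on_def Ck_on_add)

lemma smooth_on_mult [smooth_intros]:
  "open U \<Longrightarrow> smooth_on U f \<Longrightarrow> smooth_on U g \<Longrightarrow> smooth_on U (\<lambda>x. f x * g x)"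
  by (simp add: smooth_on_def Ck_on_mult)

lemma smooth_on_minus [smooth_intros]: "open U \<Longrightarrow> smooth_on U f \<Longrightarrow> smooth_on U (\<lambda>x. - f x)"
  using smooth_on_mult[of U "\<lambda>x. -1" f] by simp

lemma smooth_on_diff' [smooth_intros]:
  "open U \<Longrightarrow> smooth_on U f \<Longrightarrow> smooth_on U g \<Longrightarrow> smooth_on U (\<lambda>x. f x - g x)"
  using smooth_on_add[of U f "\<lambda>x. - g x"] smooth_on_minus[of U g] by simp

lemma smooth_on_power [smooth_intros]: "open U \<Longrightarrow> smooth_on U f \<Longrightarrow> smooth_on U (\<lambda>x. f x ^ n)"
  by (induction n) (auto intro: smooth_on_mult)

lemma smooth_on_sum [smooth_intros]:
  "open U \<Longrightarrow> (\<And>k. k \<in> I \<Longrightarrow> smooth_on U (f k)) \<Longrightarrow> smooth_on U (\<lambda>x. \<Sum>k\<in>I. f k x)"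
  by (induction I rule: infinite_finite_induct) (auto intro: smooth_on_add)

text \<open>All derivatives \<open>G n\<close> are given in advance so that the chain rule stays
  within the family: a partial derivative of \<open>G n\<close> after \<open>f\<close> is
  \<open>G (Suc n)\<close> after \<open>f\<close> times \<open>pd i f\<close>. The induction on the
  order therefore runs over all \<open>n\<close> at once.\<close>

lemma smooth_on_compose_real:
  fixes G :: "nat \<Rightarrow> real \<Rightarrow> real"
  assumes U: "open U" and f: "smooth_on U f"
    and G: "\<And>n t. t \<in> D \<Longrightarrow> (G n has_real_derivative G (Suc n) t) (at t)"
    and D: "\<And>x. x \<in> U \<Longrightarrow> f x \<in> D"
  shows "smooth_on U (\<lambda>x. G n (f x))"
proof -
  have d: "(\<lambda>x. G n (f x)) differentiable (at x)" if "x \<in> U" for n x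
    using has_derivative_compose[OF has_derivative_pd[OF smooth_on_diff[OF f that]]
        has_field_derivative_imp_has_derivative[OF G[OF D[OF that]]]]
    by (rule differentiableI)
  then have c: "continuous_on U (\<lambda>x. G n (f x))" for n
    by (metis continuous_at_imp_continuous_on differentiable_imp_continuous_within)
  have "Ck_on k U (\<lambda>x. G n (f x))" for k
  proof (induction k arbitrary: n)
    case 0 show ?case using c by simp
  next
    case (Suc k)
    have "Ck_on k U (pd i (\<lambda>x. G n (f x)))" for i
      by (rule Ck_on_cong[OF U, of "\<lambda>x. G (Suc n) (f x) * pd i f x"])
         (use Suc smooth_on_pd[OF f] pd_compose_real[OF smooth_on_diff[OF f] G[OF D]] in
           \<open>auto intro!: Ck_on_mult[OF U] simp: smooth_on_def\<close>)
    with c d show ?case by simp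
  qed
  then show ?thesis by (simp add: smooth_on_def)
qed

lemma smooth_on_powr [smooth_intros]:
  assumes "open U" "smooth_on U f" "\<And>x. x \<in> U \<Longrightarrow> 0 < f x"
  shows "smooth_on U (\<lambda>x. f x powr a)"
proof -
  \<comment> \<open>\<open>c n\<close> is the falling factorial a (a - 1) ... (a - n + 1), the
    coefficient of the \<open>n\<close>-th derivative of \<open>t powr a\<close>.\<close>
  define c where "c = rec_nat 1 (\<lambda>n r. r * (a - real n))"
  define G where "G n t = c n * t powr (a - real n)" for n t
  have "(G n has_real_derivative G (Suc n) t) (at t)" if "t \<in> {0<..}" for n t
    using that unfolding G_def c_def
    by (auto intro!: derivative_eq_intros simp: algebra_simps)
  then have "smooth_on U (\<lambda>x. G 0 (f x))"
    using assms(3) by (intro smooth_on_compose_real[where G = G and D = "{0<..}", OF assms(1,2)]) auto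
  then show ?thesis by (simp add: G_def c_def)
qed

lemma smooth_on_inverse [smooth_intros]:
  assumes "open U" "smooth_on U f" "\<And>x. x \<in> U \<Longrightarrow> 0 < f x"
  shows "smooth_on U (\<lambda>x. 1 / f x)"
  by (rule smooth_on_cong[OF assms(1) _ smooth_on_powr[OF assms, of "-1"]])
     (use assms(3) in \<open>force simp: powr_minus_divide abs_of_pos\<close>)

lemma smooth_on_divide [smooth_intros]:
  assumes "open U" "smooth_on U g" "smooth_on U f" "\<And>x. x \<in> U \<Longrightarrow> 0 < f x"
  shows "smooth_on U (\<lambda>x. g x / f x)"
  using smooth_on_mult[OF assms(1,2) smooth_on_inverse[OF assms(1,3,4)]] by simp

subsection \<open>Cutoff functions\<close>

text \<open>The polynomial parameter makes the class closed under differentiation: derivatives of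
  p(1/t) exp(-1/t) have the same form, and all members vanish to infinite order at 0.\<close>

definition flat_exp :: "real poly \<Rightarrow> real \<Rightarrow> real" where
  "flat_exp p t = (if 0 < t then poly p (1/t) * exp (- (1/t)) else 0)"

lemma tendsto_poly_exp: "((\<lambda>u::real. poly p u * exp (- u)) \<longlongrightarrow> 0) at_top"
proof -
  have "((\<lambda>u::real. \<Sum>k\<le>degree p. coeff p k * (u ^ k / exp u)) \<longlongrightarrow> (\<Sum>k\<le>degree p. coeff p k * 0)) at_top"
    by (intro tendsto_sum tendsto_mult tendsto_const tendsto_power_div_exp_0)
  then show ?thesis
    by (simp add: poly_altdef sum_divide_distrib exp_minus field_simps)
qed

text \<open>With u = 1/t the derivative of p(u) exp(-u) is u^2 (p - p')(u) exp(-u), which explains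
  the polynomial. At 0 the right difference quotient is u p(u) exp(-u) with u tending to infinity,
  where the exponential wins.\<close>

lemma flat_exp_deriv:
  "(flat_exp p has_real_derivative flat_exp ([:0,0,1:] * (p - pderiv p)) t) (at t)"
proof (cases t "0::real" rule: linorder_cases)
  case less
  have "((\<lambda>t. 0) has_real_derivative 0) (at t)" by simp
  then have "(flat_exp p has_real_derivative 0) (at t)"
    by (rule has_field_derivative_transform_within_open[of _ _ _ "{..<0}"]) (use less in \<open>auto simp: flat_exp_def\<close>)
  then show ?thesis using less by (simp add: flat_exp_def)
next
  case equal
  have "((\<lambda>h. (flat_exp p (0 + h) - flat_exp p 0) / h) \<longlongrightarrow> 0) (at 0)"
  proof -
    have "((\<lambda>h. poly (pCons 0 p) (inverse h) * exp (- inverse h)) \<longlongrightarrow> 0) (at_right (0::real))"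
      using tendsto_poly_exp filterlim_inverse_at_top_right by (rule filterlim_compose)
    then have r: "((\<lambda>h. (flat_exp p (0 + h) - flat_exp p 0) / h) \<longlongrightarrow> 0) (at_right 0)"
      by (rule Lim_transform_eventually)
         (auto simp: flat_exp_def eventually_at_filter field_simps)
    have "((\<lambda>h. 0::real) \<longlongrightarrow> 0) (at_left (0::real))" by simp
    then have "((\<lambda>h. (flat_exp p (0 + h) - flat_exp p 0) / h) \<longlongrightarrow> 0) (at_left 0)"
      by (rule Lim_transform_eventually)
         (auto simp: flat_exp_def eventually_at_filter)
    with r show ?thesis by (simp add: filterlim_split_at)
  qed
  then show ?thesis using equal by (simp add: DERIV_def flat_exp_def)
next
  case greater
  have "((\<lambda>t. poly p (1/t) * exp (- (1/t))) has_real_derivative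
      flat_exp ([:0,0,1:] * (p - pderiv p)) t) (at t)"
    using greater
    by (auto intro!: derivative_eq_intros DERIV_chain'[OF _ poly_DERIV]
       simp: flat_exp_def field_simps power2_eq_square)
  then show ?thesis
    by (rule has_field_derivative_transform_within_open[of _ _ _ "{0<..}"]) (use greater in \<open>auto simp: flat_exp_def\<close>)
qed

definition smooth_bump :: "real \<Rightarrow> real" where "smooth_bump = flat_exp 1"

lemma smooth_on_smooth_bump [smooth_intros]:
  assumes "open U" "smooth_on U f" shows "smooth_on U (\<lambda>x. smooth_bump (f x))"
proof -
  define P where "P = rec_nat (1::real poly) (\<lambda>_ p. [:0,0,1:] * (p - pderiv p))"
  have "(flat_exp (P n) has_real_derivative flat_exp (P (Suc n)) t) (at t)" for n t
    using flat_exp_deriv[of "P n" t] by (simp add: P_def)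
  then have "smooth_on U (\<lambda>x. flat_exp (P 0) (f x))"
    by (intro smooth_on_compose_real[where G = "\<lambda>n. flat_exp (P n)" and D = UNIV, OF assms]) auto
  then show ?thesis by (simp add: P_def smooth_bump_def)
qed

lemma smooth_bump_pos: "0 < smooth_bump t \<longleftrightarrow> 0 < t"
  and smooth_bump_nonneg: "0 \<le> smooth_bump t"
  and smooth_bump_zero: "smooth_bump t = 0 \<longleftrightarrow> t \<le> 0"
  by (auto simp: smooth_bump_def flat_exp_def)

text \<open>The transition is placed between 1 and 2 rather than between 0 and 1: composed with a
  continuous function f, the step vanishes off the closed set where f \<ge> 1, which lies strictly
  inside the set where f is positive.\<close>

definition smooth_step :: "real \<Rightarrow> real" where
  "smooth_step t = smooth_bump (t - 1) / (smooth_bump (t - 1) + smooth_bump (2 - t))"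

lemma smooth_bump_sum_pos: "0 < smooth_bump (t - 1) + smooth_bump (2 - t)"
  using smooth_bump_pos[of "t-1"] smooth_bump_pos[of "2-t"] smooth_bump_nonneg[of "t-1"] smooth_bump_nonneg[of "2-t"]
  by (smt (verit))

lemma smooth_step_0: "t \<le> 1 \<Longrightarrow> smooth_step t = 0"
  and smooth_step_1: "2 \<le> t \<Longrightarrow> smooth_step t = 1"
  and smooth_step_bounds: "0 \<le> smooth_step t" "smooth_step t \<le> 1"
  using smooth_bump_sum_pos[of t] smooth_bump_zero[of "t-1"] smooth_bump_zero[of "2-t"] smooth_bump_nonneg[of "t-1"] smooth_bump_nonneg[of "2-t"]
  by (auto simp: smooth_step_def)

lemma smooth_on_smooth_step [smooth_intros]:
  assumes "open U" "smooth_on U f" shows "smooth_on U (\<lambda>x. smooth_step (f x))"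
  unfolding smooth_step_def
  by (intro smooth_on_divide smooth_on_add smooth_on_smooth_bump smooth_on_diff' smooth_on_const assms smooth_bump_sum_pos)

lemma smooth_on_inner [smooth_intros]:
  assumes "open U" "\<And>i. smooth_on U (\<lambda>x. f x $ i)" "\<And>i. smooth_on U (\<lambda>x. g x $ i)"
  shows "smooth_on U (\<lambda>x. f x \<bullet> g x)"
  unfolding inner_vec_def inner_real_def by (intro smooth_on_sum smooth_on_mult assms)

lemma smooth_on_diff_component [smooth_intros]:
  "open U \<Longrightarrow> smooth_on U (\<lambda>x. f x $ i) \<Longrightarrow> smooth_on U (\<lambda>x. g x $ i) \<Longrightarrow> smooth_on U (\<lambda>x. (f x - g x) $ i)"
  by (simp add: smooth_on_diff')

lemma test_funI:
  assumes "smooth_on UNIV \<phi>" "compact K" "K \<subseteq> \<Omega>" "\<And>x. x \<notin> K \<Longrightarrow> \<phi> x = 0"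
  shows "test_fun \<Omega> \<phi>"
proof -
  have "closure {x. \<phi> x \<noteq> 0} \<subseteq> K"
    using assms(2,4) by (intro closure_minimal) (auto simp: compact_imp_closed)
  then have "closure {x. \<phi> x \<noteq> 0} = K \<inter> closure {x. \<phi> x \<noteq> 0}" by blast
  then have "compact (closure {x. \<phi> x \<noteq> 0})"
    using compact_Int_closed[OF assms(2) closed_closure] by metis
  with \<open>closure {x. \<phi> x \<noteq> 0} \<subseteq> K\<close> show ?thesis
    unfolding test_fun_def using assms by blast
qed

lemma cutoff_ball:
  fixes x0 :: "real^'n::finite"
  assumes "0 < r"
  obtains \<eta> where "smooth_on UNIV \<eta>" "\<And>x. x \<in> ball x0 r \<Longrightarrow> \<eta> x = 1"
    "\<And>x. x \<notin> cball x0 (2 * r) \<Longrightarrow> \<eta> x = 0" "\<And>x. 0 \<le> \<eta> x" "\<And>x. \<eta> x \<le> 1"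
proof -
  \<comment> \<open>The argument is at least 2 where |x - x0| \<le> r and at most 1 where |x - x0|^2
    \<ge> 2 r^2, in particular outside the ball of radius 2 r. Using the squared distance keeps it
    smooth at the centre.\<close>
  define \<eta> where "\<eta> x = smooth_step (3 - ((x - x0) \<bullet> (x - x0)) / r\<^sup>2)" for x :: "real^'n"
  have 1: "smooth_on UNIV \<eta>" unfolding \<eta>_def
    by (intro smooth_intros) (use assms in auto)
  have sq: "(x - x0) \<bullet> (x - x0) = (dist x0 x)\<^sup>2" for x :: "real^'n"
    by (metis dist_commute dist_norm power2_norm_eq_inner)
  have 2: "\<eta> x = 1" if "x \<in> ball x0 r" for x
  proof -
    have "(dist x0 x)\<^sup>2 \<le> r\<^sup>2" using that by (intro power_mono) auto
    then show ?thesis using assms unfolding \<eta>_def sq by (intro smooth_step_1) (simp add: field_simps)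
  qed
  have 3: "\<eta> x = 0" if "x \<notin> cball x0 (2*r)" for x
  proof -
    have "(2 * r)\<^sup>2 \<le> (dist x0 x)\<^sup>2" using that assms by (intro power_mono) auto
    then have "2 * r\<^sup>2 \<le> (dist x0 x)\<^sup>2" using zero_le_power2[of r] four_x_squared[of r] by linarith
    then show ?thesis using assms unfolding \<eta>_def sq by (intro smooth_step_0) (simp add: field_simps)
  qed
  from that[OF 1 2 3] smooth_step_bounds show ?thesis by (simp add: \<eta>_def)
qed

text \<open>By Lindelof \<open>W\<close> is a countable union of balls, each carrying a bump
  positive exactly on it. The partial sum \<open>s n\<close> is multiplied by \<open>n\<close> so
  that at each point of \<open>W\<close> it eventually exceeds 2, where the step equals 1, while the
  support stays inside finitely many of the balls.\<close>

lemma cutoff_open: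
  fixes W :: "(real^'n::finite) set"
  assumes "open W"
  obtains \<phi> :: "nat \<Rightarrow> real^'n \<Rightarrow> real" where "\<And>n. test_fun W (\<phi> n)" "\<And>n x. 0 \<le> \<phi> n x" "\<And>n x. \<phi> n x \<le> 1"
    "\<And>x. (\<lambda>n. \<phi> n x) \<longlonglongrightarrow> indicator W x"
proof (cases "W = {}")
  case True
  show ?thesis by (rule that[of "\<lambda>n x. 0"]) (auto simp: True intro!: test_funI[of _ "{}"])
next
  case False
  let ?F = "{ball c r | c r. 0 < r \<and> ball c r \<subseteq> W}"
  have "\<Union>?F = W" using assms by (auto simp: open_contains_ball) (metis centre_in_ball)
  obtain F' where F': "F' \<subseteq> ?F" "countable F'" "\<Union>F' = W"
    using \<open>\<Union>?F = W\<close> by (rule_tac Lindelof[of ?F]) auto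
  then have ne: "F' \<noteq> {}" using False by auto
  define B where "B = from_nat_into F'"
  have B: "range B = F'" unfolding B_def using ne F' by (simp add: range_from_nat_into)
  have "\<exists>c r. B k = ball c r \<and> 0 < r \<and> ball c r \<subseteq> W" for k using B F' by blast
  then obtain c r where cr: "\<And>k. B k = ball (c k) (r k)" "\<And>k. 0 < r k" "\<And>k. ball (c k) (r k) \<subseteq> W" by metis
  define b where "b k x = smooth_bump ((r k)\<^sup>2 - (x - c k) \<bullet> (x - c k))" for k and x :: "real^'n"
  have b: "0 < b k x \<longleftrightarrow> x \<in> B k" for k x
  proof -
    have "(x - c k) \<bullet> (x - c k) = (dist (c k) x)\<^sup>2"
      by (metis dist_commute dist_norm power2_norm_eq_inner)
    then show ?thesis using cr(2)[of k] unfolding b_def smooth_bump_pos cr(1)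
      using abs_le_square_iff[of "r k" "dist (c k) x"] by (auto simp: not_le[symmetric])
  qed
  have b0: "0 \<le> b k x" for k x by (simp add: b_def smooth_bump_nonneg)
  have bs: "smooth_on UNIV (b k)" for k unfolding b_def by (intro smooth_intros) auto
  define s where "s n x = (\<Sum>k<n. b k x)" for n x
  define \<phi> where "\<phi> n x = smooth_step (real n * s n x)" for n x
  have ss: "smooth_on UNIV (s n)" for n unfolding s_def by (intro smooth_intros bs) auto
  show ?thesis
  proof
    show "0 \<le> \<phi> n x" "\<phi> n x \<le> 1" for n x by (simp_all add: \<phi>_def smooth_step_bounds)
    show "test_fun W (\<phi> n)" for n
    proof (rule test_funI)
      show "smooth_on UNIV (\<phi> n)" unfolding \<phi>_def by (intro smooth_intros ss) auto
      let ?K = "{x. 1 \<le> real n * s n x}"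
      have K: "?K \<subseteq> (\<Union>k<n. B k)"
      proof
        fix x assume "x \<in> ?K"
        then have "s n x \<noteq> 0" by auto
        then obtain k where "k < n" "b k x \<noteq> 0" unfolding s_def by (metis lessThan_iff sum.neutral)
        then show "x \<in> (\<Union>k<n. B k)" using b[of k x] b0[of k x] by force
      qed
      have "bounded (\<Union>k<n. B k)" by (auto simp: cr)
      moreover have "closed ?K"
        by (intro closed_Collect_le continuous_intros smooth_on_continuous ss)
      ultimately show "compact ?K" using K by (meson bounded_subset compact_eq_bounded_closed)
      show "?K \<subseteq> W" using K B F'(3) by blast
      show "\<phi> n x = 0" if "x \<notin> ?K" for x using that unfolding \<phi>_def by (intro smooth_step_0) auto
    qed
    show "(\<lambda>n. \<phi> n x) \<longlonglongrightarrow> indicator W x" for x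
    proof (cases "x \<in> W")
      case True
      then obtain k where k: "x \<in> B k" using F' B by blast
      then have p: "0 < b k x" using b by blast
      obtain m where m: "2 / b k x \<le> real m" using real_arch_simple by blast
      have "\<phi> n x = 1" if "n \<ge> max (Suc k) m" for n
      proof -
        have "b k x \<le> s n x" unfolding s_def using that b0 by (intro member_le_sum) auto
        moreover have "2 \<le> real n * b k x" using m that p by (smt (verit) divide_le_eq max.bounded_iff mult_right_mono of_nat_le_iff)
        ultimately have "2 \<le> real n * s n x" by (smt (verit) mult_left_mono of_nat_0_le_iff)
        then show ?thesis unfolding \<phi>_def by (rule smooth_step_1)
      qed
      then have "\<forall>\<^sub>F n in sequentially. \<phi> n x = indicator W x"
        using True eventually_ge_at_top[of "max (Suc k) m"] by (auto elim!: eventually_mono)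
      then show ?thesis by (rule tendsto_eventually)
    next
      case False
      then have "b k x = 0" for k using b[of k x] b0[of k x] F' B by (metis UnionI less_le rangeI)
      then have "\<phi> n x = 0" for n by (simp add: \<phi>_def s_def smooth_step_0)
      then show ?thesis using False by simp
    qed
  qed
qed

subsection \<open>Integration by parts and the fundamental lemma\<close>

lemma smooth_line_deriv:
  assumes "smooth_on UNIV F"
  shows "((\<lambda>t. F (x + t *\<^sub>R axis i 1)) has_real_derivative pd i F (x + t *\<^sub>R axis i 1)) (at t)"
proof -
  have "((\<lambda>t. x + t *\<^sub>R axis i 1) has_derivative (\<lambda>t. t *\<^sub>R axis i 1)) (at t)"
    by (auto intro!: derivative_eq_intros)
  from has_derivative_compose[OF this has_derivative_pd[OF smooth_on_diff[OF assms, of "x + t *\<^sub>R axis i 1"]]]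
  have "((\<lambda>t. F (x + t *\<^sub>R axis i 1)) has_derivative
      (\<lambda>s. \<Sum>j\<in>UNIV. (s *\<^sub>R axis i 1) $ j * pd j F (x + t *\<^sub>R axis i 1))) (at t)" by simp
  moreover have "(\<lambda>s. \<Sum>j\<in>UNIV. (s *\<^sub>R axis i 1) $ j * pd j F (x + t *\<^sub>R axis i 1)) =
      times (pd i F (x + t *\<^sub>R axis i 1))"
  proof
    fix s
    have "(\<Sum>j\<in>UNIV. (s *\<^sub>R axis i 1) $ j * pd j F (x + t *\<^sub>R axis i 1)) =
        (\<Sum>j\<in>UNIV. if j = i then s * pd j F (x + t *\<^sub>R axis i 1) else 0)"
      by (rule sum.cong) (auto simp: axis_def)
    then show "(\<Sum>j\<in>UNIV. (s *\<^sub>R axis i 1) $ j * pd j F (x + t *\<^sub>R axis i 1)) = pd i F (x + t *\<^sub>R axis i 1) * s"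
      by simp
  qed
  ultimately show ?thesis by (simp add: has_field_derivative_def)
qed

lemma integrable_continuous_bounded_support:
  fixes F :: "real^'n::finite \<Rightarrow> real"
  assumes "continuous_on UNIV F" "\<And>x. x \<notin> cball 0 R \<Longrightarrow> F x = 0"
  shows "integrable lborel F"
proof -
  have "integrable lborel (\<lambda>x. indicator (cball 0 R) x *\<^sub>R F x)"
    by (rule borel_integrable_compact) (auto intro: continuous_on_subset[OF assms(1)])
  moreover have "(\<lambda>x. indicator (cball 0 R) x *\<^sub>R F x) = F"
    using assms(2) by (force simp: indicator_def)
  ultimately show ?thesis by simp
qed

lemma bounded_continuous_bounded_support:
  fixes F :: "real^'n::finite \<Rightarrow> real"
  assumes "continuous_on UNIV F" "\<And>x. x \<notin> cball 0 R \<Longrightarrow> F x = 0"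
  obtains L where "0 \<le> L" "\<And>x. \<bar>F x\<bar> \<le> L"
proof -
  have "compact (F ` cball 0 R)"
    by (rule compact_continuous_image[OF continuous_on_subset[OF assms(1)]]) auto
  then have "\<exists>L. \<forall>x\<in>cball 0 R. \<bar>F x\<bar> \<le> L"
    unfolding compact_eq_bounded_closed bounded_iff by auto
  then obtain L where L: "\<And>x. x \<in> cball 0 R \<Longrightarrow> \<bar>F x\<bar> \<le> L" by blast
  show ?thesis
  proof (rule that[of "max 0 L"])
    show "\<bar>F x\<bar> \<le> max 0 L" for x using assms(2)[of x] L[of x] by (cases "x \<in> cball 0 R") auto
  qed simp
qed

lemma pd_zero_outside:
  assumes "\<And>x. x \<notin> cball 0 R \<Longrightarrow> F x = 0" "x \<notin> cball 0 R"
  shows "pd i F x = 0"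
  using pd_cong_open[of "- cball 0 R" x F "\<lambda>x. 0" i] assms by (simp add: open_Compl)

lemma integral_lborel_translate:
  fixes F :: "real^'n::finite \<Rightarrow> real"
  assumes "F \<in> borel_measurable borel"
  shows "(\<integral>x. F (x + a) \<partial>lborel) = (\<integral>x. F x \<partial>lborel)"
proof -
  have "(\<integral>x. F x \<partial>lborel) = (\<integral>x. F x \<partial>(distr lborel borel ((+) a)))" by (simp add: lborel_distr_plus)
  also have "\<dots> = (\<integral>x. F (a + x) \<partial>lborel)" using assms by (intro integral_distr) auto
  finally show ?thesis by (simp add: add.commute)
qed

text \<open>Translation invariance of Lebesgue measure makes the integral of every difference
  quotient zero, and dominated convergence passes to the derivative. The increments are at most 1,
  so all quotients vanish outside the ball of radius R + 1.\<close>

lemma integral_pd_zero: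
  fixes F :: "real^'n::finite \<Rightarrow> real"
  assumes F: "smooth_on UNIV F" and R: "\<And>x. x \<notin> cball 0 R \<Longrightarrow> F x = 0"
  shows "integrable lborel (pd i F)" "(\<integral>x. pd i F x \<partial>lborel) = 0"
proof -
  note cF = smooth_on_continuous[OF F] and cD = smooth_on_continuous[OF smooth_on_pd[OF F, of i]]
  show iD: "integrable lborel (pd i F)"
    by (rule integrable_continuous_bounded_support[OF cD]) (rule pd_zero_outside[OF R])
  have iF: "integrable lborel F"
    by (rule integrable_continuous_bounded_support[OF cF R])
  obtain L where L: "0 \<le> L" "\<And>x. \<bar>pd i F x\<bar> \<le> L"
    using bounded_continuous_bounded_support[of "pd i F" R] cD pd_zero_outside[of R F, OF R] by blast
  define h where "h n = 1 / real (Suc n)" for n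
  have h0: "0 < h n" "h n \<le> 1" for n by (auto simp: h_def)
  have hl: "h \<longlonglongrightarrow> 0" unfolding h_def by (rule LIMSEQ_inverse_real_of_nat[unfolded inverse_eq_divide])
  define q where "q n x = (F (x + h n *\<^sub>R axis i 1) - F x) / h n" for n x
  have mF: "F \<in> borel_measurable borel" using cF by (rule borel_measurable_continuous_onI)
  have q0: "(\<integral>x. q n x \<partial>lborel) = 0" for n
  proof -
    have "F (x + h n *\<^sub>R axis i 1) = 0" if "x \<notin> cball 0 (R + 1)" for x
    proof (rule R)
      have "norm x > R + 1" using that by (simp add: dist_norm)
      moreover have "norm (h n *\<^sub>R axis i 1 :: real^'n) \<le> 1" using h0[of n] by (simp add: norm_axis_1)
      ultimately show "x + h n *\<^sub>R axis i 1 \<notin> cball 0 R"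
        using norm_triangle_ineq4[of "x + h n *\<^sub>R axis i 1" "h n *\<^sub>R axis i 1"] by (simp add: mem_cball_0)
    qed
    then have "integrable lborel (\<lambda>x. F (x + h n *\<^sub>R axis i 1))"
      by (rule integrable_continuous_bounded_support[where R = "R + 1", rotated])
         (auto intro!: continuous_on_compose2[OF cF] continuous_intros)
    then show ?thesis
      unfolding q_def using iF integral_lborel_translate[OF mF] by simp
  qed
  have "(\<lambda>n. \<integral>x. q n x \<partial>lborel) \<longlonglongrightarrow> (\<integral>x. pd i F x \<partial>lborel)"
  proof (rule integral_dominated_convergence[where w = "\<lambda>x. indicator (cball 0 (R + 1)) x *\<^sub>R L"])
    show "pd i F \<in> borel_measurable lborel" using iD by simp
    show "q n \<in> borel_measurable lborel" for n
      unfolding q_def using mF by measurable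
    show "integrable lborel (\<lambda>x. indicator (cball 0 (R+1)) x *\<^sub>R L :: real)"
      by (rule borel_integrable_compact) auto
    show "AE x in lborel. (\<lambda>n. q n x) \<longlonglongrightarrow> pd i F x"
    proof (rule AE_I2)
      fix x
      have "((\<lambda>t. F (x + t *\<^sub>R axis i 1)) has_real_derivative pd i F x) (at 0)"
        using smooth_line_deriv[OF F, of x i 0] by simp
      then have "((\<lambda>t. (F (x + t *\<^sub>R axis i 1) - F x) / t) \<longlongrightarrow> pd i F x) (at 0)"
        by (simp add: DERIV_def)
      then show "(\<lambda>n. q n x) \<longlonglongrightarrow> pd i F x"
        unfolding q_def
      proof (rule filterlim_compose)
        have "h n \<noteq> 0" for n using h0(1)[of n] by simp
        then show "filterlim h (at 0) sequentially" using hl by (simp add: filterlim_at)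
      qed
    qed
    show "AE x in lborel. norm (q n x) \<le> indicator (cball 0 (R + 1)) x *\<^sub>R L" for n
    proof (rule AE_I2)
      fix x
      show "norm (q n x) \<le> indicator (cball 0 (R + 1)) x *\<^sub>R L"
      proof (cases "x \<in> cball 0 (R + 1)")
        case True
        obtain t where "F (x + h n *\<^sub>R axis i 1) - F (x + 0 *\<^sub>R axis i 1) = (h n - 0) * pd i F (x + t *\<^sub>R axis i 1)"
          using MVT2[of 0 "h n" "\<lambda>t. F (x + t *\<^sub>R axis i 1)" "\<lambda>t. pd i F (x + t *\<^sub>R axis i 1)"] smooth_line_deriv[OF F] h0[of n] by blast
        then have "q n x = pd i F (x + t *\<^sub>R axis i 1)" using h0[of n] by (simp add: q_def)
        then show ?thesis using L True by simp
      next
        case False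
        then have "norm x > R + 1" by (simp add: dist_norm)
        moreover have "norm (h n *\<^sub>R axis i 1 :: real^'n) \<le> 1" using h0[of n] by (simp add: norm_axis_1)
        ultimately have "norm (x + h n *\<^sub>R axis i 1) > R" using norm_triangle_ineq4[of "x + h n *\<^sub>R axis i 1" "h n *\<^sub>R axis i 1"] by auto
        then have "q n x = 0" using R[of x] R[of "x + h n *\<^sub>R axis i 1"] \<open>norm x > R + 1\<close> by (simp add: q_def mem_cball_0)
        then show ?thesis using L by simp
      qed
    qed
  qed
  with q0 show "(\<integral>x. pd i F x \<partial>lborel) = 0" by (simp add: LIMSEQ_const_iff)
qed

lemma integrable_lebesgue_on_continuous_bounded_support:
  fixes F :: "real^'n::finite \<Rightarrow> real"
  assumes "continuous_on UNIV F" "\<And>x. x \<notin> \<Omega> \<Longrightarrow> F x = 0" "\<Omega> \<in> sets lebesgue" "integrable lborel F"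
  shows "integrable (lebesgue_on \<Omega>) F" "(\<integral>x. F x \<partial>lebesgue_on \<Omega>) = (\<integral>x. F x \<partial>lborel)"
proof -
  have m: "F \<in> borel_measurable lborel" using assms(4) by simp
  have e: "(\<lambda>x. indicator \<Omega> x * F x) = F" using assms(2) by (auto simp: indicator_def fun_eq_iff)
  show "integrable (lebesgue_on \<Omega>) F"
    using assms(3,4) by (simp add: integrable_restrict_space e integrable_completion m)
  show "(\<integral>x. F x \<partial>lebesgue_on \<Omega>) = (\<integral>x. F x \<partial>lborel)"
    using assms(3) integral_completion[OF m] by (simp add: integral_restrict_space e)
qed

lemma integrable_mult_bounded:
  fixes f g :: "'a \<Rightarrow> real"
  assumes "integrable M f" "g \<in> borel_measurable M" "\<And>x. x \<in> space M \<Longrightarrow> \<bar>g x\<bar> \<le> C"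
  shows "integrable M (\<lambda>x. f x * g x)"
proof (rule Bochner_Integration.integrable_bound[where f = "\<lambda>x. C * f x"])
  show "integrable M (\<lambda>x. C * f x)" using assms(1) by simp
  show "(\<lambda>x. f x * g x) \<in> borel_measurable M" using assms by measurable
  show "AE x in M. norm (f x * g x) \<le> norm (C * f x)"
  proof (rule AE_I2)
    fix x assume "x \<in> space M"
    from assms(3)[OF this] have "\<bar>g x\<bar> \<le> \<bar>C\<bar>" by linarith
    then have "\<bar>f x\<bar> * \<bar>g x\<bar> \<le> \<bar>f x\<bar> * \<bar>C\<bar>" by (intro mult_left_mono) auto
    then show "norm (f x * g x) \<le> norm (C * f x)" by (simp add: abs_mult mult.commute)
  qed
qed

lemma borel_measurable_lebesgue_on_continuous:
  fixes F :: "real^'n::finite \<Rightarrow> real"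
  assumes "continuous_on UNIV F"
  shows "F \<in> borel_measurable (lebesgue_on \<Omega>)"
proof -
  have "F \<in> borel_measurable borel" using assms by (rule borel_measurable_continuous_onI)
  then have "F \<in> borel_measurable lebesgue" by (intro measurable_completion) simp
  then show ?thesis by (rule measurable_restrict_space1)
qed

lemma integrable_mult_test:
  fixes f \<phi> :: "real^'n::finite \<Rightarrow> real"
  assumes "integrable (lebesgue_on \<Omega>) f" "continuous_on UNIV \<phi>" "\<And>x. x \<in> \<Omega> \<Longrightarrow> \<bar>\<phi> x\<bar> \<le> C"
  shows "integrable (lebesgue_on \<Omega>) (\<lambda>x. f x * \<phi> x)"
  using assms by (intro integrable_mult_bounded borel_measurable_lebesgue_on_continuous) auto

lemma test_fun_bounded_support:
  assumes "test_fun \<Omega> \<phi>"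
  obtains R where "\<And>x. x \<notin> cball 0 R \<Longrightarrow> \<phi> x = 0"
proof -
  have "bounded (closure {x. \<phi> x \<noteq> 0})" using assms by (simp add: test_fun_def compact_imp_bounded)
  then obtain R where "\<forall>x\<in>closure {x. \<phi> x \<noteq> 0}. norm x \<le> R" by (auto simp: bounded_iff)
  then have "\<phi> x = 0" if "x \<notin> cball 0 R" for x
    using that closure_subset[of "{x. \<phi> x \<noteq> 0}"] unfolding mem_cball_0 by blast
  then show ?thesis by (rule that)
qed

lemma sigma_finite_lebesgue_on:
  fixes S :: "'a::euclidean_space set"
  assumes "S \<in> sets lebesgue" shows "sigma_finite_measure (lebesgue_on S)"
proof (rule sigma_finite_measure_restrict_space[OF _ assms])
  show "sigma_finite_measure (lebesgue :: 'a measure)"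
  proof
    have "\<Union> (range (\<lambda>n::nat. cball (0::'a) (real n))) = UNIV"
    proof (intro set_eqI iffI UNIV_I)
      fix x :: 'a
      obtain n where "norm x \<le> real n" using real_arch_simple by blast
      then have "x \<in> cball 0 (real n)" by simp
      then show "x \<in> \<Union> (range (\<lambda>n::nat. cball (0::'a) (real n)))" by blast
    qed
    moreover have "emeasure lebesgue (cball (0::'a) (real n)) \<noteq> \<infinity>" for n
      using fmeasurableD2[OF lmeasurable_cball[of "0::'a" "real n"]] unfolding infinity_ennreal_def .
    ultimately show "\<exists>A. countable A \<and> A \<subseteq> sets (lebesgue :: 'a measure) \<and> \<Union> A = space lebesgue \<and> (\<forall>a\<in>A. emeasure lebesgue a \<noteq> \<infinity>)"
      by (intro exI[of _ "range (\<lambda>n::nat. cball (0::'a) (real n))"]) auto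
  qed
qed

lemma integrable_lebesgue_on_subset:
  fixes f :: "real^'n::finite \<Rightarrow> real"
  assumes "integrable (lebesgue_on A) f" "B \<subseteq> A" "A \<in> sets lebesgue" "B \<in> sets lebesgue"
  shows "integrable (lebesgue_on B) f"
  using assms set_integrable_subset[of lebesgue A f B]
  by (simp add: integrable_restrict_space set_integrable_def)

text \<open>The inequality is extended from test functions to indicators of open sets by
  \<open>cutoff_open\<close>, then to measurable sets by outer regularity, each time by dominated
  convergence with majorant |f|. Nonnegative integrals over all measurable sets force f \<ge> 0
  almost everywhere.\<close>

lemma fundamental_lemma_nonneg:
  fixes f :: "real^'n::finite \<Rightarrow> real"
  assumes Om: "open \<Omega>" and f: "integrable (lebesgue_on \<Omega>) f"
    and T: "\<And>\<phi>. test_fun \<Omega> \<phi> \<Longrightarrow> (\<And>x. 0 \<le> \<phi> x) \<Longrightarrow> 0 \<le> (\<integral>x. f x * \<phi> x \<partial>lebesgue_on \<Omega>)"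
  shows "AE x in lebesgue_on \<Omega>. 0 \<le> f x"
proof -
  have Os: "\<Omega> \<in> sets lebesgue" using Om by simp
  have fm: "f \<in> borel_measurable (lebesgue_on \<Omega>)" using f by simp
  have op: "0 \<le> (\<integral>x. f x * indicator W x \<partial>lebesgue_on \<Omega>)" if "open W" "W \<subseteq> \<Omega>" for W
  proof -
    obtain \<phi> :: "nat \<Rightarrow> real^'n \<Rightarrow> real" where p: "\<And>n. test_fun W (\<phi> n)" "\<And>n x. 0 \<le> \<phi> n x" "\<And>n x. \<phi> n x \<le> 1"
      "\<And>x. (\<lambda>n. \<phi> n x) \<longlonglongrightarrow> indicator W x" using cutoff_open[OF \<open>open W\<close>] by blast
    have "test_fun \<Omega> (\<phi> n)" for n using p(1)[of n] that by (auto simp: test_fun_def)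
    then have nn: "0 \<le> (\<integral>x. f x * \<phi> n x \<partial>lebesgue_on \<Omega>)" for n using T p(2) by blast
    have mp: "\<phi> n \<in> borel_measurable (lebesgue_on \<Omega>)" for n
      using p(1)[of n] by (auto simp: test_fun_def intro!: borel_measurable_lebesgue_on_continuous smooth_on_continuous)
    have "(\<lambda>n. \<integral>x. f x * \<phi> n x \<partial>lebesgue_on \<Omega>) \<longlonglongrightarrow> (\<integral>x. f x * indicator W x \<partial>lebesgue_on \<Omega>)"
    proof (rule integral_dominated_convergence[where w = "\<lambda>x. \<bar>f x\<bar>"])
      have "W \<in> sets (lebesgue_on \<Omega>)" using that by (auto simp: sets_restrict_space_iff Os)
      then show "(\<lambda>x. f x * indicator W x) \<in> borel_measurable (lebesgue_on \<Omega>)" using fm by measurable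
      show "(\<lambda>x. f x * \<phi> n x) \<in> borel_measurable (lebesgue_on \<Omega>)" for n using fm mp by measurable
      show "integrable (lebesgue_on \<Omega>) (\<lambda>x. \<bar>f x\<bar>)" using f by simp
      show "AE x in lebesgue_on \<Omega>. (\<lambda>n. f x * \<phi> n x) \<longlonglongrightarrow> f x * indicator W x"
        using p(4) by (intro AE_I2 tendsto_mult tendsto_const)
      show "AE x in lebesgue_on \<Omega>. norm (f x * \<phi> n x) \<le> \<bar>f x\<bar>" for n
        using p(2,3) by (intro AE_I2) (simp add: abs_mult mult_left_le)
    qed
    then show ?thesis by (rule LIMSEQ_le_const) (use nn in blast)
  qed
  have meas: "0 \<le> set_lebesgue_integral (lebesgue_on \<Omega>) A f" if A: "A \<in> sets (lebesgue_on \<Omega>)" for A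
  proof -
    have A': "A \<in> sets lebesgue" "A \<subseteq> \<Omega>" using A Os by (auto simp: sets_restrict_space_iff)
    have "\<exists>T. open T \<and> A \<subseteq> T \<and> T - A \<in> lmeasurable \<and> emeasure lebesgue (T - A) < ennreal (1 / real (Suc n))" for n
    proof -
      have "0 < 1 / real (Suc n)" by simp
      from sets_lebesgue_outer_open[OF A'(1) this] show ?thesis by metis
    qed
    then obtain T where T: "\<And>n. open (T n)" "\<And>n. A \<subseteq> T n" "\<And>n. T n - A \<in> lmeasurable"
      "\<And>n. emeasure lebesgue (T n - A) < ennreal (1 / real (Suc n))" by metis
    \<comment> \<open>Finite intersections make the open supersets decreasing, so their indicators
      converge off the null set \<open>I - A\<close>, where \<open>I\<close> is the total
      intersection.\<close>
    define W where "W n = \<Omega> \<inter> (\<Inter>k\<le>n. T k)" for n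
    have W: "open (W n)" "A \<subseteq> W n" "W n \<subseteq> \<Omega>" for n
      using T A' Om unfolding W_def by (auto intro!: open_Int open_INT)
    define I where "I = (\<Inter>n. W n)"
    have Is: "I \<in> sets lebesgue" "A \<subseteq> I"
      unfolding I_def using W(1,2) by auto
    have "emeasure lebesgue (I - A) \<le> ennreal (1 / real (Suc n))" for n
    proof -
      have "I - A \<subseteq> T n - A" by (auto simp: I_def W_def)
      then have "emeasure lebesgue (I - A) \<le> emeasure lebesgue (T n - A)" using T(3)[of n] by (intro emeasure_mono) auto
      then show ?thesis using T(4)[of n] by simp
    qed
    then have "emeasure lebesgue (I - A) \<le> ennreal 0"
      by (intro LIMSEQ_le_const[OF tendsto_ennrealI[OF LIMSEQ_inverse_real_of_nat]])
         (simp add: inverse_eq_divide)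
    then have null: "I - A \<in> null_sets lebesgue" using Is(1) A'(1) by (intro null_setsI) auto
    have AE: "AE x in lebesgue_on \<Omega>. x \<notin> I - A"
      using AE_not_in[OF null] by (auto simp: AE_restrict_space_iff Os elim!: eventually_mono)
    have Ws: "W n \<in> sets (lebesgue_on \<Omega>)" for n using W by (auto simp: sets_restrict_space_iff Os)
    have "(\<lambda>n. \<integral>x. f x * indicator (W n) x \<partial>lebesgue_on \<Omega>) \<longlonglongrightarrow> (\<integral>x. f x * indicator A x \<partial>lebesgue_on \<Omega>)"
    proof (rule integral_dominated_convergence[where w = "\<lambda>x. \<bar>f x\<bar>"])
      show "(\<lambda>x. f x * indicator A x) \<in> borel_measurable (lebesgue_on \<Omega>)" using fm A by measurable
      show "(\<lambda>x. f x * indicator (W n) x) \<in> borel_measurable (lebesgue_on \<Omega>)" for n using fm Ws[of n] by measurable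
      show "integrable (lebesgue_on \<Omega>) (\<lambda>x. \<bar>f x\<bar>)" using f by simp
      show "AE x in lebesgue_on \<Omega>. norm (f x * indicator (W n) x) \<le> \<bar>f x\<bar>" for n
        by (intro AE_I2) (simp add: indicator_def)
      show "AE x in lebesgue_on \<Omega>. (\<lambda>n. f x * indicator (W n) x) \<longlonglongrightarrow> f x * indicator A x"
        using AE
      proof eventually_elim
        case (elim x)
        show ?case
        proof (cases "x \<in> A")
          case True then show ?thesis using W(2) by (simp add: indicator_def subset_iff)
        next
          case False
          then obtain n where "x \<notin> W n" using elim by (auto simp: I_def)
          then have "x \<notin> W m" if "m \<ge> n" for m using that unfolding W_def by (auto intro: order_trans)
          then have "\<forall>\<^sub>F m in sequentially. f x * indicator (W m) x = f x * indicator A x"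
            by (intro eventually_mono[OF eventually_ge_at_top[of n]]) (use False in auto)
          then show ?thesis by (rule tendsto_eventually)
        qed
      qed
    qed
    then have "0 \<le> (\<integral>x. f x * indicator A x \<partial>lebesgue_on \<Omega>)"
      using op[OF W(1,3)] by (intro LIMSEQ_le_const) auto
    then show ?thesis by (simp add: set_lebesgue_integral_def mult.commute)
  qed
  interpret sigma_finite_measure "lebesgue_on \<Omega>"
    using Os by (rule sigma_finite_lebesgue_on)
  show ?thesis using density_nonneg[OF f meas] .
qed

lemma fundamental_lemma:
  fixes f :: "real^'n::finite \<Rightarrow> real"
  assumes Om: "open \<Omega>" and f: "integrable (lebesgue_on \<Omega>) f"
    and T: "\<And>\<phi>. test_fun \<Omega> \<phi> \<Longrightarrow> (\<integral>x. f x * \<phi> x \<partial>lebesgue_on \<Omega>) = 0"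
  shows "AE x in lebesgue_on \<Omega>. f x = 0"
proof -
  have "AE x in lebesgue_on \<Omega>. 0 \<le> f x"
    by (rule fundamental_lemma_nonneg[OF Om f]) (use T in auto)
  moreover have "AE x in lebesgue_on \<Omega>. 0 \<le> - f x"
    by (rule fundamental_lemma_nonneg[OF Om]) (use T f in auto)
  ultimately show ?thesis by eventually_elim auto
qed

section \<open>Mean value and Taylor estimates in several variables, and Fubini for kernels\<close>

lemma smooth_mvt:
  fixes F :: "real^'n::finite \<Rightarrow> real"
  assumes "smooth_on UNIV F"
  obtains t where "0 < t" "t < 1" "F (y + w) - F y = (\<Sum>i\<in>UNIV. w $ i * pd i F (y + t *\<^sub>R w))"
proof -
  have d: "((\<lambda>t. F (y + t *\<^sub>R w)) has_real_derivative (\<Sum>i\<in>UNIV. w $ i * pd i F (y + t *\<^sub>R w))) (at t)" for t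
  proof -
    have "((\<lambda>t. y + t *\<^sub>R w) has_derivative (\<lambda>t. t *\<^sub>R w)) (at t)"
      by (auto intro!: derivative_eq_intros)
    from has_derivative_compose[OF this has_derivative_pd[OF smooth_on_diff[OF assms, of "y + t *\<^sub>R w"]]]
    have "((\<lambda>t. F (y + t *\<^sub>R w)) has_derivative
      (\<lambda>s. \<Sum>j\<in>UNIV. (s *\<^sub>R w) $ j * pd j F (y + t *\<^sub>R w))) (at t)" by simp
    moreover have "(\<lambda>s. \<Sum>j\<in>UNIV. (s *\<^sub>R w) $ j * pd j F (y + t *\<^sub>R w)) =
      times (\<Sum>i\<in>UNIV. w $ i * pd i F (y + t *\<^sub>R w))"
      by (rule ext) (simp add: sum_distrib_left sum_distrib_right mult_ac)
    ultimately show ?thesis by (simp add: has_field_derivative_def)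
  qed
  obtain t where "0 < t" "t < 1" "F (y + 1 *\<^sub>R w) - F (y + 0 *\<^sub>R w) = (1 - 0) * (\<Sum>i\<in>UNIV. w $ i * pd i F (y + t *\<^sub>R w))"
    using MVT2[of 0 1 "\<lambda>t. F (y + t *\<^sub>R w)" "\<lambda>t. \<Sum>i\<in>UNIV. w $ i * pd i F (y + t *\<^sub>R w)"] d by auto
  then show ?thesis using that by simp
qed

lemma abs_sum_component_le:
  fixes w :: "real^'n::finite"
  assumes "\<And>i. \<bar>g i\<bar> \<le> L"
  shows "\<bar>\<Sum>i\<in>UNIV. w $ i * g i\<bar> \<le> real CARD('n) * L * norm w"
proof -
  have "\<bar>\<Sum>i\<in>UNIV. w $ i * g i\<bar> \<le> (\<Sum>i\<in>UNIV. \<bar>w $ i * g i\<bar>)" by (rule sum_abs)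
  also have "\<dots> \<le> (\<Sum>i\<in>(UNIV::'n set). norm w * L)"
    using assms component_le_norm_cart[of w]
    by (intro sum_mono) (simp add: abs_mult mult_mono)
  finally show ?thesis by (simp add: mult_ac)
qed

lemma smooth_Lipschitz:
  fixes F :: "real^'n::finite \<Rightarrow> real"
  assumes F: "smooth_on UNIV F" and L: "\<And>i x. \<bar>pd i F x\<bar> \<le> L"
  shows "\<bar>F x - F y\<bar> \<le> real CARD('n) * L * norm (x - y)"
proof -
  obtain t where "F (y + (x - y)) - F y = (\<Sum>i\<in>UNIV. (x - y) $ i * pd i F (y + t *\<^sub>R (x - y)))"
    using smooth_mvt[OF F] by metis
  then show ?thesis using abs_sum_component_le[of "\<lambda>i. pd i F (y + t *\<^sub>R (x - y))" L "x - y"] L by simp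
qed

lemma smooth_pd_bounded:
  fixes F :: "real^'n::finite \<Rightarrow> real"
  assumes F: "smooth_on UNIV F" and R: "\<And>x. x \<notin> cball 0 R \<Longrightarrow> F x = 0"
  obtains L where "0 \<le> L" "\<And>i x. \<bar>pd i F x\<bar> \<le> L"
proof -
  have "\<exists>L. 0 \<le> L \<and> (\<forall>x. \<bar>pd i F x\<bar> \<le> L)" for i
    using bounded_continuous_bounded_support[of "pd i F" R] smooth_on_continuous[OF smooth_on_pd[OF F]]
      pd_zero_outside[of R F, OF R] by metis
  then obtain L where L: "\<And>i. 0 \<le> L i" "\<And>i x. \<bar>pd i F x\<bar> \<le> L i" by metis
  show ?thesis
  proof (rule that[of "\<Sum>i\<in>UNIV. L i"])
    show "\<bar>pd i F x\<bar> \<le> (\<Sum>i\<in>UNIV. L i)" for i x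
      using L(2)[of i x] member_le_sum[of i UNIV L] L(1) by force
  qed (use L in \<open>simp add: sum_nonneg\<close>)
qed

text \<open>Bounded support makes the second derivatives bounded on the whole space, so one constant
  serves all \<open>y\<close> and \<open>w\<close>. The remainder comes from the mean value theorem
  and a Lipschitz bound for the first derivatives.\<close>

lemma smooth_taylor2:
  fixes F :: "real^'n::finite \<Rightarrow> real"
  assumes F: "smooth_on UNIV F" and R: "\<And>x. x \<notin> cball 0 R \<Longrightarrow> F x = 0"
  obtains C where "0 \<le> C" "\<And>y w. \<bar>F (y + w) - F y - (\<Sum>i\<in>UNIV. w $ i * pd i F y)\<bar> \<le> C * (norm w)\<^sup>2"
proof -
  have "\<exists>L. 0 \<le> L \<and> (\<forall>j x. \<bar>pd j (pd i F) x\<bar> \<le> L)" for i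
    using smooth_pd_bounded[of "pd i F" R] smooth_on_pd[OF F] pd_zero_outside[of R F, OF R] by metis
  then obtain L where L: "\<And>i. 0 \<le> L i" "\<And>i j x. \<bar>pd j (pd i F) x\<bar> \<le> L i" by metis
  define M where "M = real CARD('n) * (\<Sum>i\<in>UNIV. L i)"
  have M: "\<bar>pd i F x - pd i F y\<bar> \<le> M * norm (x - y)" for i x y
  proof -
    have "\<bar>pd i F x - pd i F y\<bar> \<le> real CARD('n) * L i * norm (x - y)"
      by (rule smooth_Lipschitz[OF smooth_on_pd[OF F] L(2)])
    also have "\<dots> \<le> M * norm (x - y)"
      unfolding M_def using member_le_sum[of i UNIV L] L(1) by (intro mult_right_mono mult_left_mono) auto
    finally show ?thesis .
  qed
  have M0: "0 \<le> M" unfolding M_def using L by (simp add: sum_nonneg)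
  show ?thesis
  proof (rule that)
    show "0 \<le> real CARD('n) * M" using M0 by simp
    fix y w :: "real^'n"
    obtain t where t: "0 < t" "t < 1" "F (y + w) - F y = (\<Sum>i\<in>UNIV. w $ i * pd i F (y + t *\<^sub>R w))"
      using smooth_mvt[OF F] by metis
    have "\<bar>pd i F (y + t *\<^sub>R w) - pd i F y\<bar> \<le> M * norm w" for i
    proof -
      have "\<bar>pd i F (y + t *\<^sub>R w) - pd i F y\<bar> \<le> M * norm (t *\<^sub>R w)" using M[of i "y + t *\<^sub>R w" y] by simp
      also have "\<dots> \<le> M * norm w" using t M0 by (intro mult_left_mono) (auto simp: mult_left_le_one_le)
      finally show ?thesis .
    qed
    from abs_sum_component_le[of "\<lambda>i. pd i F (y + t *\<^sub>R w) - pd i F y", OF this, of w]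
    show "\<bar>F (y + w) - F y - (\<Sum>i\<in>UNIV. w $ i * pd i F y)\<bar> \<le> real CARD('n) * M * (norm w)\<^sup>2"
      unfolding t(3) by (simp add: right_diff_distrib sum_subtractf power2_eq_square mult_ac)
  qed
qed

text \<open>\<open>lebesgue_on\<close> carries a completed sigma-algebra, so the product is not a
  Borel space; Borel measurability of the kernel is pulled back through the identity, which is
  measurable into \<open>borel\<close>.\<close>

lemma measurable_kernel:
  fixes K :: "real^'n::finite \<Rightarrow> real^'n \<Rightarrow> 'b::topological_space"
  assumes "(\<lambda>(x, a). K x a) \<in> borel_measurable borel"
  shows "(\<lambda>(x, a). K x a) \<in> borel_measurable (lebesgue_on \<Omega> \<Otimes>\<^sub>M lborel)"
proof -
  have i: "(\<lambda>x. x) \<in> lebesgue_on \<Omega> \<rightarrow>\<^sub>M (borel :: (real^'n) measure)"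
    using id_borel_measurable_lebesgue_on[of \<Omega>] by (simp add: id_def)
  have "(\<lambda>p. (fst p, snd p)) \<in> lebesgue_on \<Omega> \<Otimes>\<^sub>M lborel \<rightarrow>\<^sub>M (borel :: (real^'n) measure) \<Otimes>\<^sub>M borel"
    by (intro measurable_Pair measurable_compose[OF measurable_fst i] measurable_compose[OF measurable_snd]) simp
  then have "(\<lambda>p. p) \<in> lebesgue_on \<Omega> \<Otimes>\<^sub>M lborel \<rightarrow>\<^sub>M (borel :: ((real^'n) \<times> (real^'n)) measure)"
    by (simp add: borel_prod)
  from measurable_compose[OF this assms] show ?thesis by simp
qed

text \<open>The bound \<open>k\<close> does not depend on x, so |f(x)| k(a) is an integrable
  majorant on the product. In the applications x is the integration variable of the equation and a
  is a translation or a pole.\<close>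

lemma fubini_kernel:
  fixes f :: "real^'n::finite \<Rightarrow> real" and K :: "real^'n \<Rightarrow> real^'n \<Rightarrow> real"
  assumes Om: "\<Omega> \<in> sets lebesgue" and f: "integrable (lebesgue_on \<Omega>) f"
    and K: "(\<lambda>(x, a). K x a) \<in> borel_measurable borel"
    and k: "integrable lborel k" "\<And>x a. x \<in> \<Omega> \<Longrightarrow> \<bar>K x a\<bar> \<le> k a"
  shows "integrable (lebesgue_on \<Omega>) (\<lambda>x. f x * (\<integral>a. K x a \<partial>lborel))"
    and "integrable lborel (\<lambda>a. \<integral>x. f x * K x a \<partial>lebesgue_on \<Omega>)"
    and "(\<integral>x. f x * (\<integral>a. K x a \<partial>lborel) \<partial>lebesgue_on \<Omega>) = (\<integral>a. (\<integral>x. f x * K x a \<partial>lebesgue_on \<Omega>) \<partial>lborel)"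
proof -
  interpret M1: sigma_finite_measure "lebesgue_on \<Omega>" using Om by (rule sigma_finite_lebesgue_on)
  interpret P: pair_sigma_finite "lebesgue_on \<Omega>" "lborel :: (real^'n) measure" ..
  have Km: "(\<lambda>(x, a). K x a) \<in> borel_measurable (lebesgue_on \<Omega> \<Otimes>\<^sub>M lborel)" by (rule measurable_kernel[OF K])
  have fm: "(\<lambda>p. f (fst p)) \<in> borel_measurable (lebesgue_on \<Omega> \<Otimes>\<^sub>M (lborel :: (real^'n) measure))"
    using f by (intro measurable_compose[OF measurable_fst]) auto
  have m: "(\<lambda>(x, a). f x * K x a) \<in> borel_measurable (lebesgue_on \<Omega> \<Otimes>\<^sub>M lborel)"
    using borel_measurable_times[OF fm Km] by (simp add: case_prod_beta)
  have Kx: "K x \<in> borel_measurable lborel" for x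
  proof -
    have "(\<lambda>a. (x, a)) \<in> borel_measurable borel" by (intro borel_measurable_continuous_onI continuous_intros)
    from measurable_compose[OF this K] show ?thesis by simp
  qed
  have Ki: "integrable lborel (K x)" if "x \<in> \<Omega>" for x
  proof (rule Bochner_Integration.integrable_bound[OF k(1) Kx])
    show "AE a in lborel. norm (K x a) \<le> norm (k a)"
      by (rule AE_I2) (use k(2)[OF that] in \<open>simp add: order_trans[OF _ abs_ge_self]\<close>)
  qed
  have int: "integrable (lebesgue_on \<Omega> \<Otimes>\<^sub>M lborel) (\<lambda>(x, a). f x * K x a)"
  proof (rule P.Fubini_integrable[OF m])
    show "AE x in lebesgue_on \<Omega>. integrable lborel (\<lambda>a. case (x, a) of (x, a) \<Rightarrow> f x * K x a)"
      by (rule AE_I2) (use Ki in auto)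
    have bd: "(\<integral>a. \<bar>K x a\<bar> \<partial>lborel) \<le> (\<integral>a. k a \<partial>lborel)" if "x \<in> \<Omega>" for x
      using Ki[OF that] k by (intro integral_mono) (auto simp: that)
    have "(\<lambda>x. \<integral>a. norm (case (x, a) of (x, a) \<Rightarrow> K x a) \<partial>lborel) \<in> borel_measurable (lebesgue_on \<Omega>)"
      using Km by (intro lborel.borel_measurable_lebesgue_integral) (simp add: case_prod_beta)
    then have "integrable (lebesgue_on \<Omega>) (\<lambda>x. \<bar>f x\<bar> * (\<integral>a. \<bar>K x a\<bar> \<partial>lborel))"
      by (intro integrable_mult_bounded[where C = "\<integral>a. k a \<partial>lborel"]) (use f bd in \<open>auto simp: integral_nonneg_AE\<close>)
    then show "integrable (lebesgue_on \<Omega>) (\<lambda>x. \<integral>a. norm (case (x, a) of (x, a) \<Rightarrow> f x * K x a) \<partial>lborel)"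
      by (simp add: abs_mult)
  qed
  have e: "(\<lambda>x. f x * (\<integral>a. K x a \<partial>lborel)) = (\<lambda>x. \<integral>a. f x * K x a \<partial>lborel)" by simp
  show "integrable (lebesgue_on \<Omega>) (\<lambda>x. f x * (\<integral>a. K x a \<partial>lborel))"
    unfolding e using P.integrable_fst'[OF int] by simp
  show "integrable lborel (\<lambda>a. \<integral>x. f x * K x a \<partial>lebesgue_on \<Omega>)"
    using P.integrable_snd[OF int] by simp
  show "(\<integral>x. f x * (\<integral>a. K x a \<partial>lborel) \<partial>lebesgue_on \<Omega>) = (\<integral>a. (\<integral>x. f x * K x a \<partial>lebesgue_on \<Omega>) \<partial>lborel)"
    unfolding e using P.Fubini_integral[OF int] by simp
qed

lemma borel_measurable_kernelI:
  fixes K :: "real^'n::finite \<Rightarrow> real^'n \<Rightarrow> real"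
  assumes "continuous_on UNIV (\<lambda>p. K (fst p) (snd p))"
  shows "(\<lambda>(x, a). K x a) \<in> borel_measurable borel"
  using borel_measurable_continuous_onI[OF assms] by (simp add: case_prod_beta)

subsection \<open>Functions with vanishing weak gradient\<close>

lemma smooth_on_translate:
  fixes a :: "real^'n::finite"
  assumes "smooth_on UNIV F"
  shows "smooth_on UNIV (\<lambda>x. F (x - a))" "pd i (\<lambda>x. F (x - a)) x = pd i F (x - a)"
proof -
  have d: "((\<lambda>x. G (x - a)) has_derivative (\<lambda>v. \<Sum>i\<in>UNIV. v $ i * pd i G (x - a))) (at x)" if "G differentiable (at (x - a))" for G :: "real^'n \<Rightarrow> real" and x
  proof -
    have "((\<lambda>x. x - a) has_derivative (\<lambda>v. v)) (at x)" by (auto intro!: derivative_eq_intros)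
    from has_derivative_compose[OF this has_derivative_pd[OF that]] show ?thesis .
  qed
  have p: "pd i (\<lambda>x. G (x - a)) x = pd i G (x - a)" if "G differentiable (at (x - a))" for G :: "real^'n \<Rightarrow> real" and x i
    using pd_eqI[OF d[OF that], of i] by (simp add: axis_def if_distrib[of "\<lambda>z. z * _"] cong: if_cong)
  show "pd i (\<lambda>x. F (x - a)) x = pd i F (x - a)" using p smooth_on_diff[OF assms] by blast
  have "Ck_on k UNIV (\<lambda>x. G (x - a))" if "smooth_on UNIV G" for G k
    using that
  proof (induction k arbitrary: G)
    case 0
    then show ?case using smooth_on_continuous[OF 0] by (auto intro!: continuous_on_compose2[of UNIV G] continuous_intros)
  next
    case (Suc k)
    have "pd i (\<lambda>x. G (x - a)) = (\<lambda>x. pd i G (x - a))" for i using p[OF smooth_on_diff[OF Suc.prems]] by auto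
    moreover have "continuous_on UNIV (\<lambda>x. G (x - a))"
      using smooth_on_continuous[OF Suc.prems] by (auto intro!: continuous_on_compose2[of UNIV G] continuous_intros)
    ultimately show ?case using Suc.IH[OF smooth_on_pd[OF Suc.prems]] d[OF smooth_on_diff[OF Suc.prems]]
      by (auto intro: differentiableI)
  qed
  then show "smooth_on UNIV (\<lambda>x. F (x - a))" using assms by (simp add: smooth_on_def)
qed

text \<open>A quadratic modulus of continuity makes every difference quotient tend to 0, so the
  derivative vanishes throughout the convex set.\<close>

lemma constant_of_quadratic_modulus:
  fixes T :: "real^'n::finite \<Rightarrow> real"
  assumes "convex S" "open S" "\<And>a b. a \<in> S \<Longrightarrow> b \<in> S \<Longrightarrow> \<bar>T a - T b\<bar> \<le> C * (norm (a - b))\<^sup>2" "a \<in> S" "b \<in> S"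
  shows "T a = T b"
proof -
  have "(T has_derivative (\<lambda>_. 0)) (at x)" if x: "x \<in> S" for x
  proof -
    have "((\<lambda>y. C * norm (y - x)) \<longlongrightarrow> C * norm (x - x)) (at x)" by (intro tendsto_intros)
    then have l: "((\<lambda>y. C * norm (y - x)) \<longlongrightarrow> 0) (at x)" by simp
    have "((\<lambda>y. (T y - T x) /\<^sub>R norm (y - x)) \<longlongrightarrow> 0) (at x)"
    proof (rule Lim_null_comparison[OF _ l])
      show "\<forall>\<^sub>F y in at x. norm ((T y - T x) /\<^sub>R norm (y - x)) \<le> C * norm (y - x)"
        using eventually_at_in_open[OF assms(2) x]
      proof eventually_elim
        case (elim y)
        then have "\<bar>T y - T x\<bar> \<le> C * norm (y - x) * norm (y - x)" using assms(3)[of y x] x by (simp add: power2_eq_square mult_ac)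
        moreover have "norm (y - x) > 0" using elim by simp
        ultimately show ?case by (simp add: divide_simps abs_mult)
      qed
    qed
    then show ?thesis by (simp add: has_derivative_at_within has_derivative_within divide_inverse mult.commute)
  qed
  then have "\<And>x. x \<in> S \<Longrightarrow> (T has_derivative (\<lambda>_. 0)) (at x within S)" by (simp add: has_derivative_at_withinI)
  from has_derivative_zero_constant[OF assms(1) this] obtain c where "\<And>x. x \<in> S \<Longrightarrow> T x = c" by auto
  then show ?thesis using assms by simp
qed

lemma integral_lebesgue_on_zero_outside:
  fixes h :: "real^'n::finite \<Rightarrow> real"
  assumes "B \<subseteq> A" "A \<in> sets lebesgue" "B \<in> sets lebesgue" "\<And>x. x \<in> A \<Longrightarrow> x \<notin> B \<Longrightarrow> h x = 0"
  shows "(\<integral>x. h x \<partial>lebesgue_on A) = (\<integral>x. h x \<partial>lebesgue_on B)"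
proof -
  have "indicator A x *\<^sub>R h x = indicator B x *\<^sub>R h x" for x
    using assms(1) assms(4)[of x] by (cases "x \<in> B"; cases "x \<in> A") auto
  then have "(\<lambda>x. indicator A x *\<^sub>R h x) = (\<lambda>x. indicator B x *\<^sub>R h x)" by blast
  moreover have "(\<integral>x. h x \<partial>lebesgue_on A) = (\<integral>x. indicator A x *\<^sub>R h x \<partial>lebesgue)"
    "(\<integral>x. h x \<partial>lebesgue_on B) = (\<integral>x. indicator B x *\<^sub>R h x \<partial>lebesgue)"
    using assms(2,3) by (simp_all add: integral_restrict_space)
  ultimately show ?thesis by metis
qed

text \<open>\<open>T \<phi> a\<close> pairs \<open>f\<close> with the translate of \<phi> by
  \<open>a\<close>. Its derivative in \<open>a\<close> is a pairing with partial derivatives of a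
  test function, hence zero, so the pairing is invariant under small translations. As in the
  uniqueness proof for Haar measure, pairing \<open>f\<close> with the convolution of two bumps in
  both orders shows that \<open>T \<phi> x0\<close> is proportional to the integral of \<phi>; the
  factor is the constant sought. With supports of radius r and translations up to 2 r everything
  stays in the ball of radius 4 r.\<close>

lemma locally_constant_of_zero_weak_grad:
  fixes f :: "real^'n::finite \<Rightarrow> real"
  assumes Om: "open \<Omega>" and f: "integrable (lebesgue_on \<Omega>) f"
    and z: "\<And>\<phi> i. test_fun \<Omega> \<phi> \<Longrightarrow> (\<integral>x. f x * pd i \<phi> x \<partial>lebesgue_on \<Omega>) = 0"
    and r: "0 < r" "ball x0 (4 * r) \<subseteq> \<Omega>"
  obtains c where "AE x in lebesgue_on (ball x0 r). f x = c"
proof -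
  have Os: "\<Omega> \<in> sets lebesgue" using Om by simp
  define T where "T \<phi> a = (\<integral>x. f x * \<phi> (x - a) \<partial>lebesgue_on \<Omega>)" for \<phi> and a :: "real^'n"
  have i1: "integrable (lebesgue_on \<Omega>) (\<lambda>x. f x * \<phi> (x - a))"
    if \<phi>: "continuous_on UNIV \<phi>" "\<And>x. x \<notin> cball 0 r \<Longrightarrow> \<phi> x = 0" for \<phi> a
  proof -
    obtain L where "\<And>x. \<bar>\<phi> x\<bar> \<le> L" using bounded_continuous_bounded_support[OF \<phi>] by blast
    then show ?thesis using \<phi>(1)
      by (intro integrable_mult_test[OF f]) (auto intro!: continuous_on_compose2[of UNIV \<phi>] continuous_intros)
  qed
  have Tc: "T \<phi> a = T \<phi> x0" if \<phi>: "smooth_on UNIV \<phi>" "\<And>x. x \<notin> cball 0 r \<Longrightarrow> \<phi> x = 0" and a: "a \<in> ball x0 (2 * r)" for \<phi> a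
  proof -
    obtain C where C: "0 \<le> C" "\<And>y w. \<bar>\<phi> (y + w) - \<phi> y - (\<Sum>i\<in>UNIV. w $ i * pd i \<phi> y)\<bar> \<le> C * (norm w)\<^sup>2"
      using smooth_taylor2[of \<phi> r] \<phi> by blast
    have "\<bar>T \<phi> a - T \<phi> b\<bar> \<le> (C * (\<integral>x. \<bar>f x\<bar> \<partial>lebesgue_on \<Omega>)) * (norm (a - b))\<^sup>2" if b: "b \<in> ball x0 (2 * r)" for a b
    proof -
      have tf: "test_fun \<Omega> (\<lambda>x. \<phi> (x - b))"
      proof (rule test_funI[of _ "cball b r"])
        show "smooth_on UNIV (\<lambda>x. \<phi> (x - b))" by (rule smooth_on_translate[OF \<phi>(1)])
        show "cball b r \<subseteq> \<Omega>"
        proof (rule order_trans[OF _ r(2)], rule subsetI)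
          fix x assume "x \<in> cball b r"
          then show "x \<in> ball x0 (4 * r)" using b dist_triangle[of x0 x b] r(1) by (simp add: dist_commute)
        qed
        show "\<phi> (x - b) = 0" if "x \<notin> cball b r" for x using that by (intro \<phi>(2)) (simp add: dist_norm norm_minus_commute)
      qed simp
      have ip: "integrable (lebesgue_on \<Omega>) (\<lambda>x. f x * pd i \<phi> (x - b))" for i
        by (rule i1) (use smooth_on_continuous[OF smooth_on_pd[OF \<phi>(1)]] pd_zero_outside[of r \<phi>] \<phi>(2) in auto)
      have zp: "(\<integral>x. f x * pd i \<phi> (x - b) \<partial>lebesgue_on \<Omega>) = 0" for i
        using z[OF tf, of i] by (simp add: smooth_on_translate[OF \<phi>(1)])
      have ia: "integrable (lebesgue_on \<Omega>) (\<lambda>x. f x * \<phi> (x - c))" for c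
        by (rule i1) (use smooth_on_continuous[OF \<phi>(1)] \<phi>(2) in auto)
      \<comment> \<open>The Taylor remainder: the linear part pairs to zero with \<open>f\<close> by
        hypothesis, so the increment of \<open>T \<phi>\<close> equals the pairing with
        \<open>h\<close>, which is quadratically small.\<close>
      define h where "h x = \<phi> (x - a) - \<phi> (x - b) - (\<Sum>i\<in>UNIV. (b - a) $ i * pd i \<phi> (x - b))" for x
      have hb: "\<bar>h x\<bar> \<le> C * (norm (a - b))\<^sup>2" for x
        using C(2)[of "x - b" "b - a"] by (simp add: h_def norm_minus_commute)
      have eq: "(\<lambda>x. f x * h x) = (\<lambda>x. f x * \<phi> (x - a) - f x * \<phi> (x - b) - (\<Sum>i\<in>UNIV. (b - a) $ i * (f x * pd i \<phi> (x - b))))"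
        by (auto simp: h_def algebra_simps sum_distrib_left)
      have isum: "integrable (lebesgue_on \<Omega>) (\<lambda>x. \<Sum>i\<in>UNIV. (b - a) $ i * (f x * pd i \<phi> (x - b)))"
        using ip by (intro Bochner_Integration.integrable_sum integrable_mult_right) auto
      have ih: "integrable (lebesgue_on \<Omega>) (\<lambda>x. f x * h x)"
        unfolding eq using ia isum by (intro Bochner_Integration.integrable_diff)
      have "(\<integral>x. f x * h x \<partial>lebesgue_on \<Omega>) = T \<phi> a - T \<phi> b - (\<integral>x. (\<Sum>i\<in>UNIV. (b - a) $ i * (f x * pd i \<phi> (x - b))) \<partial>lebesgue_on \<Omega>)"
        unfolding eq T_def using ia isum by (simp add: Bochner_Integration.integral_diff Bochner_Integration.integrable_diff del: integral_mult_right_zero)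
      also have "(\<integral>x. (\<Sum>i\<in>UNIV. (b - a) $ i * (f x * pd i \<phi> (x - b))) \<partial>lebesgue_on \<Omega>) = 0"
        using ip zp by (subst Bochner_Integration.integral_sum) (auto simp del: vector_minus_component)
      finally have "T \<phi> a - T \<phi> b = (\<integral>x. f x * h x \<partial>lebesgue_on \<Omega>)" by simp
      then have "\<bar>T \<phi> a - T \<phi> b\<bar> \<le> (\<integral>x. \<bar>f x * h x\<bar> \<partial>lebesgue_on \<Omega>)" using integral_abs_bound by metis
      also have "\<dots> \<le> (\<integral>x. \<bar>f x\<bar> * (C * (norm (a - b))\<^sup>2) \<partial>lebesgue_on \<Omega>)"
      proof (rule integral_mono)
        show "integrable (lebesgue_on \<Omega>) (\<lambda>x. \<bar>f x * h x\<bar>)" using ih by (rule integrable_abs)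
        show "integrable (lebesgue_on \<Omega>) (\<lambda>x. \<bar>f x\<bar> * (C * (norm (a - b))\<^sup>2))" using f by simp
        show "\<bar>f x * h x\<bar> \<le> \<bar>f x\<bar> * (C * (norm (a - b))\<^sup>2)" for x
          using hb[of x] by (simp add: abs_mult mult_left_mono)
      qed
      finally show ?thesis by (simp add: mult_ac)
    qed
    then show ?thesis
      by (intro constant_of_quadratic_modulus[of "ball x0 (2 * r)" "T \<phi>"]) (use a r in auto)
  qed
  have sym: "T \<phi> x0 * (\<integral>x. \<psi> x \<partial>lborel) = T \<psi> x0 * (\<integral>x. \<phi> x \<partial>lborel)"
    if \<phi>: "smooth_on UNIV \<phi>" "\<And>x. x \<notin> cball 0 r \<Longrightarrow> \<phi> x = 0"
      and \<psi>: "smooth_on UNIV \<psi>" "\<And>x. x \<notin> cball 0 r \<Longrightarrow> \<psi> x = 0" for \<phi> \<psi>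
  proof -
    have conv: "(\<integral>x. f x * (\<integral>a. \<phi> (x - a) * \<psi> (a - x0) \<partial>lborel) \<partial>lebesgue_on \<Omega>) = T \<phi> x0 * (\<integral>x. \<psi> x \<partial>lborel)"
      if \<phi>: "smooth_on UNIV \<phi>" "\<And>x. x \<notin> cball 0 r \<Longrightarrow> \<phi> x = 0"
        and \<psi>: "smooth_on UNIV \<psi>" "\<And>x. x \<notin> cball 0 r \<Longrightarrow> \<psi> x = 0" for \<phi> \<psi>
    proof -
      note c = smooth_on_continuous[OF \<phi>(1)] smooth_on_continuous[OF \<psi>(1)]
      obtain L where L: "0 \<le> L" "\<And>x. \<bar>\<phi> x\<bar> \<le> L" using bounded_continuous_bounded_support[OF c(1) \<phi>(2)] by blast
      have mps: "\<psi> \<in> borel_measurable borel" using c(2) by (rule borel_measurable_continuous_onI)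
      have ips: "integrable lborel (\<lambda>a. \<psi> (a - x0))"
      proof (rule integrable_continuous_bounded_support[where R = "norm x0 + r"])
        show "continuous_on UNIV (\<lambda>a. \<psi> (a - x0))" using c(2) by (auto intro!: continuous_on_compose2[of UNIV \<psi>] continuous_intros)
        show "\<psi> (x - x0) = 0" if "x \<notin> cball 0 (norm x0 + r)" for x
          using that norm_triangle_ineq2[of x x0] by (intro \<psi>(2)) auto
      qed
      have "(\<integral>x. f x * (\<integral>a. \<phi> (x - a) * \<psi> (a - x0) \<partial>lborel) \<partial>lebesgue_on \<Omega>) =
          (\<integral>a. (\<integral>x. f x * (\<phi> (x - a) * \<psi> (a - x0)) \<partial>lebesgue_on \<Omega>) \<partial>lborel)"
      proof (rule fubini_kernel(3)[OF Os f])
        show "(\<lambda>(x, a). \<phi> (x - a) * \<psi> (a - x0)) \<in> borel_measurable borel"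
          using c by (intro borel_measurable_kernelI continuous_on_mult) (auto intro!: continuous_on_compose2[of UNIV \<phi>] continuous_on_compose2[of UNIV \<psi>] continuous_intros)
        show "integrable lborel (\<lambda>a. L * \<bar>\<psi> (a - x0)\<bar>)" using ips by simp
        show "\<bar>\<phi> (x - a) * \<psi> (a - x0)\<bar> \<le> L * \<bar>\<psi> (a - x0)\<bar>" for x a using L by (simp add: abs_mult mult_right_mono)
      qed
      also have "\<dots> = (\<integral>a. T \<phi> x0 * \<psi> (a - x0) \<partial>lborel)"
      proof (rule Bochner_Integration.integral_cong[OF refl])
        fix a
        have "(\<integral>x. f x * (\<phi> (x - a) * \<psi> (a - x0)) \<partial>lebesgue_on \<Omega>) = T \<phi> a * \<psi> (a - x0)"
          unfolding T_def by (simp add: mult.assoc[symmetric])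
        also have "\<dots> = T \<phi> x0 * \<psi> (a - x0)"
        \<comment> \<open>Translation invariance is available only within radius 2 r; beyond it
          \<open>\<psi> (a - x0)\<close> vanishes, since \<psi> lives in radius r.\<close>
        proof (cases "a \<in> ball x0 (2 * r)")
          case True then show ?thesis using Tc[OF \<phi> True] by simp
        next
          case False
          then have "\<psi> (a - x0) = 0" using r by (intro \<psi>(2)) (simp add: dist_norm norm_minus_commute)
          then show ?thesis by simp
        qed
        finally show "(\<integral>x. f x * (\<phi> (x - a) * \<psi> (a - x0)) \<partial>lebesgue_on \<Omega>) = T \<phi> x0 * \<psi> (a - x0)" .
      qed
      also have "\<dots> = T \<phi> x0 * (\<integral>a. \<psi> a \<partial>lborel)"
        using integral_lborel_translate[OF mps, of "- x0"] by simp
      finally show ?thesis .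
    qed
    have "(\<integral>a. \<phi> (x - a) * \<psi> (a - x0) \<partial>lborel) = (\<integral>a. \<psi> (x - a) * \<phi> (a - x0) \<partial>lborel)" for x
    proof -
      have m: "(\<lambda>a. \<psi> (x - a) * \<phi> (a - x0)) \<in> borel_measurable borel"
        using smooth_on_continuous[OF \<phi>(1)] smooth_on_continuous[OF \<psi>(1)]
        by (intro borel_measurable_continuous_onI continuous_on_mult) (auto intro!: continuous_on_compose2[of UNIV \<phi>] continuous_on_compose2[of UNIV \<psi>] continuous_intros)
      \<comment> \<open>The point reflection a -> x + x0 - a preserves the measure and exchanges the
        two factors of the convolution.\<close>
      have "(\<integral>a. \<psi> (x - a) * \<phi> (a - x0) \<partial>lborel) = (\<integral>a. \<psi> (x - a) * \<phi> (a - x0) \<partial>(distr lborel borel (\<lambda>a. (x + x0) + (-1) *\<^sub>R a)))"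
        using lborel_affine[of "-1::real" "x + x0"] by (simp add: density_1)
      also have "\<dots> = (\<integral>a. \<psi> (x - ((x + x0) + (-1) *\<^sub>R a)) * \<phi> (((x + x0) + (-1) *\<^sub>R a) - x0) \<partial>lborel)"
        using m by (intro integral_distr) auto
      also have "\<dots> = (\<integral>a. \<phi> (x - a) * \<psi> (a - x0) \<partial>lborel)" by (simp add: algebra_simps)
      finally show ?thesis by simp
    qed
    with conv[OF \<phi> \<psi>] conv[OF \<psi> \<phi>] show ?thesis by simp
  qed
  obtain \<psi> where \<psi>: "smooth_on UNIV \<psi>" "\<And>x. x \<in> ball 0 (r/2) \<Longrightarrow> \<psi> x = 1"
    "\<And>x. x \<notin> cball 0 (2 * (r/2)) \<Longrightarrow> \<psi> x = 0" "\<And>x. 0 \<le> \<psi> x" "\<And>x :: real^'n. \<psi> x \<le> 1"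
    using cutoff_ball[of "r/2" 0] r by auto
  have ip: "integrable lborel \<psi>" using integrable_continuous_bounded_support[OF smooth_on_continuous[OF \<psi>(1)] \<psi>(3)] .
  have pos: "(\<integral>x. \<psi> x \<partial>lborel) \<noteq> 0"
  proof
    assume "(\<integral>x. \<psi> x \<partial>lborel) = 0"
    then have "AE x in lborel. \<psi> x = 0" using integral_nonneg_eq_0_iff_AE[OF ip] \<psi>(4) by auto
    then have "AE x in lborel. x \<notin> ball (0::real^'n) (r/2)" 
    proof eventually_elim
      case (elim x)
      then show ?case using \<psi>(2)[of x] by auto
    qed
    then have "emeasure lborel (ball (0::real^'n) (r/2)) = 0" by (subst (asm) AE_iff_measurable[OF _ refl]) (auto simp: ball_def)
    then have "measure lborel (ball (0::real^'n) (r/2)) = 0" by (simp add: measure_def)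
    then show False using content_ball_pos[of "r/2" "0::real^'n"] r by (simp add: measure_completion)
  qed
  define c where "c = T \<psi> x0 / (\<integral>x. \<psi> x \<partial>lborel)"
  have main: "AE x in lebesgue_on (ball x0 r). f x - c = 0"
  proof (rule fundamental_lemma)
    let ?B = "ball x0 r"
    have B\<Omega>: "?B \<subseteq> \<Omega>" using r by (intro order_trans[OF subset_ball r(2)]) auto
    have iB: "integrable (lebesgue_on ?B) f"
      by (rule integrable_lebesgue_on_subset[OF f B\<Omega> Os]) simp
    show "integrable (lebesgue_on ?B) (\<lambda>x. f x - c)"
    proof -
      have "finite_measure (lebesgue_on ?B)" by (rule finite_measure_lebesgue_on) simp
      then show ?thesis using iB by (intro Bochner_Integration.integrable_diff) (auto simp: finite_measure.integrable_const)
    qed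
    fix \<phi> assume t: "test_fun ?B \<phi>"
    \<comment> \<open>The test function on the ball around x0 is recentred at 0, so that its
      translate by x0 is the original one.\<close>
    let ?p = "\<lambda>x. \<phi> (x - (- x0))"
    have s: "smooth_on UNIV ?p" using t by (intro smooth_on_translate) (auto simp: test_fun_def)
    have zo: "?p x = 0" if "x \<notin> cball 0 r" for x
    proof (rule ccontr)
      assume "?p x \<noteq> 0"
      then have "x + x0 \<in> ball x0 r" using t closure_subset[of "{x. \<phi> x \<noteq> 0}"] unfolding test_fun_def by auto
      then show False using that by (simp add: dist_norm)
    qed
    have ph0: "\<phi> x = 0" if "x \<notin> ?B" for x
      using t closure_subset[of "{x. \<phi> x \<noteq> 0}"] that unfolding test_fun_def by auto
    have cp: "continuous_on UNIV \<phi>" using t by (auto simp: test_fun_def intro: smooth_on_continuous)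
    obtain R where R: "\<And>x. x \<notin> cball 0 R \<Longrightarrow> \<phi> x = 0" using test_fun_bounded_support[OF t] by blast
    obtain L where L: "\<And>x. \<bar>\<phi> x\<bar> \<le> L" using bounded_continuous_bounded_support[OF cp R] by blast
    have ib: "integrable lborel \<phi>" by (rule integrable_continuous_bounded_support[OF cp R])
    have if1: "integrable (lebesgue_on ?B) (\<lambda>x. f x * \<phi> x)" by (rule integrable_mult_test[OF iB cp L])
    have ip1: "integrable (lebesgue_on ?B) \<phi>" "(\<integral>x. \<phi> x \<partial>lebesgue_on ?B) = (\<integral>x. \<phi> x \<partial>lborel)"
      by (rule integrable_lebesgue_on_continuous_bounded_support[OF cp _ _ ib]; use ph0 in auto)+
    have "T ?p x0 = (\<integral>x. f x * \<phi> x \<partial>lebesgue_on \<Omega>)" by (simp add: T_def)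
    also have "\<dots> = (\<integral>x. f x * \<phi> x \<partial>lebesgue_on ?B)"
    proof -
      show ?thesis by (rule integral_lebesgue_on_zero_outside[OF B\<Omega> Os]) (use ph0 in auto)
    qed
    finally have "(\<integral>x. f x * \<phi> x \<partial>lebesgue_on ?B) = T ?p x0" by simp
    moreover have "T ?p x0 * (\<integral>x. \<psi> x \<partial>lborel) = T \<psi> x0 * (\<integral>x. ?p x \<partial>lborel)"
      by (rule sym[OF s zo \<psi>(1)]) (use \<psi>(3) in auto)
    moreover have "(\<integral>x. ?p x \<partial>lborel) = (\<integral>x. \<phi> x \<partial>lborel)"
      using integral_lborel_translate[OF borel_measurable_continuous_onI[OF cp], of x0] by simp
    ultimately have "(\<integral>x. f x * \<phi> x \<partial>lebesgue_on ?B) = c * (\<integral>x. \<phi> x \<partial>lebesgue_on ?B)"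
      unfolding c_def ip1(2) using pos by (simp add: field_simps)
    then show "(\<integral>x. (f x - c) * \<phi> x \<partial>lebesgue_on ?B) = 0"
      using if1 ip1(1) by (simp add: left_diff_distrib)
  qed simp
  from main have "AE x in lebesgue_on (ball x0 r). f x = c" by eventually_elim simp
  then show ?thesis by (rule that)
qed

lemma AE_lebesgue_on_iff_negligible:
  fixes S :: "'a::euclidean_space set"
  assumes "S \<in> sets lebesgue"
  shows "(AE x in lebesgue_on S. P x) \<longleftrightarrow> negligible {x \<in> S. \<not> P x}"
proof -
  have "(AE x in lebesgue_on S. P x) \<longleftrightarrow> (AE x in lebesgue. x \<in> S \<longrightarrow> P x)"
    using assms by (simp add: AE_restrict_space_iff)
  also have "\<dots> \<longleftrightarrow> (\<exists>N. negligible N \<and> {x. \<not> (x \<in> S \<longrightarrow> P x)} \<subseteq> N)"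
    by (rule eventually_ae_filter_negligible)
  also have "\<dots> \<longleftrightarrow> negligible {x \<in> S. \<not> P x}"
  proof
    assume "\<exists>N. negligible N \<and> {x. \<not> (x \<in> S \<longrightarrow> P x)} \<subseteq> N"
    then obtain N where N: "negligible N" "{x. \<not> (x \<in> S \<longrightarrow> P x)} \<subseteq> N" by blast
    show "negligible {x \<in> S. \<not> P x}" by (rule negligible_subset[OF N(1)]) (use N(2) in blast)
  next
    assume "negligible {x \<in> S. \<not> P x}"
    then show "\<exists>N. negligible N \<and> {x. \<not> (x \<in> S \<longrightarrow> P x)} \<subseteq> N"
      by (intro exI[of _ "{x \<in> S. \<not> P x}"]) auto
  qed
  finally show ?thesis .
qed

lemma AE_lebesgue_on_not_False:
  fixes S :: "'a::euclidean_space set"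
  assumes "open S" "S \<noteq> {}" "AE x in lebesgue_on S. P x"
  obtains x where "x \<in> S" "P x"
proof -
  have "negligible {x \<in> S. \<not> P x}" using assms by (simp add: AE_lebesgue_on_iff_negligible)
  moreover have "\<not> negligible S" using assms open_not_negligible by blast
  ultimately have "{x \<in> S. \<not> P x} \<noteq> S" by auto
  then show ?thesis using that by blast
qed

lemma AE_lebesgue_on_subset:
  fixes S :: "'a::euclidean_space set"
  assumes "AE x in lebesgue_on S. P x" "T \<subseteq> S" "S \<in> sets lebesgue" "T \<in> sets lebesgue"
  shows "AE x in lebesgue_on T. P x"
  using assms by (auto simp: AE_lebesgue_on_iff_negligible elim!: negligible_subset)

text \<open>Uncountably many exceptional sets do no harm, because a set that is negligible near each
  of its points is negligible.\<close>

lemma AE_lebesgue_on_locally: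
  fixes S :: "'a::euclidean_space set"
  assumes "S \<in> sets lebesgue" "\<And>x. x \<in> S \<Longrightarrow> \<exists>r>0. ball x r \<subseteq> S \<and> (AE y in lebesgue_on (ball x r). P y)"
  shows "AE x in lebesgue_on S. P x"
  unfolding AE_lebesgue_on_iff_negligible[OF assms(1)]
proof (subst locally_negligible_alt, intro ballI)
  fix x assume "x \<in> {x \<in> S. \<not> P x}"
  then obtain r where r: "r > 0" "ball x r \<subseteq> S" "AE y in lebesgue_on (ball x r). P y" using assms(2) by blast
  have "negligible {y \<in> ball x r. \<not> P y}" using r(3) by (simp add: AE_lebesgue_on_iff_negligible)
  moreover have "{x \<in> S. \<not> P x} \<inter> ball x r = {y \<in> ball x r. \<not> P y}" using r(2) by auto
  ultimately have "negligible ({x \<in> S. \<not> P x} \<inter> ball x r)" by simp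
  then show "\<exists>U. openin (top_of_set {x \<in> S. \<not> P x}) U \<and> x \<in> U \<and> negligible U"
    using \<open>x \<in> {x \<in> S. \<not> P x}\<close> r(1)
    by (intro exI[of _ "{x \<in> S. \<not> P x} \<inter> ball x r"]) (auto intro!: openin_open_Int)
qed

lemma constant_of_zero_weak_grad:
  fixes f :: "real^'n::finite \<Rightarrow> real"
  assumes Om: "open \<Omega>" and con: "connected \<Omega>" and f: "integrable (lebesgue_on \<Omega>) f"
    and z: "\<And>\<phi> i. test_fun \<Omega> \<phi> \<Longrightarrow> (\<integral>x. f x * pd i \<phi> x \<partial>lebesgue_on \<Omega>) = 0"
  obtains c where "AE x in lebesgue_on \<Omega>. f x = c"
proof (cases "\<Omega> = {}")
  case True
  then have "AE x in lebesgue_on \<Omega>. f x = 0" by (intro AE_I2) simp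
  then show ?thesis by (rule that)
next
  case False
  have "\<exists>r c. 0 < r \<and> ball x r \<subseteq> \<Omega> \<and> (AE y in lebesgue_on (ball x r). f y = c)" if "x \<in> \<Omega>" for x
  proof -
    obtain e where e: "0 < e" "ball x e \<subseteq> \<Omega>" using openE[OF Om \<open>x \<in> \<Omega>\<close>] by blast
    then have e4: "0 < e/4" "ball x (4 * (e/4)) \<subseteq> \<Omega>" by auto
    obtain c where "AE y in lebesgue_on (ball x (e/4)). f y = c"
      using locally_constant_of_zero_weak_grad[OF Om f z e4] by blast
    moreover have "ball x (e/4) \<subseteq> \<Omega>" using e by (intro order_trans[OF subset_ball e(2)]) auto
    ultimately show ?thesis using e4(1) by blast
  qed
  then obtain r c where rc: "\<And>x. x \<in> \<Omega> \<Longrightarrow> 0 < r x" "\<And>x. x \<in> \<Omega> \<Longrightarrow> ball x (r x) \<subseteq> \<Omega>"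
    "\<And>x. x \<in> \<Omega> \<Longrightarrow> AE y in lebesgue_on (ball x (r x)). f y = c x" by metis
  \<comment> \<open>The balls around x and y overlap in a nonempty open set, which is not
    negligible, so the two almost everywhere constants agree as numbers.\<close>
  have loc: "c x = c y" if x: "x \<in> \<Omega>" and y: "y \<in> ball x (r x)" for x y
  proof -
    have y\<Omega>: "y \<in> \<Omega>" using rc(2)[OF x] y by blast
    let ?I = "ball x (r x) \<inter> ball y (r y)"
    have "AE z in lebesgue_on ?I. f z = c x" using rc(3)[OF x] by (rule AE_lebesgue_on_subset) auto
    moreover have "AE z in lebesgue_on ?I. f z = c y" using rc(3)[OF y\<Omega>] by (rule AE_lebesgue_on_subset) auto
    ultimately have "AE z in lebesgue_on ?I. c x = c y" by eventually_elim simp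
    moreover have "open ?I" "?I \<noteq> {}" using y rc(1)[OF y\<Omega>] by auto
    ultimately show ?thesis using AE_lebesgue_on_not_False by metis
  qed
  obtain x0 where x0: "x0 \<in> \<Omega>" using False by blast
  have "c x0 = c x" if "x \<in> \<Omega>" for x
  proof (rule connected_equivalence_relation[OF con x0 that])
    show "\<exists>T. openin (top_of_set \<Omega>) T \<and> a \<in> T \<and> (\<forall>x\<in>T. c a = c x)" if "a \<in> \<Omega>" for a
      using that rc loc[OF that] Om by (intro exI[of _ "ball a (r a)"]) (auto simp: openin_open_eq)
  qed auto
  then have "AE x in lebesgue_on \<Omega>. f x = c x0"
    using rc Om by (intro AE_lebesgue_on_locally) (auto, metis)
  then show ?thesis by (rule that)
qed

subsection \<open>Sobolev functions\<close>

lemma finite_measure_bounded_open: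
  fixes \<Omega> :: "(real^'n::finite) set"
  shows "bounded \<Omega> \<Longrightarrow> open \<Omega> \<Longrightarrow> finite_measure (lebesgue_on \<Omega>)"
  by (intro finite_measure_lebesgue_on bounded_set_imp_lmeasurable) auto

lemma le_one_plus_powr:
  fixes a q :: real assumes "0 \<le> a" "1 \<le> q" shows "a \<le> 1 + a powr q"
proof (cases "a \<le> 1")
  case False
  then have "a powr 1 \<le> a powr q" using assms by (intro powr_mono) auto
  then show ?thesis using assms by simp
qed (use assms in \<open>simp add: add_increasing2\<close>)

lemma Lp_integrable:
  fixes \<Omega> :: "(real^'n::finite) set"
  assumes "bounded \<Omega>" "open \<Omega>" "1 \<le> q" "Lp q \<Omega> f"
  shows "integrable (lebesgue_on \<Omega>) f"
proof -
  interpret finite_measure "lebesgue_on \<Omega>" using assms by (intro finite_measure_bounded_open)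
  have "integrable (lebesgue_on \<Omega>) (\<lambda>x. 1 + \<bar>f x\<bar> powr q)"
    using assms(4) by (simp add: Lp_def)
  then show ?thesis
    by (rule Bochner_Integration.integrable_bound)
       (use assms le_one_plus_powr[of "\<bar>f _\<bar>" q] in \<open>auto simp: Lp_def intro!: AE_I2 order_trans[OF _ abs_ge_self]\<close>)
qed

lemma Lp_bounded:
  fixes \<Omega> :: "(real^'n::finite) set"
  assumes "bounded \<Omega>" "open \<Omega>" "0 \<le> q" "f \<in> borel_measurable (lebesgue_on \<Omega>)" "AE x in lebesgue_on \<Omega>. \<bar>f x\<bar> \<le> C"
  shows "Lp q \<Omega> f"
proof -
  interpret finite_measure "lebesgue_on \<Omega>" using assms by (intro finite_measure_bounded_open)
  have "integrable (lebesgue_on \<Omega>) (\<lambda>x. \<bar>f x\<bar> powr q)"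
  proof (rule integrable_const_bound[where B = "C powr q"])
    show "AE x in lebesgue_on \<Omega>. norm (\<bar>f x\<bar> powr q) \<le> C powr q"
      using assms(5) by eventually_elim (use assms(3) in \<open>simp add: powr_mono2\<close>)
    show "(\<lambda>x. \<bar>f x\<bar> powr q) \<in> borel_measurable (lebesgue_on \<Omega>)" using assms(4) by measurable
  qed
  then show ?thesis using assms(4) by (simp add: Lp_def)
qed

text \<open>\<open>wgrad\<close> is a choice among weak gradients, so these two properties are all
  that is known of it. Any other representative is related to it only almost everywhere, through
  \<open>weak_grad_unique\<close>.\<close>

lemma W1_wgrad:
  assumes "W1 q \<Omega> f"
  shows "Lp q \<Omega> (\<lambda>x. wgrad q \<Omega> f x $ i)" "weak_grad \<Omega> f (wgrad q \<Omega> f)"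
proof -
  have "\<exists>g. (\<forall>i. Lp q \<Omega> (\<lambda>x. g x $ i)) \<and> weak_grad \<Omega> f g" using assms by (simp add: W1_def)
  from someI_ex[OF this] show "Lp q \<Omega> (\<lambda>x. wgrad q \<Omega> f x $ i)" "weak_grad \<Omega> f (wgrad q \<Omega> f)"
    by (auto simp: wgrad_def)
qed

lemma test_fun_zero_outside: "test_fun \<Omega> \<phi> \<Longrightarrow> x \<notin> \<Omega> \<Longrightarrow> \<phi> x = 0"
  using closure_subset[of "{x. \<phi> x \<noteq> 0}"] unfolding test_fun_def by auto

lemma test_fun_smooth: "test_fun \<Omega> \<phi> \<Longrightarrow> smooth_on UNIV \<phi>"
  by (simp add: test_fun_def)

lemma test_fun_continuous: "test_fun \<Omega> \<phi> \<Longrightarrow> continuous_on UNIV \<phi>"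
  by (simp add: test_fun_def smooth_on_continuous)

lemma test_fun_bounded:
  assumes "test_fun \<Omega> \<phi>"
  obtains L where "0 \<le> L" "\<And>x. \<bar>\<phi> x\<bar> \<le> L"
proof -
  obtain R where "\<And>x. x \<notin> cball 0 R \<Longrightarrow> \<phi> x = 0" using test_fun_bounded_support[OF assms] by blast
  then show ?thesis using that bounded_continuous_bounded_support[OF test_fun_continuous[OF assms]] by blast
qed

lemma weak_grad_unique:
  fixes \<Omega> :: "(real^'n::finite) set"
  assumes Om: "open \<Omega>"
    and g: "\<And>i. integrable (lebesgue_on \<Omega>) (\<lambda>x. g x $ i)" "weak_grad \<Omega> f g"
    and g': "\<And>i. integrable (lebesgue_on \<Omega>) (\<lambda>x. g' x $ i)" "weak_grad \<Omega> f g'"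
  shows "AE x in lebesgue_on \<Omega>. g x = g' x"
proof -
  have "AE x in lebesgue_on \<Omega>. g x $ i - g' x $ i = 0" for i
  proof (rule fundamental_lemma[OF Om])
    show "integrable (lebesgue_on \<Omega>) (\<lambda>x. g x $ i - g' x $ i)" using g(1) g'(1) by simp
    fix \<phi> assume t: "test_fun \<Omega> \<phi>"
    obtain L where L: "\<And>x. \<bar>\<phi> x\<bar> \<le> L" using test_fun_bounded[OF t] by blast
    have "integrable (lebesgue_on \<Omega>) (\<lambda>x. g x $ i * \<phi> x)" "integrable (lebesgue_on \<Omega>) (\<lambda>x. g' x $ i * \<phi> x)"
      using integrable_mult_test[OF g(1) test_fun_continuous[OF t] L] integrable_mult_test[OF g'(1) test_fun_continuous[OF t] L] by auto
    then show "(\<integral>x. (g x $ i - g' x $ i) * \<phi> x \<partial>lebesgue_on \<Omega>) = 0"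
      using g(2) g'(2) t unfolding weak_grad_def by (simp add: left_diff_distrib)
  qed
  then have "AE x in lebesgue_on \<Omega>. \<forall>i\<in>UNIV. g x $ i - g' x $ i = 0" by (intro AE_finite_allI) auto
  then show ?thesis by eventually_elim (simp add: vec_eq_iff)
qed

text \<open>Only the product of \<open>w\<close> with a test function has bounded support; the
  integral of its derivative is zero, and the product rule gives the claim.\<close>

lemma smooth_weak_grad:
  fixes \<Omega> :: "(real^'n::finite) set"
  assumes Om: "open \<Omega>" and w: "smooth_on UNIV w"
  shows "weak_grad \<Omega> w (\<lambda>x. \<chi> i. pd i w x)"
  unfolding weak_grad_def
proof (intro allI impI)
  fix \<phi> i assume t: "test_fun \<Omega> \<phi>"
  note s = test_fun_smooth[OF t]
  obtain R where R: "\<And>x. x \<notin> cball 0 R \<Longrightarrow> \<phi> x = 0" using test_fun_bounded_support[OF t] by blast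
  have Os: "\<Omega> \<in> sets lebesgue" using Om by simp
  have z: "\<phi> x = 0" "pd i \<phi> x = 0" if "x \<notin> \<Omega>" for x
  proof -
    show "\<phi> x = 0" using test_fun_zero_outside[OF t that] .
    have "pd i \<phi> x = pd i (\<lambda>x. 0) x"
      by (rule pd_cong_open[of "- closure {x. \<phi> x \<noteq> 0}"])
         (use t that closure_subset[of "{x. \<phi> x \<noteq> 0}"] in \<open>auto simp: test_fun_def\<close>)
    then show "pd i \<phi> x = 0" by simp
  qed
  have c: "continuous_on UNIV (\<lambda>x. w x * pd i \<phi> x)" "continuous_on UNIV (\<lambda>x. pd i w x * \<phi> x)"
    using smooth_on_continuous[OF w] smooth_on_continuous[OF s] smooth_on_continuous[OF smooth_on_pd[OF w]] smooth_on_continuous[OF smooth_on_pd[OF s]]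
    by (auto intro!: continuous_on_mult)
  have i: "integrable lborel (\<lambda>x. w x * pd i \<phi> x)" "integrable lborel (\<lambda>x. pd i w x * \<phi> x)"
    by (rule integrable_continuous_bounded_support[OF c(1), of R], use pd_zero_outside[of R \<phi>] R in simp)
       (rule integrable_continuous_bounded_support[OF c(2), of R], use R in simp)
  have "(\<integral>x. pd i (\<lambda>x. w x * \<phi> x) x \<partial>lborel) = 0"
    by (rule integral_pd_zero(2)[of _ R]) (use R w s in \<open>auto intro!: smooth_on_mult\<close>)
  then have "(\<integral>x. w x * pd i \<phi> x + pd i w x * \<phi> x \<partial>lborel) = 0"
    using smooth_on_diff[OF w] smooth_on_diff[OF s] by (simp add: pd_mult)
  then have "(\<integral>x. w x * pd i \<phi> x \<partial>lborel) = - (\<integral>x. pd i w x * \<phi> x \<partial>lborel)"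
    using i by simp
  then show "(\<integral>x. w x * pd i \<phi> x \<partial>lebesgue_on \<Omega>) = - (\<integral>x. (\<chi> i. pd i w x) $ i * \<phi> x \<partial>lebesgue_on \<Omega>)"
    using integrable_lebesgue_on_continuous_bounded_support(2)[OF c(1) _ Os i(1)]
      integrable_lebesgue_on_continuous_bounded_support(2)[OF c(2) _ Os i(2)] z by simp
qed

lemma continuous_bounded_on_bounded:
  fixes w :: "real^'n::finite \<Rightarrow> real"
  assumes "bounded \<Omega>" "continuous_on UNIV w"
  obtains C where "0 \<le> C" "\<And>x. x \<in> \<Omega> \<Longrightarrow> \<bar>w x\<bar> \<le> C"
proof -
  have "compact (w ` closure \<Omega>)"
    by (rule compact_continuous_image[OF continuous_on_subset[OF assms(2)]]) (auto simp: assms(1))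
  then have "\<exists>L. \<forall>x\<in>closure \<Omega>. \<bar>w x\<bar> \<le> L"
    unfolding compact_eq_bounded_closed bounded_iff by auto
  then obtain L where L: "\<And>x. x \<in> closure \<Omega> \<Longrightarrow> \<bar>w x\<bar> \<le> L" by blast
  show ?thesis
  proof (rule that[of "max 0 L"])
    show "\<bar>w x\<bar> \<le> max 0 L" if "x \<in> \<Omega>" for x using L[of x] that closure_subset[of \<Omega>] by (auto simp: subset_iff)
  qed simp
qed

lemma continuous_Lp:
  fixes \<Omega> :: "(real^'n::finite) set"
  assumes "bounded \<Omega>" "open \<Omega>" "0 \<le> q" "continuous_on UNIV w"
  shows "Lp q \<Omega> w"
proof -
  obtain C where "\<And>x. x \<in> \<Omega> \<Longrightarrow> \<bar>w x\<bar> \<le> C" using continuous_bounded_on_bounded[OF assms(1,4)] by blast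
  then show ?thesis
    by (intro Lp_bounded[where C = C] assms borel_measurable_lebesgue_on_continuous AE_I2) auto
qed

text \<open>On a bounded set, a function smooth on the whole space has bounded derivatives and so is
  admissible for every exponent. This is how the kernels enter the weak equation.\<close>

lemma smooth_W1:
  fixes \<Omega> :: "(real^'n::finite) set"
  assumes Om: "bounded \<Omega>" "open \<Omega>" and r: "1 \<le> r" and w: "smooth_on UNIV w"
  shows "W1 r \<Omega> w" "AE x in lebesgue_on \<Omega>. wgrad r \<Omega> w x = (\<chi> i. pd i w x)"
proof -
  have L: "Lp r \<Omega> (\<lambda>x. (\<chi> i. pd i w x) $ i)" for i
    using continuous_Lp[OF Om _ smooth_on_continuous[OF smooth_on_pd[OF w, of i]], of r] r by simp
  have W: "weak_grad \<Omega> w (\<lambda>x. \<chi> i. pd i w x)" by (rule smooth_weak_grad[OF Om(2) w])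
  show 1: "W1 r \<Omega> w" unfolding W1_def
    using continuous_Lp[OF Om _ smooth_on_continuous[OF w]] r L W by (auto intro!: exI[of _ "\<lambda>x. \<chi> i. pd i w x"])
  show "AE x in lebesgue_on \<Omega>. wgrad r \<Omega> w x = (\<chi> i. pd i w x)"
    by (rule weak_grad_unique[OF Om(2) Lp_integrable[OF Om r W1_wgrad(1)[OF 1]] W1_wgrad(2)[OF 1] Lp_integrable[OF Om r L] W])
qed

subsection \<open>Riesz kernels\<close>

lemma nn_integral_lborel_translate:
  fixes F :: "real^'n::finite \<Rightarrow> ennreal"
  assumes "F \<in> borel_measurable borel"
  shows "(\<integral>\<^sup>+x. F (x - a) \<partial>lborel) = (\<integral>\<^sup>+x. F x \<partial>lborel)"
proof -
  have "(\<integral>\<^sup>+x. F x \<partial>lborel) = (\<integral>\<^sup>+x. F x \<partial>(distr lborel borel ((+) (- a))))" by (simp add: lborel_distr_plus)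
  also have "\<dots> = (\<integral>\<^sup>+x. F (- a + x) \<partial>lborel)" using assms by (intro nn_integral_distr) auto
  finally show ?thesis by simp
qed

lemma nn_integral_lebesgue_on_le:
  fixes F :: "real^'n::finite \<Rightarrow> ennreal"
  assumes "F \<in> borel_measurable borel" "\<Omega> \<in> sets lebesgue"
  shows "(\<integral>\<^sup>+x. F x \<partial>lebesgue_on \<Omega>) \<le> (\<integral>\<^sup>+x. F x \<partial>lborel)"
proof -
  have "(\<integral>\<^sup>+x. F x \<partial>lebesgue_on \<Omega>) = (\<integral>\<^sup>+x. F x * indicator \<Omega> x \<partial>lebesgue)"
    using assms(2) by (simp add: nn_integral_restrict_space)
  also have "\<dots> \<le> (\<integral>\<^sup>+x. F x \<partial>lebesgue)" by (intro nn_integral_mono) (simp add: indicator_def)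
  also have "\<dots> = (\<integral>\<^sup>+x. F x \<partial>lborel)" by (rule nn_integral_completion)
  finally show ?thesis .
qed

text \<open>A substitute for polar coordinates: a function dominated at each point by some constant
  c_k on the ball of radius r_k is dominated by the sum of all of these, and ball volumes give a
  series in c_k r_k^N.\<close>

lemma nn_integral_shells_finite:
  fixes f :: "real^'n::finite \<Rightarrow> real" and c r :: "nat \<Rightarrow> real"
  assumes f: "f \<in> borel_measurable borel"
    and cr: "\<And>k. 0 \<le> c k" "\<And>k. 0 \<le> r k" "summable (\<lambda>k. c k * r k ^ CARD('n))"
    and b: "\<And>v. f v \<le> 0 \<or> (\<exists>k. norm v \<le> r k \<and> f v \<le> c k)"
  shows "(\<integral>\<^sup>+v. ennreal (f v) \<partial>lborel) < \<infinity>"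
proof -
  let ?V = "unit_ball_vol (real CARD('n))"
  have le: "ennreal (f v) \<le> (\<Sum>k. ennreal (c k) * indicator (cball 0 (r k)) v)" for v
  proof (cases "f v \<le> 0")
    case True then show ?thesis by (simp add: ennreal_neg)
  next
    case False
    then obtain k where k: "norm v \<le> r k" "f v \<le> c k" using b[of v] by blast
    then have "ennreal (f v) \<le> ennreal (c k) * indicator (cball 0 (r k)) v" by (simp add: ennreal_leI)
    also have "\<dots> \<le> (\<Sum>k. ennreal (c k) * indicator (cball 0 (r k)) v)"
    proof -
      define F where "F k = ennreal (c k) * indicator (cball 0 (r k)) v" for k
      have "sum F {k} \<le> suminf F" by (intro sum_le_suminf) auto
      then have "F k \<le> suminf F" by simp
      then show ?thesis unfolding F_def .
    qed
    finally show ?thesis .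
  qed
  have "(\<integral>\<^sup>+v. ennreal (f v) \<partial>lborel) \<le> (\<integral>\<^sup>+v. (\<Sum>k. ennreal (c k) * indicator (cball 0 (r k)) v) \<partial>(lborel :: (real^'n) measure))"
    by (rule nn_integral_mono) (rule le)
  also have "\<dots> = (\<Sum>k. ennreal (c k) * emeasure lborel (cball (0::real^'n) (r k)))"
    by (subst nn_integral_suminf) (auto intro!: borel_measurable_times_ennreal borel_measurable_indicator simp: nn_integral_cmult_indicator)
  also have "\<dots> = (\<Sum>k. ennreal (?V * (c k * r k ^ CARD('n))))"
    using cr by (auto simp: emeasure_cball ennreal_mult'[symmetric] mult_ac intro!: suminf_cong)
  also have "\<dots> = ennreal (\<Sum>k. ?V * (c k * r k ^ CARD('n)))"
    using cr by (intro suminf_ennreal2 summable_mult) auto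
  also have "\<dots> < \<infinity>" by simp
  finally show ?thesis .
qed

text \<open>On the dyadic shell R 2^(-k-1) \<le> |v| \<le> R 2^(-k) the kernel is at most its value
  at the inner radius; the resulting series is geometric with ratio 2^(a - N) < 1.\<close>

lemma nn_integral_riesz_ball:
  assumes "0 \<le> a" "a < real CARD('n)" "0 < R"
  shows "(\<integral>\<^sup>+v. ennreal (norm v powr (-a) * indicator (cball (0::real^'n::finite) R) v) \<partial>lborel) < \<infinity>"
proof (rule nn_integral_shells_finite)
  let ?N = "real CARD('n)"
  let ?r = "\<lambda>k::nat. R * 2 powr (- real k)"
  let ?c = "\<lambda>k::nat. (R * 2 powr (- real k - 1)) powr (-a)"
  show "(\<lambda>v. norm v powr (-a) * indicator (cball 0 R) v) \<in> borel_measurable borel"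
    by (intro borel_measurable_times borel_measurable_indicator) auto
  show "0 \<le> ?c k" "0 \<le> ?r k" for k using assms by auto
  have eq: "?c k * ?r k ^ CARD('n) = (R powr (?N - a) * 2 powr a) * (2 powr (a - ?N)) ^ k" for k
  proof -
    have "?r k ^ CARD('n) = ?r k powr ?N" using assms by (simp add: powr_realpow)
    then have "?c k * ?r k ^ CARD('n) = (R powr (-a) * 2 powr (-a * (- real k - 1))) * (R powr ?N * 2 powr (?N * (- real k)))"
      using assms by (simp add: powr_mult powr_powr mult_ac)
    also have "\<dots> = (R powr (?N - a) * 2 powr a) * (2 powr ((a - ?N) * real k))"
      using assms by (simp add: powr_add[symmetric] powr_diff powr_minus field_simps)
    also have "2 powr ((a - ?N) * real k) = (2 powr (a - ?N)) ^ k"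
      by (simp add: powr_realpow[symmetric] powr_powr)
    finally show ?thesis .
  qed
  show "summable (\<lambda>k. ?c k * ?r k ^ CARD('n))"
    unfolding eq using assms by (intro summable_mult summable_geometric) (simp add: powr_less_one)
  fix v :: "real^'n"
  show "norm v powr (-a) * indicator (cball 0 R) v \<le> 0 \<or> (\<exists>k. norm v \<le> ?r k \<and> norm v powr (-a) * indicator (cball 0 R) v \<le> ?c k)"
  \<comment> \<open>At the origin the kernel has the value 0, by the convention for
    \<open>powr\<close> at base 0.\<close>
  proof (cases "v = 0 \<or> v \<notin> cball 0 R")
    case True then show ?thesis by auto
  next
    case False
    then have v: "0 < norm v" "norm v \<le> R" by auto
    define k where "k = nat \<lfloor>log 2 (R / norm v)\<rfloor>"
    have l0: "0 \<le> log 2 (R / norm v)" using v assms by (subst zero_le_log_cancel_iff) (auto simp: field_simps)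
    have k: "real k \<le> log 2 (R / norm v)" "log 2 (R / norm v) \<le> real k + 1"
      unfolding k_def using l0 by linarith+
    have "2 powr real k \<le> R / norm v" using k(1) v assms by (simp add: le_log_iff)
    then have 1: "norm v \<le> ?r k" using v by (simp add: powr_minus field_simps)
    have "R / norm v \<le> 2 powr (real k + 1)" using k(2) v assms by (simp add: log_le_iff)
    then have "R * 2 powr (- real k - 1) \<le> norm v" using v
      by (simp add: powr_minus powr_add powr_diff field_simps)
    then have "norm v powr (-a) \<le> ?c k" using assms by (intro powr_mono2') auto
    with 1 False show ?thesis by auto
  qed
qed

lemma nn_integral_riesz_bounded:
  fixes \<Omega> :: "(real^'n::finite) set"
  assumes "bounded \<Omega>" "open \<Omega>" "0 \<le> a" "a < real CARD('n)"
  obtains C where "0 \<le> C" "\<And>z. z \<in> \<Omega> \<Longrightarrow> (\<integral>\<^sup>+x. ennreal (norm (x - z) powr (-a)) \<partial>lebesgue_on \<Omega>) \<le> ennreal C"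
proof -
  obtain R where R: "0 < R" "\<And>x. x \<in> \<Omega> \<Longrightarrow> norm x \<le> R" using assms(1) bounded_pos by blast
  define I where "I = (\<integral>\<^sup>+v. ennreal (norm v powr (-a) * indicator (cball (0::real^'n) (2 * R)) v) \<partial>lborel)"
  have I: "I < \<infinity>" unfolding I_def using nn_integral_riesz_ball[where 'n = 'n, of a "2 * R"] assms R by auto
  show ?thesis
  proof (rule that[of "enn2real I"])
    fix z assume z: "z \<in> \<Omega>"
    have "(\<integral>\<^sup>+x. ennreal (norm (x - z) powr (-a)) \<partial>lebesgue_on \<Omega>) =
        (\<integral>\<^sup>+x. ennreal (norm (x - z) powr (-a) * indicator (cball 0 (2 * R)) (x - z)) \<partial>lebesgue_on \<Omega>)"
    proof (rule nn_integral_cong)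
      fix x assume "x \<in> space (lebesgue_on \<Omega>)"
      then have "norm (x - z) \<le> 2 * R" using R(2)[of x] R(2)[OF z] norm_triangle_ineq4[of x z] by simp
      then show "ennreal (norm (x - z) powr (-a)) = ennreal (norm (x - z) powr (-a) * indicator (cball 0 (2 * R)) (x - z))" by simp
    qed
    also have "\<dots> \<le> (\<integral>\<^sup>+x. ennreal (norm (x - z) powr (-a) * indicator (cball 0 (2 * R)) (x - z)) \<partial>lborel)"
    proof (rule nn_integral_lebesgue_on_le)
      have "(\<lambda>x. indicat_real (cball 0 (2 * R)) (x - z)) \<in> borel_measurable borel"
        by (rule measurable_compose[of _ _ borel, OF _ borel_measurable_indicator]) auto
      then show "(\<lambda>x. ennreal (norm (x - z) powr (-a) * indicator (cball 0 (2 * R)) (x - z))) \<in> borel_measurable borel"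
        by measurable
    qed (use assms in auto)
    also have "\<dots> = I"
      unfolding I_def by (rule nn_integral_lborel_translate[where F = "\<lambda>v. ennreal (norm v powr (-a) * indicator (cball 0 (2 * R)) v)"])
         (intro measurable_compose[OF _ measurable_ennreal] borel_measurable_times borel_measurable_indicator, auto)
    also have "\<dots> = ennreal (enn2real I)" using I by simp
    finally show "(\<integral>\<^sup>+x. ennreal (norm (x - z) powr (-a)) \<partial>lebesgue_on \<Omega>) \<le> ennreal (enn2real I)" .
  qed simp
qed

lemma measurable_kernel2:
  fixes K :: "real^'n::finite \<Rightarrow> real^'n \<Rightarrow> 'b::topological_space"
  assumes "(\<lambda>(x, a). K x a) \<in> borel_measurable borel"
  shows "(\<lambda>(x, a). K x a) \<in> borel_measurable (lebesgue_on A \<Otimes>\<^sub>M lebesgue_on B)"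
proof -
  have i: "(\<lambda>x. x) \<in> lebesgue_on A \<rightarrow>\<^sub>M (borel :: (real^'n) measure)" for A
    using id_borel_measurable_lebesgue_on[of A] by (simp add: id_def)
  have "(\<lambda>p. (fst p, snd p)) \<in> lebesgue_on A \<Otimes>\<^sub>M lebesgue_on B \<rightarrow>\<^sub>M (borel :: (real^'n) measure) \<Otimes>\<^sub>M borel"
    by (intro measurable_Pair measurable_compose[OF measurable_fst i] measurable_compose[OF measurable_snd i])
  then have "(\<lambda>p. p) \<in> lebesgue_on A \<Otimes>\<^sub>M lebesgue_on B \<rightarrow>\<^sub>M (borel :: ((real^'n) \<times> (real^'n)) measure)"
    by (simp add: borel_prod)
  from measurable_compose[OF this assms] show ?thesis by simp
qed

text \<open>Meant for s = |y - x|, t = |x - z|, D = |y - z|. The larger of s and t is at least D/2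
  and gives up the power -a, which becomes D^(-a). The rest of its exponent is transferred to the
  smaller distance, which then carries -(b + 1/2).\<close>

lemma riesz_composition_pointwise:
  fixes s t D b a :: real
  assumes "0 < s" "0 < t" "0 < D" "D \<le> s + t" "0 \<le> a" "a \<le> b"
  shows "s powr (-b) * t powr (-(a + 1/2)) \<le> 2 powr a * D powr (-a) * (s powr (-(b + 1/2)) + t powr (-(b + 1/2)))"
proof -
  have D2: "M powr (-a) \<le> 2 powr a * D powr (-a)" if "D \<le> 2 * M" "0 < M" for M
  proof -
    have "M powr (-a) \<le> (D / 2) powr (-a)" using that assms by (intro powr_mono2') auto
    also have "\<dots> = 2 powr a * D powr (-a)" using assms by (simp add: powr_divide powr_minus field_simps)
    finally show ?thesis .
  qed
  show ?thesis
  proof (cases "s \<le> t")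
    case True
    have "t powr (-(1/2)) \<le> s powr (-(1/2))" using True assms by (intro powr_mono2') auto
    then have "s powr (-b) * t powr (-(1/2)) \<le> s powr (-b) * s powr (-(1/2))" by (intro mult_left_mono) auto
    also have "\<dots> = s powr (-(b + 1/2))" by (simp add: powr_add[symmetric])
    finally have 1: "s powr (-b) * t powr (-(1/2)) \<le> s powr (-(b + 1/2))" .
    have "s powr (-b) * t powr (-(a + 1/2)) = t powr (-a) * (s powr (-b) * t powr (-(1/2)))"
    proof -
      have "-(a + 1/2) = - a + -(1/2)" by simp
      then have "t powr (-(a + 1/2)) = t powr (-a) * t powr (-(1/2))" by (metis powr_add)
      then show ?thesis by simp
    qed
    also have "\<dots> \<le> (2 powr a * D powr (-a)) * s powr (-(b + 1/2))"
      using D2[of t] 1 True assms by (intro mult_mono) auto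
    also have "\<dots> \<le> (2 powr a * D powr (-a)) * (s powr (-(b + 1/2)) + t powr (-(b + 1/2)))"
      by (intro mult_left_mono) auto
    finally show ?thesis .
  next
    case False
    have "s powr (-(b - a)) \<le> t powr (-(b - a))" using False assms by (intro powr_mono2') auto
    then have "s powr (-(b - a)) * t powr (-(a + 1/2)) \<le> t powr (-(b - a)) * t powr (-(a + 1/2))" by (intro mult_right_mono) auto
    also have "\<dots> = t powr (-(b + 1/2))" by (simp add: powr_add[symmetric])
    finally have 1: "s powr (-(b - a)) * t powr (-(a + 1/2)) \<le> t powr (-(b + 1/2))" .
    have "s powr (-b) * t powr (-(a + 1/2)) = s powr (-a) * (s powr (-(b - a)) * t powr (-(a + 1/2)))"
      by (simp add: powr_add[symmetric] mult.assoc[symmetric])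
    also have "\<dots> \<le> (2 powr a * D powr (-a)) * t powr (-(b + 1/2))"
      using D2[of s] 1 False assms by (intro mult_mono) auto
    also have "\<dots> \<le> (2 powr a * D powr (-a)) * (s powr (-(b + 1/2)) + t powr (-(b + 1/2)))"
      by (intro mult_left_mono) auto
    finally show ?thesis .
  qed
qed

lemma AE_lebesgue_on_neq:
  fixes z :: "real^'n::finite"
  assumes "S \<in> sets lebesgue"
  shows "AE x in lebesgue_on S. x \<noteq> z"
proof -
  have "AE x in lebesgue. x \<noteq> z"
    using AE_not_in[of "{z}" lebesgue] by simp
  then show ?thesis using assms by (auto simp: AE_restrict_space_iff elim!: eventually_mono)
qed

text \<open>\<open>I a\<close> is the potential of |\<theta>| with kernel |x - z|^(-a), and
  \<open>I 0\<close> is bounded by the L1 norm. Inserting the hypothesis into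
  \<open>I (a + 1/2)\<close> and composing kernels bounds it in terms of \<open>I a\<close>, so
  boundedness climbs to the exponent b = N - 1 of the hypothesis. The increment 1/2 is admissible
  because b + 1/2 < N keeps the composed kernel integrable, and it reaches b exactly after 2 (N - 1)
  rounds.\<close>

lemma riesz_iteration:
  fixes \<theta> :: "real^'n::finite \<Rightarrow> real"
  assumes Om: "bounded \<Omega>" "open \<Omega>" and th: "integrable (lebesgue_on \<Omega>) \<theta>"
    and M: "0 \<le> M" "AE z in lebesgue_on \<Omega>. ennreal \<bar>\<theta> z\<bar> \<le> ennreal M +
       ennreal M * (\<integral>\<^sup>+x. ennreal \<bar>\<theta> x\<bar> * ennreal (norm (x - z) powr (- (real CARD('n) - 1))) \<partial>lebesgue_on \<Omega>)"
  obtains B where "AE z in lebesgue_on \<Omega>. \<bar>\<theta> z\<bar> \<le> B"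
proof -
  let ?L = "lebesgue_on \<Omega>"
  define b where "b = real CARD('n) - 1"
  have b0: "0 \<le> b" unfolding b_def by (simp add: Suc_leI)
  have Os: "\<Omega> \<in> sets lebesgue" using Om by simp
  interpret S: sigma_finite_measure ?L by (rule sigma_finite_lebesgue_on[OF Os])
  interpret P: pair_sigma_finite ?L ?L ..
  define k where "k a v = ennreal (norm v powr (-a))" for a and v :: "real^'n"
  have kb: "k a \<in> borel_measurable borel" for a unfolding k_def by measurable
  have km: "(\<lambda>x. k a (x - z)) \<in> borel_measurable ?L" "(\<lambda>x. k a (z - x)) \<in> borel_measurable ?L" for a z
  proof -
    have i: "(\<lambda>x. x) \<in> ?L \<rightarrow>\<^sub>M (borel :: (real^'n) measure)"
      using id_borel_measurable_lebesgue_on[of \<Omega>] by (simp add: id_def)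
    have "(\<lambda>x. k a (x - z)) \<in> borel_measurable borel" "(\<lambda>x. k a (z - x)) \<in> borel_measurable borel" using kb by measurable
    then show "(\<lambda>x. k a (x - z)) \<in> borel_measurable ?L" "(\<lambda>x. k a (z - x)) \<in> borel_measurable ?L"
      using measurable_compose[OF i] by blast+
  qed
  have tm: "(\<lambda>x. ennreal \<bar>\<theta> x\<bar>) \<in> borel_measurable ?L" using th by simp
  define I where "I a z = (\<integral>\<^sup>+x. ennreal \<bar>\<theta> x\<bar> * k a (x - z) \<partial>?L)" for a z
  have hyp: "AE z in ?L. ennreal \<bar>\<theta> z\<bar> \<le> ennreal M + ennreal M * I b z"
    using M(2) by (simp add: I_def k_def b_def)
  have kap: "\<exists>C\<ge>0. \<forall>z\<in>\<Omega>. (\<integral>\<^sup>+x. k a (x - z) \<partial>?L) \<le> ennreal C" if "0 \<le> a" "a < real CARD('n)" for a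
    using nn_integral_riesz_bounded[OF Om that] unfolding k_def by metis
  have step: "\<exists>C\<ge>0. \<forall>z\<in>\<Omega>. I (a + 1/2) z \<le> ennreal C" if C: "0 \<le> C" "\<forall>z\<in>\<Omega>. I a z \<le> ennreal C" and a: "0 \<le> a" "a + 1/2 \<le> b" for a C
  proof -
    obtain C1 where C1: "0 \<le> C1" "\<And>z. z \<in> \<Omega> \<Longrightarrow> (\<integral>\<^sup>+x. k (a + 1/2) (x - z) \<partial>?L) \<le> ennreal C1"
      using kap[of "a + 1/2"] a unfolding b_def by auto
    obtain C2 where C2: "0 \<le> C2" "\<And>z. z \<in> \<Omega> \<Longrightarrow> (\<integral>\<^sup>+x. k (b + 1/2) (x - z) \<partial>?L) \<le> ennreal C2"
      using kap[of "b + 1/2"] b0 unfolding b_def by auto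
    define C3 where "C3 = 2 powr a * (C2 + C2)"
    have C30: "0 \<le> C3" unfolding C3_def using C2 by simp
    \<comment> \<open>Integration over the intermediate point gains almost one order: the kernels of
      orders b and a + 1/2 compose to one of order a, with a constant independent of y and
      z.\<close>
    have inner: "(\<integral>\<^sup>+x. k b (y - x) * k (a + 1/2) (x - z) \<partial>?L) \<le> ennreal C3 * k a (y - z)"
      if y: "y \<in> \<Omega>" and z: "z \<in> \<Omega>" and yz: "y \<noteq> z" for y z
    proof -
      have "(\<integral>\<^sup>+x. k b (y - x) * k (a + 1/2) (x - z) \<partial>?L) \<le>
          (\<integral>\<^sup>+x. ennreal (2 powr a) * k a (y - z) * (k (b + 1/2) (x - y) + k (b + 1/2) (x - z)) \<partial>?L)"
      proof (rule nn_integral_mono_AE)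
        show "AE x in ?L. k b (y - x) * k (a + 1/2) (x - z) \<le> ennreal (2 powr a) * k a (y - z) * (k (b + 1/2) (x - y) + k (b + 1/2) (x - z))"
          using AE_lebesgue_on_neq[OF Os, of y] AE_lebesgue_on_neq[OF Os, of z]
        proof eventually_elim
          case (elim x)
          have "norm (y - x) powr (-b) * norm (x - z) powr (-(a + 1/2)) \<le>
              2 powr a * norm (y - z) powr (-a) * (norm (y - x) powr (-(b + 1/2)) + norm (x - z) powr (-(b + 1/2)))"
            using elim yz a norm_triangle_ineq[of "y - x" "x - z"] by (intro riesz_composition_pointwise) auto
          then have "ennreal (norm (y - x) powr (-b) * norm (x - z) powr (-(a + 1/2))) \<le>
              ennreal (2 powr a * norm (y - z) powr (-a) * (norm (y - x) powr (-(b + 1/2)) + norm (x - z) powr (-(b + 1/2))))"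
            by (rule ennreal_leI)
          then show ?case unfolding k_def by (simp add: ennreal_mult'' ennreal_plus[symmetric] norm_minus_commute[of x y] del: ennreal_plus)
        qed
      qed
      also have "\<dots> = ennreal (2 powr a) * k a (y - z) * ((\<integral>\<^sup>+x. k (b + 1/2) (x - y) \<partial>?L) + (\<integral>\<^sup>+x. k (b + 1/2) (x - z) \<partial>?L))"
        using km by (subst nn_integral_cmult) (auto simp: nn_integral_add)
      also have "\<dots> \<le> ennreal (2 powr a) * k a (y - z) * (ennreal C2 + ennreal C2)"
        using C2(2)[OF y] C2(2)[OF z] by (intro mult_left_mono add_mono) auto
      also have "\<dots> = ennreal C3 * k a (y - z)"
        unfolding C3_def using C2(1) by (simp add: ennreal_mult'' ennreal_plus[symmetric] mult_ac del: ennreal_plus)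
      finally show ?thesis .
    qed
    have "I (a + 1/2) z \<le> ennreal (M * C1 + M * (C3 * C))" if z: "z \<in> \<Omega>" for z
    proof -
      have mm: "(\<lambda>(x, y). ennreal \<bar>\<theta> y\<bar> * k b (y - x) * k (a + 1/2) (x - z)) \<in> borel_measurable (?L \<Otimes>\<^sub>M ?L)"
      proof -
        have "(\<lambda>p. ennreal \<bar>\<theta> (snd p)\<bar>) \<in> borel_measurable (?L \<Otimes>\<^sub>M ?L)"
          by (rule measurable_compose[OF measurable_snd tm])
        moreover have "(\<lambda>(x, y). k b (y - x) * k (a + 1/2) (x - z)) \<in> borel_measurable (?L \<Otimes>\<^sub>M ?L)"
        proof (rule measurable_kernel2)
          have h: "(\<lambda>p::(real^'n)\<times>(real^'n). snd p - fst p) \<in> borel_measurable borel" "(\<lambda>p::(real^'n)\<times>(real^'n). fst p - z) \<in> borel_measurable borel"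
            by (intro borel_measurable_continuous_onI continuous_intros)+
          then have "(\<lambda>p::(real^'n)\<times>(real^'n). k b (snd p - fst p) * k (a + 1/2) (fst p - z)) \<in> borel_measurable borel"
            using measurable_compose[OF h(1) kb[of b]] measurable_compose[OF h(2) kb[of "a + 1/2"]] by (intro borel_measurable_times_ennreal)
          then show "(\<lambda>(x, y). k b (y - x) * k (a + 1/2) (x - z)) \<in> borel_measurable borel" by (simp add: case_prod_beta)
        qed
        ultimately have "(\<lambda>p. ennreal \<bar>\<theta> (snd p)\<bar> * (case p of (x, y) \<Rightarrow> k b (y - x) * k (a + 1/2) (x - z))) \<in> borel_measurable (?L \<Otimes>\<^sub>M ?L)"
          by (rule borel_measurable_times_ennreal)
        then show ?thesis by (simp add: case_prod_beta mult.assoc)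
      qed
      have "I (a + 1/2) z \<le> (\<integral>\<^sup>+x. (ennreal M + ennreal M * I b x) * k (a + 1/2) (x - z) \<partial>?L)"
        unfolding I_def[of "a + 1/2"] by (rule nn_integral_mono_AE) (use hyp in \<open>eventually_elim, auto intro!: mult_right_mono\<close>)
      also have "\<dots> = (\<integral>\<^sup>+x. ennreal M * k (a + 1/2) (x - z) + ennreal M * (\<integral>\<^sup>+y. ennreal \<bar>\<theta> y\<bar> * k b (y - x) * k (a + 1/2) (x - z) \<partial>?L) \<partial>?L)"
      proof (rule nn_integral_cong)
        fix x
        have "(\<integral>\<^sup>+y. ennreal \<bar>\<theta> y\<bar> * k b (y - x) * k (a + 1/2) (x - z) \<partial>?L) = I b x * k (a + 1/2) (x - z)"
          unfolding I_def by (rule nn_integral_multc[OF borel_measurable_times_ennreal[OF tm km(1)]])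
        then show "(ennreal M + ennreal M * I b x) * k (a + 1/2) (x - z) = ennreal M * k (a + 1/2) (x - z) + ennreal M * (\<integral>\<^sup>+y. ennreal \<bar>\<theta> y\<bar> * k b (y - x) * k (a + 1/2) (x - z) \<partial>?L)"
          by (simp add: distrib_right mult.assoc)
      qed
      also have "\<dots> = ennreal M * (\<integral>\<^sup>+x. k (a + 1/2) (x - z) \<partial>?L) + ennreal M * (\<integral>\<^sup>+x. \<integral>\<^sup>+y. ennreal \<bar>\<theta> y\<bar> * k b (y - x) * k (a + 1/2) (x - z) \<partial>?L \<partial>?L)"
        using km S.borel_measurable_nn_integral[OF mm]
        by (subst nn_integral_add) (auto simp: nn_integral_cmult)
      also have "(\<integral>\<^sup>+x. \<integral>\<^sup>+y. ennreal \<bar>\<theta> y\<bar> * k b (y - x) * k (a + 1/2) (x - z) \<partial>?L \<partial>?L) =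
          (\<integral>\<^sup>+y. \<integral>\<^sup>+x. ennreal \<bar>\<theta> y\<bar> * k b (y - x) * k (a + 1/2) (x - z) \<partial>?L \<partial>?L)"
        using P.Fubini[OF mm] by simp
      also have "\<dots> = (\<integral>\<^sup>+y. ennreal \<bar>\<theta> y\<bar> * (\<integral>\<^sup>+x. k b (y - x) * k (a + 1/2) (x - z) \<partial>?L) \<partial>?L)"
        using km by (intro nn_integral_cong) (simp add: mult.assoc nn_integral_cmult)
      also have "\<dots> \<le> (\<integral>\<^sup>+y. ennreal C3 * (ennreal \<bar>\<theta> y\<bar> * k a (y - z)) \<partial>?L)"
      proof (rule nn_integral_mono_AE)
        show "AE y in ?L. ennreal \<bar>\<theta> y\<bar> * (\<integral>\<^sup>+x. k b (y - x) * k (a + 1/2) (x - z) \<partial>?L) \<le> ennreal C3 * (ennreal \<bar>\<theta> y\<bar> * k a (y - z))"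
          using AE_lebesgue_on_neq[OF Os, of z] AE_space
        proof eventually_elim
          case (elim y)
          then have "(\<integral>\<^sup>+x. k b (y - x) * k (a + 1/2) (x - z) \<partial>?L) \<le> ennreal C3 * k a (y - z)" using inner[of y z] z by simp
          then have "ennreal \<bar>\<theta> y\<bar> * (\<integral>\<^sup>+x. k b (y - x) * k (a + 1/2) (x - z) \<partial>?L) \<le> ennreal \<bar>\<theta> y\<bar> * (ennreal C3 * k a (y - z))" by (rule mult_left_mono) simp
          then show ?case by (simp add: mult_ac)
        qed
      qed
      also have "\<dots> = ennreal C3 * I a z" unfolding I_def by (rule nn_integral_cmult[OF borel_measurable_times_ennreal[OF tm km(1)]])
      also have "\<dots> \<le> ennreal C3 * ennreal C" using C z by (intro mult_left_mono) auto
      finally have "I (a + 1/2) z \<le> ennreal M * (\<integral>\<^sup>+x. k (a + 1/2) (x - z) \<partial>?L) + ennreal M * (ennreal C3 * ennreal C)"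
        by (simp add: add_left_mono mult_left_mono)
      also have "\<dots> \<le> ennreal M * ennreal C1 + ennreal M * (ennreal C3 * ennreal C)"
        using C1(2)[OF z] by (intro add_right_mono mult_left_mono) auto
      also have "\<dots> = ennreal (M * C1 + M * (C3 * C))"
        using M(1) C1(1) C30 C(1) by (simp add: ennreal_mult)
      finally show ?thesis .
    qed
    then show ?thesis using M(1) C1(1) C30 C(1) by (intro exI[of _ "M * C1 + M * (C3 * C)"]) auto
  qed
  have ind: "real m / 2 \<le> b \<longrightarrow> (\<exists>C\<ge>0. \<forall>z\<in>\<Omega>. I (real m / 2) z \<le> ennreal C)" for m
  proof (induction m)
    case 0
    have "I 0 z \<le> ennreal (\<integral>x. \<bar>\<theta> x\<bar> \<partial>?L)" for z
    proof -
      \<comment> \<open>With exponent 0 the kernel is 1 except at x = z, where \<open>powr\<close>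
        gives 0; an inequality is enough.\<close>
      have "I 0 z \<le> (\<integral>\<^sup>+x. ennreal \<bar>\<theta> x\<bar> \<partial>?L)"
        unfolding I_def k_def by (intro nn_integral_mono) (auto simp: powr_def)
      also have "\<dots> = ennreal (\<integral>x. \<bar>\<theta> x\<bar> \<partial>?L)" using th by (intro nn_integral_eq_integral) auto
      finally show ?thesis .
    qed
    then show ?case by (intro impI exI[of _ "\<integral>x. \<bar>\<theta> x\<bar> \<partial>?L"]) auto
  next
    case (Suc m)
    show ?case
    proof
      assume l: "real (Suc m) / 2 \<le> b"
      then have l': "real m / 2 \<le> b" "real m / 2 + 1/2 \<le> b" by (auto simp: field_simps)
      then obtain C where "0 \<le> C" "\<forall>z\<in>\<Omega>. I (real m / 2) z \<le> ennreal C" using Suc by blast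
      from step[OF this _ l'(2)] show "\<exists>C\<ge>0. \<forall>z\<in>\<Omega>. I (real (Suc m) / 2) z \<le> ennreal C"
        by (simp add: add_divide_distrib add.commute)
    qed
  qed
  have "b = real (2 * (CARD('n) - 1)) / 2" unfolding b_def by (simp add: of_nat_diff Suc_leI)
  then obtain C where C: "0 \<le> C" "\<forall>z\<in>\<Omega>. I b z \<le> ennreal C" using ind[of "2 * (CARD('n) - 1)"] by auto
  have "AE z in ?L. \<bar>\<theta> z\<bar> \<le> M + M * C"
    using hyp AE_space
  proof eventually_elim
    case (elim z)
    have "ennreal \<bar>\<theta> z\<bar> \<le> ennreal M + ennreal M * I b z" by (rule elim(1))
    also have "\<dots> \<le> ennreal M + ennreal M * ennreal C" using C elim(2) by (intro add_left_mono mult_left_mono) auto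
    also have "\<dots> = ennreal (M + M * C)" using M(1) C(1) by (simp add: ennreal_mult)
    finally have "ennreal \<bar>\<theta> z\<bar> \<le> ennreal (M + M * C)" .
    then show ?case by (rule iffD1[OF ennreal_le_iff, rotated]) (use M(1) C(1) in simp)
  qed
  then show ?thesis by (rule that)
qed

subsection \<open>A regularised fundamental solution\<close>

lemma integral_by_parts_lborel:
  fixes w \<phi> :: "real^'n::finite \<Rightarrow> real"
  assumes w: "smooth_on UNIV w" and s: "smooth_on UNIV \<phi>" and R: "\<And>x. x \<notin> cball 0 R \<Longrightarrow> \<phi> x = 0"
  shows "(\<integral>x. w x * pd i \<phi> x \<partial>lborel) = - (\<integral>x. pd i w x * \<phi> x \<partial>lborel)"
proof -
  have c: "continuous_on UNIV (\<lambda>x. w x * pd i \<phi> x)" "continuous_on UNIV (\<lambda>x. pd i w x * \<phi> x)"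
    using smooth_on_continuous[OF w] smooth_on_continuous[OF s] smooth_on_continuous[OF smooth_on_pd[OF w]] smooth_on_continuous[OF smooth_on_pd[OF s]]
    by (auto intro!: continuous_on_mult)
  have i: "integrable lborel (\<lambda>x. w x * pd i \<phi> x)" "integrable lborel (\<lambda>x. pd i w x * \<phi> x)"
    by (rule integrable_continuous_bounded_support[OF c(1), of R], use pd_zero_outside[of R \<phi>] R in simp)
       (rule integrable_continuous_bounded_support[OF c(2), of R], use R in simp)
  have "(\<integral>x. pd i (\<lambda>x. w x * \<phi> x) x \<partial>lborel) = 0"
    by (rule integral_pd_zero(2)[of _ R]) (use R w s in \<open>auto intro!: smooth_on_mult\<close>)
  then have "(\<integral>x. w x * pd i \<phi> x + pd i w x * \<phi> x \<partial>lborel) = 0"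
    using smooth_on_diff[OF w] smooth_on_diff[OF s] by (simp add: pd_mult)
  then show ?thesis using i by simp
qed

text \<open>Minus the Laplacian of the regularised fundamental solution: v (|v|^2 + e)^(-N/2) has
  divergence N e (|v|^2 + e)^(-N/2-1). As e tends to 0 this becomes a multiple of the Dirac mass at
  0.\<close>

definition approx_delta :: "real \<Rightarrow> real^'n::finite \<Rightarrow> real" where
  "approx_delta e v = real CARD('n) * e * (v \<bullet> v + e) powr (- (real CARD('n) / 2) - 1)"

lemma approx_delta_nonneg: "0 \<le> e \<Longrightarrow> 0 \<le> approx_delta e v"
  by (simp add: approx_delta_def)

lemma continuous_on_approx_delta:
  assumes "0 < e" "continuous_on A f"
  shows "continuous_on A (\<lambda>x. approx_delta e (f x))"
proof -
  have "f x \<bullet> f x + e \<noteq> 0" for x using assms(1) inner_ge_zero[of "f x"] by linarith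
  then show ?thesis unfolding approx_delta_def using assms by (intro continuous_intros) auto
qed

lemma inner_plus_powr_le:
  fixes v :: "real^'n::finite"
  assumes "0 \<le> e" "0 \<le> b" "v \<noteq> 0"
  shows "(v \<bullet> v + e) powr (-b) \<le> norm v powr (- (2 * b))"
proof -
  have e: "v \<bullet> v = norm v powr 2" using assms by (simp add: dot_square_norm)
  have "(v \<bullet> v + e) powr (-b) \<le> (v \<bullet> v) powr (-b)" using assms by (intro powr_mono2') auto
  also have "(v \<bullet> v) powr (-b) = norm v powr (2 * (-b))" unfolding e by (rule powr_powr)
  finally show ?thesis by simp
qed

text \<open>Decay like |v|^(-N-2) against balls of volume proportional to 2^(kN) leaves a geometric
  series with ratio 1/4.\<close>

lemma integrable_approx_delta_1: "integrable lborel (approx_delta 1 :: real^'n::finite \<Rightarrow> real)"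
proof (rule integrableI_nonneg)
  let ?N = "real CARD('n)"
  have m: "(approx_delta 1 :: real^'n \<Rightarrow> real) \<in> borel_measurable borel"
    by (intro borel_measurable_continuous_onI continuous_on_approx_delta continuous_intros) auto
  then show "(approx_delta 1 :: real^'n \<Rightarrow> real) \<in> borel_measurable lborel" by simp
  show "AE x in lborel. 0 \<le> approx_delta 1 (x :: real^'n)" by (simp add: approx_delta_nonneg)
  let ?r = "\<lambda>k::nat. 2 powr real k :: real"
  \<comment> \<open>The shell \<open>k\<close> lies between the radii 2^(k-1) and 2^k, and the bound
    is the decay at the inner radius. Index 0 covers the unit ball.\<close>
  let ?c = "\<lambda>k::nat. ?N * 2 powr ((1 - real k) * (?N + 2))"
  show "(\<integral>\<^sup>+ x. ennreal (approx_delta 1 (x :: real^'n)) \<partial>lborel) < \<infinity>"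
  proof (rule nn_integral_shells_finite[OF m, where c = ?c and r = ?r])
    show "0 \<le> ?c k" "0 \<le> ?r k" for k by auto
    have eq: "?c k * ?r k ^ CARD('n) = (?N * 2 powr (?N + 2)) * (1/4) ^ k" for k
    proof -
      have "?r k ^ CARD('n) = 2 powr (real k * ?N)" by (simp add: powr_realpow[symmetric] powr_powr)
      then have "?c k * ?r k ^ CARD('n) = ?N * 2 powr ((1 - real k) * (?N + 2) + real k * ?N)" by (simp add: powr_add)
      also have "(1 - real k) * (?N + 2) + real k * ?N = (?N + 2) + (-2) * real k" by (simp add: algebra_simps)
      also have "?N * 2 powr ((?N + 2) + (-2) * real k) = (?N * 2 powr (?N + 2)) * (2 powr (-2)) powr (real k)"
        by (simp add: powr_add[symmetric] powr_powr)
      also have "(2 powr (-2)) powr real k = (1/4 :: real) ^ k" by (simp add: powr_realpow powr_minus)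
      finally show ?thesis .
    qed
    show "summable (\<lambda>k. ?c k * ?r k ^ CARD('n))" unfolding eq by (intro summable_mult summable_geometric) simp
    fix v :: "real^'n"
    show "approx_delta 1 v \<le> 0 \<or> (\<exists>k. norm v \<le> ?r k \<and> approx_delta 1 v \<le> ?c k)"
    proof (cases "norm v \<le> 1")
      case True
      have "(v \<bullet> v + 1) powr (- (?N / 2) - 1) \<le> 1 powr (- (?N / 2) - 1)" by (rule powr_mono2') auto
      also have "\<dots> \<le> 2 powr (?N + 2)" by (simp add: ge_one_powr_ge_zero)
      finally have "approx_delta 1 v \<le> ?c 0" unfolding approx_delta_def by (simp add: mult_left_mono)
      then show ?thesis using True by (intro disjI2 exI[of _ 0]) simp
    next
      case False
      then have v: "1 < norm v" "v \<noteq> 0" by auto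
      define k where "k = nat \<lceil>log 2 (norm v)\<rceil>"
      have l0: "0 \<le> log 2 (norm v)" using v by (subst zero_le_log_cancel_iff) auto
      have k: "log 2 (norm v) \<le> real k" "real k - 1 \<le> log 2 (norm v)"
        unfolding k_def using l0 by linarith+
      have 1: "norm v \<le> ?r k" using k(1) v by (simp add: log_le_iff)
      have 2: "2 powr (real k - 1) \<le> norm v" using k(2) v by (simp add: le_log_iff)
      have "(v \<bullet> v + 1) powr (- (?N / 2 + 1)) \<le> norm v powr (- (2 * (?N / 2 + 1)))"
        by (rule inner_plus_powr_le) (use v in auto)
      also have "\<dots> \<le> (2 powr (real k - 1)) powr (- (2 * (?N / 2 + 1)))"
        using 2 by (intro powr_mono2') auto
      also have "\<dots> = 2 powr ((1 - real k) * (?N + 2))" by (simp add: powr_powr algebra_simps)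
      finally have "approx_delta 1 v \<le> ?c k" unfolding approx_delta_def by (simp add: mult_left_mono)
      with 1 show ?thesis by blast
    qed
  qed
qed

lemma integral_lborel_affine:
  fixes F :: "real^'n::finite \<Rightarrow> real"
  assumes "F \<in> borel_measurable borel" "c \<noteq> 0"
  shows "(\<integral>x. F x \<partial>lborel) = \<bar>c\<bar> ^ CARD('n) * (\<integral>x. F (t + c *\<^sub>R x) \<partial>lborel)"
proof -
  have "(\<integral>x. F x \<partial>lborel) = (\<integral>x. F x \<partial>density (distr lborel borel (\<lambda>x. t + c *\<^sub>R x)) (\<lambda>_. ennreal (\<bar>c\<bar> ^ DIM(real^'n))))"
    using lborel_affine[OF assms(2), of t] by (simp add: prod_constant)
  also have "\<dots> = (\<integral>x. \<bar>c\<bar> ^ CARD('n) *\<^sub>R F x \<partial>distr lborel borel (\<lambda>x. t + c *\<^sub>R x))"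
    using assms by (subst integral_density) auto
  also have "\<dots> = (\<integral>x. \<bar>c\<bar> ^ CARD('n) *\<^sub>R F (t + c *\<^sub>R x) \<partial>lborel)"
    using assms by (intro integral_distr) auto
  finally show ?thesis by simp
qed

text \<open>Self-similarity at the length sqrt e: the exponents N/2, 1 and -N/2 - 1 of
  \<open>e\<close> add up to 0, so the total mass does not depend on \<open>e\<close>.\<close>

lemma approx_delta_scale:
  fixes u :: "real^'n::finite"
  assumes "0 < e"
  shows "sqrt e ^ CARD('n) * approx_delta e (sqrt e *\<^sub>R u) = approx_delta 1 u"
proof -
  let ?a = "real CARD('n) / 2"
  have p: "0 < u \<bullet> u + 1" using inner_ge_zero[of u] by linarith
  have 1: "sqrt e ^ CARD('n) = e powr ?a" using assms by (simp add: powr_half_sqrt[symmetric] powr_realpow[symmetric] powr_powr)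
  have 2: "(sqrt e *\<^sub>R u) \<bullet> (sqrt e *\<^sub>R u) + e = e * (u \<bullet> u + 1)"
    using assms by (simp add: distrib_left)
  have 3: "(e * (u \<bullet> u + 1)) powr (- ?a - 1) = e powr (- ?a - 1) * (u \<bullet> u + 1) powr (- ?a - 1)"
    using assms p by (simp add: powr_mult)
  have "e powr ?a * (e powr 1 * e powr (- ?a - 1)) = e powr (?a + (1 + (- ?a - 1)))"
    by (simp only: powr_add)
  then have 4: "e powr ?a * (e * e powr (- ?a - 1)) = 1" using assms by simp
  have "sqrt e ^ CARD('n) * approx_delta e (sqrt e *\<^sub>R u) =
      (e powr ?a * (e * e powr (- ?a - 1))) * (real CARD('n) * (u \<bullet> u + 1) powr (- ?a - 1))"
    unfolding approx_delta_def 1 2 3 by (simp only: mult_ac)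
  then show ?thesis unfolding 4 approx_delta_def by simp
qed

lemma approx_delta_convolution:
  fixes \<phi> :: "real^'n::finite \<Rightarrow> real"
  assumes "0 < e" "continuous_on UNIV \<phi>"
  shows "(\<integral>z. \<phi> z * approx_delta e (y - z) \<partial>lborel) = (\<integral>u. \<phi> (y - sqrt e *\<^sub>R u) * approx_delta 1 u \<partial>lborel)"
proof -
  have m: "(\<lambda>z. \<phi> z * approx_delta e (y - z)) \<in> borel_measurable borel"
    using assms by (intro borel_measurable_continuous_onI continuous_on_mult continuous_on_approx_delta continuous_intros)
  have s: "- sqrt e \<noteq> 0" using assms by simp
  have "(\<integral>z. \<phi> z * approx_delta e (y - z) \<partial>lborel) = \<bar>- sqrt e\<bar> ^ CARD('n) * (\<integral>u. \<phi> (y + (- sqrt e) *\<^sub>R u) * approx_delta e (y - (y + (- sqrt e) *\<^sub>R u)) \<partial>lborel)"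
    by (rule integral_lborel_affine[OF m s])
  also have "\<dots> = (\<integral>u. \<phi> (y - sqrt e *\<^sub>R u) * (sqrt e ^ CARD('n) * approx_delta e (sqrt e *\<^sub>R u)) \<partial>lborel)"
    using assms by (simp add: mult_ac flip: integral_mult_right_zero)
  also have "\<dots> = (\<integral>u. \<phi> (y - sqrt e *\<^sub>R u) * approx_delta 1 u \<partial>lborel)"
    by (simp only: approx_delta_scale[OF assms(1)])
  finally show ?thesis .
qed

text \<open>The flux of v / |v|^N through a sphere around 0, that is, the surface measure of the
  unit sphere. The kernels are left unnormalised; positivity of this mass allows division by it at
  the end.\<close>

definition delta_mass :: "'n::finite itself \<Rightarrow> real" where
  "delta_mass _ = (\<integral>u. approx_delta 1 (u::real^'n) \<partial>lborel)"

lemma delta_mass_pos: "0 < delta_mass TYPE('n::finite)"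
proof -
  have "0 \<le> delta_mass TYPE('n)" unfolding delta_mass_def by (intro integral_nonneg_AE) (simp add: approx_delta_nonneg)
  moreover have "delta_mass TYPE('n) \<noteq> 0"
  proof
    assume "delta_mass TYPE('n) = 0"
    then have "AE u in lborel. approx_delta 1 (u :: real^'n) = 0"
      unfolding delta_mass_def using integral_nonneg_eq_0_iff_AE[OF integrable_approx_delta_1[where 'n = 'n]] by (simp add: approx_delta_nonneg)
    moreover have "approx_delta 1 (u :: real^'n) \<noteq> 0" for u
      using inner_ge_zero[of u] by (simp add: approx_delta_def add_nonneg_eq_0_iff)
    ultimately have "AE u in (lborel :: (real^'n) measure). False" by simp
    then have "emeasure lborel (UNIV :: (real^'n) set) = 0" by (subst (asm) AE_iff_measurable[OF _ refl]) auto
    then show False by (simp add: emeasure_lborel_UNIV)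
  qed
  ultimately show ?thesis by linarith
qed

lemma approx_delta_convolution_bound:
  fixes \<phi> :: "real^'n::finite \<Rightarrow> real"
  assumes "0 < e" "continuous_on UNIV \<phi>" "\<And>x. \<bar>\<phi> x\<bar> \<le> L"
  shows "\<bar>\<integral>z. \<phi> z * approx_delta e (y - z) \<partial>lborel\<bar> \<le> L * delta_mass TYPE('n)"
proof -
  have c: "continuous_on UNIV (\<lambda>u. \<phi> (y - sqrt e *\<^sub>R u))"
    using assms(2) by (auto intro!: continuous_on_compose2[of UNIV \<phi>] continuous_intros)
  have i: "integrable lborel (\<lambda>u. \<phi> (y - sqrt e *\<^sub>R u) * approx_delta 1 u)"
    using integrable_mult_bounded[OF integrable_approx_delta_1[where 'n = 'n], of "\<lambda>u. \<phi> (y - sqrt e *\<^sub>R u)" L] borel_measurable_continuous_onI[OF c] assms(3)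
    by (simp add: mult.commute)
  have "\<bar>\<integral>u. \<phi> (y - sqrt e *\<^sub>R u) * approx_delta 1 u \<partial>lborel\<bar> \<le> (\<integral>u. \<bar>\<phi> (y - sqrt e *\<^sub>R u) * approx_delta 1 u\<bar> \<partial>lborel)"
    by (rule integral_abs_bound)
  also have "\<dots> \<le> (\<integral>u. L * approx_delta 1 (u::real^'n) \<partial>lborel)"
  proof (rule integral_mono)
    show "integrable lborel (\<lambda>u. \<bar>\<phi> (y - sqrt e *\<^sub>R u) * approx_delta 1 u\<bar>)" using i by (rule integrable_abs)
    show "integrable lborel (\<lambda>u::real^'n. L * approx_delta 1 u)" using integrable_approx_delta_1[where 'n = 'n] by simp
    show "\<bar>\<phi> (y - sqrt e *\<^sub>R u) * approx_delta 1 u\<bar> \<le> L * approx_delta 1 u" for u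
      using assms(3) by (simp add: abs_mult approx_delta_nonneg mult_right_mono)
  qed
  finally show ?thesis unfolding approx_delta_convolution[OF assms(1,2)] delta_mass_def by simp
qed

text \<open>After rescaling, the mollifier is the fixed function \<open>approx_delta 1\<close> and
  only the argument of \<phi> moves, so dominated convergence applies.\<close>

lemma approx_delta_convolution_limit:
  fixes \<phi> :: "real^'n::finite \<Rightarrow> real"
  assumes "continuous_on UNIV \<phi>" "\<And>x. \<bar>\<phi> x\<bar> \<le> L" "\<And>n. 0 < e n" "e \<longlonglongrightarrow> 0"
  shows "(\<lambda>n. \<integral>z. \<phi> z * approx_delta (e n) (y - z) \<partial>lborel) \<longlonglongrightarrow> \<phi> y * delta_mass TYPE('n)"
proof -
  have "(\<lambda>n. \<integral>u. \<phi> (y - sqrt (e n) *\<^sub>R u) * approx_delta 1 u \<partial>lborel) \<longlonglongrightarrow> (\<integral>u. \<phi> y * approx_delta 1 u \<partial>(lborel :: (real^'n) measure))"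
  proof (rule integral_dominated_convergence[where w = "\<lambda>u. L * approx_delta 1 u"])
    have c: "continuous_on UNIV (\<lambda>u. \<phi> (y - sqrt (e n) *\<^sub>R u))" for n
      using assms(1) by (auto intro!: continuous_on_compose2[of UNIV \<phi>] continuous_intros)
    show "(\<lambda>u. \<phi> (y - sqrt (e n) *\<^sub>R u) * approx_delta 1 u) \<in> borel_measurable lborel" for n
      using borel_measurable_continuous_onI[OF c] integrable_approx_delta_1[where 'n = 'n] by simp
    show "integrable lborel (\<lambda>u::real^'n. L * approx_delta 1 u)" using integrable_approx_delta_1[where 'n = 'n] by simp
    show "(\<lambda>u. \<phi> y * approx_delta 1 (u :: real^'n)) \<in> borel_measurable lborel" using integrable_approx_delta_1[where 'n = 'n] by simp
    show "AE u in lborel. (\<lambda>n. \<phi> (y - sqrt (e n) *\<^sub>R u) * approx_delta 1 u) \<longlonglongrightarrow> \<phi> y * approx_delta 1 u"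
    proof (rule AE_I2)
      fix u
      have "(\<lambda>n. y - sqrt (e n) *\<^sub>R u) \<longlonglongrightarrow> y - sqrt 0 *\<^sub>R u" using assms(4) by (intro tendsto_intros)
      moreover have "isCont \<phi> y" using assms(1) by (simp add: continuous_on_eq_continuous_at)
      ultimately have "(\<lambda>n. \<phi> (y - sqrt (e n) *\<^sub>R u)) \<longlonglongrightarrow> \<phi> y" using isCont_tendsto_compose by fastforce
      then show "(\<lambda>n. \<phi> (y - sqrt (e n) *\<^sub>R u) * approx_delta 1 u) \<longlonglongrightarrow> \<phi> y * approx_delta 1 u" by (intro tendsto_intros)
    qed
    show "AE u in lborel. norm (\<phi> (y - sqrt (e n) *\<^sub>R u) * approx_delta 1 u) \<le> L * approx_delta 1 u" for n
      using assms(2) by (intro AE_I2) (simp add: abs_mult approx_delta_nonneg mult_right_mono)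
  qed
  then show ?thesis unfolding approx_delta_convolution[OF assms(3,1)] delta_mass_def by simp
qed

text \<open>A primitive of -s^(-a)/2 in the variable s = |v|^2 + e. With a = N/2 it is, up to a
  factor, the regularised Newtonian kernel of dimension N; the logarithm is the planar case.\<close>

definition fundsol :: "real \<Rightarrow> real \<Rightarrow> real" where
  "fundsol a s = (if a = 1 then - (1/2) * ln s else s powr (1 - a) / (2 * (a - 1)))"

lemma fundsol_DERIV:
  assumes "0 < s" shows "(fundsol a has_real_derivative - (1/2) * s powr (-a)) (at s)"
proof (cases "a = 1")
  case True
  have "((\<lambda>s. - (1/2) * ln s) has_real_derivative - (1/2) * (1 / s)) (at s)"
    using assms by (intro DERIV_cmult DERIV_ln_divide)
  moreover have "fundsol a = (\<lambda>s. - (1/2) * ln s)" using True by (auto simp: fundsol_def)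
  moreover have "s powr (-a) = 1 / s" using True assms by (simp add: powr_minus_divide)
  ultimately show ?thesis by metis
next
  case False
  have "((\<lambda>s. s powr (1 - a) / (2 * (a - 1))) has_real_derivative ((1 - a) * s powr (1 - a - 1)) / (2 * (a - 1))) (at s)"
    using assms by (intro DERIV_cdivide has_real_derivative_powr)
  moreover have "((1 - a) * s powr (1 - a - 1)) / (2 * (a - 1)) = - (1/2) * s powr (-a)"
  proof -
    have "(1 - a) / (2 * (a - 1)) = - (1/2)" using False by (simp add: divide_simps)
    then have "(1 - a) / (2 * (a - 1)) * s powr (-a) = - (1/2) * s powr (-a)" by (rule arg_cong)
    then show ?thesis by simp
  qed
  moreover have "fundsol a = (\<lambda>s. s powr (1 - a) / (2 * (a - 1)))" using False by (auto simp: fundsol_def)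
  ultimately show ?thesis by metis
qed

lemma continuous_on_fundsol:
  assumes "continuous_on A f" "\<And>x. x \<in> A \<Longrightarrow> 0 < f x"
  shows "continuous_on A (\<lambda>x. fundsol a (f x))"
proof (rule continuous_on_compose2[OF _ assms(1)])
  show "continuous_on {0<..} (fundsol a)"
    using fundsol_DERIV by (intro continuous_at_imp_continuous_on) (auto intro: DERIV_isCont)
qed (use assms in auto)

lemma pd_fundsol:
  assumes "f differentiable (at x)" "0 < f x"
  shows "pd i (\<lambda>x. fundsol a (f x)) x = - (1/2) * f x powr (-a) * pd i f x"
  by (rule pd_compose_real[OF assms(1) fundsol_DERIV[OF assms(2)]])

lemma smooth_on_fundsol [smooth_intros]:
  assumes "open U" "smooth_on U f" "\<And>x. x \<in> U \<Longrightarrow> 0 < f x"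
  shows "smooth_on U (\<lambda>x. fundsol a (f x))"
proof (subst smooth_on_iff, intro conjI ballI allI)
  fix x assume "x \<in> U"
  from has_derivative_compose[OF has_derivative_pd[OF smooth_on_diff[OF assms(2) this]]
        has_field_derivative_imp_has_derivative[OF fundsol_DERIV[OF assms(3)[OF this]]]]
  show "(\<lambda>x. fundsol a (f x)) differentiable (at x)" by (rule differentiableI)
next
  fix i
  show "smooth_on U (pd i (\<lambda>x. fundsol a (f x)))"
  proof (rule smooth_on_cong[OF assms(1)])
    show "smooth_on U (\<lambda>x. - (1/2) * f x powr (-a) * pd i f x)"
      using assms by (intro smooth_on_mult smooth_on_powr smooth_on_const smooth_on_pd)
    show "- (1/2) * f x powr (-a) * pd i f x = pd i (\<lambda>x. fundsol a (f x)) x" if "x \<in> U" for x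
      using pd_fundsol[OF smooth_on_diff[OF assms(2) that] assms(3)[OF that]] by simp
  qed
qed

section \<open>The fundamental solution composed with a map \<open>S\<close>, and its
  Laplacian\<close>

definition kq :: "real \<Rightarrow> (real^'n \<Rightarrow> real^'n) \<Rightarrow> real^'n::finite \<Rightarrow> real^'n \<Rightarrow> real" where
  "kq e S z x = (S x - z) \<bullet> (S x - z) + e"

text \<open>\<open>S\<close> acts on the integration variable and \<open>z\<close> is the pole: with
  the identity for \<open>S\<close> this is the direct kernel, with a reflection it is the image
  kernel.\<close>

definition kgam :: "real \<Rightarrow> (real^'n \<Rightarrow> real^'n) \<Rightarrow> real^'n::finite \<Rightarrow> real^'n \<Rightarrow> real" where
  "kgam e S z x = fundsol (real CARD('n) / 2) (kq e S z x)"

definition kgrad :: "real \<Rightarrow> (real^'n \<Rightarrow> real^'n) \<Rightarrow> real^'n::finite \<Rightarrow> 'n \<Rightarrow> real^'n \<Rightarrow> real" where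
  "kgrad e S z j x = - (kq e S z x powr (- (real CARD('n) / 2)) * (\<Sum>k\<in>UNIV. (S x - z) $ k * pd j (\<lambda>x. S x $ k) x))"

text \<open>\<open>SE\<close> is the deviation of \<open>DS DS\<^sup>T\<close> from the identity. It vanishes for translations; for the
  reflection at a curved boundary it is only of the order of the distance to the boundary.\<close>

definition SE :: "(real^'n \<Rightarrow> real^'n::finite) \<Rightarrow> 'n \<Rightarrow> 'n \<Rightarrow> real^'n \<Rightarrow> real" where
  "SE S k l x = (\<Sum>j\<in>UNIV. pd j (\<lambda>x. S x $ k) x * pd j (\<lambda>x. S x $ l) x) - (if k = l then 1 else 0)"

definition SB :: "(real^'n \<Rightarrow> real^'n::finite) \<Rightarrow> 'n \<Rightarrow> real^'n \<Rightarrow> real" where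
  "SB S k x = (\<Sum>j\<in>UNIV. pd j (pd j (\<lambda>x. S x $ k)) x)"

text \<open>What remains of the Laplacian in x of \<open>kgam\<close> after the mollified Dirac mass
  is split off: the double sum and the trace come from DS DS^T - I, the term with \<open>SB\<close>
  from the Laplacians of the components of \<open>S\<close>. See
  \<open>sum_pd_kgrad\<close>.\<close>

definition kdef :: "real \<Rightarrow> (real^'n \<Rightarrow> real^'n) \<Rightarrow> real^'n::finite \<Rightarrow> real^'n \<Rightarrow> real" where
  "kdef e S z x = real CARD('n) * (kq e S z x powr (- (real CARD('n) / 2 + 1)) * (\<Sum>k\<in>UNIV. \<Sum>l\<in>UNIV. (S x - z) $ k * (S x - z) $ l * SE S k l x))
     - kq e S z x powr (- (real CARD('n) / 2)) * ((\<Sum>k\<in>UNIV. SE S k k x) + (\<Sum>k\<in>UNIV. (S x - z) $ k * SB S k x))"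

lemma kq_pos: "0 < e \<Longrightarrow> 0 < kq e S z x"
  unfolding kq_def using inner_ge_zero[of "S x - z"] by linarith

lemma pd_powr:
  assumes "f differentiable (at x)" "0 < f x"
  shows "pd i (\<lambda>x. f x powr r) x = r * f x powr (r - 1) * pd i f x"
  by (rule pd_compose_real[OF assms(1) has_real_derivative_powr[OF assms(2)]])

context
  fixes S :: "real^'n::finite \<Rightarrow> real^'n" and e :: real
  assumes S: "\<And>k. smooth_on UNIV (\<lambda>x. S x $ k)" and e: "0 < e"
begin

lemma smooth_on_v: "smooth_on UNIV (\<lambda>x. (S x - z) $ k)"
  using S[of k] by (simp add: smooth_on_diff')

lemma pd_v: "pd j (\<lambda>x. (S x - z) $ k) x = pd j (\<lambda>x. S x $ k) x"
  using pd_add[of "\<lambda>x. S x $ k" x "\<lambda>_. - z $ k" j] smooth_on_diff[OF S[of k], of x] by simp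

lemma smooth_on_kq: "smooth_on UNIV (kq e S z)"
  unfolding kq_def by (intro smooth_intros S smooth_on_v) auto

lemma pd_kq: "pd j (kq e S z) x = 2 * (\<Sum>k\<in>UNIV. (S x - z) $ k * pd j (\<lambda>x. S x $ k) x)"
proof -
  have kq_eq: "kq e S z = (\<lambda>x. (\<Sum>k\<in>UNIV. (S x - z) $ k * (S x - z) $ k) + e)"
    by (rule ext) (simp add: kq_def inner_vec_def)
  have s: "smooth_on UNIV (\<lambda>x. (S x - z) $ k * (S x - z) $ k)" for k
    by (rule smooth_on_mult[OF _ smooth_on_v smooth_on_v]) simp
  have s': "smooth_on UNIV (\<lambda>x. \<Sum>k\<in>UNIV. (S x - z) $ k * (S x - z) $ k)"
    by (rule smooth_on_sum[OF _ s]) simp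
  have "pd j (kq e S z) x = pd j (\<lambda>x. \<Sum>k\<in>UNIV. (S x - z) $ k * (S x - z) $ k) x"
    unfolding kq_eq using pd_add[OF smooth_on_diff[OF s'], of x "\<lambda>_. e" j] by simp
  also have "\<dots> = (\<Sum>k\<in>UNIV. pd j (\<lambda>x. (S x - z) $ k * (S x - z) $ k) x)"
    by (rule pd_sum) (use smooth_on_diff[OF s] in auto)
  also have "\<dots> = (\<Sum>k\<in>UNIV. 2 * ((S x - z) $ k * pd j (\<lambda>x. S x $ k) x))"
    by (rule sum.cong[OF refl])
       (subst pd_mult[OF smooth_on_diff[OF smooth_on_v] smooth_on_diff[OF smooth_on_v]], simp_all only: UNIV_I pd_v, simp)
  finally show ?thesis by (simp add: sum_distrib_left)
qed

lemma smooth_on_kgam: "smooth_on UNIV (kgam e S z)"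
  unfolding kgam_def by (rule smooth_on_fundsol[OF _ smooth_on_kq]) (use kq_pos e in auto)

lemma pd_kgam: "pd j (kgam e S z) x = kgrad e S z j x"
  unfolding kgam_def kgrad_def
  by (subst pd_fundsol[OF smooth_on_diff[OF smooth_on_kq] kq_pos[OF e]]) (simp_all add: pd_kq)

lemma smooth_on_L: "smooth_on UNIV (\<lambda>x. \<Sum>k\<in>UNIV. (S x - z) $ k * pd j (\<lambda>x. S x $ k) x)"
  by (intro smooth_on_sum smooth_on_mult smooth_on_v smooth_on_pd S) auto

lemma smooth_on_kgrad: "smooth_on UNIV (kgrad e S z j)"
  unfolding kgrad_def
  by (intro smooth_on_minus smooth_on_mult smooth_on_powr smooth_on_kq smooth_on_L kq_pos e) auto

lemma pd_kgrad:
  "pd j (kgrad e S z j) x = real CARD('n) * kq e S z x powr (- (real CARD('n) / 2 + 1)) * (\<Sum>k\<in>UNIV. (S x - z) $ k * pd j (\<lambda>x. S x $ k) x)\<^sup>2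
    - kq e S z x powr (- (real CARD('n) / 2)) * (\<Sum>k\<in>UNIV. pd j (\<lambda>x. S x $ k) x * pd j (\<lambda>x. S x $ k) x + (S x - z) $ k * pd j (pd j (\<lambda>x. S x $ k)) x)"
proof -
  let ?a = "real CARD('n) / 2"
  let ?L = "\<lambda>x. \<Sum>k\<in>UNIV. (S x - z) $ k * pd j (\<lambda>x. S x $ k) x"
  have eq: "kgrad e S z j = (\<lambda>x. (-1) * (kq e S z x powr (- ?a) * ?L x))" by (rule ext) (simp add: kgrad_def)
  have sp: "smooth_on UNIV (\<lambda>x. kq e S z x powr (- ?a))"
    by (intro smooth_on_powr smooth_on_kq kq_pos e) auto
  have sm: "smooth_on UNIV (\<lambda>x. kq e S z x powr (- ?a) * ?L x)"
    by (rule smooth_on_mult[OF _ sp smooth_on_L]) simp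
  have sc: "smooth_on UNIV (\<lambda>x::real^'n. -1::real)" by simp
  have 1: "pd j (\<lambda>x. kq e S z x powr (- ?a)) x = - ?a * kq e S z x powr (- ?a - 1) * (2 * ?L x)"
    using pd_powr[OF smooth_on_diff[OF smooth_on_kq] kq_pos[OF e], where r = "- ?a"] by (simp add: pd_kq)
  have 2: "pd j ?L x = (\<Sum>k\<in>UNIV. pd j (\<lambda>x. S x $ k) x * pd j (\<lambda>x. S x $ k) x + (S x - z) $ k * pd j (pd j (\<lambda>x. S x $ k)) x)"
  proof -
    have "pd j ?L x = (\<Sum>k\<in>UNIV. pd j (\<lambda>x. (S x - z) $ k * pd j (\<lambda>x. S x $ k) x) x)"
      by (rule pd_sum) (auto intro!: smooth_on_diff[of UNIV] smooth_on_mult smooth_on_v[simplified] smooth_on_pd S)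
    also have "\<dots> = (\<Sum>k\<in>UNIV. (S x - z) $ k * pd j (pd j (\<lambda>x. S x $ k)) x + pd j (\<lambda>x. (S x - z) $ k) x * pd j (\<lambda>x. S x $ k) x)"
      by (rule sum.cong[OF refl], rule pd_mult[OF smooth_on_diff[OF smooth_on_v] smooth_on_diff[OF smooth_on_pd[OF S]]]) auto
    finally show ?thesis unfolding pd_v by (simp add: add.commute)
  qed
  have "pd j (kgrad e S z j) x = - pd j (\<lambda>x. kq e S z x powr (- ?a) * ?L x) x"
    unfolding eq using pd_mult[OF smooth_on_diff[OF sc] smooth_on_diff[OF sm], of x j] by simp
  also have "pd j (\<lambda>x. kq e S z x powr (- ?a) * ?L x) x = kq e S z x powr (- ?a) * pd j ?L x + pd j (\<lambda>x. kq e S z x powr (- ?a)) x * ?L x"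
    by (rule pd_mult[OF smooth_on_diff[OF sp] smooth_on_diff[OF smooth_on_L]]) auto
  finally show ?thesis unfolding 1 2 by (simp add: power2_eq_square)
qed

text \<open>With v = S x - z and q = |v|^2 + e the divergence is N q^(-N/2-1) |DS^T v|^2 - q^(-N/2)
  (|DS|^2 + v . Laplace S). Writing DS DS^T as the identity plus \<open>SE\<close>, the identity
  part collapses to N q^(-N/2-1) (|v|^2 - q) = -N e q^(-N/2-1), the negative mollifier at S x -
  z.\<close>

lemma sum_pd_kgrad:
  "(\<Sum>j\<in>UNIV. pd j (kgrad e S z j) x) = - approx_delta e (S x - z) + kdef e S z x"
proof -
  let ?a = "real CARD('n) / 2"
  let ?q = "kq e S z x"
  let ?v = "\<lambda>k. (S x - z) $ k"
  let ?D = "\<lambda>j k. pd j (\<lambda>x. S x $ k) x"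
  have A: "(\<Sum>j\<in>UNIV. ?D j k * ?D j l) = SE S k l x + (if k = l then 1 else 0)" for k l
    by (simp add: SE_def)
  have sq: "(\<Sum>j\<in>UNIV. (\<Sum>k\<in>UNIV. ?v k * ?D j k)\<^sup>2) = (\<Sum>k\<in>UNIV. \<Sum>l\<in>UNIV. ?v k * ?v l * SE S k l x) + (S x - z) \<bullet> (S x - z)"
  proof -
    have "(\<Sum>j\<in>UNIV. (\<Sum>k\<in>UNIV. ?v k * ?D j k)\<^sup>2) = (\<Sum>j\<in>UNIV. \<Sum>k\<in>UNIV. \<Sum>l\<in>UNIV. ?v k * ?v l * (?D j k * ?D j l))"
      by (simp only: power2_eq_square sum_product) (intro sum.cong refl, simp only: mult_ac)
    also have "\<dots> = (\<Sum>k\<in>UNIV. \<Sum>j\<in>UNIV. \<Sum>l\<in>UNIV. ?v k * ?v l * (?D j k * ?D j l))" by (rule sum.swap)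
    also have "\<dots> = (\<Sum>k\<in>UNIV. \<Sum>l\<in>UNIV. \<Sum>j\<in>UNIV. ?v k * ?v l * (?D j k * ?D j l))"
      by (rule sum.cong[OF refl], rule sum.swap)
    also have "\<dots> = (\<Sum>k\<in>UNIV. \<Sum>l\<in>UNIV. ?v k * ?v l * (SE S k l x + (if k = l then 1 else 0)))"
      by (simp only: sum_distrib_left[symmetric] A)
    also have "\<dots> = (\<Sum>k\<in>UNIV. \<Sum>l\<in>UNIV. ?v k * ?v l * SE S k l x) + (\<Sum>k\<in>UNIV. \<Sum>l\<in>UNIV. if k = l then ?v k * ?v l else 0)"
      by (simp only: distrib_left sum.distrib) (intro arg_cong2[of _ _ _ _ "(+)"] sum.cong refl, auto)
    also have "(\<Sum>k\<in>UNIV. \<Sum>l\<in>UNIV. if k = l then ?v k * ?v l else 0) = (S x - z) \<bullet> (S x - z)"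
      by (simp add: inner_vec_def)
    finally show ?thesis .
  qed
  have tr: "(\<Sum>j\<in>UNIV. \<Sum>k\<in>UNIV. ?D j k * ?D j k + ?v k * pd j (pd j (\<lambda>x. S x $ k)) x) =
      real CARD('n) + ((\<Sum>k\<in>UNIV. SE S k k x) + (\<Sum>k\<in>UNIV. ?v k * SB S k x))"
  proof -
    have "(\<Sum>j\<in>UNIV. \<Sum>k\<in>UNIV. ?D j k * ?D j k + ?v k * pd j (pd j (\<lambda>x. S x $ k)) x) =
      (\<Sum>k\<in>UNIV. \<Sum>j\<in>UNIV. ?D j k * ?D j k + ?v k * pd j (pd j (\<lambda>x. S x $ k)) x)" by (rule sum.swap)
    also have "\<dots> = (\<Sum>k\<in>UNIV. (SE S k k x + 1) + ?v k * SB S k x)"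
      by (rule sum.cong[OF refl]) (simp only: sum.distrib sum_distrib_left[symmetric] A SB_def simp_thms if_True)
    finally show ?thesis by (simp add: sum.distrib)
  qed
  have "(\<Sum>j\<in>UNIV. pd j (kgrad e S z j) x) = real CARD('n) * ?q powr (- (?a + 1)) * (\<Sum>j\<in>UNIV. (\<Sum>k\<in>UNIV. ?v k * ?D j k)\<^sup>2)
     - ?q powr (- ?a) * (\<Sum>j\<in>UNIV. \<Sum>k\<in>UNIV. ?D j k * ?D j k + ?v k * pd j (pd j (\<lambda>x. S x $ k)) x)"
    unfolding pd_kgrad by (simp only: sum_subtractf sum_distrib_left)
  also have "\<dots> = kdef e S z x + real CARD('n) * (?q powr (- (?a + 1)) * ((S x - z) \<bullet> (S x - z)) - ?q powr (- ?a))"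
    unfolding sq tr kdef_def by (simp only: algebra_simps)
  also have "?q powr (- (?a + 1)) * ((S x - z) \<bullet> (S x - z)) - ?q powr (- ?a) = - (e * ?q powr (- ?a - 1))"
  proof -
    have "?q powr (- ?a) = ?q powr (- (?a + 1)) * ?q"
      using kq_pos[OF e, of S z x] by (simp add: powr_mult_base powr_diff powr_minus field_simps)
    then have "?q powr (- (?a + 1)) * ((S x - z) \<bullet> (S x - z)) - ?q powr (- ?a) = ?q powr (- (?a + 1)) * ((S x - z) \<bullet> (S x - z) - ?q)"
      by (simp add: right_diff_distrib)
    also have "(S x - z) \<bullet> (S x - z) - ?q = - e" by (simp add: kq_def)
    finally show ?thesis by simp
  qed
  finally show ?thesis unfolding approx_delta_def kq_def by simp
qed

end

lemma SE_translation:
  fixes a :: "real^'n::finite"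
  shows "SE (\<lambda>x. x + a) k l x = 0" "SB (\<lambda>x. x + a) k x = 0"
proof -
  have p: "pd j (\<lambda>x::real^'n. (x + a) $ k) = (\<lambda>x. if j = k then 1 else 0)" for j k
  proof
    fix x :: "real^'n"
    have "pd j (\<lambda>x. x $ k + a $ k) x = pd j (\<lambda>x. x $ k) x"
      using pd_add[OF smooth_on_diff[of UNIV "\<lambda>x. x $ k"], of x "\<lambda>_. a $ k" j] by simp
    then show "pd j (\<lambda>x. (x + a) $ k) x = (if j = k then 1 else 0)" by (simp add: pd_coord)
  qed
  show "SE (\<lambda>x. x + a) k l x = 0"
  proof -
    have "(\<Sum>j\<in>UNIV. (if j = k then 1 else 0) * (if j = l then 1 else 0 :: real)) = (\<Sum>j\<in>UNIV. if j = k then (if k = l then 1 else 0) else 0)"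
      by (rule sum.cong) auto
    then show ?thesis unfolding SE_def p by simp
  qed
  show "SB (\<lambda>x. x + a) k x = 0" unfolding SB_def p by simp
qed

text \<open>The direct kernel leaves nothing singular besides its mollifier, so only the image
  kernel has to be estimated near the pole.\<close>

lemma kdef_id:
  fixes z :: "real^'n::finite"
  shows "kdef e (\<lambda>x. x) z x = 0"
  using SE_translation[of "0 :: real^'n"] by (simp add: kdef_def)

subsection \<open>Dependence of the kernels on the pole\<close>

lemma smooth_on_u:
  fixes y :: "real^'n::finite"
  shows "smooth_on UNIV (\<lambda>z. (y - z) $ k)"
  by (simp add: smooth_on_diff')

lemma pd_u:
  fixes y :: "real^'n::finite"
  shows "pd i (\<lambda>z. (y - z) $ k) z = (if i = k then - 1 else 0)"
proof -
  have "((\<lambda>z. (y - z) $ k) has_derivative (\<lambda>w. - w $ k)) (at z)"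
    by (auto intro!: derivative_eq_intros bounded_linear_imp_has_derivative bounded_linear_vec_nth)
  from pd_eqI[OF this] show ?thesis by (simp add: axis_def)
qed

context
  fixes y :: "real^'n::finite" and e :: real
  assumes e: "0 < e"
begin

lemma kq_pos': "0 < (y - z) \<bullet> (y - z) + e"
  using inner_ge_zero[of "y - z"] e by linarith

lemma smooth_on_kq_pole: "smooth_on UNIV (\<lambda>z. (y - z) \<bullet> (y - z) + e)"
  by (intro smooth_intros smooth_on_u) auto

lemma pd_kq_pole: "pd i (\<lambda>z. (y - z) \<bullet> (y - z) + e) z = - 2 * (y - z) $ i"
proof -
  have "((\<lambda>z. (y - z) \<bullet> (y - z) + e) has_derivative (\<lambda>w. (y - z) \<bullet> (- w) + (- w) \<bullet> (y - z))) (at z)"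
    by (auto intro!: derivative_eq_intros)
  from pd_eqI[OF this] show ?thesis by (simp add: inner_axis inner_axis' inner_commute)
qed

lemma smooth_on_pole_powr:
  "smooth_on UNIV m \<Longrightarrow> smooth_on UNIV (\<lambda>z. ((y - z) \<bullet> (y - z) + e) powr (- b) * m z)"
  by (intro smooth_on_mult smooth_on_powr smooth_on_kq_pole kq_pos') auto

lemma pole_powr_bound:
  assumes "y \<noteq> z" "0 \<le> b" "\<bar>m\<bar> \<le> m0"
  shows "\<bar>((y - z) \<bullet> (y - z) + e) powr (- b) * m\<bar> \<le> norm (y - z) powr (- (2 * b)) * m0"
  using inner_plus_powr_le[of e b "y - z"] assms e by (simp add: abs_mult mult_mono)

text \<open>Since |y - z|^2 + e \<ge> |y - z|^2, negative powers are controlled by those of the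
  distance uniformly in \<open>e\<close>; differentiating the power in the pole costs one further
  factor 1 / |y - z|.\<close>

lemma pd_pole_powr_bound:
  assumes m: "smooth_on UNIV m" and yz: "y \<noteq> z" and b: "0 \<le> b" and m0: "\<bar>m z\<bar> \<le> m0" and m1: "\<bar>pd i m z\<bar> \<le> m1"
  shows "\<bar>pd i (\<lambda>z. ((y - z) \<bullet> (y - z) + e) powr (- b) * m z) z\<bar>
    \<le> norm (y - z) powr (- (2 * b)) * (2 * b * m0 / norm (y - z) + m1)"
proof -
  let ?n = "norm (y - z)"
  let ?Q = "\<lambda>z. (y - z) \<bullet> (y - z) + e"
  have n: "0 < ?n" using yz by simp
  have d: "(\<lambda>z. ?Q z powr (- b)) differentiable (at z)"
    by (rule smooth_on_diff[of UNIV]) (intro smooth_on_powr smooth_on_kq_pole kq_pos', auto)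
  have "pd i (\<lambda>z. ?Q z powr (- b) * m z) z = ?Q z powr (- b) * pd i m z + pd i (\<lambda>z. ?Q z powr (- b)) z * m z"
    by (rule pd_mult[OF d smooth_on_diff[OF m]]) simp
  also have "pd i (\<lambda>z. ?Q z powr (- b)) z = - b * ?Q z powr (- b - 1) * (- 2 * (y - z) $ i)"
    by (subst pd_powr[OF smooth_on_diff[OF smooth_on_kq_pole] kq_pos']) (simp_all add: pd_kq_pole)
  finally have eq: "pd i (\<lambda>z. ?Q z powr (- b) * m z) z = ?Q z powr (- b) * pd i m z + ?Q z powr (- (b + 1)) * (2 * b * (y - z) $ i * m z)"
    by (simp del: vector_minus_component add: mult_ac)
  have 1: "\<bar>?Q z powr (- b) * pd i m z\<bar> \<le> ?n powr (- (2 * b)) * m1"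
    by (rule pole_powr_bound[OF yz b m1])
  have "\<bar>2 * b * (y - z) $ i * m z\<bar> \<le> 2 * b * ?n * m0"
    using component_le_norm_cart[of "y - z" i] b m0 by (simp add: abs_mult mult_mono)
  then have 2: "\<bar>?Q z powr (- (b + 1)) * (2 * b * (y - z) $ i * m z)\<bar> \<le> ?n powr (- (2 * (b + 1))) * (2 * b * ?n * m0)"
    using b by (intro pole_powr_bound[OF yz]) auto
  have "- (2 * (b + 1)) = - (2 * b) + (- 2)" by simp
  then have "?n powr (- (2 * (b + 1))) = ?n powr (- (2 * b)) * ?n powr (- 2)" by (metis powr_add)
  moreover have "?n powr (- 2) = 1 / (?n * ?n)"
    using n by (simp add: powr_minus_divide power2_eq_square)
  moreover have "1 / (?n * ?n) * (2 * b * ?n * m0) = 2 * b * m0 / ?n" using n by (simp add: divide_simps)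
  ultimately have 3: "?n powr (- (2 * (b + 1))) * (2 * b * ?n * m0) = ?n powr (- (2 * b)) * (2 * b * m0 / ?n)"
    by (metis mult.assoc)
  show ?thesis using abs_triangle_ineq[of "?Q z powr (- b) * pd i m z" "?Q z powr (- (b + 1)) * (2 * b * (y - z) $ i * m z)"] 1 2 3
    unfolding eq by (simp add: distrib_left)
qed

end

lemma powr_mult_power: "0 < (n::real) \<Longrightarrow> n powr s * n ^ k = n powr (s + real k)"
  by (simp add: powr_add powr_realpow)

lemma pd_mult_smooth:
  "smooth_on UNIV f \<Longrightarrow> smooth_on UNIV g \<Longrightarrow> pd i (\<lambda>x. f x * g x) x = f x * pd i g x + pd i f x * g x"
  by (intro pd_mult smooth_on_diff[of UNIV]) auto

lemma pd_add_smooth: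
  "smooth_on UNIV f \<Longrightarrow> smooth_on UNIV g \<Longrightarrow> pd i (\<lambda>x. f x + g x) x = pd i f x + pd i g x"
  by (intro pd_add smooth_on_diff[of UNIV]) auto

lemma pd_cmult_right: "smooth_on UNIV f \<Longrightarrow> pd i (\<lambda>x. f x * c) x = pd i f x * c"
  using pd_mult_smooth[of f "\<lambda>_. c"] by simp

lemma pd_cmult_left: "smooth_on UNIV f \<Longrightarrow> pd i (\<lambda>x. c * f x) x = c * pd i f x"
  using pd_mult_smooth[of "\<lambda>_. c" f] by simp

lemma abs_sum_le_card:
  fixes f :: "'n::finite \<Rightarrow> real"
  assumes "\<And>k. \<bar>f k\<bar> \<le> c"
  shows "\<bar>\<Sum>k\<in>UNIV. f k\<bar> \<le> real CARD('n) * c"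
proof -
  have "\<bar>\<Sum>k\<in>UNIV. f k\<bar> \<le> (\<Sum>k\<in>UNIV. \<bar>f k\<bar>)" by (rule sum_abs)
  also have "\<dots> \<le> (\<Sum>k\<in>(UNIV::'n set). c)" using assms by (intro sum_mono)
  finally show ?thesis by simp
qed

lemma abs_scaled_diff_le:
  fixes N A B :: real assumes "0 \<le> N"
  shows "\<bar>N * A - B\<bar> \<le> N * \<bar>A\<bar> + \<bar>B\<bar>"
proof -
  have "\<bar>N * A - B\<bar> \<le> \<bar>N * A\<bar> + \<bar>B\<bar>" by (rule abs_triangle_ineq4)
  then show ?thesis using assms by (simp add: abs_mult)
qed

text \<open>A count of powers of n = |S x - z|, uniform in \<open>e\<close>. The worst term has
  q^(-N/2-1) against two factors of S x - z and one of \<open>SE\<close>; the hypothesis that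
  \<open>SE\<close> is itself O(n) improves the order from -N to 1 - N. A derivative in the pole
  brings the order back to -N, because \<open>SE\<close> depends on x only.\<close>

lemma kdef_pole:
  fixes S :: "real^'n::finite \<Rightarrow> real^'n" and x :: "real^'n"
  assumes e: "0 < e" and C: "0 \<le> C" "\<And>k l. \<bar>SE S k l x\<bar> \<le> C * norm (S x - z)" "\<And>k. \<bar>SB S k x\<bar> \<le> C"
    and n: "S x \<noteq> z"
  defines "N \<equiv> real CARD('n)"
  shows "smooth_on UNIV (\<lambda>z. kdef e S z x)"
    and "\<bar>kdef e S z x\<bar> \<le> (N * N * N + N + N) * C * norm (S x - z) powr (- (N - 1))"
    and "\<bar>pd i (\<lambda>z. kdef e S z x) z\<bar> \<le> (N * ((N + 2) * N * N + 2 * N * N) + (2 * N * N + 1)) * C * norm (S x - z) powr (- N)"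
proof -
  let ?n = "norm (S x - z)"
  let ?y = "S x"
  let ?a = "N / 2"
  define m1 where "m1 z = (\<Sum>k\<in>UNIV. \<Sum>l\<in>UNIV. (?y - z) $ k * (?y - z) $ l * SE S k l x)" for z
  define m2 where "m2 z = (\<Sum>k\<in>UNIV. SE S k k x) + (\<Sum>k\<in>UNIV. (?y - z) $ k * SB S k x)" for z
  have n0: "0 < ?n" using n by simp
  have N0: "0 \<le> N" unfolding N_def by simp
  have cn: "\<bar>(?y - z) $ k\<bar> \<le> ?n" for k by (rule component_le_norm_cart)
  have s1: "smooth_on UNIV m1" unfolding m1_def
    by (intro smooth_on_sum smooth_on_mult smooth_on_u smooth_on_const) auto
  have s2: "smooth_on UNIV m2" unfolding m2_def
    by (intro smooth_on_add smooth_on_sum smooth_on_mult smooth_on_u smooth_on_const) auto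
  have eq: "kdef e S z x = N * (((?y - z) \<bullet> (?y - z) + e) powr (- (?a + 1)) * m1 z) - ((?y - z) \<bullet> (?y - z) + e) powr (- ?a) * m2 z" for z
    unfolding kdef_def kq_def m1_def m2_def N_def ..
  have sp1: "smooth_on UNIV (\<lambda>z. ((?y - z) \<bullet> (?y - z) + e) powr (- (?a + 1)) * m1 z)"
    and sp2: "smooth_on UNIV (\<lambda>z. ((?y - z) \<bullet> (?y - z) + e) powr (- ?a) * m2 z)"
    using smooth_on_pole_powr[OF e s1] smooth_on_pole_powr[OF e s2] by blast+
  show "smooth_on UNIV (\<lambda>z. kdef e S z x)" unfolding eq
    by (intro smooth_on_diff' smooth_on_mult[OF _ smooth_on_const sp1] sp2) auto
  have b1: "\<bar>m1 z\<bar> \<le> N * (N * (?n * ?n * (C * ?n)))"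
    unfolding m1_def N_def
    by (intro abs_sum_le_card) (auto simp: abs_mult simp del: vector_minus_component intro!: mult_mono cn C)
  have b2: "\<bar>m2 z\<bar> \<le> N * (C * ?n) + N * (?n * C)"
    unfolding m2_def N_def
    by (intro order_trans[OF abs_triangle_ineq] add_mono abs_sum_le_card)
       (auto simp: abs_mult simp del: vector_minus_component intro!: mult_mono cn C)
  have p1: "\<bar>pd i m1 z\<bar> \<le> N * (N * (2 * ?n * (C * ?n)))"
  proof -
    have d: "smooth_on UNIV (\<lambda>z. (?y - z) $ k * (?y - z) $ l * SE S k l x)" for k l
      by (intro smooth_on_mult smooth_on_u smooth_on_const) auto
    have d': "smooth_on UNIV (\<lambda>z. \<Sum>l\<in>UNIV. (?y - z) $ k * (?y - z) $ l * SE S k l x)" for k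
      by (rule smooth_on_sum[OF _ d]) simp
    have t: "\<bar>pd i (\<lambda>z. (?y - z) $ k * (?y - z) $ l * SE S k l x) z\<bar> \<le> 2 * ?n * (C * ?n)" for k l
    proof -
      have uu: "smooth_on UNIV (\<lambda>z. (?y - z) $ k * (?y - z) $ l)" by (rule smooth_on_mult[OF _ smooth_on_u smooth_on_u]) simp
      have "pd i (\<lambda>z. (?y - z) $ k * (?y - z) $ l * SE S k l x) z = pd i (\<lambda>z. (?y - z) $ k * (?y - z) $ l) z * SE S k l x"
        by (rule pd_cmult_right[OF uu])
      also have "pd i (\<lambda>z. (?y - z) $ k * (?y - z) $ l) z = (?y - z) $ k * (if i = l then - 1 else 0) + (if i = k then - 1 else 0) * (?y - z) $ l"
        by (simp only: pd_mult_smooth[OF smooth_on_u smooth_on_u] pd_u)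
      finally have "\<bar>pd i (\<lambda>z. (?y - z) $ k * (?y - z) $ l * SE S k l x) z\<bar> = \<bar>(?y - z) $ k * (if i = l then - 1 else 0) + (if i = k then - 1 else 0) * (?y - z) $ l\<bar> * \<bar>SE S k l x\<bar>"
        by (simp only: abs_mult)
      also have "\<dots> \<le> (2 * ?n) * (C * ?n)"
      proof (intro mult_mono C(2))
        show "\<bar>(?y - z) $ k * (if i = l then - 1 else 0) + (if i = k then - 1 else 0) * (?y - z) $ l\<bar> \<le> 2 * ?n"
          using cn[of k] cn[of l] by (cases "i = l"; cases "i = k") (simp_all del: vector_minus_component)
      qed auto
      finally show ?thesis .
    qed
    have "pd i m1 z = (\<Sum>k\<in>UNIV. pd i (\<lambda>z. \<Sum>l\<in>UNIV. (?y - z) $ k * (?y - z) $ l * SE S k l x) z)"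
      unfolding m1_def by (rule pd_sum) (use smooth_on_diff[OF d'] in auto)
    also have "\<dots> = (\<Sum>k\<in>UNIV. \<Sum>l\<in>UNIV. pd i (\<lambda>z. (?y - z) $ k * (?y - z) $ l * SE S k l x) z)"
      by (rule sum.cong[OF refl], rule pd_sum) (use smooth_on_diff[OF d] in auto)
    finally show ?thesis unfolding N_def by (simp only:) (intro abs_sum_le_card t)
  qed
  have p2: "\<bar>pd i m2 z\<bar> \<le> C"
  proof -
    have d: "smooth_on UNIV (\<lambda>z. (?y - z) $ k * SB S k x)" for k
      by (intro smooth_on_mult smooth_on_u smooth_on_const) auto
    have d': "smooth_on UNIV (\<lambda>z. \<Sum>k\<in>UNIV. (?y - z) $ k * SB S k x)"
      by (rule smooth_on_sum[OF _ d]) simp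
    have t: "pd i (\<lambda>z. (?y - z) $ k * SB S k x) z = (if k = i then - SB S k x else 0)" for k
      by (simp only: pd_cmult_right[OF smooth_on_u] pd_u) auto
    have "pd i m2 z = pd i (\<lambda>z. \<Sum>k\<in>UNIV. (?y - z) $ k * SB S k x) z"
      unfolding m2_def by (simp only: pd_add_smooth[OF smooth_on_const d'] pd_const add_0)
    also have "\<dots> = (\<Sum>k\<in>UNIV. pd i (\<lambda>z. (?y - z) $ k * SB S k x) z)"
      by (rule pd_sum) (use smooth_on_diff[OF d] in auto)
    also have "\<dots> = - SB S i x" unfolding t by simp
    finally show ?thesis using C(3) by simp
  qed
  have q1: "\<bar>((?y - z) \<bullet> (?y - z) + e) powr (- (?a + 1)) * m1 z\<bar> \<le> ?n powr (- (2 * (?a + 1))) * (N * (N * (?n * ?n * (C * ?n))))"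
    by (rule pole_powr_bound[OF e n _ b1]) (use N0 in simp)
  have q2: "\<bar>((?y - z) \<bullet> (?y - z) + e) powr (- ?a) * m2 z\<bar> \<le> ?n powr (- (2 * ?a)) * (N * (C * ?n) + N * (?n * C))"
    by (rule pole_powr_bound[OF e n _ b2]) (use N0 in simp)
  have e1: "?n powr (- (2 * (?a + 1))) * ?n ^ 3 = ?n powr (- (N - 1))" "?n powr (- (2 * ?a)) * ?n ^ 1 = ?n powr (- (N - 1))"
    "?n powr (- (2 * (?a + 1))) * ?n ^ 2 = ?n powr (- N)"
    by (simp_all only: powr_mult_power[OF n0]) (simp_all add: algebra_simps)
  have "\<bar>kdef e S z x\<bar> \<le> N * \<bar>((?y - z) \<bullet> (?y - z) + e) powr (- (?a + 1)) * m1 z\<bar> + \<bar>((?y - z) \<bullet> (?y - z) + e) powr (- ?a) * m2 z\<bar>"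
    unfolding eq by (rule abs_scaled_diff_le[OF N0])
  also have "\<dots> \<le> N * (?n powr (- (2 * (?a + 1))) * (N * (N * (?n * ?n * (C * ?n))))) + ?n powr (- (2 * ?a)) * (N * (C * ?n) + N * (?n * C))"
    using q1 q2 N0 by (intro add_mono mult_left_mono)
  also have "\<dots> = N * N * N * C * (?n powr (- (2 * (?a + 1))) * ?n ^ 3) + (N + N) * C * (?n powr (- (2 * ?a)) * ?n ^ 1)"
    by (simp only: power3_eq_cube power_one_right) (simp only: algebra_simps)
  also have "\<dots> = (N * N * N + N + N) * C * ?n powr (- (N - 1))" unfolding e1 by (simp only: algebra_simps)
  finally show "\<bar>kdef e S z x\<bar> \<le> (N * N * N + N + N) * C * ?n powr (- (N - 1))" .
  have r1: "\<bar>pd i (\<lambda>z. ((?y - z) \<bullet> (?y - z) + e) powr (- (?a + 1)) * m1 z) z\<bar> \<le>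
      ?n powr (- (2 * (?a + 1))) * (2 * (?a + 1) * (N * (N * (?n * ?n * (C * ?n)))) / ?n + N * (N * (2 * ?n * (C * ?n))))"
    by (rule pd_pole_powr_bound[OF e s1 n _ b1 p1]) (use N0 in simp)
  have r2: "\<bar>pd i (\<lambda>z. ((?y - z) \<bullet> (?y - z) + e) powr (- ?a) * m2 z) z\<bar> \<le>
      ?n powr (- (2 * ?a)) * (2 * ?a * (N * (C * ?n) + N * (?n * C)) / ?n + C)"
    by (rule pd_pole_powr_bound[OF e s2 n _ b2 p2]) (use N0 in simp)
  have t1: "2 * (?a + 1) * (N * (N * (?n * ?n * (C * ?n)))) / ?n + N * (N * (2 * ?n * (C * ?n))) = ((N + 2) * N * N + 2 * N * N) * C * ?n ^ 2"
    using n0 by (simp add: power2_eq_square field_simps)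
  have t2: "2 * ?a * (N * (C * ?n) + N * (?n * C)) / ?n + C = (2 * N * N + 1) * C"
    using n0 by (simp add: field_simps)
  have "pd i (\<lambda>z. kdef e S z x) z = N * pd i (\<lambda>z. ((?y - z) \<bullet> (?y - z) + e) powr (- (?a + 1)) * m1 z) z
      + (-1) * pd i (\<lambda>z. ((?y - z) \<bullet> (?y - z) + e) powr (- ?a) * m2 z) z"
  proof -
    have a: "smooth_on UNIV (\<lambda>z. N * (((?y - z) \<bullet> (?y - z) + e) powr (- (?a + 1)) * m1 z))"
      "smooth_on UNIV (\<lambda>z. (-1) * (((?y - z) \<bullet> (?y - z) + e) powr (- ?a) * m2 z))"
      by (rule smooth_on_mult[OF _ smooth_on_const sp1], simp) (rule smooth_on_mult[OF _ smooth_on_const sp2], simp)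
    have "(\<lambda>z. kdef e S z x) = (\<lambda>z. N * (((?y - z) \<bullet> (?y - z) + e) powr (- (?a + 1)) * m1 z) + (-1) * (((?y - z) \<bullet> (?y - z) + e) powr (- ?a) * m2 z))"
      by (rule ext) (simp add: eq)
    then have "pd i (\<lambda>z. kdef e S z x) z = pd i (\<lambda>z. N * (((?y - z) \<bullet> (?y - z) + e) powr (- (?a + 1)) * m1 z) + (-1) * (((?y - z) \<bullet> (?y - z) + e) powr (- ?a) * m2 z)) z"
      by (rule arg_cong)
    also have "\<dots> = pd i (\<lambda>z. N * (((?y - z) \<bullet> (?y - z) + e) powr (- (?a + 1)) * m1 z)) z + pd i (\<lambda>z. (-1) * (((?y - z) \<bullet> (?y - z) + e) powr (- ?a) * m2 z)) z"
      by (rule pd_add[OF smooth_on_diff[OF a(1)] smooth_on_diff[OF a(2)]]) auto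
    finally show ?thesis unfolding pd_cmult_left[OF sp1] pd_cmult_left[OF sp2] .
  qed
  then have "\<bar>pd i (\<lambda>z. kdef e S z x) z\<bar> \<le> N * \<bar>pd i (\<lambda>z. ((?y - z) \<bullet> (?y - z) + e) powr (- (?a + 1)) * m1 z) z\<bar>
      + \<bar>pd i (\<lambda>z. ((?y - z) \<bullet> (?y - z) + e) powr (- ?a) * m2 z) z\<bar>"
    using abs_scaled_diff_le[OF N0] by simp
  also have "\<dots> \<le> N * (?n powr (- (2 * (?a + 1))) * (((N + 2) * N * N + 2 * N * N) * C * ?n ^ 2)) + ?n powr (- (2 * ?a)) * ((2 * N * N + 1) * C)"
    using r1 r2 N0 unfolding t1 t2 by (intro add_mono mult_left_mono)
  also have "\<dots> = N * ((N + 2) * N * N + 2 * N * N) * C * (?n powr (- (2 * (?a + 1))) * ?n ^ 2) + (2 * N * N + 1) * C * ?n powr (- N)"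
    by simp
  also have "\<dots> = (N * ((N + 2) * N * N + 2 * N * N) + (2 * N * N + 1)) * C * ?n powr (- N)"
    unfolding e1 by (simp only: algebra_simps)
  finally show "\<bar>pd i (\<lambda>z. kdef e S z x) z\<bar> \<le> (N * ((N + 2) * N * N + 2 * N * N) + (2 * N * N + 1)) * C * ?n powr (- N)" .
qed

text \<open>One factor of S x - z against q^(-N/2) gives order 1 - N. In \<open>K1\<close> these
  terms occur only multiplied by a derivative of the cutoff.\<close>

lemma kgrad_pole:
  fixes S :: "real^'n::finite \<Rightarrow> real^'n" and x :: "real^'n"
  assumes e: "0 < e" and C: "0 \<le> C" "\<And>k. \<bar>pd j (\<lambda>x. S x $ k) x\<bar> \<le> C" and n: "S x \<noteq> z"
  defines "N \<equiv> real CARD('n)"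
  shows "smooth_on UNIV (\<lambda>z. kgrad e S z j x)"
    and "\<bar>kgrad e S z j x\<bar> \<le> N * C * norm (S x - z) powr (- (N - 1))"
    and "\<bar>pd i (\<lambda>z. kgrad e S z j x) z\<bar> \<le> (N * N + 1) * C * norm (S x - z) powr (- N)"
proof -
  let ?n = "norm (S x - z)"
  let ?y = "S x"
  let ?a = "N / 2"
  let ?D = "\<lambda>k. pd j (\<lambda>x. S x $ k) x"
  define m where "m z = - (\<Sum>k\<in>UNIV. (?y - z) $ k * ?D k)" for z
  have n0: "0 < ?n" using n by simp
  have N0: "0 \<le> N" unfolding N_def by simp
  have cn: "\<bar>(?y - z) $ k\<bar> \<le> ?n" for k by (rule component_le_norm_cart)
  have s: "smooth_on UNIV m" unfolding m_def
    by (intro smooth_on_minus smooth_on_sum smooth_on_mult smooth_on_u smooth_on_const) auto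
  have eq: "(\<lambda>z. kgrad e S z j x) = (\<lambda>z. ((?y - z) \<bullet> (?y - z) + e) powr (- ?a) * m z)"
    by (rule ext) (simp add: kgrad_def kq_def m_def N_def)
  show "smooth_on UNIV (\<lambda>z. kgrad e S z j x)" unfolding eq by (rule smooth_on_pole_powr[OF e s])
  have b: "\<bar>m z\<bar> \<le> N * (?n * C)"
    unfolding m_def abs_minus_cancel N_def
    by (intro abs_sum_le_card) (auto simp: abs_mult simp del: vector_minus_component intro!: mult_mono cn C)
  have p: "\<bar>pd i m z\<bar> \<le> C"
  proof -
    have d: "smooth_on UNIV (\<lambda>z. (?y - z) $ k * - ?D k)" for k
      by (intro smooth_on_mult smooth_on_u smooth_on_const) auto
    have t: "pd i (\<lambda>z. (?y - z) $ k * - ?D k) z = (if k = i then ?D k else 0)" for k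
      by (simp only: pd_cmult_right[OF smooth_on_u] pd_u) auto
    have "m = (\<lambda>z. \<Sum>k\<in>UNIV. (?y - z) $ k * - ?D k)" by (rule ext) (simp add: m_def sum_negf)
    then have "pd i m z = pd i (\<lambda>z. \<Sum>k\<in>UNIV. (?y - z) $ k * - ?D k) z" by simp
    also have "\<dots> = (\<Sum>k\<in>UNIV. pd i (\<lambda>z. (?y - z) $ k * - ?D k) z)"
      by (rule pd_sum) (use smooth_on_diff[OF d] in auto)
    also have "\<dots> = ?D i" unfolding t by simp
    finally show ?thesis using C(2) by simp
  qed
  have e1: "?n powr (- (2 * ?a)) * ?n ^ 1 = ?n powr (- (N - 1))"
    by (simp only: powr_mult_power[OF n0]) (simp add: algebra_simps)
  have "\<bar>kgrad e S z j x\<bar> \<le> ?n powr (- (2 * ?a)) * (N * (?n * C))"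
    using fun_cong[OF eq, of z] pole_powr_bound[OF e n _ b, of ?a] N0 by simp
  also have "\<dots> = N * C * (?n powr (- (2 * ?a)) * ?n ^ 1)" by simp
  finally show "\<bar>kgrad e S z j x\<bar> \<le> N * C * ?n powr (- (N - 1))" unfolding e1 .
  have "\<bar>pd i (\<lambda>z. kgrad e S z j x) z\<bar> \<le> ?n powr (- (2 * ?a)) * (2 * ?a * (N * (?n * C)) / ?n + C)"
    unfolding eq by (rule pd_pole_powr_bound[OF e s n _ b p]) (use N0 in simp)
  also have "2 * ?a * (N * (?n * C)) / ?n + C = (N * N + 1) * C" using n0 by (simp add: field_simps)
  finally show "\<bar>pd i (\<lambda>z. kgrad e S z j x) z\<bar> \<le> (N * N + 1) * C * ?n powr (- N)" by (simp add: mult.commute)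
qed

lemma kgam_pole:
  fixes S :: "real^'n::finite \<Rightarrow> real^'n" and x :: "real^'n"
  assumes e: "0 < e" and n: "S x \<noteq> z"
  defines "N \<equiv> real CARD('n)"
  shows "smooth_on UNIV (\<lambda>z. kgam e S z x)"
    and "\<bar>pd i (\<lambda>z. kgam e S z x) z\<bar> \<le> norm (S x - z) powr (- (N - 1))"
proof -
  let ?n = "norm (S x - z)"
  let ?y = "S x"
  have n0: "0 < ?n" using n by simp
  show "smooth_on UNIV (\<lambda>z. kgam e S z x)" unfolding kgam_def kq_def
    by (rule smooth_on_fundsol[OF _ smooth_on_kq_pole[OF e] kq_pos'[OF e]]) simp
  have "pd i (\<lambda>z. kgam e S z x) z = - (1/2) * ((?y - z) \<bullet> (?y - z) + e) powr (- (N / 2)) * (- 2 * (?y - z) $ i)"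
    unfolding kgam_def kq_def
    by (subst pd_fundsol[OF smooth_on_diff[OF smooth_on_kq_pole[OF e] UNIV_I] kq_pos'[OF e]]) (simp only: pd_kq_pole[OF e] N_def)
  then have "pd i (\<lambda>z. kgam e S z x) z = ((?y - z) \<bullet> (?y - z) + e) powr (- (N / 2)) * (?y - z) $ i"
    by (simp del: vector_minus_component)
  then have "\<bar>pd i (\<lambda>z. kgam e S z x) z\<bar> \<le> ?n powr (- (2 * (N / 2))) * ?n"
    using pole_powr_bound[OF e n _ component_le_norm_cart[of "?y - z" i], of "N / 2"] unfolding N_def by simp
  also have "\<dots> = ?n powr (- (2 * (N / 2))) * ?n ^ 1" by simp
  also have "\<dots> = ?n powr (- (N - 1))" by (simp only: powr_mult_power[OF n0]) (simp add: algebra_simps)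
  finally show "\<bar>pd i (\<lambda>z. kgam e S z x) z\<bar> \<le> ?n powr (- (N - 1))" .
qed

text \<open>The kernel itself follows no power law common to all dimensions (it is logarithmic for N
  = 2 and has no singularity for N = 1), so compactness is used: away from the pole its argument
  lies in [\<delta>^2, D^2 + 1], where e \<le> 1 accounts for the last 1.\<close>

lemma kgam_bounded:
  assumes "0 < \<delta>"
  obtains M where "0 \<le> M" "\<And>S z x e. 0 < e \<Longrightarrow> e \<le> 1 \<Longrightarrow> \<delta> \<le> norm (S x - z) \<Longrightarrow> norm (S x - z) \<le> D
      \<Longrightarrow> \<bar>kgam e S z (x :: real^'n::finite)\<bar> \<le> M"
proof -
  have "compact (fundsol (real CARD('n) / 2) ` {\<delta>\<^sup>2 .. D\<^sup>2 + 1})"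
    using assms by (intro compact_continuous_image continuous_on_fundsol continuous_intros)
      (auto intro: less_le_trans[of 0 "\<delta>\<^sup>2"])
  then have "\<exists>L. \<forall>t\<in>{\<delta>\<^sup>2 .. D\<^sup>2 + 1}. \<bar>fundsol (real CARD('n) / 2) t\<bar> \<le> L"
    unfolding compact_eq_bounded_closed bounded_iff by auto
  then obtain L where L: "\<And>t. t \<in> {\<delta>\<^sup>2 .. D\<^sup>2 + 1} \<Longrightarrow> \<bar>fundsol (real CARD('n) / 2) t\<bar> \<le> L" by blast
  show ?thesis
  proof (rule that[of "max 0 L"])
    fix S :: "real^'n \<Rightarrow> real^'n" and z x :: "real^'n" and e :: real
    assume h: "0 < e" "e \<le> 1" "\<delta> \<le> norm (S x - z)" "norm (S x - z) \<le> D"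
    have "\<delta>\<^sup>2 \<le> (norm (S x - z))\<^sup>2" "(norm (S x - z))\<^sup>2 \<le> D\<^sup>2" using h assms by (auto intro!: power_mono)
    then have "kq e S z x \<in> {\<delta>\<^sup>2 .. D\<^sup>2 + 1}" unfolding kq_def using h by (simp add: power2_norm_eq_inner)
    from L[OF this] show "\<bar>kgam e S z x\<bar> \<le> max 0 L" unfolding kgam_def by linarith
  qed simp
qed

text \<open>Continuity is joint in point and pole, for measurability and domination when the order
  of integration is exchanged.\<close>

lemma continuous_on_kernels:
  fixes S :: "real^'n::finite \<Rightarrow> real^'n"
  assumes S: "\<And>k. smooth_on UNIV (\<lambda>x. S x $ k)" and e: "0 < e"
  shows "continuous_on UNIV (\<lambda>p. kgam e S (snd p) (fst p))"
    and "continuous_on UNIV (\<lambda>p. kgrad e S (snd p) j (fst p))"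
    and "continuous_on UNIV (\<lambda>p. kdef e S (snd p) (fst p))"
proof -
  have cf: "continuous_on UNIV (\<lambda>p::(real^'n) \<times> (real^'n). F (fst p))" if "continuous_on UNIV F" for F :: "real^'n \<Rightarrow> real"
    by (rule continuous_on_compose2[OF that]) (auto intro!: continuous_intros)
  have cv: "continuous_on UNIV (\<lambda>p. (S (fst p) - snd p) $ k)" for k
    using cf[OF smooth_on_continuous[OF S[of k]]] by (simp add: continuous_on_diff continuous_on_component[OF continuous_on_snd[OF continuous_on_id]])
  have cq: "continuous_on UNIV (\<lambda>p. kq e S (snd p) (fst p))"
    unfolding kq_def inner_vec_def inner_real_def by (intro continuous_on_add continuous_on_sum continuous_on_mult cv continuous_on_const)
  have cD: "continuous_on UNIV (\<lambda>p::(real^'n) \<times> (real^'n). pd j (\<lambda>x. S x $ k) (fst p))" for j k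
    by (rule cf[OF smooth_on_continuous[OF smooth_on_pd[OF S]]])
  have cDD: "continuous_on UNIV (\<lambda>p::(real^'n) \<times> (real^'n). pd j (pd j (\<lambda>x. S x $ k)) (fst p))" for j k
    by (rule cf[OF smooth_on_continuous[OF smooth_on_pd[OF smooth_on_pd[OF S]]]])
  have cp: "continuous_on UNIV (\<lambda>p. kq e S (snd p) (fst p) powr r)" for r
    by (intro continuous_on_powr cq continuous_on_const) (use kq_pos[OF e] in \<open>auto simp: less_le\<close>)
  show "continuous_on UNIV (\<lambda>p. kgam e S (snd p) (fst p))" unfolding kgam_def
    by (rule continuous_on_fundsol[OF cq kq_pos[OF e]])
  show "continuous_on UNIV (\<lambda>p. kgrad e S (snd p) j (fst p))" unfolding kgrad_def
    by (intro continuous_on_minus continuous_on_mult continuous_on_sum cp cv cD)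
  show "continuous_on UNIV (\<lambda>p. kdef e S (snd p) (fst p))" unfolding kdef_def SE_def SB_def
    by (intro continuous_on_diff continuous_on_add continuous_on_mult continuous_on_sum continuous_on_const cp cv cD cDD)
qed

subsection \<open>Local estimates from an approximate Neumann kernel\<close>

lemma lebesgue_on_lborel_zero_outside:
  fixes F :: "real^'n::finite \<Rightarrow> real"
  assumes "integrable lborel F" "\<And>x. x \<notin> A \<Longrightarrow> F x = 0" "A \<in> sets lebesgue"
  shows "integrable (lebesgue_on A) F" "(\<integral>x. F x \<partial>lebesgue_on A) = (\<integral>x. F x \<partial>lborel)"
proof -
  have m: "F \<in> borel_measurable lborel" using assms(1) by simp
  have e: "(\<lambda>x. indicator A x * F x) = F" using assms(2) by (auto simp: indicator_def fun_eq_iff)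
  show "integrable (lebesgue_on A) F"
    using assms by (simp add: integrable_restrict_space e integrable_completion m)
  show "(\<integral>x. F x \<partial>lebesgue_on A) = (\<integral>x. F x \<partial>lborel)"
    using assms(3) integral_completion[OF m] by (simp add: integral_restrict_space e)
qed

lemma pd_zero_outside_closed:
  assumes "closed K" "\<And>x. x \<notin> K \<Longrightarrow> F x = 0" "x \<notin> K"
  shows "pd i F x = 0"
  using pd_cong_open[of "- K" x F "\<lambda>x. 0" i] assms by (simp add: open_Compl)

lemma test_fun_pd:
  assumes "test_fun \<Omega> \<phi>" shows "test_fun \<Omega> (pd i \<phi>)"
proof (rule test_funI)
  let ?K = "closure {x. \<phi> x \<noteq> 0}"
  show "smooth_on UNIV (pd i \<phi>)" by (rule smooth_on_pd[OF test_fun_smooth[OF assms]])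
  show "compact ?K" "?K \<subseteq> \<Omega>" using assms by (auto simp: test_fun_def)
  show "pd i \<phi> x = 0" if "x \<notin> ?K" for x
    by (rule pd_zero_outside_closed[OF closed_closure _ that]) (use closure_subset[of "{x. \<phi> x \<noteq> 0}"] in auto)
qed

lemma kernel_dominated:
  fixes K :: "real^'n::finite \<Rightarrow> real^'n \<Rightarrow> real"
  assumes "bounded \<Omega>" "continuous_on UNIV (\<lambda>p. K (fst p) (snd p))" "\<And>x z. z \<notin> cball 0 R \<Longrightarrow> K x z = 0"
  obtains k where "integrable lborel k" "\<And>x z. x \<in> \<Omega> \<Longrightarrow> \<bar>K x z\<bar> \<le> k z"
proof -
  have "compact ((\<lambda>p. K (fst p) (snd p)) ` (closure \<Omega> \<times> cball 0 R))"
    using assms(1) by (intro compact_continuous_image continuous_on_subset[OF assms(2)] compact_Times) auto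
  then have "\<exists>L. \<forall>p\<in>closure \<Omega> \<times> cball 0 R. \<bar>K (fst p) (snd p)\<bar> \<le> L"
    unfolding compact_eq_bounded_closed bounded_iff by auto
  then obtain L where L: "\<And>x z. x \<in> closure \<Omega> \<Longrightarrow> z \<in> cball 0 R \<Longrightarrow> \<bar>K x z\<bar> \<le> L" by fastforce
  show ?thesis
  proof (rule that)
    show "integrable lborel (\<lambda>z::real^'n. indicator (cball 0 R) z *\<^sub>R L)"
      by (rule borel_integrable_compact) auto
    show "\<bar>K x z\<bar> \<le> indicator (cball 0 R) z *\<^sub>R L" if "x \<in> \<Omega>" for x z
      using L[of x z] assms(3)[of z x] that closure_subset[of \<Omega>] by (cases "z \<in> cball 0 R") auto
  qed
qed

text \<open>\<open>S\<close> plays the role of a reflection at the boundary, so that the sum of the kernels with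
  poles seen from \<open>x\<close> and from \<open>S x\<close> is an approximate Neumann function; its gradient need
  only be tangential enough for \<open>ibp\<close>. In the interior \<open>S\<close> is a translation that moves \<open>\<Omega>\<close>
  off itself, and the second kernel is harmless. \<open>dd z\<close> is comparable to the distance of \<open>z\<close> to the boundary.\<close>
locale neumann_patch =
  fixes \<Omega> :: "(real^'n::finite) set" and \<theta> :: "real^'n \<Rightarrow> real" and g :: "real^'n \<Rightarrow> real^'n"
    and \<eta> :: "real^'n \<Rightarrow> real" and S :: "real^'n \<Rightarrow> real^'n" and Z K :: "(real^'n) set"
    and dd :: "real^'n \<Rightarrow> real" and C rr :: real
  assumes Om: "bounded \<Omega>" "open \<Omega>"
    and th: "integrable (lebesgue_on \<Omega>) \<theta>" and gi: "\<And>i. integrable (lebesgue_on \<Omega>) (\<lambda>x. g x $ i)"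
    and wg: "weak_grad \<Omega> \<theta> g"
    and neumann: "\<And>w. smooth_on UNIV w \<Longrightarrow> (\<integral>x. (\<Sum>j\<in>UNIV. g x $ j * pd j w x) \<partial>lebesgue_on \<Omega>) = 0"
    and eta: "smooth_on UNIV \<eta>" "\<And>x. 0 \<le> \<eta> x" "\<And>x. \<eta> x \<le> 1" "closed K" "\<And>x. x \<notin> K \<Longrightarrow> \<eta> x = 0"
    and S: "\<And>k. smooth_on UNIV (\<lambda>x. S x $ k)"
    and Z: "open Z" "Z \<subseteq> \<Omega>" "\<And>z. z \<in> Z \<Longrightarrow> \<eta> z = 1"
    and C: "0 < C" and rr: "0 < rr"
    and geo: "\<And>x z. x \<in> \<Omega> \<Longrightarrow> x \<in> K \<Longrightarrow> z \<in> Z \<Longrightarrow> norm (x - z) \<le> C * norm (S x - z)"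
      "\<And>x z. x \<in> \<Omega> \<Longrightarrow> x \<in> K \<Longrightarrow> z \<in> Z \<Longrightarrow> dd z \<le> C * norm (S x - z)"
      "\<And>x z k l. x \<in> \<Omega> \<Longrightarrow> x \<in> K \<Longrightarrow> z \<in> Z \<Longrightarrow> \<bar>SE S k l x\<bar> \<le> C * norm (S x - z)"
    and dd: "\<And>z. z \<in> Z \<Longrightarrow> 0 < dd z"
    and far: "\<And>x z j. x \<in> \<Omega> \<Longrightarrow> z \<in> Z \<Longrightarrow> pd j \<eta> x \<noteq> 0 \<Longrightarrow> rr \<le> norm (x - z)"
    and ibp: "\<And>e z. 0 < e \<Longrightarrow> z \<in> Z \<Longrightarrow>
       (\<integral>x. (\<Sum>j\<in>UNIV. g x $ j * (\<eta> x * (kgrad e (\<lambda>x. x) z j x + kgrad e S z j x))) \<partial>lebesgue_on \<Omega>)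
       = - (\<integral>x. \<theta> x * (\<Sum>j\<in>UNIV. pd j (\<lambda>x. \<eta> x * (kgrad e (\<lambda>x. x) z j x + kgrad e S z j x)) x) \<partial>lebesgue_on \<Omega>)"
begin

text \<open>\<open>K1\<close> is paired with \<theta>: it collects what the divergence of \<eta>
  times the gradient of the kernel sum leaves besides the two mollifiers. \<open>K2\<close> is
  paired with the gradient of \<theta>: it is the cutoff error, supported where \<eta> varies and
  hence away from the pole.\<close>

definition K1 where
  "K1 e x z = \<eta> x * kdef e S z x + (\<Sum>j\<in>UNIV. pd j \<eta> x * (kgrad e (\<lambda>x. x) z j x + kgrad e S z j x))"

definition K2 where
  "K2 e j x z = - (pd j \<eta> x * (kgam e (\<lambda>x. x) z x + kgam e S z x))"

lemma Os: "\<Omega> \<in> sets lebesgue" and Zs: "Z \<in> sets lebesgue" using Om Z by auto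

lemma id_smooth: "smooth_on UNIV (\<lambda>x::real^'n. x $ k)" by simp

lemma pd_eta_outside: "x \<notin> K \<Longrightarrow> pd j \<eta> x = 0"
  by (rule pd_zero_outside_closed[OF eta(4,5)])

text \<open>Image points keep the distance dd z / C > 0 from a pole z.\<close>

lemma Sx_neq: "x \<in> \<Omega> \<Longrightarrow> x \<in> K \<Longrightarrow> z \<in> Z \<Longrightarrow> S x \<noteq> z"
  using geo(2)[of x z] dd[of z] by auto

lemma integrable_mult_continuous:
  fixes f h :: "real^'n \<Rightarrow> real"
  assumes "integrable (lebesgue_on \<Omega>) f" "continuous_on UNIV h"
  shows "integrable (lebesgue_on \<Omega>) (\<lambda>x. f x * h x)"
proof -
  obtain L where "\<And>x. x \<in> \<Omega> \<Longrightarrow> \<bar>h x\<bar> \<le> L" using continuous_bounded_on_bounded[OF Om(1) assms(2)] by blast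
  then show ?thesis by (rule integrable_mult_test[OF assms])
qed

lemma continuous_K1: "0 < e \<Longrightarrow> continuous_on UNIV (\<lambda>p. K1 e (fst p) (snd p))"
  and continuous_K2: "0 < e \<Longrightarrow> continuous_on UNIV (\<lambda>p. K2 e j (fst p) (snd p))"
proof -
  assume e: "0 < e"
  have cf: "continuous_on UNIV (\<lambda>p::(real^'n) \<times> (real^'n). F (fst p))" if "continuous_on UNIV F" for F :: "real^'n \<Rightarrow> real"
    by (rule continuous_on_compose2[OF that]) (auto intro!: continuous_intros)
  note c = continuous_on_kernels[OF S e] continuous_on_kernels[OF id_smooth e]
    cf[OF smooth_on_continuous[OF eta(1)]] cf[OF smooth_on_continuous[OF smooth_on_pd[OF eta(1)]]]
  show "continuous_on UNIV (\<lambda>p. K1 e (fst p) (snd p))" unfolding K1_def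
    by (intro continuous_on_add continuous_on_mult continuous_on_sum c)
  show "continuous_on UNIV (\<lambda>p. K2 e j (fst p) (snd p))" unfolding K2_def
    by (intro continuous_on_minus continuous_on_add continuous_on_mult c)
qed

lemma continuous_section:
  fixes F :: "real^'n \<Rightarrow> real^'n \<Rightarrow> real"
  assumes "continuous_on UNIV (\<lambda>p. F (fst p) (snd p))"
  shows "continuous_on UNIV (\<lambda>x. F x z)" "continuous_on UNIV (F x)"
proof -
  have "continuous_on UNIV (\<lambda>x. (x, z))" "continuous_on UNIV (\<lambda>z. (x, z))" by (intro continuous_intros)+
  then show "continuous_on UNIV (\<lambda>x. F x z)" "continuous_on UNIV (F x)"
    using continuous_on_compose2[OF assms, of UNIV "\<lambda>x. (x, z)"] continuous_on_compose2[OF assms, of UNIV "\<lambda>z. (x, z)"] by simp_all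
qed

lemma continuous_S: "continuous_on UNIV S"
proof -
  have "continuous_on UNIV (\<lambda>x. \<chi> k. S x $ k)" by (intro continuous_on_vec_lambda smooth_on_continuous S)
  then show ?thesis by simp
qed

text \<open>The test function is \<eta> times the sum of the two kernels. Its gradient is the field
  treated by \<open>ibp\<close> minus the cutoff error \<open>K2\<close>; moving the derivatives off
  \<theta> turns that field into its divergence, which contains the mollifiers.\<close>

lemma representation:
  assumes e: "0 < e" and z: "z \<in> Z"
  shows "(\<integral>x. \<theta> x * (\<eta> x * (approx_delta e (x - z) + approx_delta e (S x - z))) \<partial>lebesgue_on \<Omega>)
    = (\<integral>x. \<theta> x * K1 e x z \<partial>lebesgue_on \<Omega>) + (\<Sum>j\<in>UNIV. \<integral>x. g x $ j * K2 e j x z \<partial>lebesgue_on \<Omega>)"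
proof -
  let ?L = "lebesgue_on \<Omega>"
  let ?G = "\<lambda>x. kgam e (\<lambda>x. x) z x + kgam e S z x"
  let ?D = "\<lambda>j x. kgrad e (\<lambda>x. x) z j x + kgrad e S z j x"
  let ?X = "\<lambda>j x. \<eta> x * ?D j x"
  let ?del = "\<lambda>x. \<eta> x * (approx_delta e (x - z) + approx_delta e (S x - z))"
  have sG: "smooth_on UNIV ?G" by (intro smooth_on_add smooth_on_kgam S e id_smooth) auto
  have sD: "smooth_on UNIV (?D j)" for j by (intro smooth_on_add smooth_on_kgrad S e id_smooth) auto
  have sX: "smooth_on UNIV (?X j)" for j by (rule smooth_on_mult[OF _ eta(1) sD]) simp
  have pG: "pd j ?G x = ?D j x" for j x
    unfolding pd_add_smooth[OF smooth_on_kgam[OF id_smooth e] smooth_on_kgam[OF S e]] pd_kgam[OF S e] pd_kgam[OF id_smooth e] ..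
  have pw: "pd j (\<lambda>x. \<eta> x * ?G x) x = ?X j x - K2 e j x z" for j x
    unfolding pd_mult_smooth[OF eta(1) sG] pG K2_def by simp
  have pX: "(\<Sum>j\<in>UNIV. pd j (?X j) x) = K1 e x z - ?del x" for x
  proof -
    have "(\<Sum>j\<in>UNIV. pd j (?X j) x) = (\<Sum>j\<in>UNIV. \<eta> x * (pd j (kgrad e (\<lambda>x. x) z j) x + pd j (kgrad e S z j) x) + pd j \<eta> x * ?D j x)"
      by (rule sum.cong[OF refl]) (simp only: pd_mult_smooth[OF eta(1) sD] pd_add_smooth[OF smooth_on_kgrad[OF id_smooth e] smooth_on_kgrad[OF S e]])
    also have "\<dots> = \<eta> x * ((\<Sum>j\<in>UNIV. pd j (kgrad e (\<lambda>x. x) z j) x) + (\<Sum>j\<in>UNIV. pd j (kgrad e S z j) x)) + (\<Sum>j\<in>UNIV. pd j \<eta> x * ?D j x)"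
      by (simp only: sum.distrib sum_distrib_left[symmetric])
    also have "\<dots> = \<eta> x * ((- approx_delta e (x - z) + 0) + (- approx_delta e (S x - z) + kdef e S z x)) + (\<Sum>j\<in>UNIV. pd j \<eta> x * ?D j x)"
      unfolding sum_pd_kgrad[OF S e] sum_pd_kgrad[OF id_smooth e] kdef_id ..
    finally show ?thesis unfolding K1_def by (simp add: algebra_simps)
  qed
  have cK1: "continuous_on UNIV (\<lambda>x. K1 e x z)" by (rule continuous_section[OF continuous_K1[OF e]])
  have cK2: "continuous_on UNIV (\<lambda>x. K2 e j x z)" for j by (rule continuous_section(1)[OF continuous_K2[OF e]])
  note cS = continuous_S
  have cdel: "continuous_on UNIV ?del"
    by (intro continuous_on_mult continuous_on_add continuous_on_approx_delta continuous_on_diff continuous_on_id continuous_on_const cS e smooth_on_continuous[OF eta(1)])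
  have iK2: "integrable ?L (\<lambda>x. g x $ j * K2 e j x z)" for j by (rule integrable_mult_continuous[OF gi cK2])
  have iX: "integrable ?L (\<lambda>x. g x $ j * ?X j x)" for j
    by (rule integrable_mult_continuous[OF gi smooth_on_continuous[OF sX]])
  have "0 = (\<integral>x. (\<Sum>j\<in>UNIV. g x $ j * pd j (\<lambda>x. \<eta> x * ?G x) x) \<partial>?L)"
    using neumann[OF smooth_on_mult[OF _ eta(1) sG]] by simp
  also have "\<dots> = (\<integral>x. (\<Sum>j\<in>UNIV. g x $ j * ?X j x) - (\<Sum>j\<in>UNIV. g x $ j * K2 e j x z) \<partial>?L)"
    unfolding pw by (simp only: right_diff_distrib sum_subtractf)
  also have "\<dots> = (\<integral>x. (\<Sum>j\<in>UNIV. g x $ j * ?X j x) \<partial>?L) - (\<integral>x. (\<Sum>j\<in>UNIV. g x $ j * K2 e j x z) \<partial>?L)"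
    by (intro Bochner_Integration.integral_diff Bochner_Integration.integrable_sum iX iK2)
  also have "(\<integral>x. (\<Sum>j\<in>UNIV. g x $ j * K2 e j x z) \<partial>?L) = (\<Sum>j\<in>UNIV. \<integral>x. g x $ j * K2 e j x z \<partial>?L)"
    by (rule Bochner_Integration.integral_sum) (rule iK2)
  also have "(\<integral>x. (\<Sum>j\<in>UNIV. g x $ j * ?X j x) \<partial>?L) = - (\<integral>x. \<theta> x * K1 e x z - \<theta> x * ?del x \<partial>?L)"
    unfolding ibp[OF e z] pX by (simp only: right_diff_distrib)
  also have "(\<integral>x. \<theta> x * K1 e x z - \<theta> x * ?del x \<partial>?L) = (\<integral>x. \<theta> x * K1 e x z \<partial>?L) - (\<integral>x. \<theta> x * ?del x \<partial>?L)"
    by (intro Bochner_Integration.integral_diff integrable_mult_continuous[OF th] cK1 cdel)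
  finally show ?thesis by simp
qed

definition Rr where
  "Rr e z = (\<integral>x. \<theta> x * K1 e x z \<partial>lebesgue_on \<Omega>) + (\<Sum>j\<in>UNIV. \<integral>x. g x $ j * K2 e j x z \<partial>lebesgue_on \<Omega>)"

text \<open>The limit e -> 0 is taken weakly in the pole: after exchanging the integrals the
  mollifiers act on \<phi>, where the convolutions converge boundedly. The image mollifier would
  produce \<phi>(S x), but \<open>S x\<close> is never in \<open>Z\<close> for x in \<Omega> and
  \<open>K\<close>; so only the pairing of \<theta> with \<phi> survives.\<close>

lemma pairing_limit:
  assumes t: "test_fun Z \<phi>" and e: "\<And>n. 0 < e n" "e \<longlonglongrightarrow> 0"
  shows "integrable lborel (\<lambda>z. \<phi> z * Rr (e n) z)"
    and "(\<lambda>n. \<integral>z. \<phi> z * Rr (e n) z \<partial>lborel) \<longlonglongrightarrow> delta_mass TYPE('n) * (\<integral>x. \<theta> x * \<phi> x \<partial>lebesgue_on \<Omega>)"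
proof -
  let ?L = "lebesgue_on \<Omega>"
  obtain R where R: "\<And>x. x \<notin> cball 0 R \<Longrightarrow> \<phi> x = 0" using test_fun_bounded_support[OF t] by blast
  obtain L where L: "0 \<le> L" "\<And>x. \<bar>\<phi> x\<bar> \<le> L" using test_fun_bounded[OF t] by blast
  have c\<phi>: "continuous_on UNIV \<phi>" by (rule test_fun_continuous[OF t])
  note cS = continuous_S
  define F where "F n x z = \<eta> x * (approx_delta (e n) (x - z) + approx_delta (e n) (S x - z)) * \<phi> z" for n x z
  have cF: "continuous_on UNIV (\<lambda>p. F n (fst p) (snd p))" for n
  proof -
    have 1: "continuous_on UNIV (\<lambda>p::(real^'n)\<times>(real^'n). \<eta> (fst p))" "continuous_on UNIV (\<lambda>p::(real^'n)\<times>(real^'n). \<phi> (snd p))"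
      "continuous_on UNIV (\<lambda>p::(real^'n)\<times>(real^'n). S (fst p))"
      using smooth_on_continuous[OF eta(1)] c\<phi> cS by (auto intro!: continuous_on_compose2[of UNIV \<eta>] continuous_on_compose2[of UNIV \<phi>] continuous_on_compose2[of UNIV S] continuous_intros)
    show ?thesis unfolding F_def
      by (intro continuous_on_mult continuous_on_add continuous_on_approx_delta 1 continuous_on_diff continuous_on_fst continuous_on_snd continuous_on_id e)
  qed
  obtain k where k: "\<And>n. integrable lborel (k n)" "\<And>n x z. x \<in> \<Omega> \<Longrightarrow> \<bar>F n x z\<bar> \<le> k n z"
  proof -
    have "\<exists>k. integrable lborel k \<and> (\<forall>x z. x \<in> \<Omega> \<longrightarrow> \<bar>F n x z\<bar> \<le> k z)" for n
      using kernel_dominated[OF Om(1) cF[of n], of R] R by (metis F_def mult_zero_right)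
    then obtain k where "\<And>n. integrable lborel (k n) \<and> (\<forall>x z. x \<in> \<Omega> \<longrightarrow> \<bar>F n x z\<bar> \<le> k n z)" by metis
    then show ?thesis using that by blast
  qed
  note fub = fubini_kernel[OF Os th borel_measurable_kernelI[OF cF] k]
  have eq: "\<phi> z * Rr (e n) z = (\<integral>x. \<theta> x * F n x z \<partial>?L)" for n z
  proof (cases "z \<in> Z")
    case True
    show ?thesis unfolding Rr_def representation[OF e(1) True, symmetric] F_def by (simp add: mult_ac flip: integral_mult_right_zero)
  next
    case False
    then have "\<phi> z = 0" by (rule test_fun_zero_outside[OF t])
    then show ?thesis by (simp add: F_def)
  qed
  show "integrable lborel (\<lambda>z. \<phi> z * Rr (e n) z)" unfolding eq by (rule fub(2))
  have inner: "(\<integral>z. F n x z \<partial>lborel) = \<eta> x * ((\<integral>z. \<phi> z * approx_delta (e n) (x - z) \<partial>lborel) + (\<integral>z. \<phi> z * approx_delta (e n) (S x - z) \<partial>lborel))" for n x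
  proof -
    have i: "integrable lborel (\<lambda>z. \<phi> z * approx_delta (e n) (y - z))" for y
    proof (rule integrable_continuous_bounded_support[of _ R])
      show "continuous_on UNIV (\<lambda>z. \<phi> z * approx_delta (e n) (y - z))"
        by (intro continuous_on_mult c\<phi> continuous_on_approx_delta e continuous_on_diff continuous_on_const continuous_on_id)
    qed (use R in simp)
    have "(\<integral>z. F n x z \<partial>lborel) = (\<integral>z. \<eta> x * (\<phi> z * approx_delta (e n) (x - z) + \<phi> z * approx_delta (e n) (S x - z)) \<partial>lborel)"
      unfolding F_def by (simp add: algebra_simps)
    also have "\<dots> = \<eta> x * (\<integral>z. \<phi> z * approx_delta (e n) (x - z) + \<phi> z * approx_delta (e n) (S x - z) \<partial>lborel)" by simp
    finally show ?thesis using i by simp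
  qed
  have "(\<lambda>n. \<integral>x. \<theta> x * (\<integral>z. F n x z \<partial>lborel) \<partial>?L) \<longlonglongrightarrow> (\<integral>x. \<theta> x * (\<phi> x * delta_mass TYPE('n)) \<partial>?L)"
  proof (rule integral_dominated_convergence[where w = "\<lambda>x. \<bar>\<theta> x\<bar> * (2 * (L * delta_mass TYPE('n)))"])
    show "(\<lambda>x. \<theta> x * (\<integral>z. F n x z \<partial>lborel)) \<in> borel_measurable ?L" for n using fub(1) by (rule borel_measurable_integrable)
    show "(\<lambda>x. \<theta> x * (\<phi> x * delta_mass TYPE('n))) \<in> borel_measurable ?L"
      using th borel_measurable_lebesgue_on_continuous[OF c\<phi>] by measurable
    show "integrable ?L (\<lambda>x. \<bar>\<theta> x\<bar> * (2 * (L * delta_mass TYPE('n))))" using th by simp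
    show "AE x in ?L. norm (\<theta> x * (\<integral>z. F n x z \<partial>lborel)) \<le> \<bar>\<theta> x\<bar> * (2 * (L * delta_mass TYPE('n)))" for n
    proof (rule AE_I2)
      fix x
      let ?a = "\<integral>z. \<phi> z * approx_delta (e n) (x - z) \<partial>lborel" and ?b = "\<integral>z. \<phi> z * approx_delta (e n) (S x - z) \<partial>lborel"
      have ab: "\<bar>?a\<bar> \<le> L * delta_mass TYPE('n)" "\<bar>?b\<bar> \<le> L * delta_mass TYPE('n)"
        by (rule approx_delta_convolution_bound[OF e(1) c\<phi> L(2)])+
      have "\<bar>\<eta> x * (?a + ?b)\<bar> \<le> 1 * \<bar>?a + ?b\<bar>"
        unfolding abs_mult using eta(2,3)[of x] by (intro mult_right_mono) auto
      also have "\<dots> \<le> 2 * (L * delta_mass TYPE('n))" using order_trans[OF abs_triangle_ineq add_mono[OF ab]] by simp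
      finally show "norm (\<theta> x * (\<integral>z. F n x z \<partial>lborel)) \<le> \<bar>\<theta> x\<bar> * (2 * (L * delta_mass TYPE('n)))"
        unfolding inner real_norm_def abs_mult[of "\<theta> x"] by (rule mult_left_mono) simp
    qed
    show "AE x in ?L. (\<lambda>n. \<theta> x * (\<integral>z. F n x z \<partial>lborel)) \<longlonglongrightarrow> \<theta> x * (\<phi> x * delta_mass TYPE('n))"
    proof (rule AE_I2)
      fix x assume "x \<in> space ?L"
      then have x: "x \<in> \<Omega>" by simp
      have "(\<lambda>n. \<eta> x * ((\<integral>z. \<phi> z * approx_delta (e n) (x - z) \<partial>lborel) + (\<integral>z. \<phi> z * approx_delta (e n) (S x - z) \<partial>lborel)))
          \<longlonglongrightarrow> \<eta> x * (\<phi> x * delta_mass TYPE('n) + \<phi> (S x) * delta_mass TYPE('n))"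
        by (intro tendsto_mult tendsto_add tendsto_const approx_delta_convolution_limit[OF c\<phi> L(2) e])
      also have "\<eta> x * (\<phi> x * delta_mass TYPE('n) + \<phi> (S x) * delta_mass TYPE('n)) = \<phi> x * delta_mass TYPE('n)"
      proof -
        have 1: "\<eta> x * \<phi> x = \<phi> x" using Z(3)[of x] test_fun_zero_outside[OF t, of x] by (cases "x \<in> Z") auto
        have 2: "\<eta> x * \<phi> (S x) = 0"
        proof (cases "S x \<in> Z \<and> x \<in> K")
          case True
          then show ?thesis using Sx_neq[OF x, of "S x"] by blast
        next
          case False
          then show ?thesis using test_fun_zero_outside[OF t, of "S x"] eta(5)[of x] by auto
        qed
        have "\<eta> x * (\<phi> x * delta_mass TYPE('n) + \<phi> (S x) * delta_mass TYPE('n)) = (\<eta> x * \<phi> x) * delta_mass TYPE('n) + (\<eta> x * \<phi> (S x)) * delta_mass TYPE('n)"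
          by (simp only: algebra_simps)
        then show ?thesis unfolding 1 2 by simp
      qed
      finally show "(\<lambda>n. \<theta> x * (\<integral>z. F n x z \<partial>lborel)) \<longlonglongrightarrow> \<theta> x * (\<phi> x * delta_mass TYPE('n))"
        unfolding inner by (rule tendsto_mult[OF tendsto_const])
    qed
  qed
  then have "(\<lambda>n. \<integral>z. \<phi> z * Rr (e n) z \<partial>lborel) \<longlonglongrightarrow> (\<integral>x. \<theta> x * (\<phi> x * delta_mass TYPE('n)) \<partial>?L)"
  proof (rule Lim_transform_eventually, intro always_eventually allI)
    show "(\<integral>x. \<theta> x * (\<integral>z. F n x z \<partial>lborel) \<partial>?L) = (\<integral>z. \<phi> z * Rr (e n) z \<partial>lborel)" for n
      unfolding eq by (rule fub(3))
  qed
  moreover have "(\<integral>x. \<theta> x * (\<phi> x * delta_mass TYPE('n)) \<partial>?L) = delta_mass TYPE('n) * (\<integral>x. \<theta> x * \<phi> x \<partial>?L)"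
  proof -
    have "(\<integral>x. \<theta> x * (\<phi> x * delta_mass TYPE('n)) \<partial>?L) = (\<integral>x. (\<theta> x * \<phi> x) * delta_mass TYPE('n) \<partial>?L)"
      by (simp only: mult.assoc)
    also have "\<dots> = (\<integral>x. \<theta> x * \<phi> x \<partial>?L) * delta_mass TYPE('n)" by (rule integral_mult_left_zero)
    finally show ?thesis by (simp only: mult.commute)
  qed
  ultimately show "(\<lambda>n. \<integral>z. \<phi> z * Rr (e n) z \<partial>lborel) \<longlonglongrightarrow> delta_mass TYPE('n) * (\<integral>x. \<theta> x * \<phi> x \<partial>?L)" by simp
qed

end

lemma finite_family_bound:
  fixes f :: "'i::finite \<Rightarrow> real^'n::finite \<Rightarrow> real"
  assumes "bounded \<Omega>" "\<And>i. continuous_on UNIV (f i)"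
  obtains L where "0 \<le> L" "\<And>i x. x \<in> \<Omega> \<Longrightarrow> \<bar>f i x\<bar> \<le> L"
proof -
  have "\<exists>L\<ge>0. \<forall>x\<in>\<Omega>. \<bar>f i x\<bar> \<le> L" for i
    using continuous_bounded_on_bounded[OF assms(1) assms(2)[of i]] by metis
  then obtain L where L: "\<And>i. 0 \<le> L i" "\<And>i x. x \<in> \<Omega> \<Longrightarrow> \<bar>f i x\<bar> \<le> L i" by metis
  show ?thesis
  proof (rule that[of "\<Sum>i\<in>UNIV. L i"])
    show "\<bar>f i x\<bar> \<le> (\<Sum>i\<in>UNIV. L i)" if "x \<in> \<Omega>" for i x
      using L(2)[OF that, of i] member_le_sum[of i UNIV L] L(1) by force
  qed (use L in \<open>simp add: sum_nonneg\<close>)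
qed

text \<open>Bounds on pairings with nonnegative test functions are what survives a weak limit;
  applied to h - f and h + f they become pointwise.\<close>

lemma fundamental_lemma_abs:
  fixes f h :: "real^'n::finite \<Rightarrow> real"
  assumes Z: "open Z" and f: "integrable (lebesgue_on Z) f" and h: "integrable (lebesgue_on Z) h"
    and t: "\<And>\<phi>. test_fun Z \<phi> \<Longrightarrow> (\<And>x. 0 \<le> \<phi> x) \<Longrightarrow> \<bar>\<integral>x. f x * \<phi> x \<partial>lebesgue_on Z\<bar> \<le> (\<integral>x. h x * \<phi> x \<partial>lebesgue_on Z)"
  shows "AE x in lebesgue_on Z. \<bar>f x\<bar> \<le> h x"
proof -
  have i: "integrable (lebesgue_on Z) (\<lambda>x. f x * \<phi> x)" "integrable (lebesgue_on Z) (\<lambda>x. h x * \<phi> x)" if "test_fun Z \<phi>" for \<phi>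
  proof -
    obtain L where "\<And>x. \<bar>\<phi> x\<bar> \<le> L" using test_fun_bounded[OF \<open>test_fun Z \<phi>\<close>] by blast
    then show "integrable (lebesgue_on Z) (\<lambda>x. f x * \<phi> x)" "integrable (lebesgue_on Z) (\<lambda>x. h x * \<phi> x)"
      using integrable_mult_test[OF f test_fun_continuous[OF that]] integrable_mult_test[OF h test_fun_continuous[OF that]] by blast+
  qed
  have "AE x in lebesgue_on Z. 0 \<le> h x - f x"
  proof (rule fundamental_lemma_nonneg[OF Z])
    show "integrable (lebesgue_on Z) (\<lambda>x. h x - f x)" using f h by simp
    show "0 \<le> (\<integral>x. (h x - f x) * \<phi> x \<partial>lebesgue_on Z)" if "test_fun Z \<phi>" "\<And>x. 0 \<le> \<phi> x" for \<phi>
      using t[OF that] i[OF that(1)] by (simp add: left_diff_distrib)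
  qed
  moreover have "AE x in lebesgue_on Z. 0 \<le> h x + f x"
  proof (rule fundamental_lemma_nonneg[OF Z])
    show "integrable (lebesgue_on Z) (\<lambda>x. h x + f x)" using f h by simp
    show "0 \<le> (\<integral>x. (h x + f x) * \<phi> x \<partial>lebesgue_on Z)" if "test_fun Z \<phi>" "\<And>x. 0 \<le> \<phi> x" for \<phi>
      using t[OF that] i[OF that(1)] by (simp add: distrib_right)
  qed
  ultimately show ?thesis by eventually_elim (simp add: abs_le_iff)
qed

text \<open>For e > 0 the kernels are smooth in the pole even across S x = z, so integration by
  parts in z needs no excision of a neighbourhood.\<close>

lemma smooth_on_pole_kernels:
  fixes S :: "real^'n::finite \<Rightarrow> real^'n"
  assumes e: "0 < e"
  shows "smooth_on UNIV (\<lambda>z. kdef e S z x)" "smooth_on UNIV (\<lambda>z. kgrad e S z j x)" "smooth_on UNIV (\<lambda>z. kgam e S z x)"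
proof -
  note s = smooth_on_kq_pole[OF e, of "S x", folded kq_def[of e S _ x]] and p = kq_pos[OF e]
  show "smooth_on UNIV (\<lambda>z. kdef e S z x)" unfolding kdef_def
    by (intro smooth_on_diff' smooth_on_add smooth_on_mult smooth_on_powr smooth_on_sum smooth_on_u smooth_on_const s p) auto
  show "smooth_on UNIV (\<lambda>z. kgrad e S z j x)" unfolding kgrad_def
    by (intro smooth_on_minus smooth_on_mult smooth_on_powr smooth_on_sum smooth_on_u smooth_on_const s p) auto
  show "smooth_on UNIV (\<lambda>z. kgam e S z x)" unfolding kgam_def
    by (intro smooth_on_fundsol s p) auto
qed

lemma powr_neg_le_scaled:
  fixes a n c s :: real
  assumes "0 < a" "0 < c" "a \<le> c * n" "0 \<le> s"
  shows "n powr (- s) \<le> c powr s * a powr (- s)"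
proof -
  have "n powr (- s) \<le> (a / c) powr (- s)" using assms by (intro powr_mono2') (auto simp: field_simps)
  also have "\<dots> = c powr s * a powr (- s)" using assms by (simp add: powr_divide powr_minus field_simps)
  finally show ?thesis .
qed

section \<open>Bounds for the kernels and their pole derivatives, uniform in the
  regularisation\<close>

context neumann_patch
begin

lemma coefficient_bounds:
  obtains \<beta> where "1 \<le> \<beta>" "C \<le> \<beta>" "\<And>x j k. x \<in> \<Omega> \<Longrightarrow> \<bar>pd j (\<lambda>x. S x $ k) x\<bar> \<le> \<beta>"
    "\<And>x k. x \<in> \<Omega> \<Longrightarrow> \<bar>SB S k x\<bar> \<le> \<beta>" "\<And>x j. x \<in> \<Omega> \<Longrightarrow> \<bar>pd j \<eta> x\<bar> \<le> \<beta>"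
    "\<And>x z. x \<in> \<Omega> \<Longrightarrow> z \<in> Z \<Longrightarrow> norm (S x - z) \<le> \<beta> \<and> norm (x - z) \<le> \<beta>"
proof -
  have c1: "continuous_on UNIV (pd (fst i) (\<lambda>x. S x $ snd i))" for i
    by (rule smooth_on_continuous[OF smooth_on_pd[OF S]])
  have c3: "continuous_on UNIV (pd j \<eta>)" for j
    by (rule smooth_on_continuous[OF smooth_on_pd[OF eta(1)]])
  obtain b1 where "0 \<le> b1" and b1: "\<And>i x. x \<in> \<Omega> \<Longrightarrow> \<bar>pd (fst i) (\<lambda>x. S x $ snd i) x\<bar> \<le> b1"
    by (rule finite_family_bound[where f = "\<lambda>i. pd (fst i) (\<lambda>x. S x $ snd i)", OF Om(1) c1]) (rule that; blast)
  have cB: "continuous_on UNIV (SB S k)" for k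
    unfolding SB_def by (intro continuous_on_sum smooth_on_continuous smooth_on_pd S)
  obtain b2 where "0 \<le> b2" and b2: "\<And>k x. x \<in> \<Omega> \<Longrightarrow> \<bar>SB S k x\<bar> \<le> b2"
    by (rule finite_family_bound[where f = "SB S", OF Om(1) cB]) (rule that; blast)
  obtain b3 where "0 \<le> b3" and b3: "\<And>j x. x \<in> \<Omega> \<Longrightarrow> \<bar>pd j \<eta> x\<bar> \<le> b3"
    by (rule finite_family_bound[where f = "\<lambda>j. pd j \<eta>", OF Om(1) c3]) (rule that; blast)
  have "compact (S ` closure \<Omega>)"
    using Om(1) by (intro compact_continuous_image continuous_on_subset[OF continuous_S]) auto
  then have "\<exists>L. \<forall>x\<in>closure \<Omega>. norm (S x) \<le> L"
    unfolding compact_eq_bounded_closed bounded_iff by auto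
  then obtain b4 where b4: "\<And>x. x \<in> \<Omega> \<Longrightarrow> norm (S x) \<le> b4" using closure_subset[of \<Omega>] by blast
  obtain b5 where b5: "\<And>x. x \<in> \<Omega> \<Longrightarrow> norm x \<le> b5" using Om(1) unfolding bounded_iff by blast
  show ?thesis
  proof (rule that[of "1 + \<bar>C\<bar> + \<bar>b1\<bar> + \<bar>b2\<bar> + \<bar>b3\<bar> + \<bar>b4\<bar> + 2 * \<bar>b5\<bar>"])
    show "\<bar>pd j (\<lambda>x. S x $ k) x\<bar> \<le> 1 + \<bar>C\<bar> + \<bar>b1\<bar> + \<bar>b2\<bar> + \<bar>b3\<bar> + \<bar>b4\<bar> + 2 * \<bar>b5\<bar>" if "x \<in> \<Omega>" for x j k
      using b1[OF that, of "(j, k)"] by simp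
    show "\<bar>SB S k x\<bar> \<le> 1 + \<bar>C\<bar> + \<bar>b1\<bar> + \<bar>b2\<bar> + \<bar>b3\<bar> + \<bar>b4\<bar> + 2 * \<bar>b5\<bar>" if "x \<in> \<Omega>" for x k
      using b2[OF that, of k] by simp
    show "\<bar>pd j \<eta> x\<bar> \<le> 1 + \<bar>C\<bar> + \<bar>b1\<bar> + \<bar>b2\<bar> + \<bar>b3\<bar> + \<bar>b4\<bar> + 2 * \<bar>b5\<bar>" if "x \<in> \<Omega>" for x j
      using b3[OF that, of j] by simp
    show "norm (S x - z) \<le> 1 + \<bar>C\<bar> + \<bar>b1\<bar> + \<bar>b2\<bar> + \<bar>b3\<bar> + \<bar>b4\<bar> + 2 * \<bar>b5\<bar> \<and> norm (x - z) \<le> 1 + \<bar>C\<bar> + \<bar>b1\<bar> + \<bar>b2\<bar> + \<bar>b3\<bar> + \<bar>b4\<bar> + 2 * \<bar>b5\<bar>" if "x \<in> \<Omega>" "z \<in> Z" for x z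
      using b4[OF that(1)] b5[OF that(1)] b5[of z] Z(2) that(2) norm_triangle_ineq4[of "S x" z] norm_triangle_ineq4[of x z] by auto
  qed auto
qed

text \<open>\<open>geo(1)\<close> converts negative powers of |S x - z| into those of |x - z|. In
  \<open>K1\<close> the defect and the cutoff terms are both of order 1 - N; \<open>K2\<close> is
  bounded because the gradient of \<eta> vanishes within distance \<open>rr\<close> of the
  poles.\<close>

lemma kernel_bounds:
  obtains M where "0 \<le> M"
    "\<And>e x z. 0 < e \<Longrightarrow> e \<le> 1 \<Longrightarrow> x \<in> \<Omega> \<Longrightarrow> z \<in> Z \<Longrightarrow> x \<noteq> z \<Longrightarrow> \<bar>K1 e x z\<bar> \<le> M * norm (x - z) powr (- (real CARD('n) - 1))"
    "\<And>e x z j. 0 < e \<Longrightarrow> e \<le> 1 \<Longrightarrow> x \<in> \<Omega> \<Longrightarrow> z \<in> Z \<Longrightarrow> \<bar>K2 e j x z\<bar> \<le> M"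
proof -
  obtain \<beta> where b: "1 \<le> \<beta>" "C \<le> \<beta>" "\<And>x j k. x \<in> \<Omega> \<Longrightarrow> \<bar>pd j (\<lambda>x. S x $ k) x\<bar> \<le> \<beta>"
    "\<And>x k. x \<in> \<Omega> \<Longrightarrow> \<bar>SB S k x\<bar> \<le> \<beta>" "\<And>x j. x \<in> \<Omega> \<Longrightarrow> \<bar>pd j \<eta> x\<bar> \<le> \<beta>"
    "\<And>x z. x \<in> \<Omega> \<Longrightarrow> z \<in> Z \<Longrightarrow> norm (S x - z) \<le> \<beta> \<and> norm (x - z) \<le> \<beta>" by (rule coefficient_bounds) (rule that; blast)
  \<comment> \<open>A lower bound for both |x - z| and |S x - z| where \<eta> varies: the first by
    \<open>far\<close>, the second by \<open>far\<close> combined with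
    \<open>geo(1)\<close>.\<close>
  define \<delta> where "\<delta> = min rr (rr / C)"
  have \<delta>: "0 < \<delta>" unfolding \<delta>_def using rr C by simp
  obtain M2 where M2: "0 \<le> M2" "\<And>S z x e. 0 < e \<Longrightarrow> e \<le> 1 \<Longrightarrow> \<delta> \<le> norm (S x - z) \<Longrightarrow> norm (S x - z) \<le> \<beta>
      \<Longrightarrow> \<bar>kgam e S z (x :: real^'n)\<bar> \<le> M2" by (rule kgam_bounded[OF \<delta>, where 'n = 'n]) (rule that; blast)
  define A where "A = (real CARD('n) * real CARD('n) * real CARD('n) + real CARD('n) + real CARD('n)) * \<beta>"
  define cN where "cN = C powr (real CARD('n) - 1)"
  define M where "M = A * cN + real CARD('n) * (\<beta> * (real CARD('n) * 1 + real CARD('n) * \<beta> * cN)) + \<beta> * (M2 + M2)"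
  have pos: "0 \<le> A" "0 \<le> cN" "0 \<le> real CARD('n) * (\<beta> * (real CARD('n) * 1 + real CARD('n) * \<beta> * cN))" "0 \<le> \<beta> * (M2 + M2)" "0 \<le> \<beta>"
    unfolding A_def cN_def using b(1) M2(1) by auto
  have N1: "0 \<le> real CARD('n) - 1" by (simp add: Suc_leI)
  show ?thesis
  proof (rule that[of M])
    show "0 \<le> M" unfolding M_def using pos by simp
  next
    fix e :: real and x z :: "real^'n" assume h: "0 < e" "e \<le> 1" "x \<in> \<Omega>" "z \<in> Z" "x \<noteq> z"
    let ?k = "norm (x - z) powr (- (real CARD('n) - 1))"
    show "\<bar>K1 e x z\<bar> \<le> M * ?k"
    proof (cases "x \<in> K")
      case False
      then have "K1 e x z = 0" unfolding K1_def by (simp add: eta(5) pd_eta_outside)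
      then show ?thesis unfolding M_def using pos by simp
    next
      case True
      let ?n = "norm (S x - z)"
      have nS: "S x \<noteq> z" by (rule Sx_neq[OF h(3) True h(4)])
      have nk: "?n powr (- (real CARD('n) - 1)) \<le> cN * ?k"
        unfolding cN_def using geo(1)[OF h(3) True h(4)] h(5) C N1 by (intro powr_neg_le_scaled) auto
      have SE: "\<bar>SE S k l x\<bar> \<le> \<beta> * ?n" for k l
        using geo(3)[OF h(3) True h(4), of k l] b(2) by (meson mult_right_mono norm_ge_zero order_trans)
      have "\<bar>kdef e S z x\<bar> \<le> A * ?n powr (- (real CARD('n) - 1))"
        unfolding A_def by (rule kdef_pole(2)[OF h(1) pos(5) SE b(4)[OF h(3)] nS])
      also have "\<dots> \<le> A * (cN * ?k)" using nk pos by (intro mult_left_mono) auto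
      finally have kd: "\<bar>kdef e S z x\<bar> \<le> A * cN * ?k" by simp
      have "\<bar>\<eta> x * kdef e S z x\<bar> \<le> 1 * \<bar>kdef e S z x\<bar>" unfolding abs_mult using eta(2,3)[of x] by (intro mult_right_mono) auto
      then have 1: "\<bar>\<eta> x * kdef e S z x\<bar> \<le> A * cN * ?k" using kd by simp
      have 2: "\<bar>pd j \<eta> x * (kgrad e (\<lambda>x. x) z j x + kgrad e S z j x)\<bar> \<le> \<beta> * (real CARD('n) * 1 + real CARD('n) * \<beta> * cN) * ?k" for j
      proof -
        have g1: "\<bar>kgrad e (\<lambda>x. x) z j x\<bar> \<le> real CARD('n) * 1 * ?k"
          by (rule kgrad_pole(2)[OF h(1), of 1 j "\<lambda>x. x" x z]) (use h in \<open>auto simp: pd_coord\<close>)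
        have "\<bar>kgrad e S z j x\<bar> \<le> real CARD('n) * \<beta> * ?n powr (- (real CARD('n) - 1))"
          by (rule kgrad_pole(2)[OF h(1) pos(5) b(3)[OF h(3)] nS])
        also have "\<dots> \<le> real CARD('n) * \<beta> * (cN * ?k)" using nk pos by (intro mult_left_mono) auto
        finally have g2: "\<bar>kgrad e S z j x\<bar> \<le> real CARD('n) * \<beta> * cN * ?k" by simp
        have "\<bar>kgrad e (\<lambda>x. x) z j x + kgrad e S z j x\<bar> \<le> real CARD('n) * 1 * ?k + real CARD('n) * \<beta> * cN * ?k"
          using g1 g2 by (rule order_trans[OF abs_triangle_ineq add_mono])
        then have "\<bar>pd j \<eta> x * (kgrad e (\<lambda>x. x) z j x + kgrad e S z j x)\<bar> \<le> \<beta> * (real CARD('n) * 1 * ?k + real CARD('n) * \<beta> * cN * ?k)"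
          unfolding abs_mult using b(5)[OF h(3), of j] pos(5) by (intro mult_mono) auto
        then show ?thesis by (simp only: algebra_simps)
      qed
      have "\<bar>K1 e x z\<bar> \<le> A * cN * ?k + real CARD('n) * (\<beta> * (real CARD('n) * 1 + real CARD('n) * \<beta> * cN) * ?k)"
        unfolding K1_def by (intro order_trans[OF abs_triangle_ineq add_mono] 1 abs_sum_le_card 2)
      also have "\<dots> = (A * cN + real CARD('n) * (\<beta> * (real CARD('n) * 1 + real CARD('n) * \<beta> * cN))) * ?k" by (simp only: algebra_simps)
      also have "\<dots> \<le> M * ?k" unfolding M_def using pos(4) by (intro mult_right_mono) auto
      finally show ?thesis .
    qed
  next
    fix e :: real and x z :: "real^'n" and j assume h: "0 < e" "e \<le> 1" "x \<in> \<Omega>" "z \<in> Z"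
    show "\<bar>K2 e j x z\<bar> \<le> M"
    proof (cases "pd j \<eta> x = 0")
      case True
      then show ?thesis unfolding K2_def M_def using pos by simp
    next
      case False
      then have K: "x \<in> K" using pd_eta_outside by blast
      have f: "rr \<le> norm (x - z)" by (rule far[OF h(3,4) False])
      have "rr / C \<le> norm (S x - z)" using f geo(1)[OF h(3) K h(4)] C by (simp add: field_simps)
      then have "\<bar>kgam e S z x\<bar> \<le> M2" "\<bar>kgam e (\<lambda>x. x) z x\<bar> \<le> M2"
        using M2(2)[OF h(1,2), of S x z] M2(2)[OF h(1,2), of "\<lambda>x. x" x z] f b(6)[OF h(3,4)] unfolding \<delta>_def by auto
      then have "\<bar>kgam e (\<lambda>x. x) z x + kgam e S z x\<bar> \<le> M2 + M2" by linarith
      then have "\<bar>K2 e j x z\<bar> \<le> \<beta> * (M2 + M2)" unfolding K2_def abs_minus_cancel abs_mult using b(5)[OF h(3), of j] pos(5)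
        by (intro mult_mono) auto
      then show ?thesis unfolding M_def using pos by (smt (verit) mult_nonneg_nonneg)
    qed
  qed
qed

lemma smooth_K1: "0 < e \<Longrightarrow> smooth_on UNIV (K1 e x)"
  and smooth_K2: "0 < e \<Longrightarrow> smooth_on UNIV (K2 e j x)"
  unfolding K1_def[abs_def] K2_def[abs_def]
  by (intro smooth_on_add smooth_on_minus smooth_on_mult smooth_on_sum smooth_on_const smooth_on_pole_kernels; simp)+

text \<open>The differentiated defect has order -N in |S x - z|, which is not integrable. The
  exponent is split as -\<alpha> - (N - \<alpha>): the first factor is estimated by
  \<open>dd z\<close> through \<open>geo(2)\<close>, the second by |x - z| through
  \<open>geo(1)\<close>, and N - \<alpha> < N is integrable. Terms with a derivative of \<eta> stay
  bounded since they live away from the pole.\<close>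

lemma kernel_pd_bounds:
  assumes al: "0 < \<alpha>" "\<alpha> < 1"
  obtains M where "0 \<le> M"
    "\<And>e x z i. 0 < e \<Longrightarrow> e \<le> 1 \<Longrightarrow> x \<in> \<Omega> \<Longrightarrow> z \<in> Z \<Longrightarrow> x \<noteq> z \<Longrightarrow>
       \<bar>pd i (K1 e x) z\<bar> \<le> M * (dd z powr (- \<alpha>) * norm (x - z) powr (- (real CARD('n) - \<alpha>))) + M"
    "\<And>e x z i j. 0 < e \<Longrightarrow> e \<le> 1 \<Longrightarrow> x \<in> \<Omega> \<Longrightarrow> z \<in> Z \<Longrightarrow> \<bar>pd i (K2 e j x) z\<bar> \<le> M"
proof -
  obtain \<beta> where b: "1 \<le> \<beta>" "C \<le> \<beta>" "\<And>x j k. x \<in> \<Omega> \<Longrightarrow> \<bar>pd j (\<lambda>x. S x $ k) x\<bar> \<le> \<beta>"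
    "\<And>x k. x \<in> \<Omega> \<Longrightarrow> \<bar>SB S k x\<bar> \<le> \<beta>" "\<And>x j. x \<in> \<Omega> \<Longrightarrow> \<bar>pd j \<eta> x\<bar> \<le> \<beta>"
    "\<And>x z. x \<in> \<Omega> \<Longrightarrow> z \<in> Z \<Longrightarrow> norm (S x - z) \<le> \<beta> \<and> norm (x - z) \<le> \<beta>" by (rule coefficient_bounds) (rule that; blast)
  have b0: "0 \<le> \<beta>" using b(1) by simp
  define A where "A = (real CARD('n) * ((real CARD('n) + 2) * real CARD('n) * real CARD('n) + 2 * real CARD('n) * real CARD('n)) + (2 * real CARD('n) * real CARD('n) + 1)) * \<beta>"
  define \<delta> where "\<delta> = min rr (rr / C)"
  have \<delta>: "0 < \<delta>" unfolding \<delta>_def using rr C by simp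
  define c\<alpha> where "c\<alpha> = C powr \<alpha> * C powr (real CARD('n) - \<alpha>)"
  define G where "G = \<beta> * (((real CARD('n) * real CARD('n) + 1) * 1 * \<delta> powr (- real CARD('n))) + ((real CARD('n) * real CARD('n) + 1) * \<beta> * \<delta> powr (- real CARD('n))))"
  define H where "H = \<beta> * (\<delta> powr (- (real CARD('n) - 1)) + \<delta> powr (- (real CARD('n) - 1)))"
  define M where "M = A * c\<alpha> + real CARD('n) * G + H"
  have N1: "0 \<le> real CARD('n) - 1" "0 \<le> real CARD('n) - \<alpha>" using al by (simp_all add: Suc_leI order.trans[of \<alpha> 1])
  have pos: "0 \<le> A" "0 \<le> c\<alpha>" "0 \<le> real CARD('n) * G" "0 \<le> H" unfolding A_def c\<alpha>_def G_def H_def using b0 by auto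
  have away: "\<delta> \<le> norm (x - z)" "\<delta> \<le> norm (S x - z)" "x \<in> K" if "x \<in> \<Omega>" "z \<in> Z" "pd j \<eta> x \<noteq> 0" for x z j
  proof -
    show K: "x \<in> K" using pd_eta_outside that(3) by blast
    have f: "rr \<le> norm (x - z)" by (rule far[OF that])
    then show "\<delta> \<le> norm (x - z)" unfolding \<delta>_def by simp
    have "rr / C \<le> norm (S x - z)" using f geo(1)[OF that(1) K that(2)] C by (simp add: field_simps)
    then show "\<delta> \<le> norm (S x - z)" unfolding \<delta>_def by simp
  qed
  show ?thesis
  proof (rule that[of M])
    show "0 \<le> M" unfolding M_def using pos by simp
  next
    fix e :: real and x z :: "real^'n" and i assume h: "0 < e" "e \<le> 1" "x \<in> \<Omega>" "z \<in> Z" "x \<noteq> z"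
    let ?k = "dd z powr (- \<alpha>) * norm (x - z) powr (- (real CARD('n) - \<alpha>))"
    note sk = smooth_on_pole_kernels[OF h(1)]
    have sg: "smooth_on UNIV (\<lambda>z. kgrad e (\<lambda>x. x) z j x + kgrad e S z j x)" for j
      by (intro smooth_on_add sk) auto
    have sg': "smooth_on UNIV (\<lambda>z. pd j \<eta> x * (kgrad e (\<lambda>x. x) z j x + kgrad e S z j x))" for j
      by (intro smooth_on_mult smooth_on_const sg) auto
    have sd: "smooth_on UNIV (\<lambda>z. \<eta> x * kdef e S z x)" by (intro smooth_on_mult smooth_on_const sk) auto
    have ss: "smooth_on UNIV (\<lambda>z. \<Sum>j\<in>UNIV. pd j \<eta> x * (kgrad e (\<lambda>x. x) z j x + kgrad e S z j x))" by (intro smooth_on_sum sg') auto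
    have eq: "pd i (K1 e x) z = \<eta> x * pd i (\<lambda>z. kdef e S z x) z +
        (\<Sum>j\<in>UNIV. pd j \<eta> x * (pd i (\<lambda>z. kgrad e (\<lambda>x. x) z j x) z + pd i (\<lambda>z. kgrad e S z j x) z))"
    proof -
      have "K1 e x = (\<lambda>z. \<eta> x * kdef e S z x + (\<Sum>j\<in>UNIV. pd j \<eta> x * (kgrad e (\<lambda>x. x) z j x + kgrad e S z j x)))"
        by (rule ext) (rule K1_def)
      then have "pd i (K1 e x) z = pd i (\<lambda>z. \<eta> x * kdef e S z x) z + pd i (\<lambda>z. \<Sum>j\<in>UNIV. pd j \<eta> x * (kgrad e (\<lambda>x. x) z j x + kgrad e S z j x)) z"
        by (simp only: pd_add_smooth[OF sd ss])
      also have "pd i (\<lambda>z. \<Sum>j\<in>UNIV. pd j \<eta> x * (kgrad e (\<lambda>x. x) z j x + kgrad e S z j x)) z = (\<Sum>j\<in>UNIV. pd i (\<lambda>z. pd j \<eta> x * (kgrad e (\<lambda>x. x) z j x + kgrad e S z j x)) z)"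
        by (rule pd_sum) (use smooth_on_diff[OF sg'] in auto)
      also have "\<dots> = (\<Sum>j\<in>UNIV. pd j \<eta> x * (pd i (\<lambda>z. kgrad e (\<lambda>x. x) z j x) z + pd i (\<lambda>z. kgrad e S z j x) z))"
        by (rule sum.cong[OF refl]) (simp only: pd_cmult_left[OF sg] pd_add_smooth[OF sk(2) sk(2)])
      finally show ?thesis by (simp only: pd_cmult_left[OF sk(1)])
    qed
    have 1: "\<bar>\<eta> x * pd i (\<lambda>z. kdef e S z x) z\<bar> \<le> A * c\<alpha> * ?k"
    proof (cases "x \<in> K")
      case False
      then show ?thesis using pos by (simp add: eta(5))
    next
      case True
      let ?n = "norm (S x - z)"
      have nS: "S x \<noteq> z" by (rule Sx_neq[OF h(3) True h(4)])
      have SE: "\<bar>SE S k l x\<bar> \<le> \<beta> * ?n" for k l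
        using geo(3)[OF h(3) True h(4), of k l] b(2) by (meson mult_right_mono norm_ge_zero order_trans)
      have s1: "?n powr (- \<alpha>) \<le> C powr \<alpha> * dd z powr (- \<alpha>)"
        using geo(2)[OF h(3) True h(4)] dd[OF h(4)] C al by (intro powr_neg_le_scaled) auto
      have s2: "?n powr (- (real CARD('n) - \<alpha>)) \<le> C powr (real CARD('n) - \<alpha>) * norm (x - z) powr (- (real CARD('n) - \<alpha>))"
        using geo(1)[OF h(3) True h(4)] h(5) C N1 by (intro powr_neg_le_scaled) auto
      have "?n powr (- real CARD('n)) = ?n powr (- \<alpha>) * ?n powr (- (real CARD('n) - \<alpha>))" by (simp add: powr_add[symmetric])
      also have "\<dots> \<le> (C powr \<alpha> * dd z powr (- \<alpha>)) * (C powr (real CARD('n) - \<alpha>) * norm (x - z) powr (- (real CARD('n) - \<alpha>)))"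
        using s1 s2 by (intro mult_mono) auto
      finally have s: "?n powr (- real CARD('n)) \<le> c\<alpha> * ?k" unfolding c\<alpha>_def by (simp add: mult_ac)
      have "\<bar>pd i (\<lambda>z. kdef e S z x) z\<bar> \<le> A * ?n powr (- real CARD('n))"
        unfolding A_def by (rule kdef_pole(3)[OF h(1) b0 SE b(4)[OF h(3)] nS])
      also have "\<dots> \<le> A * (c\<alpha> * ?k)" using s pos by (intro mult_left_mono) auto
      finally have kd: "\<bar>pd i (\<lambda>z. kdef e S z x) z\<bar> \<le> A * c\<alpha> * ?k" by simp
      have "\<bar>\<eta> x * pd i (\<lambda>z. kdef e S z x) z\<bar> \<le> 1 * \<bar>pd i (\<lambda>z. kdef e S z x) z\<bar>"
        unfolding abs_mult using eta(2,3)[of x] by (intro mult_right_mono) auto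
      then show ?thesis using kd by simp
    qed
    have 2: "\<bar>pd j \<eta> x * (pd i (\<lambda>z. kgrad e (\<lambda>x. x) z j x) z + pd i (\<lambda>z. kgrad e S z j x) z)\<bar> \<le> G" for j
    proof (cases "pd j \<eta> x = 0")
      case True
      then show ?thesis unfolding G_def using b0 by simp
    next
      case False
      note aw = away[OF h(3,4) False]
      have nS: "S x \<noteq> z" by (rule Sx_neq[OF h(3) aw(3) h(4)])
      have "\<bar>pd i (\<lambda>z. kgrad e (\<lambda>x. x) z j x) z\<bar> \<le> (real CARD('n) * real CARD('n) + 1) * 1 * norm (x - z) powr (- real CARD('n))"
        by (rule kgrad_pole(3)[OF h(1), of 1 j "\<lambda>x. x" x z]) (use h in \<open>auto simp: pd_coord\<close>)
      also have "\<dots> \<le> (real CARD('n) * real CARD('n) + 1) * 1 * \<delta> powr (- real CARD('n))" using aw(1) \<delta> by (intro mult_left_mono powr_mono2') auto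
      finally have g1: "\<bar>pd i (\<lambda>z. kgrad e (\<lambda>x. x) z j x) z\<bar> \<le> (real CARD('n) * real CARD('n) + 1) * 1 * \<delta> powr (- real CARD('n))" .
      have "\<bar>pd i (\<lambda>z. kgrad e S z j x) z\<bar> \<le> (real CARD('n) * real CARD('n) + 1) * \<beta> * norm (S x - z) powr (- real CARD('n))"
        by (rule kgrad_pole(3)[OF h(1) b0 b(3)[OF h(3)] nS])
      also have "\<dots> \<le> (real CARD('n) * real CARD('n) + 1) * \<beta> * \<delta> powr (- real CARD('n))" using aw(2) \<delta> b0 by (intro mult_left_mono powr_mono2') auto
      finally have g2: "\<bar>pd i (\<lambda>z. kgrad e S z j x) z\<bar> \<le> (real CARD('n) * real CARD('n) + 1) * \<beta> * \<delta> powr (- real CARD('n))" .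
      show ?thesis unfolding G_def abs_mult using b(5)[OF h(3), of j] b0
        by (intro mult_mono order_trans[OF abs_triangle_ineq add_mono[OF g1 g2]]) auto
    qed
    have "\<bar>pd i (K1 e x) z\<bar> \<le> A * c\<alpha> * ?k + real CARD('n) * G"
      unfolding eq by (intro order_trans[OF abs_triangle_ineq add_mono] 1 abs_sum_le_card 2)
    also have "\<dots> \<le> M * ?k + M"
      unfolding M_def using pos by (intro add_mono mult_right_mono) auto
    finally show "\<bar>pd i (K1 e x) z\<bar> \<le> M * ?k + M" .
  next
    fix e :: real and x z :: "real^'n" and i j assume h: "0 < e" "e \<le> 1" "x \<in> \<Omega>" "z \<in> Z"
    note sk = smooth_on_pole_kernels(3)[OF h(1)]
    have sg: "smooth_on UNIV (\<lambda>z. kgam e (\<lambda>x. x) z x + kgam e S z x)" by (intro smooth_on_add sk) auto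
    have eq: "pd i (K2 e j x) z = (- pd j \<eta> x) * (pd i (\<lambda>z. kgam e (\<lambda>x. x) z x) z + pd i (\<lambda>z. kgam e S z x) z)"
    proof -
      have "K2 e j x = (\<lambda>z. (- pd j \<eta> x) * (kgam e (\<lambda>x. x) z x + kgam e S z x))"
        by (rule ext) (simp add: K2_def)
      then show ?thesis by (simp only: pd_cmult_left[OF sg] pd_add_smooth[OF sk sk])
    qed
    have "\<bar>pd i (K2 e j x) z\<bar> \<le> H"
    proof (cases "pd j \<eta> x = 0")
      case True
      then show ?thesis unfolding eq using pos by simp
    next
      case False
      note aw = away[OF h(3,4) False]
      have nS: "S x \<noteq> z" by (rule Sx_neq[OF h(3) aw(3) h(4)])
      have nx: "x \<noteq> z" using aw(1) \<delta> by auto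
      have g1: "\<bar>pd i (\<lambda>z. kgam e (\<lambda>x. x) z x) z\<bar> \<le> \<delta> powr (- (real CARD('n) - 1))"
        using kgam_pole(2)[OF h(1), of "\<lambda>x. x" x z i] nx powr_mono2'[OF _ \<delta> aw(1), of "- (real CARD('n) - 1)"] N1(1) by simp
      have g2: "\<bar>pd i (\<lambda>z. kgam e S z x) z\<bar> \<le> \<delta> powr (- (real CARD('n) - 1))"
        using kgam_pole(2)[of e S x z i] h(1) nS powr_mono2'[OF _ \<delta> aw(2), of "- (real CARD('n) - 1)"] N1(1) by simp
      show ?thesis unfolding H_def eq abs_mult abs_minus_cancel using b(5)[OF h(3), of j] b0
        by (intro mult_mono order_trans[OF abs_triangle_ineq add_mono[OF g1 g2]]) auto
    qed
    then show "\<bar>pd i (K2 e j x) z\<bar> \<le> M" unfolding M_def using pos by (smt (verit) mult_nonneg_nonneg)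
  qed
qed

end

lemma nn_integral_lebesgue_on_mono_set:
  fixes A B :: "(real^'n::finite) set"
  assumes "A \<subseteq> B" "A \<in> sets lebesgue" "B \<in> sets lebesgue"
  shows "(\<integral>\<^sup>+x. f x \<partial>lebesgue_on A) \<le> (\<integral>\<^sup>+x. f x \<partial>lebesgue_on B)"
proof -
  have "(\<integral>\<^sup>+x. f x \<partial>lebesgue_on A) = (\<integral>\<^sup>+x. f x * indicator A x \<partial>lebesgue)" using assms by (simp add: nn_integral_restrict_space)
  also have "\<dots> \<le> (\<integral>\<^sup>+x. f x * indicator B x \<partial>lebesgue)" using assms(1) by (intro nn_integral_mono mult_left_mono) (auto simp: indicator_def)
  also have "\<dots> = (\<integral>\<^sup>+x. f x \<partial>lebesgue_on B)" using assms by (simp add: nn_integral_restrict_space)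
  finally show ?thesis .
qed

lemma riesz_kernel_measurable:
  fixes A B :: "(real^'n::finite) set"
  shows "(\<lambda>(x, z). ennreal (norm (x - z) powr s)) \<in> borel_measurable (lebesgue_on A \<Otimes>\<^sub>M lebesgue_on B)"
proof (rule measurable_kernel2)
  have h: "(\<lambda>p::(real^'n)\<times>(real^'n). norm (fst p - snd p)) \<in> borel_measurable borel"
    by (intro borel_measurable_continuous_onI continuous_intros)
  have "(\<lambda>p::(real^'n)\<times>(real^'n). ennreal (norm (fst p - snd p) powr s)) \<in> borel_measurable borel"
    using measurable_compose[OF h, of "\<lambda>t. ennreal (t powr s)" borel] by simp
  then show "(\<lambda>(x::real^'n, z). ennreal (norm (x - z) powr s)) \<in> borel_measurable borel" by (simp add: case_prod_beta)
qed

lemma abs_integral_le_nn_integral: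
  fixes f :: "'a \<Rightarrow> real"
  assumes "(\<integral>\<^sup>+x. ennreal \<bar>f x\<bar> \<partial>M) \<le> ennreal c" "0 \<le> c" "integrable M f"
  shows "\<bar>\<integral>x. f x \<partial>M\<bar> \<le> c"
proof -
  have "ennreal \<bar>\<integral>x. f x \<partial>M\<bar> \<le> (\<integral>\<^sup>+x. ennreal \<bar>f x\<bar> \<partial>M)"
    using integral_norm_bound_ennreal[OF assms(3)] by simp
  also have "\<dots> \<le> ennreal c" by (rule assms(1))
  finally show ?thesis using assms(2) by (simp add: ennreal_le_iff)
qed

section \<open>Pointwise bounds for the solution and its gradient on one patch\<close>

context neumann_patch
begin

text \<open>For every \<open>e\<close> the representation is dominated by M1 + M p(z), where p is
  the Riesz potential of |\<theta>| and M1 absorbs the L1 norm of the gradient. This bound does not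
  involve \<open>e\<close>, passes to the weak limit, and is then read off pointwise.\<close>

lemma potential_bound:
  obtains M where "0 \<le> M" "AE z in lebesgue_on Z. ennreal \<bar>\<theta> z\<bar> \<le> ennreal M +
       ennreal M * (\<integral>\<^sup>+x. ennreal \<bar>\<theta> x\<bar> * ennreal (norm (x - z) powr (- (real CARD('n) - 1))) \<partial>lebesgue_on \<Omega>)"
proof -
  let ?L = "lebesgue_on \<Omega>" and ?LZ = "lebesgue_on Z"
  let ?s = "- (real CARD('n) - 1)"
  let ?c = "delta_mass TYPE('n)"
  interpret LO: sigma_finite_measure ?L by (rule sigma_finite_lebesgue_on[OF Os])
  interpret LZ: sigma_finite_measure ?LZ by (rule sigma_finite_lebesgue_on[OF Zs])
  interpret P: pair_sigma_finite ?LZ ?L ..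
  interpret FZ: finite_measure ?LZ using Om(1) Z by (intro finite_measure_bounded_open) (auto intro: bounded_subset)
  obtain M where M: "0 \<le> M"
    "\<And>e x z. 0 < e \<Longrightarrow> e \<le> 1 \<Longrightarrow> x \<in> \<Omega> \<Longrightarrow> z \<in> Z \<Longrightarrow> x \<noteq> z \<Longrightarrow> \<bar>K1 e x z\<bar> \<le> M * norm (x - z) powr ?s"
    "\<And>e x z j. 0 < e \<Longrightarrow> e \<le> 1 \<Longrightarrow> x \<in> \<Omega> \<Longrightarrow> z \<in> Z \<Longrightarrow> \<bar>K2 e j x z\<bar> \<le> M"
    by (rule kernel_bounds) (rule that; blast)
  obtain B where B: "0 \<le> B" "\<And>z. z \<in> \<Omega> \<Longrightarrow> (\<integral>\<^sup>+x. ennreal (norm (x - z) powr ?s) \<partial>?L) \<le> ennreal B"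
    using nn_integral_riesz_bounded[OF Om, of "real CARD('n) - 1"] by (auto simp: Suc_leI)
  define Pot where "Pot z = (\<integral>\<^sup>+x. ennreal \<bar>\<theta> x\<bar> * ennreal (norm (x - z) powr ?s) \<partial>?L)" for z
  have tm: "(\<lambda>x. ennreal \<bar>\<theta> x\<bar>) \<in> borel_measurable ?L" using th by simp
  have mm: "(\<lambda>(z, x). ennreal \<bar>\<theta> x\<bar> * ennreal (norm (x - z) powr ?s)) \<in> borel_measurable (?LZ \<Otimes>\<^sub>M ?L)"
  proof -
    have "(\<lambda>p. ennreal \<bar>\<theta> (snd p)\<bar>) \<in> borel_measurable (?LZ \<Otimes>\<^sub>M ?L)" by (rule measurable_compose[OF measurable_snd tm])
    from borel_measurable_times_ennreal[OF this riesz_kernel_measurable[of ?s Z \<Omega>]]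
    show ?thesis by (simp add: case_prod_beta norm_minus_commute)
  qed
  have Pm: "Pot \<in> borel_measurable ?LZ" unfolding Pot_def using LO.borel_measurable_nn_integral[OF mm] by simp
  \<comment> \<open>By Tonelli the potential of an integrable function is integrable, hence finite
    almost everywhere, and may be replaced by the real function \<open>p\<close>.\<close>
  have fin: "(\<integral>\<^sup>+z. Pot z \<partial>?LZ) < \<infinity>"
  proof -
    have "(\<integral>\<^sup>+z. Pot z \<partial>?LZ) = (\<integral>\<^sup>+x. (\<integral>\<^sup>+z. ennreal \<bar>\<theta> x\<bar> * ennreal (norm (x - z) powr ?s) \<partial>?LZ) \<partial>?L)"
      unfolding Pot_def using P.Fubini[OF mm] by simp
    also have "\<dots> \<le> (\<integral>\<^sup>+x. ennreal \<bar>\<theta> x\<bar> * ennreal B \<partial>?L)"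
    proof (rule nn_integral_mono)
      fix x assume "x \<in> space ?L"
      then have x: "x \<in> \<Omega>" by simp
      have km: "(\<lambda>z. ennreal (norm (x - z) powr ?s)) \<in> borel_measurable ?LZ"
        using id_borel_measurable_lebesgue_on[of Z] unfolding id_def by measurable
      have "(\<integral>\<^sup>+z. ennreal \<bar>\<theta> x\<bar> * ennreal (norm (x - z) powr ?s) \<partial>?LZ) = ennreal \<bar>\<theta> x\<bar> * (\<integral>\<^sup>+z. ennreal (norm (x - z) powr ?s) \<partial>?LZ)"
        by (rule nn_integral_cmult[OF km])
      also have "(\<integral>\<^sup>+z. ennreal (norm (x - z) powr ?s) \<partial>?LZ) \<le> (\<integral>\<^sup>+z. ennreal (norm (x - z) powr ?s) \<partial>?L)"
        by (rule nn_integral_lebesgue_on_mono_set[OF Z(2) Zs Os])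
      also have "\<dots> \<le> ennreal B" using B(2)[OF x] by (simp add: norm_minus_commute)
      finally show "(\<integral>\<^sup>+z. ennreal \<bar>\<theta> x\<bar> * ennreal (norm (x - z) powr ?s) \<partial>?LZ) \<le> ennreal \<bar>\<theta> x\<bar> * ennreal B"
        by (simp add: mult_left_mono)
    qed
    also have "\<dots> = (\<integral>\<^sup>+x. ennreal \<bar>\<theta> x\<bar> \<partial>?L) * ennreal B" by (rule nn_integral_multc[OF tm])
    also have "(\<integral>\<^sup>+x. ennreal \<bar>\<theta> x\<bar> \<partial>?L) = ennreal (\<integral>x. \<bar>\<theta> x\<bar> \<partial>?L)" using th by (intro nn_integral_eq_integral) auto
    finally show ?thesis by (simp add: ennreal_mult_less_top order.strict_trans1)
  qed
  have finAE: "AE z in ?LZ. Pot z \<noteq> \<infinity>" using fin by (intro nn_integral_PInf_AE[OF Pm]) simp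
  define p where "p z = enn2real (Pot z)" for z
  have pm: "p \<in> borel_measurable ?LZ" unfolding p_def using Pm by measurable
  have ip: "integrable ?LZ p"
  proof (rule integrableI_bounded[OF pm])
    have "(\<integral>\<^sup>+z. ennreal (norm (p z)) \<partial>?LZ) \<le> (\<integral>\<^sup>+z. Pot z \<partial>?LZ)"
      unfolding p_def by (intro nn_integral_mono) (simp add: ennreal_enn2real_if)
    then show "(\<integral>\<^sup>+z. ennreal (norm (p z)) \<partial>?LZ) < \<infinity>" using fin by (rule order.strict_trans1)
  qed
  define M1 where "M1 = (\<Sum>j\<in>UNIV. M * (\<integral>x. \<bar>g x $ j\<bar> \<partial>?L))"
  have M10: "0 \<le> M1" unfolding M1_def using M(1) by (intro sum_nonneg mult_nonneg_nonneg integral_nonneg_AE) auto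
  have Rb: "\<bar>Rr e z\<bar> \<le> M1 + M * p z" if h: "0 < e" "e \<le> 1" "z \<in> Z" "Pot z \<noteq> \<infinity>" for e z
  proof -
    have Pz: "Pot z = ennreal (p z)" unfolding p_def using h(4) by (simp add: ennreal_enn2real_if)
    have p0: "0 \<le> p z" unfolding p_def by simp
    have "\<bar>\<integral>x. \<theta> x * K1 e x z \<partial>?L\<bar> \<le> M * p z"
    proof (rule abs_integral_le_nn_integral)
      show "integrable ?L (\<lambda>x. \<theta> x * K1 e x z)"
        by (rule integrable_mult_continuous[OF th continuous_section(1)[OF continuous_K1[OF h(1)]]])
      have "(\<integral>\<^sup>+x. ennreal \<bar>\<theta> x * K1 e x z\<bar> \<partial>?L) \<le> (\<integral>\<^sup>+x. ennreal M * (ennreal \<bar>\<theta> x\<bar> * ennreal (norm (x - z) powr ?s)) \<partial>?L)"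
      proof (rule nn_integral_mono_AE)
        show "AE x in ?L. ennreal \<bar>\<theta> x * K1 e x z\<bar> \<le> ennreal M * (ennreal \<bar>\<theta> x\<bar> * ennreal (norm (x - z) powr ?s))"
          using AE_lebesgue_on_neq[OF Os, of z] AE_space
        proof eventually_elim
          case (elim x)
          then have "\<bar>\<theta> x * K1 e x z\<bar> \<le> M * (\<bar>\<theta> x\<bar> * norm (x - z) powr ?s)"
            using mult_left_mono[OF M(2)[OF h(1,2) _ h(3), of x], of "\<bar>\<theta> x\<bar>"] by (simp add: abs_mult mult_ac)
          then have "ennreal \<bar>\<theta> x * K1 e x z\<bar> \<le> ennreal (M * (\<bar>\<theta> x\<bar> * norm (x - z) powr ?s))" by (rule ennreal_leI)
          then show ?case using M(1) by (simp add: ennreal_mult)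
        qed
      qed
      also have "\<dots> = ennreal M * Pot z" unfolding Pot_def
      proof (rule nn_integral_cmult)
        have "(\<lambda>x. ennreal (norm (x - z) powr ?s)) \<in> borel_measurable ?L"
          using id_borel_measurable_lebesgue_on[of \<Omega>] unfolding id_def by measurable
        then show "(\<lambda>x. ennreal \<bar>\<theta> x\<bar> * ennreal (norm (x - z) powr ?s)) \<in> borel_measurable ?L"
          using tm by (intro borel_measurable_times_ennreal)
      qed
      finally show "(\<integral>\<^sup>+x. ennreal \<bar>\<theta> x * K1 e x z\<bar> \<partial>?L) \<le> ennreal (M * p z)"
        unfolding Pz using M(1) p0 by (simp add: ennreal_mult)
      show "0 \<le> M * p z" using M(1) p0 by simp
    qed
    moreover have "\<bar>\<Sum>j\<in>UNIV. \<integral>x. g x $ j * K2 e j x z \<partial>?L\<bar> \<le> M1" unfolding M1_def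
    proof (rule order_trans[OF sum_abs sum_mono])
      fix j
      have "\<bar>\<integral>x. g x $ j * K2 e j x z \<partial>?L\<bar> \<le> (\<integral>x. \<bar>g x $ j * K2 e j x z\<bar> \<partial>?L)" by (rule integral_abs_bound)
      also have "\<dots> \<le> (\<integral>x. M * \<bar>g x $ j\<bar> \<partial>?L)"
      proof (rule integral_mono)
        show "integrable ?L (\<lambda>x. \<bar>g x $ j * K2 e j x z\<bar>)"
          by (intro integrable_abs integrable_mult_continuous[OF gi continuous_section(1)[OF continuous_K2[OF h(1)]]])
        show "integrable ?L (\<lambda>x. M * \<bar>g x $ j\<bar>)" using gi by simp
        show "\<bar>g x $ j * K2 e j x z\<bar> \<le> M * \<bar>g x $ j\<bar>" if "x \<in> space ?L" for x
          using mult_left_mono[OF M(3)[OF h(1,2) _ h(3), of x j], of "\<bar>g x $ j\<bar>"] that by (simp add: abs_mult mult.commute)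
      qed
      finally show "\<bar>\<integral>x. g x $ j * K2 e j x z \<partial>?L\<bar> \<le> M * (\<integral>x. \<bar>g x $ j\<bar> \<partial>?L)" by simp
    qed
    ultimately show ?thesis unfolding Rr_def by linarith
  qed
  have iZ: "integrable ?LZ \<theta>" by (rule integrable_lebesgue_on_subset[OF th Z(2) Os Zs])
  have c0: "0 < ?c" by (rule delta_mass_pos)
  have "AE z in ?LZ. \<bar>?c * \<theta> z\<bar> \<le> M1 + M * p z"
  proof (rule fundamental_lemma_abs[OF Z(1)])
    show "integrable ?LZ (\<lambda>z. ?c * \<theta> z)" using iZ by simp
    show ih: "integrable ?LZ (\<lambda>z. M1 + M * p z)" using ip by simp
    fix \<phi> assume t: "test_fun Z \<phi>" and nn: "\<And>x. 0 \<le> \<phi> x"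
    obtain L where L: "0 \<le> L" "\<And>x. \<bar>\<phi> x\<bar> \<le> L" using test_fun_bounded[OF t] by blast
    define e where "e n = 1 / real (Suc n)" for n
    have e: "0 < e n" "e n \<le> 1" for n by (auto simp: e_def)
    have el: "e \<longlonglongrightarrow> 0" unfolding e_def by (rule LIMSEQ_inverse_real_of_nat[unfolded inverse_eq_divide])
    note pl = pairing_limit[OF t e(1) el]
    have ihp: "integrable ?LZ (\<lambda>z. (M1 + M * p z) * \<phi> z)" by (rule integrable_mult_test[OF ih test_fun_continuous[OF t] L(2)])
    have bd: "\<bar>\<integral>z. \<phi> z * Rr (e n) z \<partial>lborel\<bar> \<le> (\<integral>z. (M1 + M * p z) * \<phi> z \<partial>?LZ)" for n
    proof -
      have z0: "\<phi> z * Rr (e n) z = 0" if "z \<notin> Z" for z using test_fun_zero_outside[OF t that] by simp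
      note lz = lebesgue_on_lborel_zero_outside[OF pl(1)[of n] z0 Zs]
      have "\<bar>\<integral>z. \<phi> z * Rr (e n) z \<partial>lborel\<bar> \<le> (\<integral>z. \<bar>\<phi> z * Rr (e n) z\<bar> \<partial>?LZ)"
        by (rule ord_eq_le_trans[OF arg_cong[OF lz(2)[symmetric], of abs] integral_abs_bound])
      also have "\<dots> \<le> (\<integral>z. (M1 + M * p z) * \<phi> z \<partial>?LZ)"
      proof (rule integral_mono_AE)
        show "integrable ?LZ (\<lambda>z. \<bar>\<phi> z * Rr (e n) z\<bar>)" using lz(1) by (rule integrable_abs)
        show "integrable ?LZ (\<lambda>z. (M1 + M * p z) * \<phi> z)" by (rule ihp)
        show "AE z in ?LZ. \<bar>\<phi> z * Rr (e n) z\<bar> \<le> (M1 + M * p z) * \<phi> z"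
          using finAE AE_space
        proof eventually_elim
          case (elim z)
          then have "\<bar>Rr (e n) z\<bar> \<le> M1 + M * p z" using Rb[OF e, of z n] by simp
          then show ?case using nn[of z] by (simp add: abs_mult mult.commute mult_left_mono)
        qed
      qed
      finally show ?thesis .
    qed
    have "(\<lambda>n. \<bar>\<integral>z. \<phi> z * Rr (e n) z \<partial>lborel\<bar>) \<longlonglongrightarrow> \<bar>?c * (\<integral>x. \<theta> x * \<phi> x \<partial>?L)\<bar>" using pl(2) by (rule tendsto_rabs)
    then have "\<bar>?c * (\<integral>x. \<theta> x * \<phi> x \<partial>?L)\<bar> \<le> (\<integral>z. (M1 + M * p z) * \<phi> z \<partial>?LZ)"
      by (rule LIMSEQ_le_const2) (use bd in blast)
    moreover have "(\<integral>x. \<theta> x * \<phi> x \<partial>?L) = (\<integral>x. \<theta> x * \<phi> x \<partial>?LZ)"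
      by (rule integral_lebesgue_on_zero_outside[OF Z(2) Os Zs]) (use test_fun_zero_outside[OF t] in auto)
    moreover have "(\<integral>x. ?c * \<theta> x * \<phi> x \<partial>?LZ) = ?c * (\<integral>x. \<theta> x * \<phi> x \<partial>?LZ)" by (simp add: mult.assoc)
    ultimately show "\<bar>\<integral>x. ?c * \<theta> x * \<phi> x \<partial>?LZ\<bar> \<le> (\<integral>z. (M1 + M * p z) * \<phi> z \<partial>?LZ)" by simp
  qed
  then have "AE z in ?LZ. ennreal \<bar>\<theta> z\<bar> \<le> ennreal ((M1 + M) / ?c) + ennreal ((M1 + M) / ?c) * Pot z"
    using finAE
  proof eventually_elim
    case (elim z)
    have p0: "0 \<le> p z" unfolding p_def by simp
    have "?c * \<bar>\<theta> z\<bar> \<le> M1 + M * p z" using elim(1) c0 by (simp add: abs_mult)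
    also have "\<dots> \<le> (M1 + M) + (M1 + M) * p z" using M(1) M10 p0 by (intro add_mono mult_right_mono) auto
    finally have "\<bar>\<theta> z\<bar> \<le> ((M1 + M) + (M1 + M) * p z) / ?c" using c0 by (simp add: field_simps)
    moreover have "((M1 + M) + (M1 + M) * p z) / ?c = (M1 + M) / ?c + (M1 + M) / ?c * p z" using c0 by (simp add: field_simps)
    ultimately have "\<bar>\<theta> z\<bar> \<le> (M1 + M) / ?c + (M1 + M) / ?c * p z" by (simp only:)
    then have "ennreal \<bar>\<theta> z\<bar> \<le> ennreal ((M1 + M) / ?c + (M1 + M) / ?c * p z)" by (rule ennreal_leI)
    also have "\<dots> = ennreal ((M1 + M) / ?c) + ennreal ((M1 + M) / ?c * p z)"
      using M(1) M10 c0 p0 by (intro ennreal_plus mult_nonneg_nonneg divide_nonneg_pos add_nonneg_nonneg)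
    also have "ennreal ((M1 + M) / ?c * p z) = ennreal ((M1 + M) / ?c) * ennreal (p z)"
      using M(1) M10 c0 p0 by (intro ennreal_mult divide_nonneg_pos add_nonneg_nonneg)
    also have "ennreal (p z) = Pot z" unfolding p_def using elim(2) by (simp add: ennreal_enn2real_if)
    finally show ?case .
  qed
  then show ?thesis by (intro that[of "(M1 + M) / ?c"]) (use M(1) M10 c0 in \<open>auto simp: Pot_def\<close>)
qed

text \<open>The representation is paired with a partial derivative of a test function. In the limit
  this is, up to the mass, minus the pairing with the weak derivative of \<theta>; for e > 0 the
  derivative is moved onto the pole variable of the kernels. With \<theta> already bounded, only the
  integral over x of the differentiated kernel matters, which is at most a multiple of
  \<open>dd z powr (- \<alpha>)\<close> plus a constant.\<close>

lemma gradient_bound: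
  assumes al: "0 < \<alpha>" "\<alpha> < 1" and B: "AE x in lebesgue_on \<Omega>. \<bar>\<theta> x\<bar> \<le> B"
    and idd: "integrable (lebesgue_on Z) (\<lambda>z. dd z powr (- \<alpha>))"
  obtains M where "0 \<le> M" "AE z in lebesgue_on Z. \<bar>g z $ i\<bar> \<le> M * (dd z powr (- \<alpha>) + 1)"
proof -
  let ?L = "lebesgue_on \<Omega>" and ?LZ = "lebesgue_on Z"
  let ?s = "- (real CARD('n) - \<alpha>)"
  let ?c = "delta_mass TYPE('n)"
  interpret LO: sigma_finite_measure ?L by (rule sigma_finite_lebesgue_on[OF Os])
  interpret LZ: sigma_finite_measure ?LZ by (rule sigma_finite_lebesgue_on[OF Zs])
  interpret P: pair_sigma_finite ?L ?LZ ..
  interpret FO: finite_measure ?L using Om by (intro finite_measure_bounded_open)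
  interpret FZ: finite_measure ?LZ using Om(1) Z by (intro finite_measure_bounded_open) (auto intro: bounded_subset)
  have B': "AE x in ?L. \<bar>\<theta> x\<bar> \<le> max 0 B" using B by eventually_elim auto
  obtain M where M: "0 \<le> M"
    "\<And>e x z i. 0 < e \<Longrightarrow> e \<le> 1 \<Longrightarrow> x \<in> \<Omega> \<Longrightarrow> z \<in> Z \<Longrightarrow> x \<noteq> z \<Longrightarrow>
       \<bar>pd i (K1 e x) z\<bar> \<le> M * (dd z powr (- \<alpha>) * norm (x - z) powr ?s) + M"
    "\<And>e x z i j. 0 < e \<Longrightarrow> e \<le> 1 \<Longrightarrow> x \<in> \<Omega> \<Longrightarrow> z \<in> Z \<Longrightarrow> \<bar>pd i (K2 e j x) z\<bar> \<le> M"
    by (rule kernel_pd_bounds[OF al]) (rule that; blast)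
  obtain D where D: "0 \<le> D" "\<And>z. z \<in> \<Omega> \<Longrightarrow> (\<integral>\<^sup>+x. ennreal (norm (x - z) powr ?s) \<partial>?L) \<le> ennreal D"
  proof -
    have "0 \<le> real CARD('n) - \<alpha>" using al by (simp add: Suc_leI order.trans[of \<alpha> 1])
    then show ?thesis using nn_integral_riesz_bounded[OF Om, of "real CARD('n) - \<alpha>"] al that by auto
  qed
  define m where "m = measure ?L (space ?L)"
  have m0: "0 \<le> m" unfolding m_def by simp
  define G where "G = (\<Sum>j\<in>UNIV. M * (\<integral>x. \<bar>g x $ j\<bar> \<partial>?L))"
  have G0: "0 \<le> G" unfolding G_def using M(1) by (intro sum_nonneg mult_nonneg_nonneg integral_nonneg_AE) auto
  \<comment> \<open>The pointwise majorant: the bounded \<theta> against the pole derivative of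
    \<open>K1\<close> gives the first term, the integrable gradient against the bounded pole
    derivative of \<open>K2\<close> gives \<open>G\<close>.\<close>
  define h where "h z = max 0 B * (M * D * dd z powr (- \<alpha>) + M * m) + G" for z
  have h0: "0 \<le> h z" for z unfolding h_def using M(1) D(1) m0 G0 by (intro add_nonneg_nonneg mult_nonneg_nonneg) auto
  have ih: "integrable ?LZ h" unfolding h_def using idd by (intro Bochner_Integration.integrable_add integrable_mult_right FZ.integrable_const)
  have ddm: "(\<lambda>z. dd z powr (- \<alpha>)) \<in> borel_measurable ?LZ" using idd by simp
  have iZ: "integrable ?LZ (\<lambda>z. g z $ i)" by (rule integrable_lebesgue_on_subset[OF gi Z(2) Os Zs])
  have c0: "0 < ?c" by (rule delta_mass_pos)
  have main: "AE z in ?LZ. \<bar>?c * g z $ i\<bar> \<le> h z"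
  proof (rule fundamental_lemma_abs[OF Z(1) _ ih])
    show "integrable ?LZ (\<lambda>z. ?c * g z $ i)" using iZ by simp
    fix \<phi> assume t: "test_fun Z \<phi>" and nn: "\<And>x. 0 \<le> \<phi> x"
    note t' = test_fun_pd[OF t, of i]
    have tO: "test_fun \<Omega> \<phi>" using t Z(2) by (auto simp: test_fun_def)
    obtain L where L: "0 \<le> L" "\<And>x. \<bar>\<phi> x\<bar> \<le> L" using test_fun_bounded[OF t] by blast
    obtain R where R: "\<And>x. x \<notin> cball 0 R \<Longrightarrow> \<phi> x = 0" using test_fun_bounded_support[OF t] by blast
    have c\<phi>: "continuous_on UNIV \<phi>" by (rule test_fun_continuous[OF t])
    have i\<phi>: "integrable lborel \<phi>" by (rule integrable_continuous_bounded_support[OF c\<phi> R])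
    note zZ = lebesgue_on_lborel_zero_outside[OF i\<phi> test_fun_zero_outside[OF t] Zs]
    define e where "e n = 1 / real (Suc n)" for n
    have e: "0 < e n" "e n \<le> 1" for n by (auto simp: e_def)
    have el: "e \<longlonglongrightarrow> 0" unfolding e_def by (rule LIMSEQ_inverse_real_of_nat[unfolded inverse_eq_divide])
    note pl = pairing_limit[OF t' e(1) el]
    have ihp: "integrable ?LZ (\<lambda>z. h z * \<phi> z)" by (rule integrable_mult_test[OF ih c\<phi> L(2)])
    have iddp: "integrable ?LZ (\<lambda>z. dd z powr (- \<alpha>) * \<phi> z)" by (rule integrable_mult_test[OF idd c\<phi> L(2)])
    \<comment> \<open>Stated for a general density and kernel, because it serves \<theta> with
      \<open>K1\<close> as well as each component of \<open>g\<close> with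
      \<open>K2\<close>.\<close>
    have fub: "integrable ?L (\<lambda>x. f x * (\<integral>z. pd i \<phi> z * K e x z \<partial>lborel))"
        "integrable lborel (\<lambda>z. pd i \<phi> z * (\<integral>x. f x * K e x z \<partial>?L))"
        "(\<integral>z. pd i \<phi> z * (\<integral>x. f x * K e x z \<partial>?L) \<partial>lborel) = - (\<integral>x. f x * (\<integral>z. \<phi> z * pd i (K e x) z \<partial>lborel) \<partial>?L)"
        "integrable ?L (\<lambda>x. f x * (\<integral>z. \<phi> z * pd i (K e x) z \<partial>lborel))"
      if f: "integrable ?L f" and cK: "continuous_on UNIV (\<lambda>p. K e (fst p) (snd p))" and sK: "\<And>x. smooth_on UNIV (K e x)"
      for f and K :: "real \<Rightarrow> real^'n \<Rightarrow> real^'n \<Rightarrow> real" and e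
    proof -
      have c: "continuous_on UNIV (\<lambda>p. pd i \<phi> (snd p) * K e (fst p) (snd p))"
        by (rule continuous_on_mult[OF continuous_on_compose2[OF test_fun_continuous[OF t'] continuous_on_snd[OF continuous_on_id]] cK]) simp
      obtain k where k: "integrable lborel k" "\<And>x z. x \<in> \<Omega> \<Longrightarrow> \<bar>pd i \<phi> z * K e x z\<bar> \<le> k z"
        by (rule kernel_dominated[of \<Omega> "\<lambda>x z. pd i \<phi> z * K e x z" R, OF Om(1) c]) (use pd_zero_outside[of R \<phi>] R in \<open>simp, blast\<close>)
      note fk = fubini_kernel[of \<Omega> f "\<lambda>x z. pd i \<phi> z * K e x z" k, OF Os f borel_measurable_kernelI[OF c] k]
      have eq: "(\<integral>x. f x * (pd i \<phi> z * K e x z) \<partial>?L) = pd i \<phi> z * (\<integral>x. f x * K e x z \<partial>?L)" for z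
      proof -
        have "(\<integral>x. f x * (pd i \<phi> z * K e x z) \<partial>?L) = (\<integral>x. pd i \<phi> z * (f x * K e x z) \<partial>?L)" by (simp only: mult.left_commute)
        then show ?thesis by simp
      qed
      have bp: "(\<integral>z. pd i \<phi> z * K e x z \<partial>lborel) = - (\<integral>z. \<phi> z * pd i (K e x) z \<partial>lborel)" for x
        using integral_by_parts_lborel[OF sK[of x] test_fun_smooth[OF t] R, where i = i] by (simp only: mult.commute)
      show "integrable ?L (\<lambda>x. f x * (\<integral>z. pd i \<phi> z * K e x z \<partial>lborel))" by (rule fk(1))
      then have "integrable ?L (\<lambda>x. - (f x * (\<integral>z. pd i \<phi> z * K e x z \<partial>lborel)))" by simp
      then show "integrable ?L (\<lambda>x. f x * (\<integral>z. \<phi> z * pd i (K e x) z \<partial>lborel))" unfolding bp by simp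
      show "integrable lborel (\<lambda>z. pd i \<phi> z * (\<integral>x. f x * K e x z \<partial>?L))" using fk(2) unfolding eq .
      show "(\<integral>z. pd i \<phi> z * (\<integral>x. f x * K e x z \<partial>?L) \<partial>lborel) = - (\<integral>x. f x * (\<integral>z. \<phi> z * pd i (K e x) z \<partial>lborel) \<partial>?L)"
        using fk(3) unfolding eq bp by simp
    qed
    have bd: "\<bar>\<integral>z. pd i \<phi> z * Rr (e n) z \<partial>lborel\<bar> \<le> (\<integral>z. h z * \<phi> z \<partial>?LZ)" for n
    proof -
      note e1 = e(1)[of n] and e2 = e(2)[of n]
      note f1 = fub[where K = K1, OF th continuous_K1[OF e1] smooth_K1[OF e1]]
      note f2 = fub[where K = "\<lambda>e. K2 e j" and f = "\<lambda>x. g x $ j" for j, OF gi continuous_K2[OF e1] smooth_K2[OF e1]]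
      have cp: "continuous_on UNIV (\<lambda>z. \<phi> z * pd i F z)" if "smooth_on UNIV F" for F
        by (intro continuous_on_mult c\<phi> smooth_on_continuous smooth_on_pd that)
      have ipd: "integrable lborel (\<lambda>z. \<phi> z * pd i F z)" if "smooth_on UNIV F" for F
        by (rule integrable_continuous_bounded_support[OF cp[OF that], of R]) (use R in simp)
      have inZ: "integrable ?LZ (\<lambda>z. \<phi> z * pd i F z)" "(\<integral>z. \<phi> z * pd i F z \<partial>?LZ) = (\<integral>z. \<phi> z * pd i F z \<partial>lborel)" if "smooth_on UNIV F" for F
        using lebesgue_on_lborel_zero_outside[OF ipd[OF that] _ Zs] test_fun_zero_outside[OF t] by auto
      define q where "q = max 0 B * (M * D * (\<integral>z. dd z powr (- \<alpha>) * \<phi> z \<partial>?LZ) + M * m * (\<integral>z. \<phi> z \<partial>?LZ))"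
      have nndd: "0 \<le> (\<integral>z. dd z powr (- \<alpha>) * \<phi> z \<partial>?LZ)" "0 \<le> (\<integral>z. \<phi> z \<partial>?LZ)" using nn by (auto intro!: integral_nonneg_AE)
      have q0: "0 \<le> q" unfolding q_def using M(1) D(1) m0 nndd by (intro mult_nonneg_nonneg add_nonneg_nonneg) auto
      have qe: "ennreal q = ennreal (max 0 B) * ennreal (M * D * (\<integral>z. dd z powr (- \<alpha>) * \<phi> z \<partial>?LZ) + M * m * (\<integral>z. \<phi> z \<partial>?LZ))"
        unfolding q_def by (rule ennreal_mult) (use M(1) D(1) m0 nndd in \<open>auto intro!: add_nonneg_nonneg mult_nonneg_nonneg\<close>)
      \<comment> \<open>Passing to nonnegative integrals first allows Tonelli for the singular
        majorant without prior knowledge of its integrability.\<close>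
      have b1: "\<bar>\<integral>x. \<theta> x * (\<integral>z. \<phi> z * pd i (K1 (e n) x) z \<partial>lborel) \<partial>?L\<bar> \<le> q"
      proof (rule abs_integral_le_nn_integral[OF _ q0 f1(4)])
        let ?k = "\<lambda>x z. ennreal M * (ennreal (dd z powr (- \<alpha>) * \<phi> z) * ennreal (norm (x - z) powr ?s)) + ennreal M * ennreal (\<phi> z)"
        have mk: "(\<lambda>(x, z). ?k x z) \<in> borel_measurable (?L \<Otimes>\<^sub>M ?LZ)"
        proof -
          have m1: "(\<lambda>p. ennreal (dd (snd p) powr (- \<alpha>) * \<phi> (snd p))) \<in> borel_measurable (?L \<Otimes>\<^sub>M ?LZ)"
            by (rule measurable_compose[OF measurable_snd]) (use iddp in simp)
          have m2: "(\<lambda>p. ennreal (\<phi> (snd p))) \<in> borel_measurable (?L \<Otimes>\<^sub>M ?LZ)"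
            by (rule measurable_compose[OF measurable_snd]) (use zZ(1) in simp)
          note m3 = riesz_kernel_measurable[of ?s \<Omega> Z]
          have "(\<lambda>p. ennreal M * (ennreal (dd (snd p) powr (- \<alpha>) * \<phi> (snd p)) * (case p of (x, z) \<Rightarrow> ennreal (norm (x - z) powr ?s))) + ennreal M * ennreal (\<phi> (snd p))) \<in> borel_measurable (?L \<Otimes>\<^sub>M ?LZ)"
            by (intro borel_measurable_add borel_measurable_times_ennreal borel_measurable_const m1 m2 m3)
          then show ?thesis by (simp add: case_prod_beta)
        qed
        have "(\<integral>\<^sup>+x. ennreal \<bar>\<theta> x * (\<integral>z. \<phi> z * pd i (K1 (e n) x) z \<partial>lborel)\<bar> \<partial>?L) \<le> (\<integral>\<^sup>+x. ennreal (max 0 B) * (\<integral>\<^sup>+z. ?k x z \<partial>?LZ) \<partial>?L)"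
        proof (rule nn_integral_mono_AE)
          show "AE x in ?L. ennreal \<bar>\<theta> x * (\<integral>z. \<phi> z * pd i (K1 (e n) x) z \<partial>lborel)\<bar> \<le> ennreal (max 0 B) * (\<integral>\<^sup>+z. ?k x z \<partial>?LZ)"
            using B' AE_space
          proof eventually_elim
            case (elim x)
            then have x: "x \<in> \<Omega>" by simp
            have "ennreal \<bar>\<integral>z. \<phi> z * pd i (K1 (e n) x) z \<partial>lborel\<bar> \<le> (\<integral>\<^sup>+z. ennreal \<bar>\<phi> z * pd i (K1 (e n) x) z\<bar> \<partial>?LZ)"
              using integral_norm_bound_ennreal[OF inZ(1)[OF smooth_K1[OF e1, of x]]] unfolding inZ(2)[OF smooth_K1[OF e1, of x]] by simp
            also have "\<dots> \<le> (\<integral>\<^sup>+z. ?k x z \<partial>?LZ)"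
            proof (rule nn_integral_mono_AE)
              show "AE z in ?LZ. ennreal \<bar>\<phi> z * pd i (K1 (e n) x) z\<bar> \<le> ?k x z"
                using AE_lebesgue_on_neq[OF Zs, of x] AE_space
              proof eventually_elim
                case (elim z)
                then have "\<bar>pd i (K1 (e n) x) z\<bar> \<le> M * (dd z powr (- \<alpha>) * norm (x - z) powr ?s) + M" using M(2)[OF e1 e2 x, of z i] by auto
                from mult_left_mono[OF this nn[of z]]
                have "\<bar>\<phi> z * pd i (K1 (e n) x) z\<bar> \<le> M * ((dd z powr (- \<alpha>) * \<phi> z) * norm (x - z) powr ?s) + M * \<phi> z"
                  using nn[of z] by (simp add: abs_mult algebra_simps)
                then have "ennreal \<bar>\<phi> z * pd i (K1 (e n) x) z\<bar> \<le> ennreal (M * ((dd z powr (- \<alpha>) * \<phi> z) * norm (x - z) powr ?s) + M * \<phi> z)" by (rule ennreal_leI)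
                also have "\<dots> = ?k x z" using M(1) nn[of z] by (simp add: ennreal_mult)
                finally show ?case .
              qed
            qed
            finally have "ennreal \<bar>\<theta> x\<bar> * ennreal \<bar>\<integral>z. \<phi> z * pd i (K1 (e n) x) z \<partial>lborel\<bar> \<le> ennreal (max 0 B) * (\<integral>\<^sup>+z. ?k x z \<partial>?LZ)"
              using elim(1) by (intro mult_mono ennreal_leI) auto
            then show ?case by (simp add: abs_mult ennreal_mult)
          qed
        qed
        also have "\<dots> = ennreal (max 0 B) * (\<integral>\<^sup>+x. \<integral>\<^sup>+z. ?k x z \<partial>?LZ \<partial>?L)"
          by (rule nn_integral_cmult) (use LZ.borel_measurable_nn_integral[OF mk] in simp)
        also have "(\<integral>\<^sup>+x. \<integral>\<^sup>+z. ?k x z \<partial>?LZ \<partial>?L) = (\<integral>\<^sup>+z. \<integral>\<^sup>+x. ?k x z \<partial>?L \<partial>?LZ)" using P.Fubini[OF mk] by simp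
        also have "\<dots> \<le> (\<integral>\<^sup>+z. ennreal (M * D * (dd z powr (- \<alpha>) * \<phi> z) + M * m * \<phi> z) \<partial>?LZ)"
        proof (rule nn_integral_mono)
          fix z assume "z \<in> space ?LZ"
          then have z: "z \<in> \<Omega>" using Z(2) by auto
          have km: "(\<lambda>x. ennreal (norm (x - z) powr ?s)) \<in> borel_measurable ?L"
            using id_borel_measurable_lebesgue_on[of \<Omega>] unfolding id_def by measurable
          have "(\<integral>\<^sup>+x. ?k x z \<partial>?L) = (\<integral>\<^sup>+x. ennreal M * (ennreal (dd z powr (- \<alpha>) * \<phi> z) * ennreal (norm (x - z) powr ?s)) \<partial>?L) + (\<integral>\<^sup>+x. ennreal M * ennreal (\<phi> z) \<partial>?L)"
            by (intro nn_integral_add borel_measurable_times_ennreal borel_measurable_const km)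
          also have "(\<integral>\<^sup>+x. ennreal M * (ennreal (dd z powr (- \<alpha>) * \<phi> z) * ennreal (norm (x - z) powr ?s)) \<partial>?L) = ennreal M * (ennreal (dd z powr (- \<alpha>) * \<phi> z) * (\<integral>\<^sup>+x. ennreal (norm (x - z) powr ?s) \<partial>?L))"
            using km by (simp add: nn_integral_cmult borel_measurable_times_ennreal)
          also have "(\<integral>\<^sup>+x. ennreal M * ennreal (\<phi> z) \<partial>?L) = ennreal M * ennreal (\<phi> z) * ennreal m"
            unfolding m_def by (simp add: FO.emeasure_eq_measure)
          also have "ennreal M * (ennreal (dd z powr (- \<alpha>) * \<phi> z) * (\<integral>\<^sup>+x. ennreal (norm (x - z) powr ?s) \<partial>?L)) \<le> ennreal M * (ennreal (dd z powr (- \<alpha>) * \<phi> z) * ennreal D)"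
            using D(2)[OF z] by (intro mult_left_mono) auto
          also have "ennreal M * (ennreal (dd z powr (- \<alpha>) * \<phi> z) * ennreal D) + ennreal M * ennreal (\<phi> z) * ennreal m = ennreal (M * D * (dd z powr (- \<alpha>) * \<phi> z) + M * m * \<phi> z)"
            using M(1) D(1) nn[of z] m0 by (simp add: ennreal_mult mult_ac)
          finally show "(\<integral>\<^sup>+x. ?k x z \<partial>?L) \<le> ennreal (M * D * (dd z powr (- \<alpha>) * \<phi> z) + M * m * \<phi> z)" by (simp add: add_right_mono)
        qed
        also have "\<dots> = ennreal (\<integral>z. M * D * (dd z powr (- \<alpha>) * \<phi> z) + M * m * \<phi> z \<partial>?LZ)"
          by (rule nn_integral_eq_integral) (use iddp zZ(1) M(1) D(1) m0 nn in auto)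
        also have "(\<integral>z. M * D * (dd z powr (- \<alpha>) * \<phi> z) + M * m * \<phi> z \<partial>?LZ) = M * D * (\<integral>z. dd z powr (- \<alpha>) * \<phi> z \<partial>?LZ) + M * m * (\<integral>z. \<phi> z \<partial>?LZ)"
          using iddp zZ(1) by simp
        finally show "(\<integral>\<^sup>+x. ennreal \<bar>\<theta> x * (\<integral>z. \<phi> z * pd i (K1 (e n) x) z \<partial>lborel)\<bar> \<partial>?L) \<le> ennreal q"
          unfolding qe by (simp add: mult_left_mono del: ennreal_plus)
      qed
      have b2: "\<bar>\<integral>x. g x $ j * (\<integral>z. \<phi> z * pd i (K2 (e n) j x) z \<partial>lborel) \<partial>?L\<bar> \<le> M * (\<integral>x. \<bar>g x $ j\<bar> \<partial>?L) * (\<integral>z. \<phi> z \<partial>?LZ)" for j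
      proof -
        have s: "\<bar>\<integral>z. \<phi> z * pd i (K2 (e n) j x) z \<partial>lborel\<bar> \<le> M * (\<integral>z. \<phi> z \<partial>?LZ)" if x: "x \<in> \<Omega>" for x
        proof -
          have "\<bar>\<integral>z. \<phi> z * pd i (K2 (e n) j x) z \<partial>?LZ\<bar> \<le> (\<integral>z. \<bar>\<phi> z * pd i (K2 (e n) j x) z\<bar> \<partial>?LZ)" by (rule integral_abs_bound)
          also have "\<dots> \<le> (\<integral>z. M * \<phi> z \<partial>?LZ)"
          proof (rule integral_mono)
            show "integrable ?LZ (\<lambda>z. \<bar>\<phi> z * pd i (K2 (e n) j x) z\<bar>)" by (rule integrable_abs[OF inZ(1)[OF smooth_K2[OF e1]]])
            show "integrable ?LZ (\<lambda>z. M * \<phi> z)" using zZ(1) by simp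
            show "\<bar>\<phi> z * pd i (K2 (e n) j x) z\<bar> \<le> M * \<phi> z" if "z \<in> space ?LZ" for z
              using mult_left_mono[OF M(3)[OF e1 e2 x, of z i j] nn[of z]] that nn[of z] by (simp add: abs_mult mult.commute)
          qed
          finally show ?thesis unfolding inZ(2)[OF smooth_K2[OF e1]] by simp
        qed
        have "\<bar>\<integral>x. g x $ j * (\<integral>z. \<phi> z * pd i (K2 (e n) j x) z \<partial>lborel) \<partial>?L\<bar> \<le> (\<integral>x. \<bar>g x $ j * (\<integral>z. \<phi> z * pd i (K2 (e n) j x) z \<partial>lborel)\<bar> \<partial>?L)" by (rule integral_abs_bound)
        also have "\<dots> \<le> (\<integral>x. \<bar>g x $ j\<bar> * (M * (\<integral>z. \<phi> z \<partial>?LZ)) \<partial>?L)"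
        proof (rule integral_mono)
          show "integrable ?L (\<lambda>x. \<bar>g x $ j * (\<integral>z. \<phi> z * pd i (K2 (e n) j x) z \<partial>lborel)\<bar>)" by (rule integrable_abs[OF f2(4)])
          show "integrable ?L (\<lambda>x. \<bar>g x $ j\<bar> * (M * (\<integral>z. \<phi> z \<partial>?LZ)))" using gi by simp
          show "\<bar>g x $ j * (\<integral>z. \<phi> z * pd i (K2 (e n) j x) z \<partial>lborel)\<bar> \<le> \<bar>g x $ j\<bar> * (M * (\<integral>z. \<phi> z \<partial>?LZ))" if "x \<in> space ?L" for x
            unfolding abs_mult using s[of x] that by (intro mult_left_mono) auto
        qed
        also have "\<dots> = M * (\<integral>x. \<bar>g x $ j\<bar> \<partial>?L) * (\<integral>z. \<phi> z \<partial>?LZ)" by simp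
        finally show ?thesis .
      qed
      have "(\<integral>z. pd i \<phi> z * Rr (e n) z \<partial>lborel) = (\<integral>z. pd i \<phi> z * (\<integral>x. \<theta> x * K1 (e n) x z \<partial>?L) + (\<Sum>j\<in>UNIV. pd i \<phi> z * (\<integral>x. g x $ j * K2 (e n) j x z \<partial>?L)) \<partial>lborel)"
        unfolding Rr_def by (simp only: distrib_left sum_distrib_left)
      also have "\<dots> = (\<integral>z. pd i \<phi> z * (\<integral>x. \<theta> x * K1 (e n) x z \<partial>?L) \<partial>lborel) + (\<Sum>j\<in>UNIV. \<integral>z. pd i \<phi> z * (\<integral>x. g x $ j * K2 (e n) j x z \<partial>?L) \<partial>lborel)"
        using f1(2) f2(2) by (subst Bochner_Integration.integral_add) (auto intro!: Bochner_Integration.integrable_sum Bochner_Integration.integral_sum)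
      also have "\<dots> = - (\<integral>x. \<theta> x * (\<integral>z. \<phi> z * pd i (K1 (e n) x) z \<partial>lborel) \<partial>?L) + (\<Sum>j\<in>UNIV. - (\<integral>x. g x $ j * (\<integral>z. \<phi> z * pd i (K2 (e n) j x) z \<partial>lborel) \<partial>?L))"
        by (simp only: f1(3) f2(3))
      finally have "\<bar>\<integral>z. pd i \<phi> z * Rr (e n) z \<partial>lborel\<bar> \<le> q + (\<Sum>j\<in>UNIV. M * (\<integral>x. \<bar>g x $ j\<bar> \<partial>?L) * (\<integral>z. \<phi> z \<partial>?LZ))"
        using b1 b2 by (simp only:) (intro order_trans[OF abs_triangle_ineq add_mono] order_trans[OF sum_abs sum_mono], simp_all)
      also have "\<dots> = q + G * (\<integral>z. \<phi> z \<partial>?LZ)" unfolding G_def by (simp only: sum_distrib_right)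
      also have "\<dots> = (\<integral>z. h z * \<phi> z \<partial>?LZ)"
      proof -
        have "(\<integral>z. h z * \<phi> z \<partial>?LZ) = (\<integral>z. max 0 B * (M * D) * (dd z powr (- \<alpha>) * \<phi> z) + (max 0 B * (M * m) + G) * \<phi> z \<partial>?LZ)"
          unfolding h_def by (simp only: algebra_simps)
        also have "\<dots> = max 0 B * (M * D) * (\<integral>z. dd z powr (- \<alpha>) * \<phi> z \<partial>?LZ) + (max 0 B * (M * m) + G) * (\<integral>z. \<phi> z \<partial>?LZ)"
          using iddp zZ(1) by simp
        finally show ?thesis unfolding q_def by (simp only: algebra_simps)
      qed
      finally show ?thesis .
    qed
    have "(\<lambda>n. \<bar>\<integral>z. pd i \<phi> z * Rr (e n) z \<partial>lborel\<bar>) \<longlonglongrightarrow> \<bar>?c * (\<integral>x. \<theta> x * pd i \<phi> x \<partial>?L)\<bar>" using pl(2) by (rule tendsto_rabs)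
    then have "\<bar>?c * (\<integral>x. \<theta> x * pd i \<phi> x \<partial>?L)\<bar> \<le> (\<integral>z. h z * \<phi> z \<partial>?LZ)"
      by (rule LIMSEQ_le_const2) (use bd in blast)
    moreover have "(\<integral>x. \<theta> x * pd i \<phi> x \<partial>?L) = - (\<integral>x. g x $ i * \<phi> x \<partial>?L)" using wg tO unfolding weak_grad_def by blast
    moreover have "(\<integral>x. g x $ i * \<phi> x \<partial>?L) = (\<integral>x. g x $ i * \<phi> x \<partial>?LZ)"
      by (rule integral_lebesgue_on_zero_outside[OF Z(2) Os Zs]) (use test_fun_zero_outside[OF t] in auto)
    moreover have "(\<integral>x. ?c * g x $ i * \<phi> x \<partial>?LZ) = ?c * (\<integral>x. g x $ i * \<phi> x \<partial>?LZ)" by (simp add: mult.assoc)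
    ultimately show "\<bar>\<integral>x. ?c * g x $ i * \<phi> x \<partial>?LZ\<bar> \<le> (\<integral>z. h z * \<phi> z \<partial>?LZ)" by (simp add: abs_mult)
  qed
  define M' where "M' = (max 0 B * (M * D) + max 0 B * (M * m) + G) / ?c"
  have nn: "0 \<le> max 0 B * (M * D)" "0 \<le> max 0 B * (M * m)" using M(1) D(1) m0 by (auto intro!: mult_nonneg_nonneg)
  show ?thesis
  proof (rule that[of M'])
    show "0 \<le> M'" unfolding M'_def using nn G0 c0 by simp
    show "AE z in ?LZ. \<bar>g z $ i\<bar> \<le> M' * (dd z powr (- \<alpha>) + 1)"
      using main
    proof eventually_elim
      case (elim z)
      have "?c * \<bar>g z $ i\<bar> \<le> h z" using elim c0 by (simp add: abs_mult)
      also have "h z = max 0 B * (M * D) * dd z powr (- \<alpha>) + (max 0 B * (M * m) + G)" unfolding h_def by (simp only: algebra_simps)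
      also have "\<dots> \<le> (max 0 B * (M * D) + max 0 B * (M * m) + G) * dd z powr (- \<alpha>) + (max 0 B * (M * D) + max 0 B * (M * m) + G)"
        using nn G0 by (intro add_mono mult_right_mono) auto
      also have "\<dots> = ?c * (M' * (dd z powr (- \<alpha>) + 1))" unfolding M'_def using c0 by (simp add: field_simps)
      finally show ?case using c0 by simp
    qed
  qed
qed

end

subsection \<open>Geometry near a smooth boundary point\<close>

lemma smooth_on_Un:
  assumes "open A" "open B" "smooth_on A f" "smooth_on B f"
  shows "smooth_on (A \<union> B) f"
proof -
  have "Ck_on k (A \<union> B) f" if "smooth_on A f" "smooth_on B f" for k f
    using that
  proof (induction k arbitrary: f)
    case 0
    then show ?case using assms(1,2) smooth_on_continuous by (auto intro!: continuous_on_open_Un)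
  next
    case (Suc k)
    have "Ck_on k (A \<union> B) (pd i f)" for i by (rule Suc.IH) (rule smooth_on_pd, rule Suc.prems)+
    moreover have "f differentiable (at x)" if "x \<in> A \<union> B" for x
      using that smooth_on_diff[OF Suc.prems(1)] smooth_on_diff[OF Suc.prems(2)] by blast
    moreover have "continuous_on (A \<union> B) f"
      by (rule continuous_on_open_Un[OF assms(1,2)]) (rule smooth_on_continuous, rule Suc.prems)+
    ultimately show ?case by simp
  qed
  then show ?thesis using assms by (simp add: smooth_on_def)
qed

text \<open>Smoothness is local: \<open>U\<close> and the complement of \<open>K\<close> are open
  and cover the space, and on the latter the product is identically 0.\<close>

lemma smooth_on_cutoff_extend:
  assumes "open U" "closed K" "K \<subseteq> U" "smooth_on UNIV \<kappa>" "\<And>x. x \<notin> K \<Longrightarrow> \<kappa> x = 0" "smooth_on U f"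
  shows "smooth_on UNIV (\<lambda>x. \<kappa> x * f x)"
proof -
  have "smooth_on U (\<lambda>x. \<kappa> x * f x)"
    by (rule smooth_on_mult[OF assms(1) smooth_on_subset[OF assms(4)] assms(6)]) simp
  moreover have "smooth_on (- K) (\<lambda>x. \<kappa> x * f x)"
    by (rule smooth_on_cong[of "- K" "\<lambda>x. 0"]) (use assms in auto)
  ultimately have "smooth_on (U \<union> - K) (\<lambda>x. \<kappa> x * f x)" using assms(1,2) by (intro smooth_on_Un) auto
  moreover have "U \<union> - K = UNIV" using assms(3) by auto
  ultimately show ?thesis by simp
qed

lemma cutoff_ball_ex:
  fixes x0 :: "real^'n::finite"
  assumes "0 < r"
  shows "\<exists>\<eta>. smooth_on UNIV \<eta> \<and> (\<forall>x\<in>ball x0 r. \<eta> x = 1) \<and> (\<forall>x. x \<notin> cball x0 (2 * r) \<longrightarrow> \<eta> x = 0) \<and> (\<forall>x. 0 \<le> \<eta> x \<and> \<eta> x \<le> 1)"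
proof (rule cutoff_ball[OF assms, of x0])
  fix \<eta> :: "real^'n \<Rightarrow> real"
  assume "smooth_on UNIV \<eta>" "\<And>x. x \<in> ball x0 r \<Longrightarrow> \<eta> x = 1" "\<And>x. x \<notin> cball x0 (2 * r) \<Longrightarrow> \<eta> x = 0" "\<And>x. 0 \<le> \<eta> x" "\<And>x. \<eta> x \<le> 1"
  then show ?thesis by (intro exI[of _ \<eta>]) auto
qed

text \<open>The local defining function and the field grad / |grad|^2 are multiplied by a cutoff, so
  that both become smooth on the whole space as the kernel calculus requires; near x0 nothing
  changes. \<open>V\<close> is normalised so that its inner product with the gradient of
  \<open>P\<close> is 1 there.\<close>

lemma boundary_defining_function:
  fixes \<Omega> :: "(real^'n::finite) set"
  assumes Om: "open \<Omega>" and sb: "smooth_boundary \<Omega>" and x0: "x0 \<in> frontier \<Omega>"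
  obtains P V R where "smooth_on UNIV P" "\<And>k. smooth_on UNIV (V k)" "0 < R" "\<And>x. x \<notin> cball 0 (norm x0 + 2 * R) \<Longrightarrow> P x = 0"
    "P x0 = 0" "\<And>x. x \<in> ball x0 R \<Longrightarrow> x \<in> \<Omega> \<longleftrightarrow> P x < 0"
    "\<And>x. x \<in> ball x0 R \<Longrightarrow> 0 < (\<Sum>j\<in>UNIV. pd j P x * pd j P x)"
    "\<And>x k. x \<in> ball x0 R \<Longrightarrow> V k x = pd k P x / (\<Sum>j\<in>UNIV. pd j P x * pd j P x)"
proof -
  obtain U \<rho> where U: "open U" "x0 \<in> U" "smooth_on U \<rho>" "\<Omega> \<inter> U = {x\<in>U. \<rho> x < 0}"
    "\<forall>x\<in>U. frechet_derivative \<rho> (at x) \<noteq> (\<lambda>v. 0)" using sb x0 unfolding smooth_boundary_def by meson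
  have gpos: "0 < (\<Sum>j\<in>UNIV. pd j \<rho> x * pd j \<rho> x)" if "x \<in> U" for x
  proof -
    have d: "\<rho> differentiable (at x)" by (rule smooth_on_diff[OF U(3) that])
    have "frechet_derivative \<rho> (at x) = (\<lambda>v. \<Sum>i\<in>UNIV. v $ i * pd i \<rho> x)"
      using frechet_derivative_at[OF has_derivative_pd[OF d]] by simp
    then have "\<exists>i. pd i \<rho> x \<noteq> 0" using U(5) that by (metis (no_types, lifting) mult_zero_right sum.neutral)
    then obtain i where "pd i \<rho> x \<noteq> 0" by blast
    then have "0 < pd i \<rho> x * pd i \<rho> x" by (simp add: zero_less_mult_iff linorder_neq_iff disj_commute)
    also have "\<dots> \<le> (\<Sum>j\<in>UNIV. pd j \<rho> x * pd j \<rho> x)" by (rule member_le_sum) auto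
    finally show ?thesis .
  qed
  obtain r where r: "0 < r" "ball x0 r \<subseteq> U" using openE[OF U(1,2)] by blast
  define R where "R = r / 3"
  have R: "0 < R" "cball x0 (2 * R) \<subseteq> U" unfolding R_def using r by (auto simp: subset_iff)
  obtain \<kappa> where "smooth_on UNIV \<kappa>" and "\<forall>x\<in>ball x0 R. \<kappa> x = 1" and "\<forall>x. x \<notin> cball x0 (2 * R) \<longrightarrow> \<kappa> x = 0"
    using cutoff_ball_ex[OF R(1), of x0] by blast
  then have \<kappa>: "smooth_on UNIV \<kappa>" "\<And>x. x \<in> ball x0 R \<Longrightarrow> \<kappa> x = 1" "\<And>x. x \<notin> cball x0 (2 * R) \<Longrightarrow> \<kappa> x = 0" by auto
  define P where "P x = \<kappa> x * \<rho> x" for x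
  define V where "V k x = \<kappa> x * (pd k \<rho> x / (\<Sum>j\<in>UNIV. pd j \<rho> x * pd j \<rho> x))" for k x
  have sP: "smooth_on UNIV P" unfolding P_def
    by (rule smooth_on_cutoff_extend[OF U(1) closed_cball R(2) \<kappa>(1,3) U(3)])
  have sV: "smooth_on UNIV (V k)" for k unfolding V_def
  proof (rule smooth_on_cutoff_extend[OF U(1) closed_cball R(2) \<kappa>(1)])
    show "\<kappa> x = 0" if "x \<notin> cball x0 (2 * R)" for x by (rule \<kappa>(3)[OF that])
    show "smooth_on U (\<lambda>x. pd k \<rho> x / (\<Sum>j\<in>UNIV. pd j \<rho> x * pd j \<rho> x))"
      by (intro smooth_on_divide smooth_on_sum smooth_on_mult smooth_on_pd U(1,3) gpos)
  qed
  have sub: "ball x0 R \<subseteq> U" using R by (intro order_trans[OF _ R(2)]) auto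
  have PR: "P x = \<rho> x" "pd j P x = pd j \<rho> x" if "x \<in> ball x0 R" for x j
  proof -
    show "P x = \<rho> x" using \<kappa>(2)[OF that] by (simp add: P_def)
    show "pd j P x = pd j \<rho> x" by (rule pd_cong_open[OF open_ball that]) (simp only: P_def \<kappa>(2) mult_1)
  qed
  have inO: "x \<in> \<Omega> \<longleftrightarrow> P x < 0" if "x \<in> ball x0 R" for x
  proof -
    have "x \<in> U" using sub that by (rule subsetD)
    then have "x \<in> \<Omega> \<longleftrightarrow> x \<in> {x\<in>U. \<rho> x < 0}" unfolding U(4)[symmetric] by simp
    then show ?thesis using \<open>x \<in> U\<close> by (simp add: PR(1)[OF that])
  qed
  have c: "x0 \<in> ball x0 R" using R by simp
  have "x0 \<notin> \<Omega>" using x0 Om by (simp add: frontier_def interior_open)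
  then have ge: "0 \<le> P x0" using inO[OF c] by simp
  \<comment> \<open>If \<open>P\<close> were positive at x0 it would be positive nearby, yet points
    of \<Omega>, where \<open>P\<close> is negative, accumulate at x0.\<close>
  have le: "P x0 \<le> 0"
  proof (rule ccontr)
    assume "\<not> P x0 \<le> 0"
    then have "x0 \<in> {x. 0 < P x} \<inter> ball x0 R" using c by simp
    moreover have "open ({x. 0 < P x} \<inter> ball x0 R)"
      by (intro open_Int open_ball open_Collect_less continuous_on_const smooth_on_continuous[OF sP])
    moreover have "x0 \<in> closure \<Omega>" using x0 by (simp add: frontier_def)
    ultimately obtain y where "y \<in> \<Omega>" "y \<in> {x. 0 < P x} \<inter> ball x0 R"
      using open_Int_closure_eq_empty[of "{x. 0 < P x} \<inter> ball x0 R" \<Omega>] by blast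
    then show False using inO[of y] by auto
  qed
  show ?thesis
  proof (rule that[OF sP sV R(1)])
    show "P x = 0" if "x \<notin> cball 0 (norm x0 + 2 * R)" for x
    proof -
      have "x \<notin> cball x0 (2 * R)" using that norm_triangle_ineq2[of x x0] by (auto simp: dist_norm norm_minus_commute)
      then show ?thesis using \<kappa>(3) by (simp add: P_def)
    qed
    show "P x0 = 0" using ge le by simp
    show "x \<in> \<Omega> \<longleftrightarrow> P x < 0" if "x \<in> ball x0 R" for x by (rule inO[OF that])
    show "0 < (\<Sum>j\<in>UNIV. pd j P x * pd j P x)" if "x \<in> ball x0 R" for x
      using gpos[of x] sub that by (auto simp: PR(2)[OF that])
    show "V k x = pd k P x / (\<Sum>j\<in>UNIV. pd j P x * pd j P x)" if "x \<in> ball x0 R" for x k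
      using \<kappa>(2)[OF that] by (simp add: V_def PR(2)[OF that])
  qed
qed

text \<open>The derivative is continuous and vanishes off [1,2], hence it is bounded; its support is
  what confines the cutoff error to a boundary layer.\<close>

lemma smooth_step_derivative:
  "\<exists>D c. (\<forall>t. (smooth_step has_real_derivative D t) (at t)) \<and> 0 \<le> c \<and> (\<forall>t. \<bar>D t\<bar> \<le> c) \<and> (\<forall>t. t \<notin> {1..2} \<longrightarrow> D t = 0)"
proof -
  let ?b' = "flat_exp ([:0,0,1:] * (1 - pderiv 1))"
  have b: "(smooth_bump has_real_derivative ?b' t) (at t)" for t unfolding smooth_bump_def by (rule flat_exp_deriv)
  have cb: "continuous_on UNIV smooth_bump" "continuous_on UNIV ?b'"
    using b flat_exp_deriv by (auto intro!: continuous_at_imp_continuous_on intro: DERIV_isCont)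
  define s where "s t = smooth_bump (t - 1) + smooth_bump (2 - t)" for t
  have s0: "s t \<noteq> 0" for t unfolding s_def using smooth_bump_sum_pos[of t] by simp
  define D where "D t = (?b' (t - 1) * s t - smooth_bump (t - 1) * (?b' (t - 1) - ?b' (2 - t))) / (s t * s t)" for t
  have b1: "((\<lambda>t. smooth_bump (t - 1)) has_real_derivative ?b' (t - 1)) (at t)" for t
    by (rule DERIV_chain2[OF b, of "\<lambda>t. t - 1", THEN DERIV_cong]) (auto intro!: derivative_eq_intros)
  have b2: "((\<lambda>t. smooth_bump (2 - t)) has_real_derivative - ?b' (2 - t)) (at t)" for t
    by (rule DERIV_chain2[OF b, of "\<lambda>t. 2 - t", THEN DERIV_cong]) (auto intro!: derivative_eq_intros)
  have ds: "(s has_real_derivative ?b' (t - 1) - ?b' (2 - t)) (at t)" for t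
    unfolding s_def using DERIV_add[OF b1 b2] by simp
  have 1: "(smooth_step has_real_derivative D t) (at t)" for t
  proof -
    have "smooth_step = (\<lambda>t. smooth_bump (t - 1) / s t)" by (rule ext) (simp add: smooth_step_def s_def)
    then show ?thesis using DERIV_divide[OF b1 ds s0, of t] unfolding D_def by simp
  qed
  have cD: "continuous_on UNIV D"
    unfolding D_def s_def using s0 unfolding s_def
    by (intro continuous_on_divide continuous_on_diff continuous_on_mult continuous_on_add
        continuous_on_compose2[OF cb(1)] continuous_on_compose2[OF cb(2)] continuous_on_id continuous_on_const) auto
  have z: "D t = 0" if "t \<notin> {1..2}" for t
  proof (cases "t < 1")
    case True
    have "((\<lambda>t. 0) has_real_derivative 0) (at t)" by simp
    then have "(smooth_step has_real_derivative 0) (at t)"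
      by (rule has_field_derivative_transform_within_open[of _ _ _ "{..<1}"]) (use True in \<open>auto simp: smooth_step_0\<close>)
    then show ?thesis using 1 DERIV_unique by blast
  next
    case False
    then have t2: "2 < t" using that by auto
    have "((\<lambda>t. 1) has_real_derivative 0) (at t)" by simp
    then have "(smooth_step has_real_derivative 0) (at t)"
      by (rule has_field_derivative_transform_within_open[of _ _ _ "{2<..}"]) (use t2 in \<open>auto simp: smooth_step_1\<close>)
    then show ?thesis using 1 DERIV_unique by blast
  qed
  have "compact (D ` {1..2})" by (rule compact_continuous_image[OF continuous_on_subset[OF cD]]) auto
  then have "\<exists>c. \<forall>t\<in>{1..2}. \<bar>D t\<bar> \<le> c" unfolding compact_eq_bounded_closed bounded_iff by auto
  then obtain c where c: "\<forall>t\<in>{1..2}. \<bar>D t\<bar> \<le> c" by blast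
  have c': "\<bar>D t\<bar> \<le> max 0 c" for t
  proof (cases "t \<in> {1..2}")
    case True
    then have "\<bar>D t\<bar> \<le> c" using c by blast
    then show ?thesis by simp
  next
    case False
    then show ?thesis using z[OF False] by simp
  qed
  show ?thesis by (intro exI[of _ D] exI[of _ "max 0 c"] conjI allI impI 1 c' z) simp_all
qed

text \<open>Weak gradients may be tested only with functions compactly supported in \<Omega>, so the
  field is multiplied by smooth_step(-m P). The derivative of this cutoff has size m on the layer 1
  \<le> m |P| \<le> 2, but it meets only the product of the field with the gradient of
  \<open>P\<close>, which is at most c |P|. The error therefore stays bounded and tends to 0
  pointwise.\<close>

lemma tangential_integration_by_parts:
  fixes \<Omega> :: "(real^'n::finite) set" and X :: "'n \<Rightarrow> real^'n \<Rightarrow> real"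
  assumes Om: "bounded \<Omega>" "open \<Omega>" and th: "integrable (lebesgue_on \<Omega>) \<theta>"
    and gi: "\<And>i. integrable (lebesgue_on \<Omega>) (\<lambda>x. g x $ i)" and wg: "weak_grad \<Omega> \<theta> g"
    and X: "\<And>j. smooth_on UNIV (X j)" and P: "smooth_on UNIV P"
    and K: "compact K" "\<And>j x. x \<notin> K \<Longrightarrow> X j x = 0"
    and PK: "\<And>x. x \<in> K \<Longrightarrow> x \<in> \<Omega> \<longleftrightarrow> P x < 0"
    and c: "0 \<le> c" "\<And>x. x \<in> K \<Longrightarrow> x \<in> \<Omega> \<Longrightarrow> \<bar>\<Sum>j\<in>UNIV. X j x * pd j P x\<bar> \<le> c * \<bar>P x\<bar>"
  shows "(\<integral>x. (\<Sum>j\<in>UNIV. g x $ j * X j x) \<partial>lebesgue_on \<Omega>) = - (\<integral>x. \<theta> x * (\<Sum>j\<in>UNIV. pd j (X j) x) \<partial>lebesgue_on \<Omega>)"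
proof -
  let ?L = "lebesgue_on \<Omega>"
  obtain D c0 where D': "\<forall>t. (smooth_step has_real_derivative D t) (at t)" "0 \<le> c0" "\<forall>t. \<bar>D t\<bar> \<le> c0" "\<forall>t. t \<notin> {1..2} \<longrightarrow> D t = 0"
    using smooth_step_derivative by blast
  then have D: "\<And>t. (smooth_step has_real_derivative D t) (at t)" "0 \<le> c0" "\<And>t. \<bar>D t\<bar> \<le> c0" "\<And>t. t \<notin> {1..2} \<Longrightarrow> D t = 0" by blast+
  define s where "s m x = smooth_step (- real m * P x)" for m x
  have mP: "smooth_on UNIV (\<lambda>x. - real m * P x)" for m by (rule smooth_on_mult[OF _ smooth_on_const P]) simp
  have ss: "smooth_on UNIV (s m)" for m unfolding s_def by (rule smooth_on_smooth_step[OF _ mP]) simp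
  have ps: "pd j (s m) x = D (- real m * P x) * (- real m * pd j P x)" for j m x
    unfolding s_def by (subst pd_compose_real[OF smooth_on_diff[OF mP UNIV_I] D(1)]) (simp only: pd_cmult_left[OF P])
  have s01: "0 \<le> s m x" "s m x \<le> 1" for m x unfolding s_def by (rule smooth_step_bounds)+
  have sX: "smooth_on UNIV (\<lambda>x. X j x * s m x)" for j m by (rule smooth_on_mult[OF _ X ss]) simp
  have tf: "test_fun \<Omega> (\<lambda>x. X j x * s m x)" for j m
  proof (rule test_funI[OF sX])
    let ?K = "K \<inter> {x. 1 \<le> - real m * P x}"
    show "compact ?K" by (intro compact_Int_closed K(1) closed_Collect_le continuous_on_const smooth_on_continuous[OF mP])
    show "?K \<subseteq> \<Omega>"
    proof
      fix x assume x: "x \<in> ?K"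
      have "P x < 0"
      proof (rule ccontr)
        assume "\<not> P x < 0"
        then have "- real m * P x \<le> 0" by (simp add: mult_nonneg_nonneg)
        then show False using x by auto
      qed
      then show "x \<in> \<Omega>" using PK[of x] x by blast
    qed
    show "X j x * s m x = 0" if "x \<notin> ?K" for x
      using that K(2)[of x j] smooth_step_0[of "- real m * P x"] by (auto simp: s_def)
  qed
  define E where "E m x = D (- real m * P x) * (- real m) * (\<Sum>j\<in>UNIV. X j x * pd j P x)" for m x
  have divm: "(\<Sum>j\<in>UNIV. pd j (\<lambda>x. X j x * s m x) x) = s m x * (\<Sum>j\<in>UNIV. pd j (X j) x) + E m x" for m x
  proof -
    have "(\<Sum>j\<in>UNIV. pd j (\<lambda>x. X j x * s m x) x) = (\<Sum>j\<in>UNIV. s m x * pd j (X j) x + D (- real m * P x) * (- real m) * (X j x * pd j P x))"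
      by (rule sum.cong[OF refl]) (simp add: pd_mult_smooth[OF X ss] ps algebra_simps)
    then show ?thesis unfolding E_def by (simp only: sum.distrib sum_distrib_left)
  qed
  \<comment> \<open>The factor 2 is the bound for m |P x| on the layer where the derivative of the
    step is nonzero.\<close>
  have Eb: "\<bar>E m x\<bar> \<le> 2 * c0 * c" if x: "x \<in> \<Omega>" for m x
  proof (cases "x \<in> K \<and> - real m * P x \<in> {1..2}")
    case False
    then have "E m x = 0" unfolding E_def using D(4)[of "- real m * P x"] K(2)[of x] by auto
    then show ?thesis using D(2) c(1) by simp
  next
    case True
    have Pn: "P x < 0" using PK[of x] True x by blast
    have "\<bar>E m x\<bar> = \<bar>D (- real m * P x)\<bar> * real m * \<bar>\<Sum>j\<in>UNIV. X j x * pd j P x\<bar>" unfolding E_def by (simp add: abs_mult)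
    also have "\<dots> \<le> c0 * real m * (c * \<bar>P x\<bar>)" using D(2,3) c(2)[of x] True x by (intro mult_mono) auto
    also have "\<dots> = c0 * c * (- real m * P x)" using Pn by simp
    also have "\<dots> \<le> c0 * c * 2" using True D(2) c(1) by (intro mult_left_mono) auto
    finally show ?thesis by simp
  qed
  have El: "(\<lambda>m. E m x) \<longlonglongrightarrow> 0" and sl: "(\<lambda>m. g x $ j * (X j x * s m x)) \<longlonglongrightarrow> g x $ j * X j x"
    and sl': "(\<lambda>m. s m x * (\<Sum>j\<in>UNIV. pd j (X j) x)) \<longlonglongrightarrow> (\<Sum>j\<in>UNIV. pd j (X j) x)" if x: "x \<in> \<Omega>" for x j
  proof -
    have ev: "\<forall>\<^sub>F m in sequentially. 2 < - real m * P x" if "x \<in> K"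
    proof -
      have Pn: "P x < 0" using PK[of x] that x by blast
      obtain m0 where m0: "3 / (- P x) \<le> real m0" using real_arch_simple by blast
      show ?thesis
      proof (rule eventually_mono[OF eventually_ge_at_top[of m0]])
        fix m assume "m0 \<le> m"
        then have "3 / (- P x) \<le> real m" using m0 by linarith
        then have "3 \<le> real m * (- P x)" using Pn by (simp add: field_simps)
        then show "2 < - real m * P x" by simp
      qed
    qed
    have pdX: "pd j (X j) x = 0" if "x \<notin> K" for j
      by (rule pd_zero_outside_closed[OF compact_imp_closed[OF K(1)] K(2) that])
    show "(\<lambda>m. E m x) \<longlonglongrightarrow> 0"
    proof (cases "x \<in> K")
      case True
      show ?thesis by (rule tendsto_eventually) (rule eventually_mono[OF ev[OF True]], simp add: E_def D(4))
    next
      case False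
      then show ?thesis unfolding E_def by (simp add: K(2))
    qed
    have s1: "(\<lambda>m. s m x) \<longlonglongrightarrow> 1" if "x \<in> K"
      by (rule tendsto_eventually) (rule eventually_mono[OF ev[OF that]], simp add: s_def smooth_step_1)
    show "(\<lambda>m. g x $ j * (X j x * s m x)) \<longlonglongrightarrow> g x $ j * X j x"
    proof (cases "x \<in> K")
      case True
      have "(\<lambda>m. g x $ j * (X j x * s m x)) \<longlonglongrightarrow> g x $ j * (X j x * 1)" by (intro tendsto_mult tendsto_const s1 True)
      then show ?thesis by simp
    qed (simp add: K(2))
    show "(\<lambda>m. s m x * (\<Sum>j\<in>UNIV. pd j (X j) x)) \<longlonglongrightarrow> (\<Sum>j\<in>UNIV. pd j (X j) x)"
    proof (cases "x \<in> K")
      case True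
      have "(\<lambda>m. s m x * (\<Sum>j\<in>UNIV. pd j (X j) x)) \<longlonglongrightarrow> 1 * (\<Sum>j\<in>UNIV. pd j (X j) x)" by (intro tendsto_mult tendsto_const s1 True)
      then show ?thesis by simp
    qed (simp add: pdX)
  qed
  have imc: "integrable ?L (\<lambda>x. f x * h x)" if fi: "integrable ?L f" and ch: "continuous_on UNIV h" for f h :: "real^'n \<Rightarrow> real"
  proof -
    obtain L where "\<And>x. x \<in> \<Omega> \<Longrightarrow> \<bar>h x\<bar> \<le> L" using continuous_bounded_on_bounded[OF Om(1) ch] by blast
    then show ?thesis by (rule integrable_mult_test[OF fi ch])
  qed
  have cXj: "continuous_on UNIV (\<lambda>x. \<Sum>j\<in>UNIV. pd j (X j) x)" by (intro continuous_on_sum smooth_on_continuous smooth_on_pd X)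
  obtain A where A: "0 \<le> A" "\<And>x. x \<in> \<Omega> \<Longrightarrow> \<bar>\<Sum>j\<in>UNIV. pd j (X j) x\<bar> \<le> A" using continuous_bounded_on_bounded[OF Om(1) cXj] by blast
  have im: "(\<integral>x. \<theta> x * (s m x * (\<Sum>j\<in>UNIV. pd j (X j) x) + E m x) \<partial>?L) = - (\<integral>x. (\<Sum>j\<in>UNIV. g x $ j * (X j x * s m x)) \<partial>?L)" for m
  proof -
    have i1: "integrable ?L (\<lambda>x. \<theta> x * pd j (\<lambda>x. X j x * s m x) x)" for j
      by (rule imc[OF th smooth_on_continuous[OF smooth_on_pd[OF sX]]])
    have i2: "integrable ?L (\<lambda>x. g x $ j * (X j x * s m x))" for j by (rule imc[OF gi smooth_on_continuous[OF sX]])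
    have "(\<integral>x. \<theta> x * (s m x * (\<Sum>j\<in>UNIV. pd j (X j) x) + E m x) \<partial>?L) = (\<integral>x. (\<Sum>j\<in>UNIV. \<theta> x * pd j (\<lambda>x. X j x * s m x) x) \<partial>?L)"
      unfolding divm[symmetric] by (simp only: sum_distrib_left)
    also have "\<dots> = (\<Sum>j\<in>UNIV. \<integral>x. \<theta> x * pd j (\<lambda>x. X j x * s m x) x \<partial>?L)" by (rule Bochner_Integration.integral_sum) (rule i1)
    also have "\<dots> = (\<Sum>j\<in>UNIV. - (\<integral>x. g x $ j * (X j x * s m x) \<partial>?L))"
      by (rule sum.cong[OF refl]) (use wg tf in \<open>simp add: weak_grad_def\<close>)
    also have "\<dots> = - (\<Sum>j\<in>UNIV. \<integral>x. g x $ j * (X j x * s m x) \<partial>?L)" by (rule sum_negf)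
    also have "(\<Sum>j\<in>UNIV. \<integral>x. g x $ j * (X j x * s m x) \<partial>?L) = (\<integral>x. (\<Sum>j\<in>UNIV. g x $ j * (X j x * s m x)) \<partial>?L)"
      by (rule Bochner_Integration.integral_sum[symmetric]) (rule i2)
    finally show ?thesis .
  qed
  have cD: "continuous_on UNIV (\<lambda>x. s m x * (\<Sum>j\<in>UNIV. pd j (X j) x) + E m x)" for m
    unfolding divm[symmetric] by (intro continuous_on_sum smooth_on_continuous smooth_on_pd sX)
  have l1: "(\<lambda>m. \<integral>x. \<theta> x * (s m x * (\<Sum>j\<in>UNIV. pd j (X j) x) + E m x) \<partial>?L) \<longlonglongrightarrow> (\<integral>x. \<theta> x * (\<Sum>j\<in>UNIV. pd j (X j) x) \<partial>?L)"
  proof (rule integral_dominated_convergence[where w = "\<lambda>x. \<bar>\<theta> x\<bar> * (A + 2 * c0 * c)"])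
    show "(\<lambda>x. \<theta> x * (\<Sum>j\<in>UNIV. pd j (X j) x)) \<in> borel_measurable ?L" by (rule borel_measurable_integrable[OF imc[OF th cXj]])
    show "(\<lambda>x. \<theta> x * (s m x * (\<Sum>j\<in>UNIV. pd j (X j) x) + E m x)) \<in> borel_measurable ?L" for m by (rule borel_measurable_integrable[OF imc[OF th cD]])
    show "integrable ?L (\<lambda>x. \<bar>\<theta> x\<bar> * (A + 2 * c0 * c))" using th by simp
    show "AE x in ?L. (\<lambda>m. \<theta> x * (s m x * (\<Sum>j\<in>UNIV. pd j (X j) x) + E m x)) \<longlonglongrightarrow> \<theta> x * (\<Sum>j\<in>UNIV. pd j (X j) x)"
    proof (rule AE_I2)
      fix x assume "x \<in> space ?L"
      then have x: "x \<in> \<Omega>" by simp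
      have "(\<lambda>m. \<theta> x * (s m x * (\<Sum>j\<in>UNIV. pd j (X j) x) + E m x)) \<longlonglongrightarrow> \<theta> x * ((\<Sum>j\<in>UNIV. pd j (X j) x) + 0)"
        by (rule tendsto_mult[OF tendsto_const tendsto_add[OF sl'[OF x] El[OF x]]])
      then show "(\<lambda>m. \<theta> x * (s m x * (\<Sum>j\<in>UNIV. pd j (X j) x) + E m x)) \<longlonglongrightarrow> \<theta> x * (\<Sum>j\<in>UNIV. pd j (X j) x)" by simp
    qed
    show "AE x in ?L. norm (\<theta> x * (s m x * (\<Sum>j\<in>UNIV. pd j (X j) x) + E m x)) \<le> \<bar>\<theta> x\<bar> * (A + 2 * c0 * c)" for m
    proof (rule AE_I2)
      fix x assume "x \<in> space ?L"
      then have x: "x \<in> \<Omega>" by simp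
      have "\<bar>s m x * (\<Sum>j\<in>UNIV. pd j (X j) x)\<bar> \<le> 1 * A" unfolding abs_mult using s01[of m x] A(2)[OF x] by (intro mult_mono) auto
      then have "\<bar>s m x * (\<Sum>j\<in>UNIV. pd j (X j) x) + E m x\<bar> \<le> A + 2 * c0 * c" using Eb[OF x, of m] by linarith
      then show "norm (\<theta> x * (s m x * (\<Sum>j\<in>UNIV. pd j (X j) x) + E m x)) \<le> \<bar>\<theta> x\<bar> * (A + 2 * c0 * c)"
        unfolding real_norm_def abs_mult[of "\<theta> x"] by (rule mult_left_mono) simp
    qed
  qed
  have l2: "(\<lambda>m. \<integral>x. (\<Sum>j\<in>UNIV. g x $ j * (X j x * s m x)) \<partial>?L) \<longlonglongrightarrow> (\<integral>x. (\<Sum>j\<in>UNIV. g x $ j * X j x) \<partial>?L)"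
  proof (rule integral_dominated_convergence[where w = "\<lambda>x. \<Sum>j\<in>UNIV. \<bar>g x $ j * X j x\<bar>"])
    have i2: "integrable ?L (\<lambda>x. g x $ j * (X j x * s m x))" for j m by (rule imc[OF gi smooth_on_continuous[OF sX]])
    have i3: "integrable ?L (\<lambda>x. g x $ j * X j x)" for j by (rule imc[OF gi smooth_on_continuous[OF X]])
    show "(\<lambda>x. \<Sum>j\<in>UNIV. g x $ j * X j x) \<in> borel_measurable ?L" by (intro borel_measurable_sum borel_measurable_integrable i3)
    show "(\<lambda>x. \<Sum>j\<in>UNIV. g x $ j * (X j x * s m x)) \<in> borel_measurable ?L" for m by (intro borel_measurable_sum borel_measurable_integrable i2)
    show "integrable ?L (\<lambda>x. \<Sum>j\<in>UNIV. \<bar>g x $ j * X j x\<bar>)" by (intro Bochner_Integration.integrable_sum integrable_abs i3)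
    show "AE x in ?L. (\<lambda>m. \<Sum>j\<in>UNIV. g x $ j * (X j x * s m x)) \<longlonglongrightarrow> (\<Sum>j\<in>UNIV. g x $ j * X j x)"
      by (rule AE_I2) (intro tendsto_sum sl, simp)
    show "AE x in ?L. norm (\<Sum>j\<in>UNIV. g x $ j * (X j x * s m x)) \<le> (\<Sum>j\<in>UNIV. \<bar>g x $ j * X j x\<bar>)" for m
    proof (rule AE_I2)
      fix x
      have "\<bar>g x $ j * (X j x * s m x)\<bar> \<le> \<bar>g x $ j * X j x\<bar>" for j
        unfolding mult.assoc[symmetric] abs_mult[of _ "s m x"] using s01[of m x] by (intro mult_left_le) auto
      then show "norm (\<Sum>j\<in>UNIV. g x $ j * (X j x * s m x)) \<le> (\<Sum>j\<in>UNIV. \<bar>g x $ j * X j x\<bar>)"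
        unfolding real_norm_def by (intro order_trans[OF sum_abs sum_mono])
    qed
  qed
  have "(\<lambda>m. - (\<integral>x. (\<Sum>j\<in>UNIV. g x $ j * (X j x * s m x)) \<partial>?L)) \<longlonglongrightarrow> (\<integral>x. \<theta> x * (\<Sum>j\<in>UNIV. pd j (X j) x) \<partial>?L)"
    using l1 unfolding im .
  from LIMSEQ_unique[OF this tendsto_minus[OF l2]] show ?thesis by simp
qed

lemma smooth_locally_Lipschitz:
  fixes F :: "real^'n::finite \<Rightarrow> real"
  assumes F: "smooth_on UNIV F"
  shows "\<exists>L\<ge>0. \<forall>x\<in>cball x0 R. \<forall>y\<in>cball x0 R. \<bar>F x - F y\<bar> \<le> L * norm (x - y)"
proof (rule finite_family_bound[of "cball x0 R" "\<lambda>i. pd i F"])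
  show "bounded (cball x0 R)" by simp
  show "continuous_on UNIV (pd i F)" for i by (rule smooth_on_continuous[OF smooth_on_pd[OF F]])
next
  fix L assume L: "0 \<le> L" "\<And>i x. x \<in> cball x0 R \<Longrightarrow> \<bar>pd i F x\<bar> \<le> L"
  have "\<bar>F x - F y\<bar> \<le> real CARD('n) * L * norm (x - y)" if x: "x \<in> cball x0 R" and y: "y \<in> cball x0 R" for x y
  proof -
    obtain t where t: "0 < t" "t < 1" "F (y + (x - y)) - F y = (\<Sum>i\<in>UNIV. (x - y) $ i * pd i F (y + t *\<^sub>R (x - y)))"
      using smooth_mvt[OF F] by metis
    have "y + t *\<^sub>R (x - y) = (1 - t) *\<^sub>R y + t *\<^sub>R x" by (simp add: algebra_simps)
    then have "y + t *\<^sub>R (x - y) \<in> cball x0 R"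
      using convexD[OF convex_cball y x, of "1 - t" t] t by simp
    from abs_sum_component_le[of "\<lambda>i. pd i F (y + t *\<^sub>R (x - y))", OF L(2)[OF this], of "x - y"]
    show ?thesis using t(3) by simp
  qed
  then show ?thesis using L(1) by (intro exI[of _ "real CARD('n) * L"]) auto
qed

text \<open>The divergence theorem is applied to the compactly supported field \<eta> G grad P,
  where G = P (P^2 + d)^(-1/4) is a smooth version of sign(P) |P|^(1/2). Its divergence contains
  \<eta> G' |grad P|^2 with G' \<ge> (P^2 + d)^(-1/4) / 2, and the other terms are bounded
  independently of d; Fatou's lemma lets d tend to 0. This takes the place of coordinates that
  flatten the boundary.\<close>

lemma boundary_layer_integral:
  fixes P \<eta> :: "real^'n::finite \<Rightarrow> real"
  assumes P: "smooth_on UNIV P" and eta: "smooth_on UNIV \<eta>" "\<And>x. 0 \<le> \<eta> x" "\<And>x. x \<notin> cball 0 R \<Longrightarrow> \<eta> x = 0"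
    and Z: "Z \<in> sets lebesgue" "\<And>z. z \<in> Z \<Longrightarrow> \<eta> z = 1" "\<And>z. z \<in> Z \<Longrightarrow> P z \<noteq> 0"
    and c: "0 < c" "\<And>z. z \<in> Z \<Longrightarrow> c \<le> (\<Sum>j\<in>UNIV. pd j P z * pd j P z)"
  shows "(\<integral>\<^sup>+z. ennreal (\<bar>P z\<bar> powr (- (1/2))) \<partial>lebesgue_on Z) < \<infinity>"
proof -
  \<comment> \<open>\<open>Q\<close> is the divergence of \<eta> grad P, the coefficient of G in the
    divergence of the field.\<close>
  define Q where "Q x = \<eta> x * (\<Sum>j\<in>UNIV. pd j (pd j P) x) + (\<Sum>j\<in>UNIV. pd j \<eta> x * pd j P x)" for x
  define q where "q x = (\<Sum>j\<in>UNIV. pd j P x * pd j P x)" for x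
  have cQ: "continuous_on UNIV Q" unfolding Q_def
    by (intro continuous_on_add continuous_on_mult continuous_on_sum smooth_on_continuous smooth_on_pd P eta)
  have Q0: "Q x = 0" if "x \<notin> cball 0 R" for x
    unfolding Q_def using eta(3)[OF that] pd_zero_outside[of R \<eta>, OF eta(3) that] by simp
  have iQ: "integrable lborel (\<lambda>x. (1 + \<bar>P x\<bar>) * \<bar>Q x\<bar>)"
    by (rule integrable_continuous_bounded_support[of _ R])
       (use Q0 in \<open>auto intro!: continuous_intros cQ smooth_on_continuous[OF P]\<close>)
  define C0 where "C0 = (\<integral>x. (1 + \<bar>P x\<bar>) * \<bar>Q x\<bar> \<partial>lborel)"
  have bd: "(\<integral>\<^sup>+z. ennreal (1/2 * c * ((P z)\<^sup>2 + d) powr (- (1/4))) \<partial>lebesgue_on Z) \<le> ennreal C0" if d: "0 < d" for d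
  proof -
    define w where "w x = (P x)\<^sup>2 + d" for x
    have w0: "0 < w x" for x unfolding w_def using d by (simp add: add_nonneg_pos)
    have sw: "smooth_on UNIV w" unfolding w_def by (intro smooth_on_add smooth_on_power smooth_on_const P) auto
    define G where "G x = P x * w x powr (- (1/4))" for x
    define G' where "G' x = w x powr (- (1/4)) - 1/2 * (P x)\<^sup>2 * w x powr (- (5/4))" for x
    have swp: "smooth_on UNIV (\<lambda>x. w x powr r)" for r by (rule smooth_on_powr[OF _ sw w0]) simp
    have sG: "smooth_on UNIV G" unfolding G_def by (rule smooth_on_mult[OF _ P swp]) simp
    have pw: "pd j w x = 2 * P x * pd j P x" for j x
    proof -
      have "w = (\<lambda>x. P x * P x + d)" by (rule ext) (simp add: w_def power2_eq_square)
      then have "pd j w x = pd j (\<lambda>x. P x * P x + d) x" by simp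
      also have "\<dots> = pd j (\<lambda>x. P x * P x) x + pd j (\<lambda>x. d) x" by (rule pd_add_smooth[OF smooth_on_mult[OF _ P P] smooth_on_const]) simp
      finally show ?thesis by (simp add: pd_mult_smooth[OF P P])
    qed
    have pG: "pd j G x = G' x * pd j P x" for j x
    proof -
      have "pd j G x = P x * pd j (\<lambda>x. w x powr (- (1/4))) x + pd j P x * w x powr (- (1/4))"
        unfolding G_def by (rule pd_mult_smooth[OF P swp])
      also have "pd j (\<lambda>x. w x powr (- (1/4))) x = - (1/4) * w x powr (- (1/4) - 1) * pd j w x"
        by (rule pd_powr[OF smooth_on_diff[OF sw UNIV_I] w0])
      also have "- (1/4) - 1 = (- (5/4) :: real)" by simp
      finally show ?thesis unfolding pw G'_def by (simp add: power2_eq_square algebra_simps)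
    qed
    define X where "X j x = \<eta> x * G x * pd j P x" for j x
    have seG: "smooth_on UNIV (\<lambda>x. \<eta> x * G x)" by (rule smooth_on_mult[OF _ eta(1) sG]) simp
    have sX: "smooth_on UNIV (X j)" for j unfolding X_def by (rule smooth_on_mult[OF _ seG smooth_on_pd[OF P]]) simp
    have X0: "X j x = 0" if "x \<notin> cball 0 R" for j x unfolding X_def using eta(3)[OF that] by simp
    have pX: "(\<Sum>j\<in>UNIV. pd j (X j) x) = G x * Q x + \<eta> x * G' x * q x" for x
    proof -
      have "(\<Sum>j\<in>UNIV. pd j (X j) x) = (\<Sum>j\<in>UNIV. \<eta> x * G x * pd j (pd j P) x + (\<eta> x * (G' x * pd j P x) + pd j \<eta> x * G x) * pd j P x)"
        unfolding X_def by (simp only: pd_mult_smooth[OF seG smooth_on_pd[OF P]] pd_mult_smooth[OF eta(1) sG] pG)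
      also have "\<dots> = (\<Sum>j\<in>UNIV. G x * \<eta> x * pd j (pd j P) x + G x * (pd j \<eta> x * pd j P x) + \<eta> x * G' x * (pd j P x * pd j P x))"
        by (intro sum.cong refl) (simp only: algebra_simps)
      also have "\<dots> = G x * Q x + \<eta> x * G' x * q x"
        unfolding Q_def q_def by (simp only: sum.distrib sum_distrib_left[symmetric] distrib_left mult.assoc)
      finally show ?thesis .
    qed
    have cG': "continuous_on UNIV G'" unfolding G'_def
      by (intro continuous_on_diff continuous_on_mult continuous_on_const continuous_on_power smooth_on_continuous[OF swp] smooth_on_continuous[OF P])
    have cE: "continuous_on UNIV (\<lambda>x. \<eta> x * G' x * q x)" unfolding q_def
      by (intro continuous_on_mult continuous_on_sum cG' smooth_on_continuous[OF eta(1)] smooth_on_continuous[OF smooth_on_pd[OF P]])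
    have iE: "integrable lborel (\<lambda>x. \<eta> x * G' x * q x)" by (rule integrable_continuous_bounded_support[OF cE, of R]) (simp add: eta(3))
    have iGQ: "integrable lborel (\<lambda>x. G x * Q x)"
      by (rule integrable_continuous_bounded_support[of _ R]) (use Q0 in \<open>auto intro!: continuous_on_mult cQ smooth_on_continuous[OF sG]\<close>)
    have "0 = (\<Sum>j\<in>UNIV. \<integral>x. pd j (X j) x \<partial>lborel)" using integral_pd_zero(2)[OF sX X0] by simp
    also have "\<dots> = (\<integral>x. (\<Sum>j\<in>UNIV. pd j (X j) x) \<partial>lborel)" by (rule Bochner_Integration.integral_sum[symmetric]) (rule integral_pd_zero(1)[OF sX X0])
    also have "\<dots> = (\<integral>x. G x * Q x \<partial>lborel) + (\<integral>x. \<eta> x * G' x * q x \<partial>lborel)" unfolding pX by (rule Bochner_Integration.integral_add[OF iGQ iE])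
    finally have "(\<integral>x. \<eta> x * G' x * q x \<partial>lborel) = - (\<integral>x. G x * Q x \<partial>lborel)" by simp
    also have "\<dots> \<le> (\<integral>x. \<bar>G x * Q x\<bar> \<partial>lborel)" using integral_abs_bound[of lborel "\<lambda>x. G x * Q x"] by linarith
    also have "\<dots> \<le> C0" unfolding C0_def
    proof (rule integral_mono[OF integrable_abs[OF iGQ] iQ])
      fix x
      \<comment> \<open>|G| is at most |P|^(1/2), and a square root is at most 1 plus its
        square.\<close>
      have "\<bar>G x\<bar> \<le> 1 + \<bar>P x\<bar>"
      proof (cases "P x = 0")
        case False
        have "w x powr (- (1/4)) \<le> ((P x)\<^sup>2) powr (- (1/4))" using False d unfolding w_def by (intro powr_mono2') auto
        also have "(P x)\<^sup>2 = \<bar>P x\<bar> powr 2" using False by simp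
        also have "(\<bar>P x\<bar> powr 2) powr (- (1/4)) = \<bar>P x\<bar> powr (- (1/2))" unfolding powr_powr by simp
        finally have "\<bar>G x\<bar> \<le> \<bar>P x\<bar> * \<bar>P x\<bar> powr (- (1/2))" unfolding G_def by (simp add: abs_mult mult_left_mono)
        also have "\<dots> = \<bar>P x\<bar> powr (1 + - (1/2))" using False by (simp only: powr_add) simp
        also have "\<dots> \<le> 1 + (\<bar>P x\<bar> powr (1 + - (1/2))) powr 2" by (rule le_one_plus_powr) auto
        also have "(\<bar>P x\<bar> powr (1 + - (1/2))) powr 2 = \<bar>P x\<bar>" unfolding powr_powr by simp
        finally show ?thesis .
      qed (simp add: G_def)
      then show "\<bar>G x * Q x\<bar> \<le> (1 + \<bar>P x\<bar>) * \<bar>Q x\<bar>" unfolding abs_mult by (rule mult_right_mono) simp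
    qed
    finally have main: "(\<integral>x. \<eta> x * G' x * q x \<partial>lborel) \<le> C0" .
    \<comment> \<open>P^2 \<le> w, so the subtracted term of \<open>G'\<close> is at most half of
      the first one.\<close>
    have G'b: "1/2 * w x powr (- (1/4)) \<le> G' x" for x
    proof -
      have "(P x)\<^sup>2 * w x powr (- (5/4)) \<le> w x * w x powr (- (5/4))" unfolding w_def using d by (intro mult_right_mono) auto
      also have "\<dots> = w x powr (1 + - (5/4))" using w0[of x] by (simp only: powr_add) simp
      finally show ?thesis unfolding G'_def by simp
    qed
    have G'0: "0 \<le> G' x" for x using G'b[of x] powr_ge_zero[of "w x" "- (1/4)"] by linarith
    have q0: "0 \<le> q x" for x unfolding q_def by (simp add: sum_nonneg)
    have nnE: "0 \<le> \<eta> x * G' x * q x" for x using eta(2)[of x] G'0[of x] q0[of x] by simp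
    have "(\<integral>\<^sup>+z. ennreal (1/2 * c * ((P z)\<^sup>2 + d) powr (- (1/4))) \<partial>lebesgue_on Z) \<le> (\<integral>\<^sup>+z. ennreal (\<eta> z * G' z * q z) \<partial>lebesgue_on Z)"
    proof (rule nn_integral_mono, rule ennreal_leI)
      fix z assume "z \<in> space (lebesgue_on Z)"
      then have z: "z \<in> Z" by simp
      have "(1/2 * w z powr (- (1/4))) * c \<le> G' z * q z" using G'b[of z] c(2)[OF z] G'0[of z] c(1) unfolding q_def by (intro mult_mono) auto
      then show "1/2 * c * ((P z)\<^sup>2 + d) powr (- (1/4)) \<le> \<eta> z * G' z * q z" using Z(2)[OF z] unfolding w_def by (simp add: mult_ac)
    qed
    also have "\<dots> \<le> (\<integral>\<^sup>+z. ennreal (\<eta> z * G' z * q z) \<partial>lborel)"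
      using borel_measurable_continuous_onI[OF cE] by (intro nn_integral_lebesgue_on_le Z(1)) simp
    also have "\<dots> = ennreal (\<integral>x. \<eta> x * G' x * q x \<partial>lborel)" by (rule nn_integral_eq_integral[OF iE]) (use nnE in simp)
    also have "\<dots> \<le> ennreal C0" using main by (rule ennreal_leI)
    finally show ?thesis .
  qed
  define d where "d n = 1 / real (Suc n)" for n
  have d0: "0 < d n" for n by (simp add: d_def)
  have dl: "d \<longlonglongrightarrow> 0" unfolding d_def by (rule LIMSEQ_inverse_real_of_nat[unfolded inverse_eq_divide])
  have mP: "P \<in> borel_measurable (lebesgue_on Z)" by (rule borel_measurable_lebesgue_on_continuous[OF smooth_on_continuous[OF P]])
  let ?f = "\<lambda>n z. ennreal (1/2 * c * ((P z)\<^sup>2 + d n) powr (- (1/4)))"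
  have fm: "?f n \<in> borel_measurable (lebesgue_on Z)" for n using mP by measurable
  have "(\<integral>\<^sup>+z. ennreal (1/2 * c * \<bar>P z\<bar> powr (- (1/2))) \<partial>lebesgue_on Z) = (\<integral>\<^sup>+z. liminf (\<lambda>n. ?f n z) \<partial>lebesgue_on Z)"
  proof (rule nn_integral_cong)
    fix z assume "z \<in> space (lebesgue_on Z)"
    then have Pz: "P z \<noteq> 0" using Z(3) by simp
    have "(\<lambda>n. 1/2 * c * ((P z)\<^sup>2 + d n) powr (- (1/4))) \<longlonglongrightarrow> 1/2 * c * ((P z)\<^sup>2 + 0) powr (- (1/4))"
      using Pz by (intro tendsto_mult tendsto_const tendsto_powr tendsto_add dl) auto
    also have "((P z)\<^sup>2 + 0) powr (- (1/4)) = (\<bar>P z\<bar> powr 2) powr (- (1/4))" using Pz by simp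
    also have "\<dots> = \<bar>P z\<bar> powr (- (1/2))" unfolding powr_powr by simp
    finally have "(\<lambda>n. ?f n z) \<longlonglongrightarrow> ennreal (1/2 * c * \<bar>P z\<bar> powr (- (1/2)))" by (rule tendsto_ennrealI)
    then show "ennreal (1/2 * c * \<bar>P z\<bar> powr (- (1/2))) = liminf (\<lambda>n. ?f n z)" by (simp add: lim_imp_Liminf)
  qed
  also have "\<dots> \<le> liminf (\<lambda>n. \<integral>\<^sup>+z. ?f n z \<partial>lebesgue_on Z)" by (rule nn_integral_liminf[OF fm])
  also have "\<dots> \<le> ennreal C0"
  proof -
    have "liminf (\<lambda>n. \<integral>\<^sup>+z. ?f n z \<partial>lebesgue_on Z) \<le> liminf (\<lambda>n. ennreal C0)"
      by (rule Liminf_mono) (intro always_eventually allI bd d0)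
    then show ?thesis by (simp add: Liminf_const)
  qed
  finally have fin: "(\<integral>\<^sup>+z. ennreal (1/2 * c * \<bar>P z\<bar> powr (- (1/2))) \<partial>lebesgue_on Z) \<le> ennreal C0" .
  have "(\<integral>\<^sup>+z. ennreal (\<bar>P z\<bar> powr (- (1/2))) \<partial>lebesgue_on Z) = (\<integral>\<^sup>+z. ennreal (2 / c) * ennreal (1/2 * c * \<bar>P z\<bar> powr (- (1/2))) \<partial>lebesgue_on Z)"
    using c(1) by (intro nn_integral_cong) (simp add: ennreal_mult'[symmetric])
  also have "\<dots> = ennreal (2 / c) * (\<integral>\<^sup>+z. ennreal (1/2 * c * \<bar>P z\<bar> powr (- (1/2))) \<partial>lebesgue_on Z)"
    by (rule nn_integral_cmult) (use mP in measurable)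
  also have "\<dots> \<le> ennreal (2 / c) * ennreal C0" using fin by (rule mult_left_mono) simp
  also have "\<dots> < \<infinity>" by (simp add: ennreal_mult_less_top)
  finally show ?thesis .
qed

text \<open>The gradient part is conditional on a bound for \<theta> because the two parts are used
  at different moments: the Riesz potential in the first part is global, so that estimate must be
  collected over all of \<Omega> before \<theta> is known to be bounded.\<close>

definition good_point :: "(real^'n::finite) set \<Rightarrow> (real^'n \<Rightarrow> real) \<Rightarrow> (real^'n \<Rightarrow> real^'n) \<Rightarrow> real^'n \<Rightarrow> bool" where
  "good_point \<Omega> \<theta> g x0 \<longleftrightarrow> (\<exists>r>0.
     (\<exists>M\<ge>0. AE z in lebesgue_on (\<Omega> \<inter> ball x0 r). ennreal \<bar>\<theta> z\<bar> \<le> ennreal M +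
        ennreal M * (\<integral>\<^sup>+x. ennreal \<bar>\<theta> x\<bar> * ennreal (norm (x - z) powr (- (real CARD('n) - 1))) \<partial>lebesgue_on \<Omega>)) \<and>
     (\<forall>B. (AE x in lebesgue_on \<Omega>. \<bar>\<theta> x\<bar> \<le> B) \<longrightarrow>
        (\<forall>s\<ge>1. \<forall>i. integrable (lebesgue_on (\<Omega> \<inter> ball x0 r)) (\<lambda>z. \<bar>g z $ i\<bar> powr s))))"

text \<open>The exponent is tuned to the integrability: with \<alpha> = 1/(2s) the s-th power of
  dd^(-\<alpha>) is dd^(-1/2), so one integrability hypothesis serves every s.\<close>

lemma (in neumann_patch) good_point:
  assumes r: "0 < r" "Z = \<Omega> \<inter> ball x0 r" and idd: "integrable (lebesgue_on Z) (\<lambda>z. dd z powr (- (1/2)))"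
  shows "good_point \<Omega> \<theta> g x0"
  unfolding good_point_def
proof (rule exI[of _ r], intro conjI allI impI r(1))
  show "\<exists>M\<ge>0. AE z in lebesgue_on (\<Omega> \<inter> ball x0 r). ennreal \<bar>\<theta> z\<bar> \<le> ennreal M +
        ennreal M * (\<integral>\<^sup>+x. ennreal \<bar>\<theta> x\<bar> * ennreal (norm (x - z) powr (- (real CARD('n) - 1))) \<partial>lebesgue_on \<Omega>)"
    using potential_bound unfolding r(2) by blast
next
  fix B s i assume B: "AE x in lebesgue_on \<Omega>. \<bar>\<theta> x\<bar> \<le> B" and s: "(1::real) \<le> s"
  interpret FZ: finite_measure "lebesgue_on Z" using Om(1) Z by (intro finite_measure_bounded_open) (auto intro: bounded_subset)
  define \<alpha> where "\<alpha> = 1 / (2 * s)"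
  have al: "0 < \<alpha>" "\<alpha> < 1" unfolding \<alpha>_def using s by (auto simp: field_simps)
  have aps: "(dd z powr (- \<alpha>)) powr s = dd z powr (- (1/2))" for z unfolding powr_powr \<alpha>_def using s by simp
  \<comment> \<open>Measurability of the power -\<alpha> is recovered from that of the integrable
    power -1/2, since \<open>dd\<close> carries no measurability of its own.\<close>
  have m: "(\<lambda>z. dd z powr (- \<alpha>)) \<in> borel_measurable (lebesgue_on Z)"
  proof (rule measurable_cong[THEN iffD1])
    show "(dd z powr (- (1/2))) powr (2 * \<alpha>) = dd z powr (- \<alpha>)" for z unfolding powr_powr by simp
    show "(\<lambda>z. (dd z powr (- (1/2))) powr (2 * \<alpha>)) \<in> borel_measurable (lebesgue_on Z)" using borel_measurable_integrable[OF idd] by measurable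
  qed
  have ia: "integrable (lebesgue_on Z) (\<lambda>z. dd z powr (- \<alpha>))"
  proof (rule Bochner_Integration.integrable_bound[OF _ m])
    show "integrable (lebesgue_on Z) (\<lambda>z. 1 + dd z powr (- (1/2)))" using idd by simp
    show "AE z in lebesgue_on Z. norm (dd z powr (- \<alpha>)) \<le> norm (1 + dd z powr (- (1/2)))"
    proof (rule AE_I2)
      fix z
      have "dd z powr (- \<alpha>) \<le> 1 + (dd z powr (- \<alpha>)) powr s" using s by (intro le_one_plus_powr) auto
      then show "norm (dd z powr (- \<alpha>)) \<le> norm (1 + dd z powr (- (1/2)))" unfolding aps by simp
    qed
  qed
  obtain M where M: "0 \<le> M" "AE z in lebesgue_on Z. \<bar>g z $ i\<bar> \<le> M * (dd z powr (- \<alpha>) + 1)"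
    using gradient_bound[OF al B ia] by blast
  have gm: "(\<lambda>z. g z $ i) \<in> borel_measurable (lebesgue_on Z)"
    by (rule borel_measurable_integrable[OF integrable_lebesgue_on_subset[OF gi Z(2) Os Zs]])
  have "integrable (lebesgue_on Z) (\<lambda>z. \<bar>g z $ i\<bar> powr s)"
  proof (rule Bochner_Integration.integrable_bound)
    show "integrable (lebesgue_on Z) (\<lambda>z. (2 * M) powr s * (dd z powr (- (1/2)) + 1))" using idd by simp
    show "(\<lambda>z. \<bar>g z $ i\<bar> powr s) \<in> borel_measurable (lebesgue_on Z)" using gm by measurable
    show "AE z in lebesgue_on Z. norm (\<bar>g z $ i\<bar> powr s) \<le> norm ((2 * M) powr s * (dd z powr (- (1/2)) + 1))"
      using M(2)
    proof eventually_elim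
      case (elim z)
      define a where "a = dd z powr (- \<alpha>)"
      have a0: "0 \<le> a" unfolding a_def by simp
      have "\<bar>g z $ i\<bar> \<le> M * (a + 1)" using elim unfolding a_def .
      also have "\<dots> \<le> M * (2 * max a 1)" using M(1) by (intro mult_left_mono) auto
      finally have "\<bar>g z $ i\<bar> powr s \<le> ((2 * M) * max a 1) powr s" using s by (intro powr_mono2) auto
      also have "\<dots> = (2 * M) powr s * (max a 1) powr s" using M(1) by (simp add: powr_mult)
      also have "\<dots> \<le> (2 * M) powr s * (a powr s + 1)"
        by (intro mult_left_mono) (auto simp: max_def)
      also have "a powr s = dd z powr (- (1/2))" unfolding a_def by (rule aps)
      finally show ?case by simp
    qed
  qed
  then show "integrable (lebesgue_on (\<Omega> \<inter> ball x0 r)) (\<lambda>z. \<bar>g z $ i\<bar> powr s)" unfolding r(2) .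
qed

lemma kgrad_id_eq:
  fixes y z :: "real^'n::finite"
  shows "kgrad e (\<lambda>x. x) z k y = - (((y - z) \<bullet> (y - z) + e) powr (- (real CARD('n) / 2)) * (y - z) $ k)"
proof -
  have "(\<Sum>l\<in>UNIV. (y - z) $ l * pd k (\<lambda>x. x $ l) y) = (\<Sum>l\<in>UNIV. if l = k then (y - z) $ l else 0)"
    by (rule sum.cong) (auto simp: pd_coord)
  then show ?thesis unfolding kgrad_def kq_def by simp
qed

text \<open>The patch is instantiated with a translation longer than the diameter, for which
  \<open>SE\<close> and \<open>SB\<close> vanish and the image kernel has no singularity in
  \<Omega>. As \<eta> is supported inside \<Omega>, the integration by parts meets no boundary,
  which is encoded by P = -1 and c = 0.\<close>

lemma interior_good_point:
  fixes \<Omega> :: "(real^'n::finite) set"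
  assumes Om: "bounded \<Omega>" "open \<Omega>" and x0: "x0 \<in> \<Omega>"
    and th: "integrable (lebesgue_on \<Omega>) \<theta>" and gi: "\<And>i. integrable (lebesgue_on \<Omega>) (\<lambda>x. g x $ i)"
    and wg: "weak_grad \<Omega> \<theta> g"
    and neumann: "\<And>w. smooth_on UNIV w \<Longrightarrow> (\<integral>x. (\<Sum>j\<in>UNIV. g x $ j * pd j w x) \<partial>lebesgue_on \<Omega>) = 0"
  shows "good_point \<Omega> \<theta> g x0"
proof -
  obtain r0 where r0: "0 < r0" "ball x0 r0 \<subseteq> \<Omega>" using openE[OF Om(2) x0] by blast
  define r where "r = r0 / 3"
  have r: "0 < r" "cball x0 (2 * r) \<subseteq> \<Omega>" unfolding r_def using r0 by (auto simp: subset_iff)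
  obtain \<eta> where e1: "smooth_on UNIV \<eta>" and e2: "\<forall>x\<in>ball x0 r. \<eta> x = 1" and e3: "\<forall>x. x \<notin> cball x0 (2 * r) \<longrightarrow> \<eta> x = 0"
    and e4: "\<forall>x. 0 \<le> \<eta> x \<and> \<eta> x \<le> 1" using cutoff_ball_ex[OF r(1), of x0] by blast
  obtain D where D: "0 < D" "\<forall>x\<in>\<Omega>. norm x \<le> D" using Om(1) bounded_pos by blast
  \<comment> \<open>Points of \<Omega> differ by at most 2 D, so a shift of length 2 D + 1 leaves |S
    x - z| \<ge> 1.\<close>
  define a where "a = (2 * D + 1) *\<^sub>R (axis undefined 1 :: real^'n)"
  have na: "norm a = 2 * D + 1" unfolding a_def using D(1) by (simp add: norm_axis_1)
  define S where "S x = x + a" for x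
  define K where "K = cball x0 (2 * r)"
  have dist: "norm (x - z) \<le> 2 * D" "1 \<le> norm (S x - z)" if "x \<in> \<Omega>" "z \<in> \<Omega>" for x z
  proof -
    have "norm x \<le> D" "norm z \<le> D" using D(2) that by auto
    then show *: "norm (x - z) \<le> 2 * D" using norm_triangle_ineq4[of x z] by linarith
    have "norm a - norm (x - z) \<le> norm (a + (x - z))" by (rule norm_diff_ineq)
    then show "1 \<le> norm (S x - z)" unfolding S_def using * na by (simp add: algebra_simps)
  qed
  have sS: "smooth_on UNIV (\<lambda>x. S x $ k)" for k unfolding S_def by (simp add: smooth_on_add)
  have KO: "K \<subseteq> \<Omega>" unfolding K_def by (rule r(2))
  interpret neumann_patch \<Omega> \<theta> g \<eta> S "\<Omega> \<inter> ball x0 (r/2)" K "\<lambda>_. 1" "2 * D + 1" "r/2"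
  proof
    show "bounded \<Omega>" "open \<Omega>" "integrable (lebesgue_on \<Omega>) \<theta>" "weak_grad \<Omega> \<theta> g" by fact+
    show "integrable (lebesgue_on \<Omega>) (\<lambda>x. g x $ i)" for i by (rule gi)
    show "(\<integral>x. (\<Sum>j\<in>UNIV. g x $ j * pd j w x) \<partial>lebesgue_on \<Omega>) = 0" if "smooth_on UNIV w" for w by (rule neumann[OF that])
    show "smooth_on UNIV \<eta>" by fact
    show "0 \<le> \<eta> x" "\<eta> x \<le> 1" for x using e4 by auto
    show "closed K" unfolding K_def by simp
    show "\<eta> x = 0" if "x \<notin> K" for x using e3 that unfolding K_def by blast
    show "smooth_on UNIV (\<lambda>x. S x $ k)" for k by (rule sS)
    show "open (\<Omega> \<inter> ball x0 (r/2))" using Om(2) by auto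
    show "\<Omega> \<inter> ball x0 (r/2) \<subseteq> \<Omega>" by simp
    show "\<eta> z = 1" if "z \<in> \<Omega> \<inter> ball x0 (r/2)" for z using e2 that r(1) by auto
    show "0 < 2 * D + 1" "0 < r / 2" using D(1) r(1) by auto
    show "norm (x - z) \<le> (2 * D + 1) * norm (S x - z)" if "x \<in> \<Omega>" "x \<in> K" "z \<in> \<Omega> \<inter> ball x0 (r/2)" for x z
    proof -
      have "norm (x - z) \<le> (2 * D + 1) * 1" using dist(1)[of x z] that by simp
      also have "\<dots> \<le> (2 * D + 1) * norm (S x - z)" using dist(2)[of x z] that D(1) by (intro mult_left_mono) auto
      finally show ?thesis .
    qed
    show "1 \<le> (2 * D + 1) * norm (S x - z)" if "x \<in> \<Omega>" "x \<in> K" "z \<in> \<Omega> \<inter> ball x0 (r/2)" for x z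
    proof -
      have "1 * 1 \<le> (2 * D + 1) * norm (S x - z)" using dist(2)[of x z] that D(1) by (intro mult_mono) auto
      then show ?thesis by simp
    qed
    show "\<bar>SE S k l x\<bar> \<le> (2 * D + 1) * norm (S x - z)" for x z k l
      unfolding S_def SE_translation using D(1) by simp
    show "0 < (1::real)" by simp
    show "r / 2 \<le> norm (x - z)" if "x \<in> \<Omega>" "z \<in> \<Omega> \<inter> ball x0 (r/2)" "pd j \<eta> x \<noteq> 0" for x z j
    proof -
      have "x \<notin> ball x0 r"
      proof
        assume x: "x \<in> ball x0 r"
        have "pd j \<eta> x = pd j (\<lambda>_. 1) x" by (rule pd_cong_open[OF open_ball x]) (use e2 in blast)
        then show False using that(3) by simp
      qed
      then have "r \<le> dist x0 x" "dist x0 z < r/2" using that(2) by auto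
      then show ?thesis using dist_triangle[of x0 x z] by (simp add: dist_norm norm_minus_commute)
    qed
    fix e :: real and z :: "real^'n" assume e: "0 < e"
    have id: "\<And>k. smooth_on UNIV (\<lambda>x::real^'n. x $ k)" by simp
    show "(\<integral>x. (\<Sum>j\<in>UNIV. g x $ j * (\<eta> x * (kgrad e (\<lambda>x. x) z j x + kgrad e S z j x))) \<partial>lebesgue_on \<Omega>)
       = - (\<integral>x. \<theta> x * (\<Sum>j\<in>UNIV. pd j (\<lambda>x. \<eta> x * (kgrad e (\<lambda>x. x) z j x + kgrad e S z j x)) x) \<partial>lebesgue_on \<Omega>)"
    proof (rule tangential_integration_by_parts[OF Om th gi wg, where P = "\<lambda>_. -1" and K = K and c = 0])
      show "smooth_on UNIV (\<lambda>x. \<eta> x * (kgrad e (\<lambda>x. x) z j x + kgrad e S z j x))" for j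
        by (intro smooth_on_mult smooth_on_add smooth_on_kgrad e1 sS e id) auto
      show "compact K" unfolding K_def by simp
      show "\<eta> x * (kgrad e (\<lambda>x. x) z j x + kgrad e S z j x) = 0" if "x \<notin> K" for j x using e3 that unfolding K_def by simp
      show "x \<in> \<Omega> \<longleftrightarrow> (-1::real) < 0" if "x \<in> K" for x using KO that by auto
    qed simp_all
  qed
  show ?thesis
  proof (rule good_point[of "r/2"])
    interpret FZ: finite_measure "lebesgue_on (\<Omega> \<inter> ball x0 (r/2))" using Om by (intro finite_measure_bounded_open) auto
    show "integrable (lebesgue_on (\<Omega> \<inter> ball x0 (r/2))) (\<lambda>z. 1 powr (- (1/2)))" by simp
  qed (use r in auto)
qed

text \<open>On the boundary near x0 the map \<open>S\<close> is the identity and its derivative is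
  the orthogonal reflection in the tangent plane, so the sum of direct and image kernel has almost
  vanishing normal derivative. The comparisons \<open>geo\<close> follow from the inequality
  \<open>key\<close>: the image \<open>S x\<close> lies on the other side of the boundary from z, so
  P(S x) - P(z) is at least |P x| / 2 + |P z|, while P is Lipschitz.\<close>

lemma boundary_good_point:
  fixes \<Omega> :: "(real^'n::finite) set"
  assumes Om: "bounded \<Omega>" "open \<Omega>" and sb: "smooth_boundary \<Omega>" and x0: "x0 \<in> frontier \<Omega>"
    and th: "integrable (lebesgue_on \<Omega>) \<theta>" and gi: "\<And>i. integrable (lebesgue_on \<Omega>) (\<lambda>x. g x $ i)"
    and wg: "weak_grad \<Omega> \<theta> g"
    and neumann: "\<And>w. smooth_on UNIV w \<Longrightarrow> (\<integral>x. (\<Sum>j\<in>UNIV. g x $ j * pd j w x) \<partial>lebesgue_on \<Omega>) = 0"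
  shows "good_point \<Omega> \<theta> g x0"
proof (rule boundary_defining_function[OF Om(2) sb x0])
  fix P V R
  assume P: "smooth_on UNIV P" and V: "\<And>k. smooth_on UNIV (V k)" and R: "0 < R"
    and P0: "\<And>x. x \<notin> cball 0 (norm x0 + 2 * R) \<Longrightarrow> P x = 0" and Px0: "P x0 = 0"
    and inO: "\<And>x. x \<in> ball x0 R \<Longrightarrow> x \<in> \<Omega> \<longleftrightarrow> P x < 0"
    and qpos: "\<And>x. x \<in> ball x0 R \<Longrightarrow> 0 < (\<Sum>j\<in>UNIV. pd j P x * pd j P x)"
    and Veq: "\<And>x k. x \<in> ball x0 R \<Longrightarrow> V k x = pd k P x / (\<Sum>j\<in>UNIV. pd j P x * pd j P x)"
  let ?N = "real CARD('n)"
  define S where "S x = (\<chi> k. x $ k - 2 * (P x * V k x))" for x :: "real^'n"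
  have Sk: "S x $ k = x $ k - 2 * (P x * V k x)" for x k by (simp add: S_def)
  have sPV: "smooth_on UNIV (\<lambda>x. P x * V k x)" for k by (rule smooth_on_mult[OF _ P V]) simp
  have sS: "smooth_on UNIV (\<lambda>x. S x $ k)" for k unfolding Sk
    by (intro smooth_on_diff' smooth_on_coord smooth_on_mult[OF _ smooth_on_const sPV]) auto
  have cS: "continuous_on UNIV S"
  proof -
    have "continuous_on UNIV (\<lambda>x. \<chi> k. S x $ k)" by (intro continuous_on_vec_lambda smooth_on_continuous sS)
    then show ?thesis by simp
  qed
  define p where "p j x = pd j P x" for j x
  define n where "n j k x = pd j (V k) x" for j k x
  define q where "q x = (\<Sum>j\<in>UNIV. p j x * p j x)" for x
  have qp: "0 < q x" "V k x = p k x / q x" if "x \<in> ball x0 R" for x k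
    using qpos[OF that] Veq[OF that] unfolding q_def p_def by auto
  have pS: "pd j (\<lambda>x. S x $ k) x = (if j = k then 1 else 0) - 2 * (p j x * V k x) - 2 * (P x * n j k x)" for j k x
  proof -
    have "pd j (\<lambda>x. S x $ k) x = pd j (\<lambda>x. x $ k + (-2) * (P x * V k x)) x" unfolding Sk by simp
    also have "\<dots> = pd j (\<lambda>x. x $ k) x + pd j (\<lambda>x. (-2) * (P x * V k x)) x"
      by (rule pd_add_smooth[OF smooth_on_coord smooth_on_mult[OF _ smooth_on_const sPV]]) simp
    also have "\<dots> = (if j = k then 1 else 0) + (-2) * (P x * n j k x + p j x * V k x)"
      unfolding pd_cmult_left[OF sPV] pd_mult_smooth[OF P V] p_def n_def pd_coord ..
    finally show ?thesis by simp
  qed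
  have cp: "continuous_on UNIV (p j)" for j unfolding p_def by (rule smooth_on_continuous[OF smooth_on_pd[OF P]])
  have cV: "continuous_on UNIV (V k)" for k by (rule smooth_on_continuous[OF V])
  have cn: "continuous_on UNIV (n j k)" for j k unfolding n_def by (rule smooth_on_continuous[OF smooth_on_pd[OF V]])
  \<comment> \<open>At (x0, x0) the sum equals 1. Two independent points are allowed because the
    gradient will be taken at an intermediate point supplied by the mean value theorem.\<close>
  obtain R1 where R1: "0 < R1" "R1 \<le> R" "\<forall>\<xi>\<in>ball x0 R1. \<forall>x\<in>ball x0 R1. 3/4 < (\<Sum>k\<in>UNIV. p k \<xi> * V k x)"
  proof -
    let ?T = "{w::(real^'n)\<times>(real^'n). 3/4 < (\<Sum>k\<in>UNIV. p k (fst w) * V k (snd w))}"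
    have "open ?T"
      by (intro open_Collect_less continuous_on_const continuous_on_sum continuous_on_mult continuous_on_compose2[OF cp] continuous_on_compose2[OF cV] continuous_on_fst continuous_on_snd continuous_on_id) auto
    moreover have "(x0, x0) \<in> ?T"
    proof -
      have b: "x0 \<in> ball x0 R" using R by simp
      have "(\<Sum>k\<in>UNIV. p k x0 * V k x0) = (\<Sum>k\<in>UNIV. p k x0 * p k x0) / q x0" unfolding qp(2)[OF b] by (simp add: sum_divide_distrib)
      also have "\<dots> = 1" unfolding q_def[symmetric] using qp(1)[OF b] by simp
      finally show ?thesis by simp
    qed
    ultimately obtain A B where AB: "open A" "open B" "(x0, x0) \<in> A \<times> B" "A \<times> B \<subseteq> ?T" by (rule open_prod_elim)
    then have "open (A \<inter> B)" "x0 \<in> A \<inter> B" by auto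
    then obtain r where r: "0 < r" "ball x0 r \<subseteq> A \<inter> B" by (rule openE)
    show ?thesis
    proof (rule that[of "min r R"])
      show "0 < min r R" "min r R \<le> R" using r R by auto
      show "\<forall>\<xi>\<in>ball x0 (min r R). \<forall>x\<in>ball x0 (min r R). 3/4 < (\<Sum>k\<in>UNIV. p k \<xi> * V k x)"
      proof (intro ballI)
        fix \<xi> x assume "\<xi> \<in> ball x0 (min r R)" "x \<in> ball x0 (min r R)"
        then have "(\<xi>, x) \<in> A \<times> B" using r(2) by auto
        then show "3/4 < (\<Sum>k\<in>UNIV. p k \<xi> * V k x)" using AB(4) by auto
      qed
    qed
  qed
  have Sx0: "S x0 = x0" by (simp add: vec_eq_iff Sk Px0)
  obtain d where d: "0 < d" "ball x0 d \<subseteq> S -` ball x0 R1"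
  proof -
    have "open (S -` ball x0 R1)" by (rule open_vimage[OF open_ball cS])
    moreover have "x0 \<in> S -` ball x0 R1" using Sx0 R1(1) by simp
    ultimately show ?thesis using that by (rule openE)
  qed
  \<comment> \<open>\<open>K\<close> has radius 2 r, small enough that both \<open>K\<close> and its
    image under \<open>S\<close> lie in the ball of radius \<open>R1\<close>.\<close>
  define r where "r = min d R1 / 3"
  define K where "K = cball x0 (2 * r)"
  have r0: "0 < r" "2 * r < d" "2 * r < R1" unfolding r_def using d(1) R1(1) by auto
  have KR1: "x \<in> ball x0 R1" "S x \<in> ball x0 R1" "x \<in> ball x0 R" if "x \<in> K" for x
  proof -
    have "dist x0 x \<le> 2 * r" using that by (simp add: K_def)
    then have "x \<in> ball x0 d" and x: "x \<in> ball x0 R1" using r0 by auto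
    then show "S x \<in> ball x0 R1" using d(2) by blast
    show "x \<in> ball x0 R1" "x \<in> ball x0 R" using x R1(2) by auto
  qed
  obtain \<eta> where e1: "smooth_on UNIV \<eta>" and e2: "\<forall>x\<in>ball x0 r. \<eta> x = 1" and e3: "\<forall>x. x \<notin> cball x0 (2 * r) \<longrightarrow> \<eta> x = 0"
    and e4: "\<forall>x. 0 \<le> \<eta> x \<and> \<eta> x \<le> 1" using cutoff_ball_ex[OF r0(1), of x0] by blast
  define Z where "Z = \<Omega> \<inter> ball x0 (r/2)"
  have ZK: "z \<in> K" "P z < 0" "z \<in> \<Omega>" if "z \<in> Z" for z
  proof -
    show z: "z \<in> K" using that r0(1) unfolding Z_def K_def by auto
    show o: "z \<in> \<Omega>" using that unfolding Z_def by simp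
    show "P z < 0" using inO[OF KR1(3)[OF z]] o by simp
  qed
  obtain L where L: "0 \<le> L" "\<And>x y. \<bar>P x - P y\<bar> \<le> L * norm (x - y)"
  proof -
    obtain L0 where L0: "0 \<le> L0" "\<And>i x. \<bar>pd i P x\<bar> \<le> L0" using smooth_pd_bounded[OF P P0] by blast
    show ?thesis by (rule that[of "real CARD('n) * L0"]) (use L0 smooth_Lipschitz[OF P L0(2)] in auto)
  qed
  obtain cV where cV0: "0 \<le> cV" and cVb: "\<forall>k. \<forall>x\<in>cball x0 R. \<bar>V k x\<bar> \<le> cV"
    by (rule finite_family_bound[of "cball x0 R" V]) (use cV in auto)
  obtain cP where cP0: "0 \<le> cP" and cPb: "\<forall>k. \<forall>x\<in>cball x0 R. \<bar>p k x\<bar> \<le> cP"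
    by (rule finite_family_bound[of "cball x0 R" p]) (use cp in auto)
  obtain cn where cn0: "0 \<le> cn" and cnb: "\<forall>jk. \<forall>x\<in>cball x0 R. \<bar>n (fst jk) (snd jk) x\<bar> \<le> cn"
    by (rule finite_family_bound[of "cball x0 R" "\<lambda>jk. n (fst jk) (snd jk)"]) (use cn in auto)
  obtain cPP where cPP0: "0 \<le> cPP" and cPPb: "\<forall>x\<in>cball x0 R. \<bar>P x\<bar> \<le> cPP"
    by (rule continuous_bounded_on_bounded[OF bounded_cball smooth_on_continuous[OF P], of x0 R]) (rule that; blast)
  have Sdist: "norm (S x - x) \<le> ?N * (2 * cV) * \<bar>P x\<bar>" if "x \<in> ball x0 R" for x
  proof -
    have "norm (S x - x) \<le> (\<Sum>k\<in>UNIV. \<bar>(S x - x) $ k\<bar>)" by (rule norm_le_l1_cart)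
    also have "\<dots> \<le> (\<Sum>k\<in>(UNIV::'n set). 2 * cV * \<bar>P x\<bar>)"
    proof (rule sum_mono)
      fix k
      have "\<bar>(S x - x) $ k\<bar> = 2 * \<bar>V k x\<bar> * \<bar>P x\<bar>" by (simp add: Sk abs_mult)
      also have "\<dots> \<le> 2 * cV * \<bar>P x\<bar>" using cVb that by (intro mult_right_mono) auto
      finally show "\<bar>(S x - x) $ k\<bar> \<le> 2 * cV * \<bar>P x\<bar>" .
    qed
    finally show ?thesis by simp
  qed
  \<comment> \<open>The mean value theorem gives P(S x) = -P(x) (2 \<tau> - 1); the threshold 3/4
    for \<tau> is what yields the factor 1/2.\<close>
  have reflP: "- P x / 2 \<le> P (S x)" if x: "x \<in> K" "x \<in> \<Omega>" for x
  proof -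
    obtain t where t: "0 < t" "t < 1" "P (x + (S x - x)) - P x = (\<Sum>k\<in>UNIV. (S x - x) $ k * pd k P (x + t *\<^sub>R (S x - x)))"
      using smooth_mvt[OF P] by metis
    let ?\<xi> = "x + t *\<^sub>R (S x - x)"
    have "?\<xi> = (1 - t) *\<^sub>R x + t *\<^sub>R S x" by (simp add: algebra_simps)
    then have xi: "?\<xi> \<in> ball x0 R1" using convexD[OF convex_ball KR1(1,2)[OF x(1)], of "1 - t" t] t by simp
    define \<tau> where "\<tau> = (\<Sum>k\<in>UNIV. p k ?\<xi> * V k x)"
    have tau: "3/4 < \<tau>" unfolding \<tau>_def using R1(3) xi KR1(1)[OF x(1)] by blast
    have "P (S x) - P x = (\<Sum>k\<in>UNIV. (S x - x) $ k * pd k P ?\<xi>)" using t(3) by simp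
    also have "\<dots> = (\<Sum>k\<in>UNIV. - 2 * P x * (p k ?\<xi> * V k x))" by (rule sum.cong[OF refl]) (simp add: Sk p_def)
    also have "\<dots> = - 2 * P x * \<tau>" unfolding \<tau>_def by (simp only: sum_distrib_left)
    finally have eq: "P (S x) = - P x * (2 * \<tau> - 1)" by (simp add: algebra_simps)
    have "P x < 0" using inO[OF KR1(3)[OF x(1)]] x(2) by simp
    then have "- P x * (1/2) \<le> - P x * (2 * \<tau> - 1)" using tau by (intro mult_left_mono) auto
    then show ?thesis unfolding eq by simp
  qed
  have key: "\<bar>P x\<bar> / 2 + \<bar>P z\<bar> \<le> L * norm (S x - z)" if "x \<in> \<Omega>" "x \<in> K" "z \<in> Z" for x z
  proof -
    have "P x < 0" using inO[OF KR1(3)[OF that(2)]] that(1) by simp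
    then have "\<bar>P x\<bar> / 2 + \<bar>P z\<bar> \<le> P (S x) - P z" using reflP[OF that(2,1)] ZK(2)[OF that(3)] by simp
    also have "\<dots> \<le> L * norm (S x - z)" using L(2)[of "S x" z] by linarith
    finally show ?thesis .
  qed
  define cE where "cE = ?N * (2 * (2 * ((1 + 2 * (cP * cV)) * cn) + 2 * (cPP * (cn * cn))))"
  have cE0: "0 \<le> cE" unfolding cE_def using cP0 cV0 cn0 cPP0 by simp
  \<comment> \<open>The part of DS without the factor P is the Householder matrix I - 2 V p^T,
    orthogonal because V = p / |p|^2. Hence every term of \<open>SE\<close> carries a factor
    P.\<close>
  have SEb: "\<bar>SE S k l x\<bar> \<le> cE * \<bar>P x\<bar>" if x: "x \<in> ball x0 R" for k l x
  proof -
    define a where "a j k = (if j = k then 1 else 0) - 2 * (p j x * V k x)" for j k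
    have xc: "x \<in> cball x0 R" using x by simp
    have aa: "(\<Sum>j\<in>UNIV. a j k * a j l) = (if k = l then 1 else 0)"
    proof -
      have "(\<Sum>j\<in>UNIV. a j k * a j l) = (\<Sum>j\<in>UNIV. (if j = k then (if k = l then 1 else 0) else 0) - (if j = k then 2 * (p j x * V l x) else 0)
          - (if j = l then 2 * (p j x * V k x) else 0) + 4 * (V k x * V l x) * (p j x * p j x))"
        by (rule sum.cong[OF refl]) (auto simp: a_def algebra_simps)
      also have "\<dots> = (if k = l then 1 else 0) - 2 * (p k x * V l x) - 2 * (p l x * V k x) + 4 * (V k x * V l x) * q x"
        by (simp add: sum.distrib sum_subtractf sum_distrib_left[symmetric] q_def)
      also have "\<dots> = (if k = l then 1 else 0)" unfolding qp(2)[OF x] using qp(1)[OF x] by (simp add: field_simps)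
      finally show ?thesis .
    qed
    have ab: "\<bar>a j k\<bar> \<le> 1 + 2 * (cP * cV)" for j k
    proof -
      have "\<bar>p j x * V k x\<bar> \<le> cP * cV" unfolding abs_mult using cPb cVb xc cP0 by (intro mult_mono) auto
      moreover have "\<bar>a j k\<bar> \<le> 1 + 2 * \<bar>p j x * V k x\<bar>" unfolding a_def mult.commute[of "V k x"] by auto
      ultimately show ?thesis by linarith
    qed
    have nb: "\<bar>n j k x\<bar> \<le> cn" for j k using cnb xc by (metis fst_conv snd_conv)
    have "SE S k l x = (\<Sum>j\<in>UNIV. (a j k - 2 * (P x * n j k x)) * (a j l - 2 * (P x * n j l x))) - (\<Sum>j\<in>UNIV. a j k * a j l)"
      unfolding SE_def pS aa by (simp only: a_def)
    also have "\<dots> = (\<Sum>j\<in>UNIV. - 2 * P x * ((a j k * n j l x + n j k x * a j l) - 2 * (P x * (n j k x * n j l x))))"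
      unfolding sum_subtractf[symmetric] by (rule sum.cong[OF refl]) (simp add: algebra_simps)
    also have "\<bar>\<dots>\<bar> \<le> ?N * (2 * \<bar>P x\<bar> * (2 * ((1 + 2 * (cP * cV)) * cn) + 2 * (cPP * (cn * cn))))"
    proof (rule abs_sum_le_card)
      fix j
      have t1: "\<bar>a j k * n j l x\<bar> \<le> (1 + 2 * (cP * cV)) * cn" unfolding abs_mult using ab nb cP0 cV0 by (intro mult_mono) auto
      have t2: "\<bar>n j k x * a j l\<bar> \<le> (1 + 2 * (cP * cV)) * cn" unfolding abs_mult mult.commute[of "\<bar>n j k x\<bar>"] using ab nb cP0 cV0 by (intro mult_mono) auto
      have t3: "\<bar>P x * (n j k x * n j l x)\<bar> \<le> cPP * (cn * cn)" unfolding abs_mult using cPPb xc nb cPP0 cn0 by (intro mult_mono) auto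
      have "\<bar>(a j k * n j l x + n j k x * a j l) - 2 * (P x * (n j k x * n j l x))\<bar> \<le> 2 * ((1 + 2 * (cP * cV)) * cn) + 2 * (cPP * (cn * cn))"
        using t1 t2 t3 by linarith
      then show "\<bar>- 2 * P x * ((a j k * n j l x + n j k x * a j l) - 2 * (P x * (n j k x * n j l x)))\<bar> \<le> 2 * \<bar>P x\<bar> * (2 * ((1 + 2 * (cP * cV)) * cn) + 2 * (cPP * (cn * cn)))"
        unfolding abs_mult[of "- 2 * P x"] by (simp only: abs_mult abs_minus_cancel abs_numeral) (rule mult_left_mono, simp_all)
    qed
    finally show ?thesis unfolding cE_def by (simp only: mult_ac)
  qed
  \<comment> \<open>The summands pay for the three requirements in \<open>geo\<close>: L for the
    bound on -P z, 1 together with the third for |x - z|, and the last for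
    \<open>SE\<close>.\<close>
  define C where "C = 1 + L + ?N * (2 * cV) * (2 * L) + cE * (2 * L)"
  have nnC: "0 \<le> ?N * (2 * cV) * (2 * L)" "0 \<le> cE * (2 * L)" using L(1) cV0 cE0 by auto
  have C0: "0 < C" unfolding C_def using L(1) nnC by linarith
  have CL: "c * norm (S x - z) \<le> C * norm (S x - z)" if "c \<le> C" for c x z using that by (rule mult_right_mono) simp
  interpret neumann_patch \<Omega> \<theta> g \<eta> S Z K "\<lambda>z. - P z" C "r/2"
  proof
    show "bounded \<Omega>" "open \<Omega>" "integrable (lebesgue_on \<Omega>) \<theta>" "weak_grad \<Omega> \<theta> g" by fact+
    show "integrable (lebesgue_on \<Omega>) (\<lambda>x. g x $ i)" for i by (rule gi)
    show "(\<integral>x. (\<Sum>j\<in>UNIV. g x $ j * pd j w x) \<partial>lebesgue_on \<Omega>) = 0" if "smooth_on UNIV w" for w by (rule neumann[OF that])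
    show "smooth_on UNIV \<eta>" by fact
    show "0 \<le> \<eta> x" "\<eta> x \<le> 1" for x using e4 by auto
    show "closed K" unfolding K_def by simp
    show "\<eta> x = 0" if "x \<notin> K" for x using e3 that unfolding K_def by blast
    show "smooth_on UNIV (\<lambda>x. S x $ k)" for k by (rule sS)
    show "open Z" "Z \<subseteq> \<Omega>" unfolding Z_def using Om(2) by auto
    show "\<eta> z = 1" if "z \<in> Z" for z using e2 that r0(1) unfolding Z_def by auto
    show "0 < C" "0 < r / 2" using C0 r0(1) by auto
    show "norm (x - z) \<le> C * norm (S x - z)" if "x \<in> \<Omega>" "x \<in> K" "z \<in> Z" for x z
    proof -
      have "norm (x - z) \<le> norm (S x - z) + norm (S x - x)" using norm_triangle_ineq4[of "S x - z" "S x - x"] by simp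
      also have "norm (S x - x) \<le> ?N * (2 * cV) * \<bar>P x\<bar>" by (rule Sdist[OF KR1(3)[OF that(2)]])
      also have "\<dots> \<le> ?N * (2 * cV) * (2 * L * norm (S x - z))" using key[OF that] cV0 by (intro mult_left_mono) auto
      also have "norm (S x - z) + ?N * (2 * cV) * (2 * L * norm (S x - z)) = (1 + ?N * (2 * cV) * (2 * L)) * norm (S x - z)" by (simp add: algebra_simps)
      also have "\<dots> \<le> C * norm (S x - z)" by (rule CL) (use nnC L(1) in \<open>simp add: C_def\<close>)
      finally show ?thesis by simp
    qed
    show "- P z \<le> C * norm (S x - z)" if "x \<in> \<Omega>" "x \<in> K" "z \<in> Z" for x z
    proof -
      have "- P z \<le> L * norm (S x - z)" using key[OF that] by simp
      also have "\<dots> \<le> C * norm (S x - z)" by (rule CL) (use nnC in \<open>simp add: C_def\<close>)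
      finally show ?thesis .
    qed
    show "\<bar>SE S k l x\<bar> \<le> C * norm (S x - z)" if "x \<in> \<Omega>" "x \<in> K" "z \<in> Z" for x z k l
    proof -
      have "\<bar>SE S k l x\<bar> \<le> cE * \<bar>P x\<bar>" by (rule SEb[OF KR1(3)[OF that(2)]])
      also have "\<dots> \<le> cE * (2 * L * norm (S x - z))" using key[OF that] cE0 by (intro mult_left_mono) auto
      also have "\<dots> = cE * (2 * L) * norm (S x - z)" by simp
      also have "\<dots> \<le> C * norm (S x - z)" by (rule CL) (use nnC L(1) in \<open>simp add: C_def\<close>)
      finally show ?thesis .
    qed
    show "0 < - P z" if "z \<in> Z" for z using ZK(2)[OF that] by simp
    show "r / 2 \<le> norm (x - z)" if "x \<in> \<Omega>" "z \<in> Z" "pd j \<eta> x \<noteq> 0" for x z j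
    proof -
      have "x \<notin> ball x0 r"
      proof
        assume x: "x \<in> ball x0 r"
        have "pd j \<eta> x = pd j (\<lambda>_. 1) x" by (rule pd_cong_open[OF open_ball x]) (use e2 in blast)
        then show False using that(3) by simp
      qed
      then have "r \<le> dist x0 x" "dist x0 z < r/2" using that(2) unfolding Z_def by auto
      then show ?thesis using dist_triangle[of x0 x z] by (simp add: dist_norm norm_minus_commute)
    qed
    fix e :: real and z :: "real^'n" assume e: "0 < e"
    have id: "\<And>k. smooth_on UNIV (\<lambda>x::real^'n. x $ k)" by simp
    define \<kappa> where "\<kappa> k = kgrad e (\<lambda>x. x) z k" for k
    have sk: "smooth_on UNIV (\<kappa> k)" for k unfolding \<kappa>_def by (rule smooth_on_kgrad[OF id e])
    define w where "w k x = (\<Sum>j\<in>UNIV. p j x * n j k x)" for k x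
    \<comment> \<open>DS sends the gradient of P to its negative up to O(|P|). The normal components
      of the two kernel gradients therefore combine into differences \<kappa>(x) - \<kappa>(S x),
      small by Lipschitz continuity, and into terms with the factor P.\<close>
    have tang: "(\<Sum>j\<in>UNIV. (kgrad e (\<lambda>x. x) z j x + kgrad e S z j x) * pd j P x) =
        (\<Sum>k\<in>UNIV. p k x * (\<kappa> k x - \<kappa> k (S x))) - (\<Sum>k\<in>UNIV. 2 * P x * (\<kappa> k (S x) * w k x))" if x: "x \<in> ball x0 R" for x
    proof -
      have pk: "(\<Sum>j\<in>UNIV. p j x * pd j (\<lambda>x. S x $ k) x) = - p k x - 2 * (P x * w k x)" for k
      proof -
        have "(\<Sum>j\<in>UNIV. p j x * pd j (\<lambda>x. S x $ k) x) = (\<Sum>j\<in>UNIV. (if j = k then p j x else 0) - 2 * V k x * (p j x * p j x) - 2 * P x * (p j x * n j k x))"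
          by (rule sum.cong[OF refl]) (auto simp: pS algebra_simps)
        also have "\<dots> = p k x - 2 * V k x * q x - 2 * P x * w k x"
          by (simp add: sum_subtractf sum_distrib_left[symmetric] q_def w_def)
        also have "\<dots> = - p k x - 2 * (P x * w k x)" unfolding qp(2)[OF x] using qp(1)[OF x] by (simp add: field_simps)
        finally show ?thesis .
      qed
      have "(\<Sum>j\<in>UNIV. kgrad e S z j x * pd j P x) = (\<Sum>j\<in>UNIV. \<Sum>k\<in>UNIV. \<kappa> k (S x) * (p j x * pd j (\<lambda>x. S x $ k) x))"
        unfolding \<kappa>_def kgrad_id_eq kgrad_def[of e S] kq_def p_def
        by (rule sum.cong[OF refl]) (simp add: sum_distrib_left sum_distrib_right sum_negf mult_ac)
      also have "\<dots> = (\<Sum>k\<in>UNIV. \<Sum>j\<in>UNIV. \<kappa> k (S x) * (p j x * pd j (\<lambda>x. S x $ k) x))" by (rule sum.swap)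
      also have "\<dots> = (\<Sum>k\<in>UNIV. \<kappa> k (S x) * (- p k x - 2 * (P x * w k x)))" by (simp only: sum_distrib_left[symmetric] pk)
      finally have s: "(\<Sum>j\<in>UNIV. kgrad e S z j x * pd j P x) = (\<Sum>k\<in>UNIV. \<kappa> k (S x) * (- p k x - 2 * (P x * w k x)))" .
      have "(\<Sum>j\<in>UNIV. (kgrad e (\<lambda>x. x) z j x + kgrad e S z j x) * pd j P x) = (\<Sum>j\<in>UNIV. \<kappa> j x * p j x) + (\<Sum>j\<in>UNIV. kgrad e S z j x * pd j P x)"
        unfolding \<kappa>_def p_def by (simp only: distrib_right sum.distrib)
      also have "\<dots> = (\<Sum>k\<in>UNIV. \<kappa> k x * p k x + \<kappa> k (S x) * (- p k x - 2 * (P x * w k x)))" unfolding s by (simp only: sum.distrib)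
      also have "\<dots> = (\<Sum>k\<in>UNIV. p k x * (\<kappa> k x - \<kappa> k (S x)) - 2 * P x * (\<kappa> k (S x) * w k x))"
        by (rule sum.cong[OF refl]) (simp add: algebra_simps)
      finally show ?thesis by (simp only: sum_subtractf)
    qed
    have "\<exists>Lk. \<forall>k. 0 \<le> Lk k \<and> (\<forall>x\<in>cball x0 R. \<forall>y\<in>cball x0 R. \<bar>\<kappa> k x - \<kappa> k y\<bar> \<le> Lk k * norm (x - y))"
      using smooth_locally_Lipschitz[OF sk, of x0 R] by metis
    then obtain Lk where Lk: "\<forall>k. 0 \<le> Lk k \<and> (\<forall>x\<in>cball x0 R. \<forall>y\<in>cball x0 R. \<bar>\<kappa> k x - \<kappa> k y\<bar> \<le> Lk k * norm (x - y))" by blast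
    define L1 where "L1 = (\<Sum>k\<in>UNIV. Lk k)"
    have L10: "0 \<le> L1" "\<And>k. Lk k \<le> L1" unfolding L1_def using Lk by (auto intro!: sum_nonneg member_le_sum)
    obtain ck where ck0: "0 \<le> ck" and ckb: "\<forall>k. \<forall>x\<in>cball x0 R. \<bar>\<kappa> k x\<bar> \<le> ck"
      by (rule finite_family_bound[of "cball x0 R" \<kappa>]) (use smooth_on_continuous[OF sk] in auto)
    \<comment> \<open>This constant depends on \<open>e\<close> and \<open>z\<close>. That is
      harmless, because it only justifies the integration by parts, whose conclusion is an
      identity.\<close>
    define ct where "ct = ?N * (cP * (L1 * (?N * (2 * cV)))) + ?N * (2 * (ck * (?N * (cP * cn))))"
    have ct0: "0 \<le> ct" unfolding ct_def using cP0 L10 cV0 ck0 cn0 by simp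
    have tb: "\<bar>\<Sum>j\<in>UNIV. (kgrad e (\<lambda>x. x) z j x + kgrad e S z j x) * pd j P x\<bar> \<le> ct * \<bar>P x\<bar>" if x: "x \<in> K" for x
    proof -
      have xb: "x \<in> ball x0 R" "x \<in> cball x0 R" "S x \<in> cball x0 R" using KR1[OF x] R1(2) by auto
      have t1: "\<bar>p k x * (\<kappa> k x - \<kappa> k (S x))\<bar> \<le> cP * (L1 * (?N * (2 * cV) * \<bar>P x\<bar>))" for k
      proof -
        have "\<bar>\<kappa> k x - \<kappa> k (S x)\<bar> \<le> Lk k * norm (x - S x)" using Lk xb by blast
        also have "\<dots> \<le> L1 * (?N * (2 * cV) * \<bar>P x\<bar>)" using L10 Sdist[OF xb(1)] by (intro mult_mono) (auto simp: norm_minus_commute)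
        finally show ?thesis unfolding abs_mult using cPb xb cP0 by (intro mult_mono) auto
      qed
      have t2: "\<bar>2 * P x * (\<kappa> k (S x) * w k x)\<bar> \<le> 2 * \<bar>P x\<bar> * (ck * (?N * (cP * cn)))" for k
      proof -
        have "\<bar>w k x\<bar> \<le> ?N * (cP * cn)" unfolding w_def
        proof (rule abs_sum_le_card)
          fix j
          have "\<bar>n j k x\<bar> \<le> cn" using cnb xb(2) by (metis fst_conv snd_conv)
          then show "\<bar>p j x * n j k x\<bar> \<le> cP * cn" unfolding abs_mult using cPb xb cP0 by (intro mult_mono) auto
        qed
        then have "\<bar>\<kappa> k (S x) * w k x\<bar> \<le> ck * (?N * (cP * cn))" unfolding abs_mult using ckb xb ck0 by (intro mult_mono) auto
        then show ?thesis unfolding abs_mult[of "2 * P x"] by (simp only: abs_mult[of 2] abs_numeral) (rule mult_left_mono, simp_all)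
      qed
      have "\<bar>\<Sum>j\<in>UNIV. (kgrad e (\<lambda>x. x) z j x + kgrad e S z j x) * pd j P x\<bar> \<le> ?N * (cP * (L1 * (?N * (2 * cV) * \<bar>P x\<bar>))) + ?N * (2 * \<bar>P x\<bar> * (ck * (?N * (cP * cn))))"
        unfolding tang[OF xb(1)] by (intro order_trans[OF abs_triangle_ineq4 add_mono] abs_sum_le_card t1 t2)
      also have "\<dots> = ct * \<bar>P x\<bar>" unfolding ct_def by (simp only: algebra_simps)
      finally show ?thesis .
    qed
    show "(\<integral>x. (\<Sum>j\<in>UNIV. g x $ j * (\<eta> x * (kgrad e (\<lambda>x. x) z j x + kgrad e S z j x))) \<partial>lebesgue_on \<Omega>)
       = - (\<integral>x. \<theta> x * (\<Sum>j\<in>UNIV. pd j (\<lambda>x. \<eta> x * (kgrad e (\<lambda>x. x) z j x + kgrad e S z j x)) x) \<partial>lebesgue_on \<Omega>)"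
    proof (rule tangential_integration_by_parts[OF Om th gi wg _ P _ _ _ ct0, where K = K])
      show "smooth_on UNIV (\<lambda>x. \<eta> x * (kgrad e (\<lambda>x. x) z j x + kgrad e S z j x))" for j
        by (intro smooth_on_mult smooth_on_add smooth_on_kgrad e1 sS e id) auto
      show "compact K" unfolding K_def by simp
      show "\<eta> x * (kgrad e (\<lambda>x. x) z j x + kgrad e S z j x) = 0" if "x \<notin> K" for j x using e3 that unfolding K_def by simp
      show "x \<in> \<Omega> \<longleftrightarrow> P x < 0" if "x \<in> K" for x by (rule inO[OF KR1(3)[OF that]])
      show "\<bar>\<Sum>j\<in>UNIV. \<eta> x * (kgrad e (\<lambda>x. x) z j x + kgrad e S z j x) * pd j P x\<bar> \<le> ct * \<bar>P x\<bar>" if "x \<in> K" for x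
      proof -
        have "\<bar>\<Sum>j\<in>UNIV. \<eta> x * (kgrad e (\<lambda>x. x) z j x + kgrad e S z j x) * pd j P x\<bar> = \<bar>\<eta> x\<bar> * \<bar>\<Sum>j\<in>UNIV. (kgrad e (\<lambda>x. x) z j x + kgrad e S z j x) * pd j P x\<bar>"
          by (simp only: mult.assoc sum_distrib_left[symmetric] abs_mult)
        also have "\<dots> \<le> 1 * (ct * \<bar>P x\<bar>)" using e4 tb[OF that] by (intro mult_mono) auto
        finally show ?thesis by simp
      qed
    qed
  qed
  show ?thesis
  proof (rule good_point[of "r/2" x0])
    show "0 < r / 2" using r0(1) by simp
    show "Z = \<Omega> \<inter> ball x0 (r/2)" by (rule Z_def)
    obtain cq where cq: "0 < cq" "\<forall>z\<in>K. cq \<le> q z"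
    proof -
      have "continuous_on K q" unfolding q_def by (intro continuous_on_sum continuous_on_mult continuous_on_subset[OF cp]) auto
      moreover have "compact K" "K \<noteq> {}" unfolding K_def using r0(1) by auto
      ultimately obtain y where "y \<in> K" "\<forall>z\<in>K. q y \<le> q z" using continuous_attains_inf[of K q] by blast
      then show ?thesis using that[of "q y"] qp(1)[OF KR1(3)] by blast
    qed
    have fin: "(\<integral>\<^sup>+z. ennreal (\<bar>P z\<bar> powr (- (1/2))) \<partial>lebesgue_on Z) < \<infinity>"
    proof (rule boundary_layer_integral[OF P e1, where R = "norm x0 + 2 * r" and c = cq])
      show "0 \<le> \<eta> x" for x using e4 by simp
      show "\<eta> x = 0" if "x \<notin> cball 0 (norm x0 + 2 * r)" for x
      proof -
        have "x \<notin> cball x0 (2 * r)" using that norm_triangle_ineq2[of x x0] by (auto simp: dist_norm norm_minus_commute)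
        then show ?thesis using e3 by blast
      qed
      show "Z \<in> sets lebesgue" by (rule Zs)
      show "\<eta> z = 1" if "z \<in> Z" for z using e2 that r0(1) unfolding Z_def by auto
      show "P z \<noteq> 0" if "z \<in> Z" for z using ZK(2)[OF that] by simp
      show "0 < cq" by (rule cq(1))
      show "cq \<le> (\<Sum>j\<in>UNIV. pd j P z * pd j P z)" if "z \<in> Z" for z using cq(2) ZK(1)[OF that] unfolding q_def p_def by blast
    qed
    show "integrable (lebesgue_on Z) (\<lambda>z. (- P z) powr (- (1/2)))"
    proof (rule integrableI_bounded)
      show "(\<lambda>z. (- P z) powr (- (1/2))) \<in> borel_measurable (lebesgue_on Z)"
        using borel_measurable_lebesgue_on_continuous[OF smooth_on_continuous[OF P], of Z] by measurable
      have "(\<integral>\<^sup>+z. ennreal (norm ((- P z) powr (- (1/2)))) \<partial>lebesgue_on Z) = (\<integral>\<^sup>+z. ennreal (\<bar>P z\<bar> powr (- (1/2))) \<partial>lebesgue_on Z)"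
        by (rule nn_integral_cong) (use ZK(2) in \<open>auto simp: abs_of_neg\<close>)
      then show "(\<integral>\<^sup>+z. ennreal (norm ((- P z) powr (- (1/2)))) \<partial>lebesgue_on Z) < \<infinity>" using fin by simp
    qed
  qed
qed

subsection \<open>Harmonic functions with Neumann condition are constant\<close>

lemma AE_lebesgue_on_finite_UN:
  fixes S :: "'i \<Rightarrow> 'a::euclidean_space set"
  assumes "finite I" "\<And>i. i \<in> I \<Longrightarrow> S i \<in> sets lebesgue" "\<And>i. i \<in> I \<Longrightarrow> AE x in lebesgue_on (S i). P x"
  shows "AE x in lebesgue_on (\<Union>i\<in>I. S i). P x"
proof -
  have "negligible (\<Union>i\<in>I. {x \<in> S i. \<not> P x})"
    by (rule negligible_Union) (use assms in \<open>auto simp: AE_lebesgue_on_iff_negligible\<close>)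
  moreover have "{x \<in> (\<Union>i\<in>I. S i). \<not> P x} = (\<Union>i\<in>I. {x \<in> S i. \<not> P x})" by auto
  moreover have "(\<Union>i\<in>I. S i) \<in> sets lebesgue" using assms by (intro sets.finite_UN) auto
  ultimately show ?thesis by (simp add: AE_lebesgue_on_iff_negligible)
qed

lemma integrable_lebesgue_on_finite_UN:
  fixes S :: "'i \<Rightarrow> 'a::euclidean_space set" and f :: "'a \<Rightarrow> real"
  assumes "finite I" "\<And>i. i \<in> I \<Longrightarrow> S i \<in> sets lebesgue" "\<And>i. i \<in> I \<Longrightarrow> integrable (lebesgue_on (S i)) f"
  shows "integrable (lebesgue_on (\<Union>i\<in>I. S i)) f"
proof -
  have "set_integrable lebesgue (\<Union>i\<in>I. S i) f"
    by (rule set_integrable_UN[OF assms(1)]) (use assms in \<open>auto simp: set_integrable_def integrable_restrict_space\<close>)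
  moreover have "(\<Union>i\<in>I. S i) \<in> sets lebesgue" using assms by (intro sets.finite_UN) auto
  ultimately show ?thesis by (simp add: set_integrable_def integrable_restrict_space)
qed

text \<open>Compactness of the closure of \<Omega> leaves finitely many patches, and the sum of
  their constants serves everywhere; the potential bound becomes global and can be iterated. Only
  then does the conditional gradient part of \<open>good_point\<close> become available.\<close>

lemma neumann_harmonic_regularity:
  fixes \<Omega> :: "(real^'n::finite) set"
  assumes Om: "bounded \<Omega>" "open \<Omega>" and sb: "smooth_boundary \<Omega>"
    and th: "integrable (lebesgue_on \<Omega>) \<theta>" and gi: "\<And>i. integrable (lebesgue_on \<Omega>) (\<lambda>x. g x $ i)"
    and wg: "weak_grad \<Omega> \<theta> g"
    and neumann: "\<And>w. smooth_on UNIV w \<Longrightarrow> (\<integral>x. (\<Sum>j\<in>UNIV. g x $ j * pd j w x) \<partial>lebesgue_on \<Omega>) = 0"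
  shows "(\<exists>B. AE z in lebesgue_on \<Omega>. \<bar>\<theta> z\<bar> \<le> B) \<and>
    (\<forall>s\<ge>1. \<forall>i. integrable (lebesgue_on \<Omega>) (\<lambda>z. \<bar>g z $ i\<bar> powr s))"
proof -
  have "good_point \<Omega> \<theta> g x" if "x \<in> closure \<Omega>" for x
  proof (cases "x \<in> \<Omega>")
    case True
    show ?thesis by (rule interior_good_point[OF Om True th gi wg neumann])
  next
    case False
    then have "x \<in> frontier \<Omega>" using that Om(2) by (simp add: frontier_def interior_open)
    show ?thesis by (rule boundary_good_point[OF Om sb \<open>x \<in> frontier \<Omega>\<close> th gi wg neumann])
  qed
  \<comment> \<open>Radius and constant become arguments, so that they can be chosen as functions of
    the point before compactness is used.\<close>
  define G where "G x r M \<longleftrightarrow> 0 < r \<and> 0 \<le> M \<and>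
     (AE z in lebesgue_on (\<Omega> \<inter> ball x r). ennreal \<bar>\<theta> z\<bar> \<le> ennreal M +
        ennreal M * (\<integral>\<^sup>+x. ennreal \<bar>\<theta> x\<bar> * ennreal (norm (x - z) powr (- (real CARD('n) - 1))) \<partial>lebesgue_on \<Omega>)) \<and>
     (\<forall>B. (AE x in lebesgue_on \<Omega>. \<bar>\<theta> x\<bar> \<le> B) \<longrightarrow>
        (\<forall>s\<ge>1. \<forall>i. integrable (lebesgue_on (\<Omega> \<inter> ball x r)) (\<lambda>z. \<bar>g z $ i\<bar> powr s)))" for x r M
  have "\<forall>x\<in>closure \<Omega>. \<exists>r M. G x r M"
    using \<open>\<And>x. x \<in> closure \<Omega> \<Longrightarrow> good_point \<Omega> \<theta> g x\<close> unfolding good_point_def G_def by blast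
  then obtain r M where G: "\<And>x. x \<in> closure \<Omega> \<Longrightarrow> G x (r x) (M x)" by metis
  have "compact (closure \<Omega>)" using Om(1) by (simp add: compact_closure)
  moreover have "closure \<Omega> \<subseteq> (\<Union>x\<in>closure \<Omega>. ball x (r x))" using G by (force simp: G_def)
  ultimately obtain I where I: "I \<subseteq> closure \<Omega>" "finite I" "closure \<Omega> \<subseteq> (\<Union>x\<in>I. ball x (r x))"
    by (rule compactE_image[OF _ open_ball])
  have U: "(\<Union>x\<in>I. \<Omega> \<inter> ball x (r x)) = \<Omega>" using I(3) closure_subset[of \<Omega>] by auto
  have L: "\<Omega> \<inter> ball x (r x) \<in> sets lebesgue" for x using Om(2) by (auto intro: borel_open)
  define m where "m = (\<Sum>x\<in>I. M x)"
  have M0: "0 \<le> M x" if "x \<in> I" for x using G[of x] I(1) that by (auto simp: G_def)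
  have m: "M x \<le> m" if "x \<in> I" for x unfolding m_def
    using that I(2) M0 by (intro member_le_sum) auto
  have m0: "0 \<le> m" unfolding m_def using M0 by (rule sum_nonneg)
  have "AE z in lebesgue_on (\<Union>x\<in>I. \<Omega> \<inter> ball x (r x)). ennreal \<bar>\<theta> z\<bar> \<le> ennreal m +
        ennreal m * (\<integral>\<^sup>+x. ennreal \<bar>\<theta> x\<bar> * ennreal (norm (x - z) powr (- (real CARD('n) - 1))) \<partial>lebesgue_on \<Omega>)"
  proof (rule AE_lebesgue_on_finite_UN[OF I(2) L])
    fix x assume x: "x \<in> I"
    then have "AE z in lebesgue_on (\<Omega> \<inter> ball x (r x)). ennreal \<bar>\<theta> z\<bar> \<le> ennreal (M x) +
        ennreal (M x) * (\<integral>\<^sup>+x. ennreal \<bar>\<theta> x\<bar> * ennreal (norm (x - z) powr (- (real CARD('n) - 1))) \<partial>lebesgue_on \<Omega>)"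
      using G[of x] I(1) by (auto simp: G_def)
    then show "AE z in lebesgue_on (\<Omega> \<inter> ball x (r x)). ennreal \<bar>\<theta> z\<bar> \<le> ennreal m +
        ennreal m * (\<integral>\<^sup>+x. ennreal \<bar>\<theta> x\<bar> * ennreal (norm (x - z) powr (- (real CARD('n) - 1))) \<partial>lebesgue_on \<Omega>)"
    proof eventually_elim
      case (elim z)
      have "ennreal (M x) \<le> ennreal m" using m[OF x] by (rule ennreal_leI)
      then show ?case by (intro order_trans[OF elim] add_mono mult_right_mono) auto
    qed
  qed
  then obtain B where B: "AE z in lebesgue_on \<Omega>. \<bar>\<theta> z\<bar> \<le> B"
    unfolding U by (rule riesz_iteration[OF Om th m0])
  have "integrable (lebesgue_on (\<Union>x\<in>I. \<Omega> \<inter> ball x (r x))) (\<lambda>z. \<bar>g z $ i\<bar> powr s)" if "1 \<le> s" for s i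
    by (rule integrable_lebesgue_on_finite_UN[OF I(2) L]) (use G I(1) B that in \<open>auto simp: G_def\<close>)
  then show ?thesis unfolding U using B by blast
qed

lemma constant_of_wgrad_zero:
  fixes \<Omega> :: "(real^'n::finite) set"
  assumes Om: "bounded \<Omega>" "open \<Omega>" "connected \<Omega>" and q: "1 \<le> q" and f: "W1 q \<Omega> f"
    and z: "AE x in lebesgue_on \<Omega>. wgrad q \<Omega> f x = 0"
  shows "\<exists>c. AE x in lebesgue_on \<Omega>. f x = c"
proof -
  have "integrable (lebesgue_on \<Omega>) f" using Lp_integrable[OF Om(1,2) q] f by (simp add: W1_def)
  moreover have "(\<integral>x. f x * pd i \<phi> x \<partial>lebesgue_on \<Omega>) = 0" if "test_fun \<Omega> \<phi>" for \<phi> i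
  proof -
    have "(\<integral>x. wgrad q \<Omega> f x $ i * \<phi> x \<partial>lebesgue_on \<Omega>) = 0"
      by (rule integral_eq_zero_AE) (use z in eventually_elim, simp)
    then show ?thesis using W1_wgrad(2)[OF f] that by (simp add: weak_grad_def)
  qed
  ultimately show ?thesis by (rule constant_of_zero_weak_grad[OF Om(2,3)]) (assumption, rule exI)
qed

lemma AE_zero_of_Dirichlet_zero:
  fixes g :: "'a \<Rightarrow> real^'n::finite"
  assumes i: "\<And>i. integrable M (\<lambda>x. \<bar>g x $ i\<bar> powr 2)" and m: "\<And>i. (\<lambda>x. g x $ i) \<in> borel_measurable M"
    and z: "(\<integral>x. inner (g x) (g x) \<partial>M) \<le> 0"
  shows "AE x in M. g x = 0"
proof -
  have "\<bar>a\<bar> powr 2 = a * a" for a :: real by (simp add: powr_numeral power2_eq_square)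
  then have "integrable M (\<lambda>x. g x $ i * g x $ i)" for i using i[of i] by simp
  then have I: "integrable M (\<lambda>x. inner (g x) (g x))" by (simp add: inner_vec_def)
  have "0 \<le> (\<integral>x. inner (g x) (g x) \<partial>M)" by (rule Bochner_Integration.integral_nonneg) simp
  then have "(\<integral>x. inner (g x) (g x) \<partial>M) = 0" using z by linarith
  then have "AE x in M. inner (g x) (g x) = 0" using integral_nonneg_eq_0_iff_AE[OF I] by simp
  then show ?thesis by simp
qed

lemma wgrad_eq_AE:
  fixes \<Omega> :: "(real^'n::finite) set"
  assumes Om: "bounded \<Omega>" "open \<Omega>" and q: "1 \<le> q" and f: "W1 q \<Omega> f"
    and g: "\<And>i. integrable (lebesgue_on \<Omega>) (\<lambda>x. g x $ i)" "weak_grad \<Omega> f g"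
  shows "AE x in lebesgue_on \<Omega>. wgrad q \<Omega> f x = g x"
  by (rule weak_grad_unique[OF Om(2) Lp_integrable[OF Om q W1_wgrad(1)[OF f]] W1_wgrad(2)[OF f] g])

lemma neumann_harmonic_constant:
  fixes \<Omega> :: "(real^'n::finite) set"
  assumes Om: "bounded \<Omega>" "open \<Omega>" "connected \<Omega>" and sb: "smooth_boundary \<Omega>"
    and q: "1 < q" "q < 2" and th: "W1 q \<Omega> \<theta>"
    and eq: "\<And>w. W1 (q / (q - 1)) \<Omega> w \<Longrightarrow> Aform q (q / (q - 1)) \<Omega> \<theta> w = 0"
  shows "\<exists>c. AE x in lebesgue_on \<Omega>. \<theta> x = c"
proof -
  define g where "g = wgrad q \<Omega> \<theta>"
  define r where "r = q / (q - 1)"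
  have r: "2 \<le> r" unfolding r_def using q by (simp add: field_simps)
  have q1: "1 \<le> q" and r1: "1 \<le> r" using q r by auto
  have gL: "Lp q \<Omega> (\<lambda>x. g x $ i)" for i unfolding g_def by (rule W1_wgrad[OF th])
  have gi: "integrable (lebesgue_on \<Omega>) (\<lambda>x. g x $ i)" for i by (rule Lp_integrable[OF Om(1,2) q1 gL])
  have thi: "integrable (lebesgue_on \<Omega>) \<theta>" using Lp_integrable[OF Om(1,2) q1] th by (simp add: W1_def)
  have wg: "weak_grad \<Omega> \<theta> g" unfolding g_def by (rule W1_wgrad[OF th])
  have "(\<integral>x. (\<Sum>j\<in>UNIV. g x $ j * pd j w x) \<partial>lebesgue_on \<Omega>) = 0" if w: "smooth_on UNIV w" for w
  proof -
    have "(\<integral>x. (\<Sum>j\<in>UNIV. g x $ j * pd j w x) \<partial>lebesgue_on \<Omega>) = Aform q r \<Omega> \<theta> w"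
      unfolding Aform_def g_def[symmetric]
    proof (rule integral_cong_AE)
      have mp: "pd j w \<in> borel_measurable (lebesgue_on \<Omega>)" for j
        by (rule borel_measurable_lebesgue_on_continuous[OF smooth_on_continuous[OF smooth_on_pd[OF w]]])
      have mg: "(\<lambda>x. g x $ j) \<in> borel_measurable (lebesgue_on \<Omega>)" for j using gL by (simp add: Lp_def)
      have mr: "(\<lambda>x. wgrad r \<Omega> w x $ j) \<in> borel_measurable (lebesgue_on \<Omega>)" for j
        using W1_wgrad(1)[OF smooth_W1(1)[OF Om(1,2) r1 w]] by (simp add: Lp_def)
      show "(\<lambda>x. \<Sum>j\<in>UNIV. g x $ j * pd j w x) \<in> borel_measurable (lebesgue_on \<Omega>)" using mp mg by simp
      show "(\<lambda>x. inner (g x) (wgrad r \<Omega> w x)) \<in> borel_measurable (lebesgue_on \<Omega>)"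
        unfolding inner_vec_def using mg mr by simp
      show "AE x in lebesgue_on \<Omega>. (\<Sum>j\<in>UNIV. g x $ j * pd j w x) = inner (g x) (wgrad r \<Omega> w x)"
        using smooth_W1(2)[OF Om(1,2) r1 w] by eventually_elim (simp add: inner_vec_def)
    qed
    then show ?thesis using eq smooth_W1(1)[OF Om(1,2) r1 w] by (simp add: r_def)
  qed
  from neumann_harmonic_regularity[OF Om(1,2) sb thi gi wg this]
  obtain B where B: "AE z in lebesgue_on \<Omega>. \<bar>\<theta> z\<bar> \<le> B"
    and gs: "\<And>s i. 1 \<le> s \<Longrightarrow> integrable (lebesgue_on \<Omega>) (\<lambda>z. \<bar>g z $ i\<bar> powr s)" by blast
  have "Lp r \<Omega> \<theta>" using Lp_bounded[OF Om(1,2) _ _ B] thi r1 by simp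
  moreover have gLr: "Lp r \<Omega> (\<lambda>x. g x $ i)" for i using gs[OF r1] gL[of i] by (simp add: Lp_def)
  ultimately have W: "W1 r \<Omega> \<theta>" using wg by (auto simp: W1_def)
  \<comment> \<open>The gradients for the exponents q and r are separate choices of representative
    and must be identified almost everywhere before the form becomes the integral of |g|^2.\<close>
  have "AE x in lebesgue_on \<Omega>. wgrad r \<Omega> \<theta> x = g x" by (rule wgrad_eq_AE[OF Om(1,2) r1 W gi wg])
  moreover have mg: "(\<lambda>x. g x $ j) \<in> borel_measurable (lebesgue_on \<Omega>)" for j using gL by (simp add: Lp_def)
  moreover have "(\<lambda>x. wgrad r \<Omega> \<theta> x $ j) \<in> borel_measurable (lebesgue_on \<Omega>)" for j
    using W1_wgrad(1)[OF W] by (simp add: Lp_def)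
  ultimately have "Aform q r \<Omega> \<theta> \<theta> = (\<integral>x. inner (g x) (g x) \<partial>lebesgue_on \<Omega>)"
    unfolding Aform_def g_def[symmetric] inner_vec_def by (intro integral_cong_AE) auto
  then have "(\<integral>x. inner (g x) (g x) \<partial>lebesgue_on \<Omega>) \<le> 0" using eq W by (simp add: r_def)
  then have "AE x in lebesgue_on \<Omega>. g x = 0" by (intro AE_zero_of_Dirichlet_zero gs mg) auto
  then show ?thesis unfolding g_def by (rule constant_of_wgrad_zero[OF Om q1 th])
qed

text \<open>Because \<open>wgrad\<close> is a choice, its linearity holds only almost everywhere.
  Affine maps cover the functions formed from a solution: t p in the equation for u, and c - chi and
  the segment from chi to c in the inclusion.\<close>

lemma V_affine:
  fixes \<Omega> :: "(real^'n::finite) set"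
  assumes Om: "bounded \<Omega>" "open \<Omega>" and f: "V \<Omega> f"
  shows "V \<Omega> (\<lambda>x. a * f x + b)" "AE x in lebesgue_on \<Omega>. wgrad 2 \<Omega> (\<lambda>x. a * f x + b) x = a *\<^sub>R wgrad 2 \<Omega> f x"
proof -
  interpret finite_measure "lebesgue_on \<Omega>" using Om by (rule finite_measure_bounded_open)
  have abs2: "\<bar>r\<bar> powr 2 = r^2" for r :: real by simp
  have mf: "f \<in> borel_measurable (lebesgue_on \<Omega>)" and f2: "integrable (lebesgue_on \<Omega>) (\<lambda>x. (f x)^2)"
    using f by (auto simp: W1_def Lp_def abs2)
  have fi: "integrable (lebesgue_on \<Omega>) f" using f Lp_integrable[OF Om, of 2] by (simp add: W1_def)
  have gL: "Lp 2 \<Omega> (\<lambda>x. wgrad 2 \<Omega> f x $ i)" for i by (rule W1_wgrad[OF f])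
  have gi: "integrable (lebesgue_on \<Omega>) (\<lambda>x. wgrad 2 \<Omega> f x $ i)" for i
    by (rule Lp_integrable[OF Om _ gL]) simp
  have "(a * f x + b)^2 = a^2 * (f x)^2 + (2 * a * b) * f x + b^2" for x by (simp add: power2_eq_square algebra_simps)
  then have "Lp 2 \<Omega> (\<lambda>x. a * f x + b)" unfolding Lp_def abs2 using mf f2 fi by simp
  moreover have gL': "Lp 2 \<Omega> (\<lambda>x. (a *\<^sub>R wgrad 2 \<Omega> f x) $ i)" for i
    using gL[of i] by (auto simp: Lp_def abs2 power_mult_distrib)
  moreover have W: "weak_grad \<Omega> (\<lambda>x. a * f x + b) (\<lambda>x. a *\<^sub>R wgrad 2 \<Omega> f x)"
    unfolding weak_grad_def
  proof (intro allI impI)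
    fix \<phi> i assume t: "test_fun \<Omega> \<phi>"
    have s: "smooth_on UNIV (pd i \<phi>)" by (rule smooth_on_pd[OF test_fun_smooth[OF t]])
    obtain C where C: "\<And>x. x \<in> \<Omega> \<Longrightarrow> \<bar>pd i \<phi> x\<bar> \<le> C"
      using continuous_bounded_on_bounded[OF Om(1) smooth_on_continuous[OF s]] by blast
    have i1: "integrable (lebesgue_on \<Omega>) (\<lambda>x. f x * pd i \<phi> x)"
      by (rule integrable_mult_test[OF fi smooth_on_continuous[OF s] C])
    have i2: "integrable (lebesgue_on \<Omega>) (\<lambda>x. b * pd i \<phi> x)"
      by (rule integrable_mult_test[OF _ smooth_on_continuous[OF s] C]) simp
    have "weak_grad \<Omega> (\<lambda>x. b) (\<lambda>x. \<chi> i. pd i (\<lambda>x. b) x)" by (rule smooth_weak_grad[OF Om(2)]) simp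
    then have z: "(\<integral>x. b * pd i \<phi> x \<partial>lebesgue_on \<Omega>) = 0" using t unfolding weak_grad_def by (auto simp: pd_const)
    have "(\<integral>x. (a * f x + b) * pd i \<phi> x \<partial>lebesgue_on \<Omega>) = (\<integral>x. a * (f x * pd i \<phi> x) + b * pd i \<phi> x \<partial>lebesgue_on \<Omega>)"
      by (simp add: algebra_simps)
    also have "\<dots> = a * (\<integral>x. f x * pd i \<phi> x \<partial>lebesgue_on \<Omega>)" using i1 i2 z by simp
    also have "\<dots> = - (\<integral>x. (a *\<^sub>R wgrad 2 \<Omega> f x) $ i * \<phi> x \<partial>lebesgue_on \<Omega>)"
      using W1_wgrad(2)[OF f] t by (simp add: weak_grad_def mult.assoc)
    finally show "(\<integral>x. (a * f x + b) * pd i \<phi> x \<partial>lebesgue_on \<Omega>) =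
       - (\<integral>x. (a *\<^sub>R wgrad 2 \<Omega> f x) $ i * \<phi> x \<partial>lebesgue_on \<Omega>)" .
  qed
  ultimately show 1: "V \<Omega> (\<lambda>x. a * f x + b)" by (auto simp: W1_def intro!: exI[of _ "\<lambda>x. a *\<^sub>R wgrad 2 \<Omega> f x"])
  show "AE x in lebesgue_on \<Omega>. wgrad 2 \<Omega> (\<lambda>x. a * f x + b) x = a *\<^sub>R wgrad 2 \<Omega> f x"
    by (rule wgrad_eq_AE[OF Om _ 1 _ W]) (use gi in auto)
qed

lemma wgrad_measurable: "W1 q \<Omega> f \<Longrightarrow> (\<lambda>x. wgrad q \<Omega> f x $ i) \<in> borel_measurable (lebesgue_on \<Omega>)"
  using W1_wgrad(1) by (auto simp: Lp_def)

lemma Aform_affine: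
  fixes \<Omega> :: "(real^'n::finite) set"
  assumes Om: "bounded \<Omega>" "open \<Omega>" and f: "V \<Omega> f" and w: "V \<Omega> w"
  shows "Aform 2 2 \<Omega> (\<lambda>x. a * f x + b) w = a * Aform 2 2 \<Omega> f w" "Aform 2 2 \<Omega> w (\<lambda>x. a * f x + b) = a * Aform 2 2 \<Omega> w f"
proof -
  note * = wgrad_measurable[OF f] wgrad_measurable[OF w] wgrad_measurable[OF V_affine(1)[OF Om f, of a b]]
  have "Aform 2 2 \<Omega> (\<lambda>x. a * f x + b) w = (\<integral>x. a * inner (wgrad 2 \<Omega> f x) (wgrad 2 \<Omega> w x) \<partial>lebesgue_on \<Omega>)"
    unfolding Aform_def
  proof (rule integral_cong_AE)
    show "AE x in lebesgue_on \<Omega>. inner (wgrad 2 \<Omega> (\<lambda>x. a * f x + b) x) (wgrad 2 \<Omega> w x) = a * inner (wgrad 2 \<Omega> f x) (wgrad 2 \<Omega> w x)"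
      using V_affine(2)[OF Om f, of a b] by eventually_elim simp
  qed (use * in \<open>simp_all add: inner_vec_def\<close>)
  then show 1: "Aform 2 2 \<Omega> (\<lambda>x. a * f x + b) w = a * Aform 2 2 \<Omega> f w" by (simp add: Aform_def)
  have "Aform 2 2 \<Omega> f' g' = Aform 2 2 \<Omega> g' f'" for f' g' by (simp add: Aform_def inner_commute)
  then show "Aform 2 2 \<Omega> w (\<lambda>x. a * f x + b) = a * Aform 2 2 \<Omega> w f" using 1 by metis
qed

lemma constant_of_Aform_self:
  fixes \<Omega> :: "(real^'n::finite) set"
  assumes Om: "bounded \<Omega>" "open \<Omega>" "connected \<Omega>" and f: "V \<Omega> f" and z: "Aform 2 2 \<Omega> f f \<le> 0"
  shows "AE x in lebesgue_on \<Omega>. wgrad 2 \<Omega> f x = 0" "\<exists>c. AE x in lebesgue_on \<Omega>. f x = c"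
proof -
  show 1: "AE x in lebesgue_on \<Omega>. wgrad 2 \<Omega> f x = 0"
    by (rule AE_zero_of_Dirichlet_zero) (use W1_wgrad(1)[OF f] z in \<open>auto simp: Lp_def Aform_def\<close>)
  show "\<exists>c. AE x in lebesgue_on \<Omega>. f x = c" by (rule constant_of_wgrad_zero[OF Om _ f 1]) simp
qed

subsection \<open>Stationary solutions\<close>

text \<open>Subtracting the identity at two different times leaves the stationary equation for p.\<close>
lemma pressure_constant:
  fixes \<Omega> :: "(real^'n::finite) set" and F u0 :: "(real^'n \<Rightarrow> real) \<Rightarrow> real"
  assumes Om: "bounded \<Omega>" "open \<Omega>" "connected \<Omega>" and p: "V \<Omega> p" and T: "0 < T"
    and eq: "AE t in lebesgue_on {0<..<T}. \<forall>w. V \<Omega> w \<longrightarrow> F w + Aform 2 2 \<Omega> (\<lambda>x. t * p x) w = u0 w"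
  shows "\<exists>c. AE x in lebesgue_on \<Omega>. p x = c"
proof -
  obtain t where t: "t \<in> {0<..<T}" "\<forall>w. V \<Omega> w \<longrightarrow> F w + Aform 2 2 \<Omega> (\<lambda>x. t * p x) w = u0 w"
    by (rule AE_lebesgue_on_not_False[OF _ _ eq]) (use T in auto)
  have "AE t in lebesgue_on {0<..<t}. \<forall>w. V \<Omega> w \<longrightarrow> F w + Aform 2 2 \<Omega> (\<lambda>x. t * p x) w = u0 w"
    by (rule AE_lebesgue_on_subset[OF eq]) (use t(1) in auto)
  \<comment> \<open>Choosing the second time below the first gives t - s > 0, so the difference of
    the two identities forces the form to vanish.\<close>
  then obtain s where s: "s \<in> {0<..<t}" "\<forall>w. V \<Omega> w \<longrightarrow> F w + Aform 2 2 \<Omega> (\<lambda>x. s * p x) w = u0 w"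
    by (rule AE_lebesgue_on_not_False[rotated 2]) (use t(1) in auto)
  have "Aform 2 2 \<Omega> (\<lambda>x. r * p x) p = r * Aform 2 2 \<Omega> p p" for r
    using Aform_affine(1)[OF Om(1,2) p p, of r 0] by simp
  then have "t * Aform 2 2 \<Omega> p p = s * Aform 2 2 \<Omega> p p" using s(2) t(2) p by (metis add_left_cancel)
  then have "Aform 2 2 \<Omega> p p \<le> 0" using s(1) by simp
  then show ?thesis by (rule constant_of_Aform_self(2)[OF Om p])
qed

text \<open>The primitive of ln (1 + s) that vanishes at 0, in closed form; on [0,1] it gives the
  real values of \<open>beta_hat\<close>.\<close>

definition beta_prim :: "real \<Rightarrow> real" where
  "beta_prim r = (1 + r) * ln (1 + r) - r"

text \<open>Concavity of ln, as the tangent inequality at 1 + a.\<close>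

lemma ln_one_plus_diff_le:
  fixes a b :: real
  assumes "0 \<le> a" "0 \<le> b"
  shows "(1 + a) * (ln (1 + b) - ln (1 + a)) \<le> b - a"
  using ln_diff_le[of "1 + b" "1 + a"] assms by (simp add: field_simps)

lemma beta_prim_bounds:
  assumes "0 \<le> r" "r \<le> 1"
  shows "0 \<le> beta_prim r" "beta_prim r \<le> 1"
proof -
  show "0 \<le> beta_prim r" unfolding beta_prim_def using ln_one_plus_diff_le[of r 0] assms by simp
  have "(1 + r) * ln (1 + r) \<le> (1 + r) * r" using assms ln_add_one_self_le_self[of r] by (intro mult_left_mono) auto
  moreover have "r * r \<le> 1 * 1" using assms by (intro mult_mono) auto
  ultimately show "beta_prim r \<le> 1" unfolding beta_prim_def by (simp add: algebra_simps)
qed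

lemma beta_hat_eq: "beta_hat r = (if 0 \<le> r \<and> r \<le> 1 then ennreal (beta_prim r) else \<infinity>)"
proof -
  have "integral {0..r} (\<lambda>s. ln (1 + s)) = beta_prim r" if "0 \<le> r"
  proof -
    have "((\<lambda>s. ln (1 + s)) has_integral (beta_prim r - beta_prim 0)) {0..r}"
    proof (rule fundamental_theorem_of_calculus[OF that])
      fix x assume x: "x \<in> {0..r}"
      have "(beta_prim has_real_derivative ln (1 + x)) (at x within {0..r})"
        unfolding beta_prim_def[abs_def] by (rule derivative_eq_intros refl | use x in simp)+
      then show "(beta_prim has_vector_derivative ln (1 + x)) (at x within {0..r})"
        by (simp add: has_real_derivative_iff_has_vector_derivative)
    qed
    then show ?thesis by (simp add: integral_unique beta_prim_def)
  qed
  then show ?thesis by (simp add: beta_hat_def)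
qed

lemma beta_hat_measurable [measurable]: "beta_hat \<in> borel_measurable borel"
  unfolding beta_hat_eq[abs_def] beta_prim_def by measurable

text \<open>Convexity bounds the increment by ln (1 + b) (b - a). Replacing b by a in the logarithm
  costs at most (b - a)^2, because ln (1 + r) is 1-Lipschitz for r \<ge> 0. The error is of second
  order, so it disappears when a small step is divided out.\<close>

lemma beta_prim_diff_le:
  assumes "0 \<le> a" "0 \<le> b"
  shows "beta_prim b - beta_prim a \<le> ln (1 + a) * (b - a) + (b - a)^2"
proof -
  have 1: "beta_prim b - beta_prim a \<le> ln (1 + b) * (b - a)"
    unfolding beta_prim_def using ln_one_plus_diff_le[OF assms] by (simp add: algebra_simps)
  have le: "ln (1 + d) - ln (1 + c) \<le> d - c" if "0 \<le> c" "c \<le> d" for c d :: real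
    using ln_diff_le[of "1 + d" "1 + c"] that divide_left_mono[of 1 "1 + c" "d - c"] by simp
  have "(ln (1 + b) - ln (1 + a)) * (b - a) \<le> (b - a)^2"
  proof (cases "a \<le> b")
    case True
    then show ?thesis unfolding power2_eq_square using le[OF assms(1) True] by (intro mult_right_mono) auto
  next
    case False
    then have "(ln (1 + a) - ln (1 + b)) * (a - b) \<le> (a - b) * (a - b)" using le[OF assms(2), of a] by (intro mult_right_mono) auto
    then show ?thesis by (simp add: power2_eq_square algebra_simps)
  qed
  then show ?thesis using 1 by (simp add: algebra_simps)
qed

text \<open>The origin of the bounds on chi: finiteness of the potential forbids values outside
  [0,1] on a set of positive measure.\<close>

lemma J_finite_imp:
  assumes "v \<in> borel_measurable (lebesgue_on \<Omega>)" "J \<Omega> v < \<infinity>"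
  shows "AE x in lebesgue_on \<Omega>. 0 \<le> v x \<and> v x \<le> 1"
proof -
  have "AE x in lebesgue_on \<Omega>. beta_hat (v x) \<noteq> \<infinity>"
    by (rule nn_integral_PInf_AE) (use assms in \<open>auto simp: J_def\<close>)
  then show ?thesis by eventually_elim (simp add: beta_hat_eq split: if_splits)
qed

text \<open>Transfers \<open>J\<close> from extended nonnegative values to a real integral, where
  the subdifferential inequality can be rearranged by subtraction.\<close>

lemma J_eq:
  fixes \<Omega> :: "(real^'n::finite) set"
  assumes Om: "bounded \<Omega>" "open \<Omega>" and v: "v \<in> borel_measurable (lebesgue_on \<Omega>)"
    and b: "AE x in lebesgue_on \<Omega>. 0 \<le> v x \<and> v x \<le> 1"
  shows "integrable (lebesgue_on \<Omega>) (\<lambda>x. beta_prim (v x))"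
    "enn2ereal (J \<Omega> v) = ereal (\<integral>x. beta_prim (v x) \<partial>lebesgue_on \<Omega>)"
proof -
  interpret finite_measure "lebesgue_on \<Omega>" using Om by (rule finite_measure_bounded_open)
  have B: "AE x in lebesgue_on \<Omega>. 0 \<le> beta_prim (v x) \<and> beta_prim (v x) \<le> 1"
    using b by eventually_elim (simp add: beta_prim_bounds)
  show I: "integrable (lebesgue_on \<Omega>) (\<lambda>x. beta_prim (v x))"
  proof (rule integrable_const_bound[where B = 1])
    show "AE x in lebesgue_on \<Omega>. norm (beta_prim (v x)) \<le> 1" using B by eventually_elim simp
    show "(\<lambda>x. beta_prim (v x)) \<in> borel_measurable (lebesgue_on \<Omega>)" unfolding beta_prim_def using v by measurable
  qed
  have "J \<Omega> v = (\<integral>\<^sup>+x. ennreal (beta_prim (v x)) \<partial>lebesgue_on \<Omega>)"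
    unfolding J_def by (rule nn_integral_cong_AE) (use b in \<open>eventually_elim, simp add: beta_hat_eq\<close>)
  also have "\<dots> = ennreal (\<integral>x. beta_prim (v x) \<partial>lebesgue_on \<Omega>)"
    by (rule nn_integral_eq_integral[OF I]) (use B in \<open>eventually_elim, simp\<close>)
  finally have "J \<Omega> v = ennreal (\<integral>x. beta_prim (v x) \<partial>lebesgue_on \<Omega>)" .
  moreover have "0 \<le> (\<integral>x. beta_prim (v x) \<partial>lebesgue_on \<Omega>)"
    by (rule integral_nonneg_AE) (use B in \<open>eventually_elim, simp\<close>)
  ultimately show "enn2ereal (J \<Omega> v) = ereal (\<integral>x. beta_prim (v x) \<partial>lebesgue_on \<Omega>)"
    by (simp add: enn2ereal_ennreal)
qed

text \<open>Only directions towards a constant are tested, so that the perturbation stays in the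
  domain of \<open>J\<close>; the one-sided derivative of \<open>J\<close> then bounds \<open>\<xi>\<close>.\<close>
lemma subdiff_J_le:
  fixes \<Omega> :: "(real^'n::finite) set"
  assumes Om: "bounded \<Omega>" "open \<Omega>" and sub: "subdiff_J \<Omega> f \<xi>" and c: "0 \<le> c" "c \<le> 1"
  shows "\<xi> (\<lambda>x. c - f x) \<le> (\<integral>x. ln (1 + f x) * (c - f x) \<partial>lebesgue_on \<Omega>)"
proof -
  interpret finite_measure "lebesgue_on \<Omega>" using Om by (rule finite_measure_bounded_open)
  have f: "V \<Omega> f" and d: "dual 2 \<Omega> \<xi>" using sub by (auto simp: subdiff_J_def)
  have mf: "f \<in> borel_measurable (lebesgue_on \<Omega>)" using f by (simp add: W1_def Lp_def)
  have b: "AE x in lebesgue_on \<Omega>. 0 \<le> f x \<and> f x \<le> 1"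
    using J_finite_imp[OF mf] sub by (simp add: subdiff_J_def)
  have w: "V \<Omega> (\<lambda>x. c - f x)" using V_affine(1)[OF Om f, of "- 1" c] by simp
  have I1: "integrable (lebesgue_on \<Omega>) (\<lambda>x. ln (1 + f x) * (c - f x))"
  proof (rule integrable_const_bound[where B = 1])
    show "AE x in lebesgue_on \<Omega>. norm (ln (1 + f x) * (c - f x)) \<le> 1"
      using b
    proof eventually_elim
      case (elim x)
      then have "0 \<le> ln (1 + f x)" "ln (1 + f x) \<le> 1" using ln_add_one_self_le_self[of "f x"] by auto
      moreover have "\<bar>c - f x\<bar> \<le> 1" using elim c by auto
      ultimately have "\<bar>ln (1 + f x)\<bar> * \<bar>c - f x\<bar> \<le> 1 * 1" by (intro mult_mono) auto
      then show ?case by (simp add: abs_mult)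
    qed
    show "(\<lambda>x. ln (1 + f x) * (c - f x)) \<in> borel_measurable (lebesgue_on \<Omega>)" using mf by measurable
  qed
  have I2: "integrable (lebesgue_on \<Omega>) (\<lambda>x. (c - f x)^2)" using w by (simp add: W1_def Lp_def)
  define D where "D = (\<integral>x. (c - f x)^2 \<partial>lebesgue_on \<Omega>)"
  have D: "0 \<le> D" unfolding D_def by (rule Bochner_Integration.integral_nonneg) simp
  define Y where "Y = (\<integral>x. ln (1 + f x) * (c - f x) \<partial>lebesgue_on \<Omega>)"
  have step: "\<xi> (\<lambda>x. c - f x) \<le> Y + s * D" if s: "0 < s" "s \<le> 1" for s
  proof -
    define v where "v = (\<lambda>x. (1 - s) * f x + s * c)"
    have v: "V \<Omega> v" unfolding v_def by (rule V_affine(1)[OF Om f])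
    have mv: "v \<in> borel_measurable (lebesgue_on \<Omega>)" using v by (simp add: W1_def Lp_def)
    have bv: "AE x in lebesgue_on \<Omega>. 0 \<le> v x \<and> v x \<le> 1" using b
    proof eventually_elim
      case (elim x)
      have "(1 - s) * f x + s * c \<le> (1 - s) * 1 + s * 1" using elim c s by (intro add_mono mult_left_mono) auto
      then show ?case unfolding v_def using elim c s by simp
    qed
    have vf: "v x - f x = s * (c - f x)" for x unfolding v_def by (simp add: algebra_simps)
    have "ereal (\<integral>x. beta_prim (f x) \<partial>lebesgue_on \<Omega>) + ereal (\<xi> (\<lambda>x. v x - f x)) \<le> ereal (\<integral>x. beta_prim (v x) \<partial>lebesgue_on \<Omega>)"
      using sub v unfolding subdiff_J_def J_eq(2)[OF Om mf b, symmetric] J_eq(2)[OF Om mv bv, symmetric] by blast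
    then have "\<xi> (\<lambda>x. v x - f x) \<le> (\<integral>x. beta_prim (v x) \<partial>lebesgue_on \<Omega>) - (\<integral>x. beta_prim (f x) \<partial>lebesgue_on \<Omega>)" by simp
    also have "\<dots> = (\<integral>x. beta_prim (v x) - beta_prim (f x) \<partial>lebesgue_on \<Omega>)"
      using J_eq(1)[OF Om mf b] J_eq(1)[OF Om mv bv] by simp
    also have "\<dots> \<le> (\<integral>x. s * (ln (1 + f x) * (c - f x)) + s^2 * (c - f x)^2 \<partial>lebesgue_on \<Omega>)"
    proof (rule integral_mono_AE)
      show "AE x in lebesgue_on \<Omega>. beta_prim (v x) - beta_prim (f x) \<le> s * (ln (1 + f x) * (c - f x)) + s^2 * (c - f x)^2"
        using b bv
      proof eventually_elim
        case (elim x)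
        have "beta_prim (v x) - beta_prim (f x) \<le> ln (1 + f x) * (v x - f x) + (v x - f x)^2"
          using elim by (intro beta_prim_diff_le) auto
        then show ?case unfolding vf by (simp add: power_mult_distrib mult.left_commute)
      qed
    qed (use J_eq(1)[OF Om mf b] J_eq(1)[OF Om mv bv] I1 I2 in auto)
    also have "\<dots> = s * (Y + s * D)" using I1 I2 unfolding Y_def D_def by (simp add: power2_eq_square[of s] distrib_left mult.assoc)
    finally have "s * \<xi> (\<lambda>x. c - f x) \<le> s * (Y + s * D)" unfolding vf using d w by (simp add: dual_def)
    then show ?thesis using s by simp
  qed
  show ?thesis unfolding Y_def[symmetric]
  proof (rule field_le_epsilon)
    fix e :: real assume e: "0 < e"
    \<comment> \<open>The denominator D + 1 avoids a division by zero when \<open>f\<close> equals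
      \<open>c\<close> almost everywhere.\<close>
    define s where "s = min 1 (e / (D + 1))"
    have "s * D \<le> (e / (D + 1)) * (D + 1)" unfolding s_def using D e by (intro mult_mono) auto
    then have "s * D \<le> e" using D by simp
    moreover have "0 < s" "s \<le> 1" unfolding s_def using e D by auto
    ultimately show "\<xi> (\<lambda>x. c - f x) \<le> Y + e" using step[of s] by linarith
  qed
qed

theorem theorem2p6:
  fixes \<Omega> :: "(real^'n::finite) set"
    and T \<mu> :: real and h :: "real \<Rightarrow> real"
    and e0 chi0 e \<theta> chi u p :: "real^'n \<Rightarrow> real"
    and u0 \<xi> :: "(real^'n \<Rightarrow> real) \<Rightarrow> real"
  assumes "CARD('n) \<le> 3"
    and "bounded \<Omega>" and "open \<Omega>" and "connected \<Omega>" and "smooth_boundary \<Omega>"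
    and "\<mu> > 0" and "T > 0"
    and "assumption_H h"
    and "stationary_weak_solution \<Omega> T \<mu> h e0 chi0 u0 e \<theta> chi \<xi> u p"
  shows "\<exists>ce c\<theta> cchi cu cp c\<xi> :: real.
           (AE x in lebesgue_on \<Omega>. e x = ce) \<and>
           (AE x in lebesgue_on \<Omega>. \<theta> x = c\<theta>) \<and>
           (AE x in lebesgue_on \<Omega>. chi x = cchi) \<and>
           (\<forall>w. V \<Omega> w \<longrightarrow> \<xi> w = (\<integral>x. c\<xi> * w x \<partial>lebesgue_on \<Omega>)) \<and>
           (AE x in lebesgue_on \<Omega>. u x = cu) \<and>
           (AE x in lebesgue_on \<Omega>. p x = cp) \<and>
           (h c\<theta> - ln cp > 0 \<longrightarrow> cchi = 1 \<and> cp = 2 * cu) \<and>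
           (h c\<theta> - ln cp = 0 \<longrightarrow> 0 \<le> cchi \<and> cchi \<le> 1 \<and> cp = (1 + cchi) * cu) \<and>
           (h c\<theta> - ln cp < 0 \<longrightarrow> cchi = 0 \<and> cp = cu)"
proof -
  note Om = assms(2,3,4)
  from assms(9) obtain q where q: "1 < q" "q < (real CARD('n) + 2) / (real CARD('n) + 1)"
    and th: "W1 q \<Omega> \<theta>"
    and theq: "\<And>w. W1 (q / (q - 1)) \<Omega> w \<Longrightarrow> Aform q (q / (q - 1)) \<Omega> \<theta> w = 0"
    and chi: "V \<Omega> chi" and dual: "dual 2 \<Omega> \<xi>" and u: "AE x in lebesgue_on \<Omega>. u x > 0" and p: "V \<Omega> p"
    and e: "AE x in lebesgue_on \<Omega>. e x = psi h (\<theta> x) (chi x)"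
    and chieq: "\<And>w. V \<Omega> w \<Longrightarrow> integrable (lebesgue_on \<Omega>) (\<lambda>x. (h (\<theta> x) - ln (u x)) * w x) \<and>
        Aform 2 2 \<Omega> chi w + \<xi> w = (\<integral>x. (h (\<theta> x) - ln (u x)) * w x \<partial>lebesgue_on \<Omega>)"
    and sub: "subdiff_J \<Omega> chi \<xi>"
    and ueq: "AE t in lebesgue_on {0<..<T}. \<forall>w. V \<Omega> w \<longrightarrow>
        (\<integral>x. u x * w x \<partial>lebesgue_on \<Omega>) + Aform 2 2 \<Omega> (\<lambda>x. t * p x) w = u0 w"
    and pu: "AE x in lebesgue_on \<Omega>. p x = u x * (1 + chi x)"
    unfolding stationary_weak_solution_def by auto
  show ?thesis
  \<comment> \<open>On the empty set the Sobolev norm is 0, so continuity forces \<xi> = 0, and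
    \<open>cu\<close> = \<open>cp\<close> = \<open>exp (h 0)\<close> with \<open>c\<theta>\<close> =
    \<open>cchi\<close> = 0 falls into the case of equality. Otherwise \<Omega> has positive
    measure, which is needed to turn almost everywhere statements into statements about the
    constants.\<close>
  proof (cases "\<Omega> = {}")
    case True
    have AE0: "AE x in lebesgue_on \<Omega>. P x" for P by (rule AE_I2) (simp add: True)
    have I0: "(\<integral>x. f x \<partial>lebesgue_on \<Omega>) = 0" for f :: "real^'n \<Rightarrow> real"
      by (rule integral_eq_zero_AE[OF AE0])
    obtain C where "\<And>v. V \<Omega> v \<Longrightarrow> \<bar>\<xi> v\<bar> \<le> C * W1_norm 2 \<Omega> v" using dual by (auto simp: dual_def)
    then have "\<xi> w = 0" if "V \<Omega> w" for w using that[THEN \<open>\<And>v. V \<Omega> v \<Longrightarrow> \<bar>\<xi> v\<bar> \<le> C * W1_norm 2 \<Omega> v\<close>] by (simp add: W1_norm_def Lp_norm_def I0)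
    then show ?thesis
      by (intro exI[of _ "0::real"] exI[of _ "exp (h 0)"] conjI AE0) (auto simp: I0)
  next
    case False
    interpret finite_measure "lebesgue_on \<Omega>" using Om by (intro finite_measure_bounded_open)
    have "q < 2" using q(2) by (rule order.strict_trans2) (simp add: field_simps)
    then obtain cth where cth: "AE x in lebesgue_on \<Omega>. \<theta> x = cth"
      using neumann_harmonic_constant[OF Om assms(5) q(1) _ th theq] by blast
    obtain cp where cp: "AE x in lebesgue_on \<Omega>. p x = cp"
      using pressure_constant[OF Om p assms(7) ueq] by blast
    have mchi: "chi \<in> borel_measurable (lebesgue_on \<Omega>)" using chi by (simp add: W1_def Lp_def)
    have chii: "integrable (lebesgue_on \<Omega>) chi" using chi Lp_integrable[OF Om(1,2), of 2] by (simp add: W1_def)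
    have b: "AE x in lebesgue_on \<Omega>. 0 \<le> chi x \<and> chi x \<le> 1"
      using J_finite_imp[OF mchi] sub by (simp add: subdiff_J_def)
    define k where "k = h cth - ln cp"
    have rhs: "AE x in lebesgue_on \<Omega>. h (\<theta> x) - ln (u x) = k + ln (1 + chi x)"
      using cp u b pu cth
    proof eventually_elim
      case (elim x)
      then have "ln cp = ln (u x) + ln (1 + chi x)" using ln_mult[of "u x" "1 + chi x"] by simp
      then show ?case using elim by (simp add: k_def)
    qed
    \<comment> \<open>The equation and the bound on \<xi> both produce the integral of ln (1 + chi)
      (c - chi), which cancels; what remains is linear in chi apart from the Dirichlet term.\<close>
    have ineq: "Aform 2 2 \<Omega> chi chi + k * (\<integral>x. c - chi x \<partial>lebesgue_on \<Omega>) \<le> 0" if c: "0 \<le> c" "c \<le> 1" for c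
    proof -
      have w: "V \<Omega> (\<lambda>x. c - chi x)" using V_affine(1)[OF Om(1,2) chi, of "- 1" c] by simp
      have wi: "integrable (lebesgue_on \<Omega>) (\<lambda>x. c - chi x)" using chii by simp
      have A: "Aform 2 2 \<Omega> chi (\<lambda>x. c - chi x) = - Aform 2 2 \<Omega> chi chi"
        using Aform_affine(2)[OF Om(1,2) chi chi, of "- 1" c] by simp
      have ae: "AE x in lebesgue_on \<Omega>. (h (\<theta> x) - ln (u x)) * (c - chi x) - k * (c - chi x) = ln (1 + chi x) * (c - chi x)"
        using rhs by eventually_elim (simp add: algebra_simps)
      have "(\<integral>x. (h (\<theta> x) - ln (u x)) * (c - chi x) \<partial>lebesgue_on \<Omega>) - k * (\<integral>x. c - chi x \<partial>lebesgue_on \<Omega>) =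
          (\<integral>x. (h (\<theta> x) - ln (u x)) * (c - chi x) - k * (c - chi x) \<partial>lebesgue_on \<Omega>)"
        using chieq[OF w] wi by (simp only: Bochner_Integration.integral_diff integrable_mult_right integral_mult_right_zero)
      also have "\<dots> = (\<integral>x. ln (1 + chi x) * (c - chi x) \<partial>lebesgue_on \<Omega>)"
      proof (rule integral_cong_AE[OF _ _ ae])
        have "(\<lambda>x. (h (\<theta> x) - ln (u x)) * (c - chi x)) \<in> borel_measurable (lebesgue_on \<Omega>)"
          using chieq[OF w] by (intro borel_measurable_integrable) simp
        then show "(\<lambda>x. (h (\<theta> x) - ln (u x)) * (c - chi x) - k * (c - chi x)) \<in> borel_measurable (lebesgue_on \<Omega>)"
          using mchi by measurable
        show "(\<lambda>x. ln (1 + chi x) * (c - chi x)) \<in> borel_measurable (lebesgue_on \<Omega>)" using mchi by measurable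
      qed
      finally show ?thesis using subdiff_J_le[OF Om(1,2) sub c] chieq[OF w] A by linarith
    qed
    have "0 \<le> k * (\<integral>x. (if 0 \<le> k then 1 else 0) - chi x \<partial>lebesgue_on \<Omega>)"
    proof (cases "0 \<le> k")
      case True
      have "0 \<le> (\<integral>x. 1 - chi x \<partial>lebesgue_on \<Omega>)" by (rule integral_nonneg_AE) (use b in \<open>eventually_elim, simp\<close>)
      then show ?thesis using True by simp
    next
      case False
      have "0 \<le> (\<integral>x. chi x \<partial>lebesgue_on \<Omega>)" by (rule integral_nonneg_AE) (use b in \<open>eventually_elim, simp\<close>)
      then show ?thesis using False by (simp add: mult_nonpos_nonneg)
    qed
    then have E: "Aform 2 2 \<Omega> chi chi \<le> 0" using ineq[of "if 0 \<le> k then 1 else 0"] by (cases "0 \<le> k") (simp_all only: if_True if_False, linarith+)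
    have grad0: "AE x in lebesgue_on \<Omega>. wgrad 2 \<Omega> chi x = 0" by (rule constant_of_Aform_self(1)[OF Om chi E])
    obtain cc where cc: "AE x in lebesgue_on \<Omega>. chi x = cc"
      using constant_of_Aform_self(2)[OF Om chi E] by blast
    have "AE x in lebesgue_on \<Omega>. 0 \<le> cc \<and> cc \<le> 1" using b cc by eventually_elim simp
    then have ccb: "0 \<le> cc" "cc \<le> 1" using AE_lebesgue_on_not_False[OF Om(2) False] by blast+
    define m where "m = measure (lebesgue_on \<Omega>) (space (lebesgue_on \<Omega>))"
    have m: "0 < m"
    proof -
      have "\<not> negligible \<Omega>" using Om(2) False open_not_negligible by blast
      then have "measure lebesgue \<Omega> \<noteq> 0"
        using Om bounded_set_imp_lmeasurable[of \<Omega>] by (simp add: negligible_iff_measure)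
      then show ?thesis unfolding m_def using Om(2) by (simp add: measure_restrict_space zero_less_measure_iff)
    qed
    have A0: "Aform 2 2 \<Omega> chi w = 0" for w
      unfolding Aform_def by (rule integral_eq_zero_AE) (use grad0 in \<open>eventually_elim, simp\<close>)
    \<comment> \<open>With the Dirichlet term gone, \<open>cc\<close> maximises k c over c in [0,1].
      Comparison with c = 1 and c = 0 decides the two strict cases, while k = 0 leaves
      \<open>cc\<close> free.\<close>
    have kc: "k * (c - cc) \<le> 0" if c: "0 \<le> c" "c \<le> 1" for c
    proof -
      have "(\<integral>x. c - chi x \<partial>lebesgue_on \<Omega>) = (\<integral>x. c - cc \<partial>lebesgue_on \<Omega>)"
        by (rule integral_cong_AE) (use mchi cc in auto)
      then have "k * ((c - cc) * m) \<le> 0" using ineq[OF c] A0 by (simp add: m_def mult.commute)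
      then show ?thesis using m by (simp add: mult_le_0_iff zero_le_mult_iff)
    qed
    \<comment> \<open>Constancy of \<xi> means that the functional is integration against a
      constant; the equation identifies it as k + ln (1 + cc) once the form with chi
      vanishes.\<close>
    have xi: "\<xi> w = (\<integral>x. (k + ln (1 + cc)) * w x \<partial>lebesgue_on \<Omega>)" if w: "V \<Omega> w" for w
    proof -
      have "\<xi> w = (\<integral>x. (h (\<theta> x) - ln (u x)) * w x \<partial>lebesgue_on \<Omega>)" using chieq[OF w] A0 by simp
      also have "\<dots> = (\<integral>x. (k + ln (1 + cc)) * w x \<partial>lebesgue_on \<Omega>)"
      proof (rule integral_cong_AE)
        show "(\<lambda>x. (h (\<theta> x) - ln (u x)) * w x) \<in> borel_measurable (lebesgue_on \<Omega>)"
          using chieq[OF w] by (intro borel_measurable_integrable) simp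
        show "(\<lambda>x. (k + ln (1 + cc)) * w x) \<in> borel_measurable (lebesgue_on \<Omega>)" using w by (auto simp: W1_def Lp_def)
        show "AE x in lebesgue_on \<Omega>. (h (\<theta> x) - ln (u x)) * w x = (k + ln (1 + cc)) * w x"
          using rhs cc by eventually_elim simp
      qed
      finally show ?thesis .
    qed
    have eae: "AE x in lebesgue_on \<Omega>. e x = psi h cth cc" using e cth cc by eventually_elim simp
    have uae: "AE x in lebesgue_on \<Omega>. u x = cp / (1 + cc)" using pu cc cp by eventually_elim (use ccb in \<open>simp add: field_simps\<close>)
    have k1: "cc = 1" if "0 < k" using kc[of 1] that ccb by (simp add: mult_le_0_iff)
    have k0: "cc = 0" if "k < 0" using kc[of 0] that ccb by (simp add: mult_le_0_iff zero_le_mult_iff)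
    have cpu: "cp = (1 + cc) * (cp / (1 + cc))" using ccb by simp
    show ?thesis
      by (rule exI[of _ "psi h cth cc"], rule exI[of _ cth], rule exI[of _ cc], rule exI[of _ "cp / (1 + cc)"],
          rule exI[of _ cp], rule exI[of _ "k + ln (1 + cc)"], intro conjI eae cth cc uae cp allI impI xi)
        (use ccb k1 k0 cpu in \<open>auto simp: k_def\<close>)
  qed
qed

end
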